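(* The function $$\mathcal{N}_2(1,0;q)+\frac{(-q)_\infty}{(q)_\infty}\left(\frac1{12}+\frac16E_2(2z)\right)-\overline{NH}(z)$$ is a (harmonic) weak Maass form of weight $\frac32$ on $\Gamma_0(16)$.
   Context: $z\in\mathbb{H}$, $q=e^{2\pi iz}$; $(a)_\infty=\prod_{t\ge0}(1-aq^t)$, $(a_1,\dots,a_j)_n=\prod_i(a_i)_\infty/(a_iq^n)_\infty$ for $n\in\mathbb{Z}$. $\mathcal{N}_2(1,0;q)$ is the $e\to0$ limit at $d=1$ of $\frac{(-dq,-eq)_\infty}{(q,deq)_\infty}\sum_{n\ne0}\frac{(-1)^{n-1}q^{\binom{n+1}2+n}(de)^n(-1/d,-1/e)_n}{(1-q^n)^2(-dq,-eq)_n}$; explicitly $\mathcal{N}_2(1,0;q)=\frac{(-q)_\infty}{(q)_\infty}\sum_{n\neq0}\frac{(-1)^{n-1}q^{n^2+n}(-1)_n}{(1-q^n)^2(-q)_n}$. $E_2(z):=1-24\sum_{n\ge1}\frac{nq^n}{1-q^n}$. $\eta(\tau)=e^{\pi i\tau/12}\prod_{n\ge1}(1-e^{2\pi in\tau})$, and $\overline{NH}(z):=\frac{1}{2\sqrt2\pi i}\int_{-\bar z}^{i\infty}\frac{\eta^2(\tau)}{\eta(2\tau)(-i(\tau+z))^{3/2}}d\tau$. Weak Maass form of weight $k\in\frac12\mathbb{Z}\setminus\mathbb{Z}$ on $\Gamma\subset\Gamma_0(4)$ (with some Nebentypus $\chi$): smooth $g:\mathbb{H}\to\mathbb{C}$ with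 $g(Az)=\left(\frac cd\right)\epsilon_d^{-2k}\chi(d)(cz+d)^kg(z)$ for $A=\begin{pmatrix}a&b\\c&d\end{pmatrix}\in\Gamma$ ($\epsilon_d=1$ or $i$ as $d\equiv1$ or $3\pmod4$), annihilated by $\Delta_k=-y^2(\partial_x^2+\partial_y^2)+iky(\partial_x+i\partial_y)$ ($z=x+iy$), with at most linear exponential growth at the cusps. *)

theory Defs
  imports "HOL-Analysis.Analysis" "HOL-Number_Theory.Number_Theory"
begin

section \<open>The functions in the statement\<close>

definition nome :: "complex \<Rightarrow> complex" where
  "nome z = exp (2 * of_real pi * \<i> * z)"

definition qpoch_inf :: "complex \<Rightarrow> complex \<Rightarrow> complex" where
  "qpoch_inf a q = (\<Prod>t. 1 - a * q ^ t)"

definition qpoch :: "complex \<Rightarrow> complex \<Rightarrow> int \<Rightarrow> complex" where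
  "qpoch a q n = qpoch_inf a q / qpoch_inf (a * q powi n) q"

text \<open>
  The series for \<open>\<N>\<^sub>2(1,0;q)\<close>, i.e. the limit \<open>e \<rightarrow> 0\<close> at \<open>d = 1\<close> of the series for
  \<open>\<N>\<^sub>2(d,e;q)\<close>: there \<open>e\<^sup>n (-1/e)\<^sub>n\<close> tends to \<open>q\<close> to the power \<open>n(n-1)/2\<close>.
\<close>

definition N2_1_0 :: "complex \<Rightarrow> complex" where
  "N2_1_0 q = qpoch_inf (-q) q / qpoch_inf q q *
     (\<Sum>\<^sub>\<infinity>n\<in>{n::int. n \<noteq> 0}.
        (-1) powi (n - 1) * q powi (n\<^sup>2 + n) * qpoch (-1) q n /
        ((1 - q powi n)\<^sup>2 * qpoch (-q) q n))"

definition Eisenstein_E2 :: "complex \<Rightarrow> complex" where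
  "Eisenstein_E2 z =
     1 - 24 * (\<Sum>n. of_nat (Suc n) * nome z ^ Suc n / (1 - nome z ^ Suc n))"

definition dedekind_eta :: "complex \<Rightarrow> complex" where
  "dedekind_eta \<tau> =
     exp (of_real pi * \<i> * \<tau> / 12) * (\<Prod>n. 1 - exp (2 * of_real pi * \<i> * of_nat (Suc n) * \<tau>))"

text \<open>
  The path of integration from \<open>-cnj z\<close> to \<open>\<i>\<infinity>\<close> is the vertical ray \<open>\<tau> = -cnj z + \<i>t\<close>,
  \<open>t > 0\<close>, whence the factor \<open>\<i>\<close> for \<open>d\<tau> = \<i> dt\<close>.  On it \<open>-\<i>(\<tau> + z) = 2 Im z + t\<close> is a
  positive real number.
\<close>

definition NH_bar :: "complex \<Rightarrow> complex" where
  "NH_bar z = 1 / (2 * of_real (sqrt 2) * of_real pi * \<i>) *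
     (LINT t:{0<..}|lborel.
        (let \<tau> = - cnj z + \<i> * of_real t
         in (dedekind_eta \<tau>)\<^sup>2 / (dedekind_eta (2 * \<tau>) * (- \<i> * (\<tau> + z)) powr (3/2)) * \<i>))"


section \<open>Weak Maass forms of half-integral weight\<close>

abbreviation upper_half_plane :: "complex set" where
  "upper_half_plane \<equiv> {z. Im z > 0}"

definition SL2Z :: "(int ^ 2 ^ 2) set" where
  "SL2Z = {A. det A = 1}"

definition Gamma0 :: "int \<Rightarrow> (int ^ 2 ^ 2) set" where
  "Gamma0 N = {A \<in> SL2Z. N dvd A $ 2 $ 1}"

definition aut_factor :: "int ^ 2 ^ 2 \<Rightarrow> complex \<Rightarrow> complex" where
  "aut_factor A z = of_int (A $ 2 $ 1) * z + of_int (A $ 2 $ 2)"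

definition moebius_act :: "int ^ 2 ^ 2 \<Rightarrow> complex \<Rightarrow> complex" where
  "moebius_act A z = (of_int (A $ 1 $ 1) * z + of_int (A $ 1 $ 2)) / aut_factor A z"

text \<open>
  Shimura's extension of the Jacobi symbol \<open>(c/d)\<close> to all odd \<open>d\<close>: it is multiplicative in \<open>d\<close>,
  \<open>(c/-1)\<close> is \<open>-1\<close> if \<open>c < 0\<close> and \<open>1\<close> otherwise, and \<open>(0/1) = (0/-1) = 1\<close>.
  The value for even \<open>d\<close> is not meaningful.  The prime factors of a negative \<open>d\<close> are those
  of \<open>-d\<close>.
\<close>

definition shimura_symbol :: "int \<Rightarrow> int \<Rightarrow> int" where
  "shimura_symbol c d =
     (if c < 0 \<and> d < 0 then -1 else 1) * (\<Prod>p\<in>#prime_factorization d. Legendre c p)"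

definition theta_eps :: "int \<Rightarrow> complex" where
  "theta_eps d = (if [d = 1] (mod 4) then 1 else \<i>)"

definition dirichlet_char :: "int \<Rightarrow> (int \<Rightarrow> complex) \<Rightarrow> bool" where
  "dirichlet_char N \<psi> \<longleftrightarrow>
     \<psi> 1 = 1 \<and>
     (\<forall>m n. \<psi> (m * n) = \<psi> m * \<psi> n) \<and>
     (\<forall>m. \<psi> (m + N) = \<psi> m) \<and>
     (\<forall>m. \<psi> m = 0 \<longleftrightarrow> \<not> coprime m N)"

text \<open>Real smoothness on an open set: all iterated directional derivatives exist.\<close>

primrec Ck_on :: "nat \<Rightarrow> (complex \<Rightarrow> complex) \<Rightarrow> complex set \<Rightarrow> bool" where
  "Ck_on 0 g S \<longleftrightarrow> continuous_on S g"
| "Ck_on (Suc n) g S \<longleftrightarrow>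
     (\<forall>z\<in>S. g differentiable (at z)) \<and>
     (\<forall>v. Ck_on n (\<lambda>z. frechet_derivative g (at z) v) S)"

definition smooth_on :: "(complex \<Rightarrow> complex) \<Rightarrow> complex set \<Rightarrow> bool" where
  "smooth_on g S \<longleftrightarrow> (\<forall>n. Ck_on n g S)"

definition partial_x :: "(complex \<Rightarrow> complex) \<Rightarrow> complex \<Rightarrow> complex" where
  "partial_x g z = frechet_derivative g (at z) 1"

definition partial_y :: "(complex \<Rightarrow> complex) \<Rightarrow> complex \<Rightarrow> complex" where
  "partial_y g z = frechet_derivative g (at z) \<i>"

definition hyp_laplacian :: "real \<Rightarrow> (complex \<Rightarrow> complex) \<Rightarrow> complex \<Rightarrow> complex" where
  "hyp_laplacian k g z =
     - (of_real (Im z))\<^sup>2 * (partial_x (partial_x g) z + partial_y (partial_y g) z)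
     + \<i> * of_real k * of_real (Im z) * (partial_x g z + \<i> * partial_y g z)"

text \<open>
  Every cusp has the form \<open>A\<infinity>\<close> with \<open>A\<close> in \<open>SL\<^sub>2(\<int>)\<close>; the growth there is that of
  \<open>(cz+d)\<close> to the power \<open>-k\<close> times \<open>g(Az)\<close> as \<open>Im z\<close> tends to infinity, uniformly in \<open>Re z\<close>.
\<close>

definition linear_exp_growth_at_cusps :: "real \<Rightarrow> (complex \<Rightarrow> complex) \<Rightarrow> bool" where
  "linear_exp_growth_at_cusps k g \<longleftrightarrow>
     (\<forall>A\<in>SL2Z. \<exists>C K Y. Y > 0 \<and> (\<forall>z. Im z \<ge> Y \<longrightarrow>
        norm (aut_factor A z powr of_real (- k) * g (moebius_act A z)) \<le> K * exp (C * Im z)))"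

text \<open>
  Powers are principal values, so \<open>(cz+d)\<^sup>k\<close> has argument of \<open>cz+d\<close> in \<open>(-\<pi>, \<pi>]\<close>; the
  exponent \<open>-2k\<close> of \<open>theta_eps d\<close> is an integer.
\<close>

definition weak_maass_form ::
  "real \<Rightarrow> (int ^ 2 ^ 2) set \<Rightarrow> (int \<Rightarrow> complex) \<Rightarrow> (complex \<Rightarrow> complex) \<Rightarrow> bool" where
  "weak_maass_form k \<Gamma> \<psi> g \<longleftrightarrow>
     2 * k \<in> \<int> \<and> k \<notin> \<int> \<and> \<Gamma> \<subseteq> Gamma0 4 \<and>
     smooth_on g upper_half_plane \<and>
     (\<forall>A\<in>\<Gamma>. \<forall>z\<in>upper_half_plane.
        g (moebius_act A z) =
          of_int (shimura_symbol (A $ 2 $ 1) (A $ 2 $ 2)) *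
          theta_eps (A $ 2 $ 2) powr of_real (- 2 * k) *
          \<psi> (A $ 2 $ 2) * aut_factor A z powr of_real k * g z) \<and>
     (\<forall>z\<in>upper_half_plane. hyp_laplacian k g z = 0) \<and>
     linear_exp_growth_at_cusps k g"

end

theory Submission
  imports Defs "HOL-Probability.Probability" "HOL-Complex_Analysis.Complex_Analysis"
begin

text \<open>
  Let \<open>\<theta>(z) = \<Sum> (-1)\<^sup>n q^(n\<^sup>2)\<close>, which by Gauss equals \<open>(q)\<^sub>\<infinity> / (-q)\<^sub>\<infinity> = \<eta>\<^sup>2(z) / \<eta>(2z)\<close>, and let \<open>g\<close> be the
  function in question. The product \<open>\<theta> g\<close> is \<open>\<pi>\<^sup>-\<^sup>2\<close> times the lattice sum
  \<open>H(z) = \<Sum> \<lambda>\<^sup>-\<^sup>2 exp(-\<pi> \<bar>\<lambda>\<bar>\<^sup>2 / 4y)\<close> over \<open>\<lambda> = 2nz + m\<close> with \<open>m\<close> odd, which has weight 2 on \<open>\<Gamma>\<^sub>0(2)\<close> because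
  a modular substitution permutes the \<open>\<lambda>\<close> up to a common factor.

  To see this, write \<open>\<lambda>\<^sup>-\<^sup>2 (exp(\<pi>in\<lambda>) - exp(-\<pi> \<bar>\<lambda>\<bar>\<^sup>2 / 4y))\<close> as the integral over \<open>t > y\<close> of
  \<open>\<pi> / (4t\<^sup>2) exp(-\<pi> \<lambda>\<^sup>2 / 4t + \<pi>in\<lambda>)\<close>. The sum of \<open>\<lambda>\<^sup>-\<^sup>2 exp(\<pi>in\<lambda>)\<close> over \<open>m\<close> follows from the partial
  fractions of \<open>1 / sin\<^sup>2\<close> and, with a divisor-sum identity for the \<open>E\<^sub>2\<close> term, yields the holomorphic part of
  \<open>\<theta> g\<close>. Poisson summation over \<open>m\<close> turns the sum of the integrands into a multiple of
  \<open>t^(-3/2) \<theta>(z) \<theta>(-z + 2it)\<close>, whose integral is \<open>\<theta>\<close> times the period integral of \<open>\<theta>\<close>.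

  The multiplier of \<open>g\<close> is thus the inverse of the theta multiplier, which on \<open>\<Gamma>\<^sub>0(16)\<close> gives trivial \<open>\<psi>\<close>.
  Growth at the cusps follows from bounds for \<open>H\<close> and for the product \<open>1 / \<theta>\<close>.
\<close>

section \<open>Reciprocity for the Jacobi symbol\<close>

text \<open>None of the three summands is transformed by itself. The sum of the bare inverse squares
  of the lattice points would converge only conditionally; the Gaussian factor makes it absolutely
  convergent, so that the modularity of H is pure reindexing, and all analysis goes into identifying
  H. The level 16 is forced by theta, not by H. Passing from the series of q^(n^2) to the
  alternating one conjugates by the translation by 1/2, which moves d by c/2. The symbol (c/d) does
  not notice this when 16 divides c: it equals ((c/4)/d), which is periodic modulo c/4 because 4
  still divides c/4. Since the symbol is given only as a product over prime factors, this
  periodicity, for all signs of c and d, amounts to quadratic reciprocity with its supplements.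
  Growth is read off H and 1/theta: g is bounded by K exp(K / Im w) on the whole half-plane, which
  serves all cusps at once. Smoothness and the Laplace equation are read off the other description,
  a holomorphic quotient minus a series of incomplete gamma functions.\<close>

definition jacobi :: "int \<Rightarrow> int \<Rightarrow> int" where
  "jacobi c n = (\<Prod>p\<in>#prime_factorization n. Legendre c p)"

lemma Legendre_cong: "[a = b] (mod p) \<Longrightarrow> Legendre a p = Legendre b p"
proof -
  assume "[a = b] (mod p)"
  hence "[a = 0] (mod p) \<longleftrightarrow> [b = 0] (mod p)" "QuadRes p a \<longleftrightarrow> QuadRes p b"
    by (simp_all add: cong_def QuadRes_def)
  thus ?thesis by (simp add: Legendre_def)
qed

lemma Legendre_cases: "Legendre a p = 0 \<or> Legendre a p = 1 \<or> Legendre a p = -1"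
  by (simp add: Legendre_def)

text \<open>Euler's criterion makes both sides congruent modulo \<open>p\<close>. Both lie in {-1,
  0, 1}, so their difference is at most 2 in absolute value, hence 0 because
  \<open>p > 2\<close>.\<close>

lemma Legendre_prime_mult:
  fixes p :: int
  assumes "prime p" "p > 2"
  shows "Legendre (a * b) p = Legendre a p * Legendre b p"
proof -
  define q where "q = nat p"
  have "prime q" using assms(1) prime_int_nat_transfer[of p] unfolding q_def by blast
  hence q: "prime q" "2 < q" "int q = p"
    using assms(2) by (auto simp: q_def)
  have "[Legendre (a * b) p = (a * b) ^ ((q - 1) div 2)] (mod p)"
    using euler_criterion[of q "a * b"] q by simp
  moreover have "[Legendre a p * Legendre b p = a ^ ((q - 1) div 2) * b ^ ((q - 1) div 2)] (mod p)"
    using euler_criterion[of q a] euler_criterion[of q b] q by (auto intro: cong_mult)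
  ultimately have "[Legendre (a * b) p = Legendre a p * Legendre b p] (mod p)"
    by (simp add: power_mult_distrib) (metis cong_sym cong_trans)
  hence dv: "p dvd Legendre (a * b) p - Legendre a p * Legendre b p"
    by (simp add: cong_iff_dvd_diff)
  have "\<bar>Legendre (a * b) p - Legendre a p * Legendre b p\<bar> < p"
    using Legendre_cases[of "a*b" p] Legendre_cases[of a p] Legendre_cases[of b p] assms(2)
    by auto
  thus ?thesis using dv dvd_imp_le_int[of "Legendre (a * b) p - Legendre a p * Legendre b p" p] assms
    by (cases "Legendre (a * b) p - Legendre a p * Legendre b p = 0") auto
qed

lemma Legendre_minus_one:
  fixes p :: int
  assumes "prime p" "p > 2"
  shows "Legendre (-1) p = (if p mod 4 = 1 then 1 else -1)"
proof -
  define q where "q = nat p"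
  have "prime q" using assms(1) prime_int_nat_transfer[of p] unfolding q_def by blast
  hence q: "prime q" "2 < q" "int q = p"
    using assms(2) by (auto simp: q_def)
  have "odd q" using q prime_odd_nat by auto
  have e: "[Legendre (-1) p = (-1) ^ ((q - 1) div 2)] (mod p)"
    using euler_criterion[of q "-1"] q by simp
  have v: "(-1::int) ^ ((q - 1) div 2) = (if p mod 4 = 1 then 1 else -1)"
  proof -
    have "q mod 4 = 1 \<or> q mod 4 = 3" using \<open>odd q\<close> by presburger
    thus ?thesis
    proof
      assume h: "q mod 4 = 1"
      hence "even ((q - 1) div 2)" by presburger
      moreover have "p mod 4 = 1" using h q(3) by presburger
      ultimately show ?thesis by simp
    next
      assume h: "q mod 4 = 3"
      hence "odd ((q - 1) div 2)" by presburger
      moreover have "p mod 4 = 3" using h q(3) by presburger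
      ultimately show ?thesis by simp
    qed
  qed
  have dv: "p dvd Legendre (-1) p - (if p mod 4 = 1 then 1 else -1)"
    using e v by (simp add: cong_iff_dvd_diff)
  have "\<bar>Legendre (-1) p - (if p mod 4 = 1 then 1 else -1)\<bar> < p"
    using Legendre_cases[of "-1" p] assms(2) by auto
  thus ?thesis using dv dvd_imp_le_int[of "Legendre (-1) p - (if p mod 4 = 1 then 1 else -1)" p] assms
    by (cases "Legendre (-1) p - (if p mod 4 = 1 then 1 else -1) = 0") auto
qed

lemma jacobi_1 [simp]: "jacobi c 1 = 1"
  by (simp add: jacobi_def)

text \<open>\<open>prime_factorization\<close> sees its argument only up to units, so
  \<open>jacobi\<close> ignores the sign of the denominator; signs enter later, through
  \<open>shimura_symbol\<close>.\<close>

lemma jacobi_uminus [simp]: "jacobi c (-n) = jacobi c n"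
  by (simp add: jacobi_def flip: prime_factorization_normalize[of "-n"] prime_factorization_normalize[of n])

lemma jacobi_mult_right: "m \<noteq> 0 \<Longrightarrow> n \<noteq> 0 \<Longrightarrow> jacobi c (m * n) = jacobi c m * jacobi c n"
  by (simp add: jacobi_def prime_factorization_mult)

lemma jacobi_prime: "prime p \<Longrightarrow> jacobi c p = Legendre c p"
  by (simp add: jacobi_def prime_factorization_prime)

lemma jacobi_cong: "[a = b] (mod n) \<Longrightarrow> jacobi a n = jacobi b n"
  unfolding jacobi_def
proof (intro arg_cong[of _ _ prod_mset] image_mset_cong)
  fix p assume "[a = b] (mod n)" "p \<in># prime_factorization n"
  hence "p dvd n" by auto
  thus "Legendre a p = Legendre b p" using \<open>[a = b] (mod n)\<close>
    by (intro Legendre_cong) (metis cong_dvd_modulus)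
qed

lemma odd_prime_factor_gt_2:
  fixes n :: int
  assumes "odd n" "p \<in># prime_factorization n"
  shows "prime p" "p > 2"
proof -
  show p: "prime p" using assms by auto
  have "p dvd n" using assms by auto
  hence "odd p" using assms(1) by auto
  thus "p > 2" using prime_ge_2_int[OF p] by (cases "p = 2") auto
qed

lemma jacobi_mult_left:
  assumes "odd n"
  shows "jacobi (a * b) n = jacobi a n * jacobi b n"
proof -
  have "image_mset (Legendre (a * b)) (prime_factorization n) =
        image_mset (\<lambda>p. Legendre a p * Legendre b p) (prime_factorization n)"
    using odd_prime_factor_gt_2[OF assms] by (intro image_mset_cong Legendre_prime_mult) auto
  thus ?thesis unfolding jacobi_def by (simp add: prod_mset.distrib)
qed

lemma jacobi_one_left: "odd n \<Longrightarrow> jacobi 1 n = 1"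
proof -
  assume "odd n"
  have "image_mset (Legendre 1) (prime_factorization n) = image_mset (\<lambda>p. 1) (prime_factorization n)"
  proof (intro image_mset_cong)
    fix p assume "p \<in># prime_factorization n"
    from odd_prime_factor_gt_2[OF \<open>odd n\<close> this] have "p > 2" by auto
    hence "\<not> [1 = 0] (mod p)" by (simp add: cong_def)
    moreover have "QuadRes p 1" unfolding QuadRes_def by (rule exI[of _ 1]) simp
    ultimately show "Legendre 1 p = 1" by (simp add: Legendre_def)
  qed
  thus ?thesis by (simp add: jacobi_def)
qed

lemma jacobi_unit:
  assumes "coprime c n" "n \<noteq> 0"
  shows "jacobi c n = 1 \<or> jacobi c n = -1"
proof -
  have "\<forall>p\<in>#M. Legendre c p \<noteq> 0 \<Longrightarrow>
    (\<Prod>p\<in>#M. Legendre c p) = 1 \<or> (\<Prod>p\<in>#M. Legendre c p) = -1" for M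
    by (induction M) (use Legendre_cases in fastforce)+
  moreover have "\<forall>p\<in>#prime_factorization n. Legendre c p \<noteq> 0"
  proof
    fix p assume p: "p \<in># prime_factorization n"
    hence "prime p" "p dvd n" by auto
    hence "\<not> p dvd c" using assms(1) not_prime_unit coprime_common_divisor by blast
    thus "Legendre c p \<noteq> 0" by (simp add: Legendre_def cong_0_iff)
  qed
  ultimately show ?thesis unfolding jacobi_def by blast
qed

text \<open>Splitting off one prime at a time fits a symbol defined over the prime factorization:
  laws that are multiplicative in \<open>n\<close> need to be checked at odd primes only.\<close>

lemma odd_pos_induct [consumes 2, case_names one mult]:
  fixes n :: int
  assumes "odd n" "n > 0" "P 1"
    "\<And>p n. prime p \<Longrightarrow> odd p \<Longrightarrow> odd n \<Longrightarrow> n > 0 \<Longrightarrow> P n \<Longrightarrow> P (p * n)"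
  shows "P n"
  using assms(1,2)
proof (induction "nat n" arbitrary: n rule: less_induct)
  case less
  show ?case
  proof (cases "n = 1")
    case False
    then obtain p where p: "prime p" "p dvd n"
      using less.prems prime_divisor_exists[of n] by (auto simp: zdvd1_eq)
    then obtain k where k: "n = p * k" by auto
    have "p > 1" using p(1) by (rule prime_gt_1_int)
    have "k > 0" using k less.prems(2) \<open>p > 1\<close> by (simp add: zero_less_mult_iff)
    have "k < n" using k \<open>p > 1\<close> \<open>k > 0\<close> by simp
    have "odd p" "odd k" using less.prems(1) k by auto
    have "P k" using less.hyps[of k] \<open>k < n\<close> \<open>k > 0\<close> \<open>odd k\<close> by simp
    thus ?thesis using assms(4) p(1) \<open>odd p\<close> \<open>odd k\<close> \<open>k > 0\<close> k by blast
  qed (use assms(3) in auto)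
qed

text \<open>On odd arguments this is the nontrivial character modulo 4. It takes the value -1 at
  even arguments, so multiplicativity is claimed for odd ones only.\<close>

definition chi4 :: "int \<Rightarrow> int" where "chi4 n = (if n mod 4 = 1 then 1 else -1)"

lemma odd_mod_4: "odd (n::int) \<Longrightarrow> n mod 4 = 1 \<or> n mod 4 = 3" by presburger

lemma chi4_mult: "odd m \<Longrightarrow> odd n \<Longrightarrow> chi4 (m * n) = chi4 m * chi4 n"
  using odd_mod_4[of m] odd_mod_4[of n] mod_mult_eq[of m 4 n, symmetric]
  by (auto simp: chi4_def)

lemma jacobi_minus_one: "odd n \<Longrightarrow> n > 0 \<Longrightarrow> jacobi (-1) n = chi4 n"
proof (induction rule: odd_pos_induct)
  case (mult p n)
  have "p > 2" using mult prime_ge_2_int[of p] by (cases "p = 2") auto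
  hence "jacobi (-1) (p * n) = chi4 p * chi4 n" using mult
    by (simp add: jacobi_mult_right jacobi_prime Legendre_minus_one chi4_def)
  thus ?case using mult by (simp add: chi4_mult)
qed (simp add: chi4_def)

text \<open>For odd arguments this is -1 to the power (m-1)/2 * (n-1)/2. Expressed by
  \<open>chi4\<close>, its multiplicativity in either argument becomes a finite case check.\<close>

definition reciprocity_sign :: "int \<Rightarrow> int \<Rightarrow> int" where
  "reciprocity_sign m n = (if chi4 m = -1 \<and> chi4 n = -1 then -1 else 1)"

lemma chi4_unit: "chi4 n = 1 \<or> chi4 n = -1" by (simp add: chi4_def)

lemma reciprocity_sign_mult: "odd m \<Longrightarrow> odd n \<Longrightarrow> reciprocity_sign k (m * n) = reciprocity_sign k m * reciprocity_sign k n"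
  "odd m \<Longrightarrow> odd n \<Longrightarrow> reciprocity_sign (m * n) k = reciprocity_sign m k * reciprocity_sign n k"
  using chi4_unit[of m] chi4_unit[of n] chi4_unit[of k] by (auto simp: reciprocity_sign_def chi4_mult)

lemma Legendre_reciprocity:
  fixes p r :: int
  assumes "prime p" "prime r" "odd p" "odd r" "p \<noteq> r"
  shows "Legendre p r * Legendre r p = reciprocity_sign p r"
proof -
  have g: "p > 2" "r > 2" using assms prime_ge_2_int[of p] prime_ge_2_int[of r]
    by (cases "p = 2"; cases "r = 2"; auto)+
  have pr: "prime (nat p)" "prime (nat r)"
    using assms prime_int_nat_transfer[of p] prime_int_nat_transfer[of r] by blast+
  define a where "a = (p - 1) div 2"
  define b where "b = (r - 1) div 2"
  have ab: "a > 0" "b > 0" "p = 2 * a + 1" "r = 2 * b + 1"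
    using g assms unfolding a_def b_def by presburger+
  have "Legendre p r * Legendre r p = (-1::int) ^ nat (a * b)"
    using Quadratic_Reciprocity_int[of p r] pr g assms(5) unfolding a_def b_def by blast
  also have "\<dots> = (if even (a * b) then 1 else -1)"
    using ab by (simp add: minus_one_power_iff even_nat_iff)
  also have "\<dots> = reciprocity_sign p r"
  proof -
    have "chi4 p = -1 \<longleftrightarrow> odd a" using ab(3,4) by (simp add: chi4_def) presburger
    moreover have "chi4 r = -1 \<longleftrightarrow> odd b" using ab(3,4) by (simp add: chi4_def) presburger
    ultimately show ?thesis by (simp add: reciprocity_sign_def)
  qed
  finally show ?thesis .
qed

text \<open>One argument stays prime while the prime factors of the other are collected.
  \<open>jacobi_reciprocity\<close> then inducts on the remaining argument, with this lemma
  supplying each new prime.\<close>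

lemma jacobi_reciprocity_prime:
  fixes p n :: int
  assumes "odd n" "n > 0" "prime p" "odd p" "coprime p n"
  shows "jacobi p n * jacobi n p = reciprocity_sign p n"
  using assms
proof (induction rule: odd_pos_induct)
  case one
  thus ?case by (simp add: jacobi_one_left reciprocity_sign_def chi4_def)
next
  case (mult r n)
  have "p \<noteq> r" using mult.prems mult.hyps by (auto simp: prime_gt_1_int)
  have nz: "r \<noteq> 0" "n \<noteq> 0" "p \<noteq> 0" using mult by auto
  have "jacobi p (r * n) * jacobi (r * n) p = (jacobi p r * jacobi r p) * (jacobi p n * jacobi n p)"
    using mult nz by (simp add: jacobi_mult_right jacobi_mult_left)
  also have "jacobi p n * jacobi n p = reciprocity_sign p n" using mult by (simp add: coprime_mult_right_iff)
  also have "jacobi p r * jacobi r p = reciprocity_sign p r"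
    using Legendre_reciprocity[of p r] mult \<open>p \<noteq> r\<close> by (simp add: jacobi_prime)
  finally show ?case using mult reciprocity_sign_mult by simp
qed

lemma jacobi_reciprocity:
  fixes m n :: int
  assumes "odd m" "m > 0" "odd n" "n > 0" "coprime m n"
  shows "jacobi m n * jacobi n m = reciprocity_sign m n"
  using assms
proof (induction rule: odd_pos_induct)
  case one
  thus ?case by (simp add: jacobi_one_left reciprocity_sign_def chi4_def)
next
  case (mult r m)
  have nz: "r \<noteq> 0" "n \<noteq> 0" "m \<noteq> 0" using mult by auto
  have "jacobi (r * m) n * jacobi n (r * m) = (jacobi r n * jacobi n r) * (jacobi m n * jacobi n m)"
    using mult nz by (simp add: jacobi_mult_right jacobi_mult_left)
  also have "jacobi m n * jacobi n m = reciprocity_sign m n" using mult by (simp)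
  also have "jacobi r n * jacobi n r = reciprocity_sign r n"
    using jacobi_reciprocity_prime[of n r] mult by simp
  finally show ?case using mult reciprocity_sign_mult by simp
qed

section \<open>The symbol of 2, and periodicity of the symbol in its denominator\<close>

definition chi8 :: "int \<Rightarrow> int" where
  "chi8 n = (if n mod 8 = 1 \<or> n mod 8 = 7 then 1 else -1)"

lemma odd_pos_half: "odd n \<Longrightarrow> n > 0 \<Longrightarrow> \<exists>k. n = 2 * int k + 1"
proof -
  assume "odd n" "n > 0"
  then obtain m where "n = 2 * m + 1" by (elim oddE)
  with \<open>n > 0\<close> have "m \<ge> 0" by simp
  then obtain k where "m = int k" by (elim nonneg_int_cases)
  with \<open>n = 2 * m + 1\<close> show ?thesis by blast
qed

text \<open>Since \<open>2 \<equiv> (-1)(n - 2)\<close> modulo \<open>n\<close>, reciprocity lowers \<open>n\<close> by 2.\<close>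

lemma jacobi_two: 
  assumes "odd n" "n > 0" shows "jacobi 2 n = chi8 n"
proof -
  have "jacobi 2 (2 * int k + 1) = chi8 (2 * int k + 1)" for k
  proof (induction k)
    case 0 thus ?case by (simp add: chi8_def)
  next
    case (Suc k)
    define m where "m = 2 * int k + 1"
    have m: "odd m" "m > 0" by (auto simp: m_def)
    have cop: "coprime m (m + 2)"
    proof -
      have "coprime m 2" using m by simp
      thus ?thesis by (simp add: coprime_iff_gcd_eq_1)
    qed
    have "jacobi 2 (m + 2) = jacobi (-1 * m) (m + 2)"
      by (rule jacobi_cong) (simp add: cong_iff_dvd_diff add.commute)
    also have "\<dots> = chi4 (m + 2) * jacobi m (m + 2)"
      using m by (subst jacobi_mult_left) (auto simp: jacobi_minus_one)
    also have "jacobi m (m + 2) = reciprocity_sign m (m + 2) * jacobi (m + 2) m"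
    proof -
      have "jacobi (m+2) m = 1 \<or> jacobi (m+2) m = -1"
        using jacobi_unit[of "m+2" m] cop m by (simp add: coprime_commute)
      moreover have "jacobi m (m + 2) * jacobi (m + 2) m = reciprocity_sign m (m + 2)"
        using jacobi_reciprocity[of m "m+2"] m cop by simp
      ultimately show ?thesis by auto
    qed
    also have "jacobi (m + 2) m = jacobi 2 m"
      by (rule jacobi_cong) (simp add: cong_iff_dvd_diff)
    also have "jacobi 2 m = chi8 m" using Suc by (simp add: m_def)
    also have "reciprocity_sign m (m + 2) = 1"
    proof -
      have "m mod 4 = 1 \<or> (m + 2) mod 4 = 1" using m(1) by presburger
      thus ?thesis by (auto simp: reciprocity_sign_def chi4_def)
    qed
    also have "chi4 (m + 2) * (1 * chi8 m) = chi8 (m + 2)"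
    proof -
      have "m mod 8 = 1 \<or> m mod 8 = 3 \<or> m mod 8 = 5 \<or> m mod 8 = 7" using m(1) by presburger
      thus ?thesis
      proof (elim disjE)
        assume h: "m mod 8 = 1"
        have "(m + 2) mod 4 = 3" "(m + 2) mod 8 = 3" using h by presburger+
        thus ?thesis using h by (simp add: chi4_def chi8_def)
      next
        assume h: "m mod 8 = 3"
        have "(m + 2) mod 4 = 1" "(m + 2) mod 8 = 5" using h by presburger+
        thus ?thesis using h by (simp add: chi4_def chi8_def)
      next
        assume h: "m mod 8 = 5"
        have "(m + 2) mod 4 = 3" "(m + 2) mod 8 = 7" using h by presburger+
        thus ?thesis using h by (simp add: chi4_def chi8_def)
      next
        assume h: "m mod 8 = 7"
        have "(m + 2) mod 4 = 1" "(m + 2) mod 8 = 1" using h by presburger+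
        thus ?thesis using h by (simp add: chi4_def chi8_def)
      qed
    qed
    finally show ?case by (simp add: m_def algebra_simps)
  qed
  moreover obtain k where "n = 2 * int k + 1"
    using odd_pos_half[OF assms] by blast
  ultimately show ?thesis by simp
qed

lemma jacobi_power_left: "odd n \<Longrightarrow> jacobi (a ^ e) n = jacobi a n ^ e"
  by (induction e) (auto simp: jacobi_one_left jacobi_mult_left)

lemma int_decomp:
  fixes c :: int assumes "c \<noteq> 0"
  obtains s e u where "c = s * 2 ^ e * u" "s = sgn c" "odd u" "u > 0"
proof -
  obtain u where u: "c = 2 ^ multiplicity 2 c * u" "\<not> 2 dvd u"
    using multiplicity_decompose'[of c "2::int"] assms by auto
  have "sgn c = sgn u" by (subst u(1)) (simp add: sgn_mult)
  hence "c = sgn c * 2 ^ multiplicity 2 c * \<bar>u\<bar>"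
    using u(1) by (cases "u > 0") (auto simp: sgn_if)
  moreover have "odd \<bar>u\<bar>" "\<bar>u\<bar> > 0" using u(2) by auto
  ultimately show ?thesis using that by blast
qed

text \<open>Multiplicativity in \<open>c\<close>, both supplements, and reciprocity for the odd
  part. On the right, \<open>n\<close> enters only through its residues modulo 4, 8 and
  \<open>u\<close>, which is what makes the symbol periodic in \<open>n\<close>.\<close>

lemma jacobi_factor:
  assumes c: "c = s * 2 ^ e * u" "s = 1 \<or> s = -1" "odd u" "u > 0"
    and n: "odd n" "n > 0" "coprime c n"
  shows "jacobi c n = (if s = 1 then 1 else chi4 n) * chi8 n ^ e * (reciprocity_sign u n * jacobi n u)"
proof -
  have cop: "coprime u n" using c(1) n(3) by simp
  have "jacobi c n = jacobi s n * jacobi 2 n ^ e * jacobi u n"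
    using c n by (simp add: jacobi_mult_left jacobi_power_left)
  also have "jacobi s n = (if s = 1 then 1 else chi4 n)"
    using c n by (auto simp: jacobi_one_left jacobi_minus_one)
  also have "jacobi 2 n = chi8 n" using n by (simp add: jacobi_two)
  also have "jacobi u n = reciprocity_sign u n * jacobi n u"
  proof -
    have "jacobi n u = 1 \<or> jacobi n u = -1"
      using jacobi_unit[of n u] cop c by (simp add: coprime_commute)
    moreover have "jacobi u n * jacobi n u = reciprocity_sign u n"
      using jacobi_reciprocity[of u n] c n cop by simp
    ultimately show ?thesis by auto
  qed
  finally show ?thesis .
qed

text \<open>The residue of \<open>n\<close> modulo 8 enters \<open>jacobi_factor\<close> only
  through \<open>chi8 n ^ e\<close>. If \<open>e\<close> is odd, then 4 dividing \<open>c\<close>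
  forces \<open>e\<close> to be at least 3, so that a congruence modulo \<open>c\<close> is also one
  modulo 8.\<close>

lemma eight_dvd_or_even_exponent:
  fixes c :: int
  assumes "4 dvd c" "c = s * 2 ^ e * u" "s = 1 \<or> s = -1" "odd u"
  shows "8 dvd c \<or> even e"
proof (cases "e \<ge> 3")
  case True
  hence "(2::int) ^ 3 dvd 2 ^ e" by (rule le_imp_power_dvd)
  thus ?thesis using assms(2) by auto
next
  case False
  moreover have "e \<noteq> 1"
  proof
    assume "e = 1"
    hence "2 * 2 dvd 2 * (s * u)" using assms by (simp add: mult_ac)
    hence "2 dvd s * u" by (simp only: dvd_mult_cancel_left) simp
    thus False using assms by auto
  qed
  ultimately have "e = 0 \<or> e = 2" by auto
  thus ?thesis by auto
qed

lemma chi8_power_eq: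
  assumes "8 dvd c \<or> even e" "8 dvd c \<Longrightarrow> chi8 n = chi8 n'"
  shows "chi8 n ^ e = chi8 n' ^ e"
proof (cases "8 dvd c")
  case False
  hence "even e" using assms by auto
  have "chi8 x ^ e = 1" for x using \<open>even e\<close> by (simp add: chi8_def)
  thus ?thesis by simp
qed (use assms in auto)

lemma jacobi_periodic:
  assumes "4 dvd c" "c \<noteq> 0" "odd n" "n > 0" "odd n'" "n' > 0" "coprime c n" "coprime c n'"
    and "c dvd n - n'"
  shows "jacobi c n = jacobi c n'"
proof -
  obtain s e u where c: "c = s * 2 ^ e * u" "s = sgn c" "odd u" "u > 0"
    using int_decomp[OF assms(2)] by metis
  have s: "s = 1 \<or> s = -1" using c(2) assms(2) by (simp add: sgn_if)
  have m4: "n mod 4 = n' mod 4" using assms(1,9) by (meson dvd_trans mod_eq_dvd_iff)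
  have x4: "chi4 n = chi4 n'" using m4 by (simp add: chi4_def)
  have "u dvd n - n'" using c(1) assms(9) by (meson dvd_trans dvd_triv_right)
  hence "jacobi n u = jacobi n' u" by (intro jacobi_cong) (simp add: cong_iff_dvd_diff)
  moreover have "chi8 n ^ e = chi8 n' ^ e"
  proof (rule chi8_power_eq[OF eight_dvd_or_even_exponent[OF assms(1) c(1) s c(3)]])
    assume "8 dvd c"
    hence "n mod 8 = n' mod 8" using assms(9) by (meson dvd_trans mod_eq_dvd_iff)
    thus "chi8 n = chi8 n'" by (simp add: chi8_def)
  qed
  ultimately show ?thesis
    using jacobi_factor[OF c(1) s c(3,4) assms(3,4,7)] jacobi_factor[OF c(1) s c(3,4) assms(5,6,8)] x4
    by (simp add: reciprocity_sign_def)
qed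

text \<open>When \<open>n\<close> is replaced by its negative modulo \<open>c\<close>,
  \<open>chi8\<close> is even, \<open>chi4\<close> changes sign, and \<open>jacobi n u\<close> gains
  \<open>chi4 u\<close>, which turns \<open>reciprocity_sign u n\<close> into
  \<open>reciprocity_sign u n'\<close>. Only the \<open>chi4 n\<close> attached to a negative
  \<open>c\<close> is left over, whence \<open>sgn c\<close>.\<close>

lemma jacobi_reflect:
  assumes "4 dvd c" "c \<noteq> 0" "odd n" "n > 0" "odd n'" "n' > 0" "coprime c n" "coprime c n'"
    and "c dvd n + n'"
  shows "jacobi c n = sgn c * jacobi c n'"
proof -
  obtain s e u where c: "c = s * 2 ^ e * u" "s = sgn c" "odd u" "u > 0"
    using int_decomp[OF assms(2)] by metis
  have s: "s = 1 \<or> s = -1" using c(2) assms(2) by (simp add: sgn_if)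
  have "4 dvd n + n'" using assms(1,9) by (meson dvd_trans)
  hence "n mod 4 = 1 \<longleftrightarrow> n' mod 4 \<noteq> 1" using assms(3,5) by presburger
  hence x4: "chi4 n = - chi4 n'" by (auto simp: chi4_def)
  have "u dvd n - (- n')" using c(1) assms(9) by (simp add: dvd_mult_right)
  hence "jacobi n u = jacobi (-1 * n') u" by (intro jacobi_cong) (simp add: cong_iff_dvd_diff)
  hence ju: "jacobi n u = chi4 u * jacobi n' u" using jacobi_mult_left[OF c(3), of "-1" n'] jacobi_minus_one[OF c(3,4)] by simp
  moreover have "chi8 n ^ e = chi8 n' ^ e"
  proof (rule chi8_power_eq[OF eight_dvd_or_even_exponent[OF assms(1) c(1) s c(3)]])
    assume "8 dvd c"
    hence "8 dvd n + n'" using assms(9) dvd_trans by blast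
    have "n mod 8 = 1 \<or> n mod 8 = 3 \<or> n mod 8 = 5 \<or> n mod 8 = 7" using assms(3) by presburger
    thus "chi8 n = chi8 n'"
    proof (elim disjE)
      assume h: "n mod 8 = 1"
      have "n' mod 8 = 7" using h \<open>8 dvd n + n'\<close> by presburger
      thus ?thesis using h by (simp add: chi8_def)
    next
      assume h: "n mod 8 = 3"
      have "n' mod 8 = 5" using h \<open>8 dvd n + n'\<close> by presburger
      thus ?thesis using h by (simp add: chi8_def)
    next
      assume h: "n mod 8 = 5"
      have "n' mod 8 = 3" using h \<open>8 dvd n + n'\<close> by presburger
      thus ?thesis using h by (simp add: chi8_def)
    next
      assume h: "n mod 8 = 7"
      have "n' mod 8 = 1" using h \<open>8 dvd n + n'\<close> by presburger
      thus ?thesis using h by (simp add: chi8_def)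
    qed
  qed
  moreover have "reciprocity_sign u n * chi4 u = reciprocity_sign u n'"
    using x4 chi4_unit[of u] chi4_unit[of n'] by (auto simp: reciprocity_sign_def)
  ultimately show ?thesis
    using jacobi_factor[OF c(1) s c(3,4) assms(3,4,7)] jacobi_factor[OF c(1) s c(3,4) assms(5,6,8)] x4 c(2) s
    by (auto simp: mult_ac)
qed

lemma shimura_symbol_jacobi:
  "shimura_symbol c d = (if c < 0 \<and> d < 0 then -1 else 1) * jacobi c d"
  by (simp add: shimura_symbol_def jacobi_def)

lemma jacobi_abs: "jacobi c \<bar>d\<bar> = jacobi c d"
  by (simp add: abs_if)

text \<open>For denominators of equal sign this is \<open>jacobi_periodic\<close> on absolute
  values. For opposite signs the absolute values add up to a multiple of \<open>c\<close>, and the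
  factor \<open>sgn c\<close> of \<open>jacobi_reflect\<close> is exactly what Shimura's sign
  convention absorbs.\<close>

lemma shimura_symbol_periodic:
  assumes "4 dvd c" "c \<noteq> 0" "odd d" "odd d'" "coprime c d" "coprime c d'" "c dvd d - d'"
  shows "shimura_symbol c d = shimura_symbol c d'"
proof -
  have nz: "d \<noteq> 0" "d' \<noteq> 0" using assms by auto
  have per: "jacobi c d = jacobi c d'" if "(d > 0 \<and> d' > 0) \<or> (d < 0 \<and> d' < 0)"
  proof -
    have "c dvd \<bar>d\<bar> - \<bar>d'\<bar>" using that assms(7) 
      by (auto simp: abs_if) (metis dvd_diff_commute)
    hence "jacobi c \<bar>d\<bar> = jacobi c \<bar>d'\<bar>" using assms nz by (intro jacobi_periodic) auto
    thus ?thesis by (simp add: jacobi_abs)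
  qed
  have refl: "jacobi c d = sgn c * jacobi c d'" if "(d > 0 \<and> d' < 0) \<or> (d < 0 \<and> d' > 0)"
  proof -
    have "c dvd \<bar>d\<bar> + \<bar>d'\<bar>" using that assms(7) 
      by (auto simp: abs_if) (metis dvd_diff_commute)
    hence "jacobi c \<bar>d\<bar> = sgn c * jacobi c \<bar>d'\<bar>" using assms nz by (intro jacobi_reflect) auto
    thus ?thesis by (simp add: jacobi_abs)
  qed
  show ?thesis
    using per refl nz assms(2) unfolding shimura_symbol_jacobi sgn_if
    by (cases "d > 0"; cases "d' > 0"; cases "c > 0") auto
qed

text \<open>4 is a square prime to \<open>n\<close>. In \<open>theta4_multiplier\<close> this allows
  \<open>c\<close> to be replaced by c/4, whose symbol has the shorter period that is needed
  there.\<close>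

lemma jacobi_four_mult: "odd n \<Longrightarrow> jacobi (4 * c) n = jacobi c n"
proof -
  assume n: "odd n"
  hence "n \<noteq> 0" by auto
  have "jacobi (4 * c) n = jacobi (2 * 2) n * jacobi c n" using jacobi_mult_left[OF n, of 4 c] by simp
  also have "jacobi (2 * 2) n = jacobi 2 n * jacobi 2 n" using jacobi_mult_left[OF n] by blast
  also have "\<dots> = 1" using jacobi_unit[of 2 n] n \<open>n \<noteq> 0\<close> by auto
  finally show ?thesis by simp
qed

lemma shimura_symbol_four_mult: "odd d \<Longrightarrow> shimura_symbol (4 * c) d = shimura_symbol c d"
  by (simp add: shimura_symbol_jacobi jacobi_four_mult)

section \<open>Sums and integrals of Gaussian series\<close>

lemma int_UNIV_split: "(UNIV :: int set) = range int \<union> range (\<lambda>n. - int (Suc n))"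
proof -
  have "x \<in> range int \<union> range (\<lambda>n. - int (Suc n))" for x :: int
    by (cases x) auto
  thus ?thesis by blast
qed

lemma summable_on_int:
  fixes f :: "int \<Rightarrow> 'a :: banach"
  assumes "(\<lambda>n::nat. f (int n)) summable_on UNIV" "(\<lambda>n::nat. f (- int (Suc n))) summable_on UNIV"
  shows "f summable_on UNIV"
proof -
  have "f summable_on range int"
    using assms(1) by (subst summable_on_reindex) (auto simp: o_def inj_on_def)
  moreover have "f summable_on range (\<lambda>n. - int (Suc n))"
    using assms(2) by (subst summable_on_reindex) (auto simp: o_def inj_on_def)
  moreover have "range int \<inter> range (\<lambda>n. - int (Suc n)) = {}" by auto
  ultimately show ?thesis by (subst int_UNIV_split) (rule summable_on_Un_disjoint)
qed

lemma summable_on_int_geometric: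
  assumes "\<beta> > 0" shows "(\<lambda>n::int. exp (- \<beta> * \<bar>of_int n\<bar>) :: real) summable_on UNIV"
proof -
  have s: "summable (\<lambda>n. exp (- \<beta>) ^ n)" using assms by (intro summable_geometric) simp
  have e: "exp (- \<beta> * real n) = exp (- \<beta>) ^ n" for n
    by (simp add: exp_of_nat_mult[symmetric] mult.commute)
  show ?thesis
  proof (rule summable_on_int)
    show "(\<lambda>n. exp (- \<beta> * \<bar>of_int (int n)\<bar>)) summable_on UNIV"
      using s e by (intro summable_nonneg_imp_summable_on) simp_all
    have "summable (\<lambda>n. exp (- \<beta> * real (Suc n)))"
      unfolding e using s by (subst summable_Suc_iff)
    thus "(\<lambda>n. exp (- \<beta> * \<bar>of_int (- int (Suc n))\<bar>)) summable_on UNIV"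
      by (intro summable_nonneg_imp_summable_on) (simp_all add: add.commute)
  qed
qed

lemma power_le_fact_exp:
  fixes x :: real assumes "x \<ge> 0" shows "x ^ k \<le> fact k * exp x"
proof -
  have "(\<Sum>n\<in>{k}. x ^ n /\<^sub>R fact n) \<le> (\<Sum>n. x ^ n /\<^sub>R fact n)"
    using assms by (intro sum_le_suminf summable_exp_generic) auto
  hence "x ^ k /\<^sub>R fact k \<le> exp x" by (simp add: exp_def)
  thus ?thesis by (simp add: field_simps)
qed

lemma abs_int_le_square: "\<bar>n::int\<bar> \<le> n\<^sup>2"
proof (cases "n = 0")
  case False
  hence "\<bar>n\<bar> * 1 \<le> \<bar>n\<bar> * \<bar>n\<bar>" by (intro mult_left_mono) auto
  thus ?thesis by (simp add: power2_eq_square)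
qed simp

text \<open>Half of the exponent absorbs the power, since x^k is at most k! exp(x) for x = \<beta>
  n^2 / 2. The other half is dominated by a geometric term because |n| \<le> n^2.\<close>

lemma summable_on_gaussian_poly:
  assumes "\<beta> > 0"
  shows "(\<lambda>n::int. \<bar>of_int n\<bar> ^ k * exp (- \<beta> * (of_int n)\<^sup>2) :: real) summable_on UNIV"
proof (rule summable_on_comparison_test)
  show "(\<lambda>n::int. fact k * (2 / \<beta>) ^ k * exp (- (\<beta> / 2) * \<bar>of_int n\<bar>) :: real) summable_on UNIV"
    using assms by (intro summable_on_cmult_right summable_on_int_geometric) simp
  fix n :: int
  define x where "x = \<beta> / 2 * (of_int n :: real)\<^sup>2"
  have x0: "x \<ge> 0" using assms by (simp add: x_def)
  have sq: "\<bar>of_int n\<bar> \<le> ((of_int n)\<^sup>2 :: real)"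
    using abs_int_le_square[of n] by (metis of_int_abs of_int_le_iff of_int_power)
  have "\<bar>of_int n :: real\<bar> ^ k \<le> ((of_int n)\<^sup>2) ^ k" using sq by (intro power_mono) auto
  also have "\<dots> = (2 / \<beta>) ^ k * x ^ k"
    using assms by (simp add: x_def flip: power_mult_distrib)
  also have "\<dots> \<le> (2 / \<beta>) ^ k * (fact k * exp x)"
    using assms power_le_fact_exp[OF x0] by (intro mult_left_mono) auto
  finally have "\<bar>of_int n\<bar> ^ k * exp (- \<beta> * (of_int n)\<^sup>2) \<le>
     (2 / \<beta>) ^ k * (fact k * exp x) * exp (- \<beta> * (of_int n)\<^sup>2)"
    by (intro mult_right_mono) auto
  also have "\<dots> = fact k * (2 / \<beta>) ^ k * exp (- x)"
    by (simp add: x_def mult_ac flip: exp_add)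
  also have "\<dots> \<le> fact k * (2 / \<beta>) ^ k * exp (- (\<beta> / 2) * \<bar>of_int n\<bar>)"
    using sq assms by (intro mult_left_mono) (auto simp: x_def)
  finally show "\<bar>of_int n\<bar> ^ k * exp (- \<beta> * (of_int n)\<^sup>2) \<le>
    fact k * (2 / \<beta>) ^ k * exp (- (\<beta> / 2) * \<bar>of_int n\<bar>)" .
qed auto

lemma summable_on_gaussian:
  "\<beta> > 0 \<Longrightarrow> (\<lambda>n::int. exp (- \<beta> * (of_int n)\<^sup>2) :: real) summable_on UNIV"
  using summable_on_gaussian_poly[of \<beta> 0] by simp

lemma summable_on_int_inverse_square:
  "(\<lambda>n::int. 1 / (1 + (of_int n)\<^sup>2) :: real) summable_on UNIV"
proof (rule summable_on_int)
  have s: "summable (\<lambda>n. 1 / (1 + (real n)\<^sup>2))"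
  proof (rule summable_comparison_test_ev)
    show "summable (\<lambda>n. inverse (real n ^ 2))" by (rule inverse_power_summable) simp
    show "\<forall>\<^sub>F n in sequentially. norm (1 / (1 + (real n)\<^sup>2)) \<le> inverse (real n ^ 2)"
      using eventually_gt_at_top[of 0] by eventually_elim (auto simp: inverse_eq_divide intro!: divide_left_mono mult_pos_pos add_pos_nonneg)
  qed
  thus "(\<lambda>n. 1 / (1 + (of_int (int n))\<^sup>2) :: real) summable_on UNIV"
    by (intro summable_nonneg_imp_summable_on) simp_all
  have "summable (\<lambda>n. 1 / (1 + (real (Suc n))\<^sup>2))" using s by (subst summable_Suc_iff)
  thus "(\<lambda>n. 1 / (1 + (of_int (- int (Suc n)))\<^sup>2) :: real) summable_on UNIV"
    by (intro summable_nonneg_imp_summable_on) (simp_all add: power2_eq_square algebra_simps)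
qed

lemma summable_on_norm_comparison:
  fixes f :: "'a \<Rightarrow> 'b :: banach" and g :: "'a \<Rightarrow> real"
  assumes "g summable_on A" "\<And>x. x \<in> A \<Longrightarrow> norm (f x) \<le> g x"
  shows "(\<lambda>x. norm (f x)) summable_on A" "f summable_on A"
proof -
  show n: "(\<lambda>x. norm (f x)) summable_on A"
    using assms by (intro summable_on_comparison_test[OF assms(1)]) auto
  show "f summable_on A" by (rule abs_summable_summable) (use n in simp)
qed

lemma summable_on_times_nonneg:
  fixes f :: "'a \<Rightarrow> real" and g :: "'b \<Rightarrow> real"
  assumes "f summable_on A" "g summable_on B" "\<And>x. f x \<ge> 0" "\<And>x. g x \<ge> 0"
  shows "(\<lambda>(x, y). f x * g y) summable_on A \<times> B"
proof -
  have "(\<lambda>p. norm ((\<lambda>(x, y). f x * g y) p)) summable_on A \<times> B"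
    unfolding Infinite_Sum.abs_summable_on_Sigma_iff
  proof (intro conjI ballI)
    fix x assume "x \<in> A"
    show "(\<lambda>y. norm (case (x, y) of (x, y) \<Rightarrow> f x * g y)) summable_on B"
      using assms by (simp add: abs_mult summable_on_cmult_right)
  next
    show "(\<lambda>x. norm (\<Sum>\<^sub>\<infinity>y\<in>B. norm (case (x, y) of (x, y) \<Rightarrow> f x * g y))) summable_on A"
      using assms by (simp add: abs_mult infsum_cmult_right' infsum_nonneg summable_on_cmult_left)
  qed
  thus ?thesis by (rule abs_summable_summable)
qed

text \<open>The M-test on closed balls gives a uniform limit of finite sums. The majorant may vary
  with the ball because series on the half-plane have no common majorant near the real axis.\<close>

lemma holomorphic_on_infsum:
  fixes f :: "'i \<Rightarrow> complex \<Rightarrow> complex"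
  assumes "open S" "\<And>i. i \<in> I \<Longrightarrow> f i holomorphic_on S"
    and loc: "\<And>z. z \<in> S \<Longrightarrow> \<exists>r>0. \<exists>M. cball z r \<subseteq> S \<and> M summable_on I \<and>
                 (\<forall>i\<in>I. \<forall>w\<in>cball z r. norm (f i w) \<le> M i)"
  shows "(\<lambda>z. \<Sum>\<^sub>\<infinity>i\<in>I. f i z) holomorphic_on S"
proof -
  have "(\<lambda>z. \<Sum>\<^sub>\<infinity>i\<in>I. f i z) field_differentiable (at z)" if z: "z \<in> S" for z
  proof -
    obtain r M where r: "r > 0" "cball z r \<subseteq> S" "M summable_on I"
      "\<And>i w. i \<in> I \<Longrightarrow> w \<in> cball z r \<Longrightarrow> norm (f i w) \<le> M i"
      using loc[OF z] by blast
    have u: "uniform_limit (cball z r) (\<lambda>X w. \<Sum>i\<in>X. f i w) (\<lambda>w. \<Sum>\<^sub>\<infinity>i\<in>I. f i w)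
        (finite_subsets_at_top I)"
      using r by (intro Weierstrass_m_test_general) auto
    have ev: "\<forall>\<^sub>F X in finite_subsets_at_top I.
       continuous_on (cball z r) (\<lambda>w. \<Sum>i\<in>X. f i w) \<and> (\<lambda>w. \<Sum>i\<in>X. f i w) holomorphic_on ball z r"
      unfolding eventually_finite_subsets_at_top
    proof (intro exI[of _ "{}"] conjI allI impI)
      fix X assume X: "finite X \<and> {} \<subseteq> X \<and> X \<subseteq> I"
      hence "(\<lambda>w. \<Sum>i\<in>X. f i w) holomorphic_on S"
        using assms(2) by (intro holomorphic_on_sum) auto
      thus "continuous_on (cball z r) (\<lambda>w. \<Sum>i\<in>X. f i w)" "(\<lambda>w. \<Sum>i\<in>X. f i w) holomorphic_on ball z r"
        using r(2) ball_subset_cball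
        by (blast intro: holomorphic_on_subset holomorphic_on_imp_continuous_on continuous_on_subset)+
    qed auto
    have "(\<lambda>w. \<Sum>\<^sub>\<infinity>i\<in>I. f i w) holomorphic_on ball z r"
      by (rule holomorphic_uniform_limit[OF ev u finite_subsets_at_top_neq_bot])
    thus ?thesis using r(1) by (simp add: holomorphic_on_open field_differentiable_def)
  qed
  thus ?thesis unfolding holomorphic_on_def
    using field_differentiable_at_within by blast
qed

lemma continuous_on_infsum:
  fixes f :: "'i \<Rightarrow> 'a :: topological_space \<Rightarrow> 'b :: banach"
  assumes "\<And>i. i \<in> I \<Longrightarrow> continuous_on S (f i)" "M summable_on I"
    "\<And>i x. i \<in> I \<Longrightarrow> x \<in> S \<Longrightarrow> norm (f i x) \<le> M i"
  shows "continuous_on S (\<lambda>x. \<Sum>\<^sub>\<infinity>i\<in>I. f i x)"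
proof (rule uniform_limit_theorem)
  show "uniform_limit S (\<lambda>X w. \<Sum>i\<in>X. f i w) (\<lambda>w. \<Sum>\<^sub>\<infinity>i\<in>I. f i w) (finite_subsets_at_top I)"
    using assms by (intro Weierstrass_m_test_general) auto
  show "\<forall>\<^sub>F X in finite_subsets_at_top I. continuous_on S (\<lambda>w. \<Sum>i\<in>X. f i w)"
    unfolding eventually_finite_subsets_at_top using assms(1)
    by (intro exI[of _ "{}"]) (auto intro!: continuous_on_sum)
qed auto

text \<open>The majorant makes the finite partial sums converge uniformly, and integration over a
  compact interval commutes with uniform limits.\<close>

lemma has_sum_integral:
  fixes f :: "'i \<Rightarrow> real \<Rightarrow> complex"
  assumes "\<And>i. continuous_on {a..b} (f i)" "M summable_on I"
    "\<And>i x. i \<in> I \<Longrightarrow> x \<in> {a..b} \<Longrightarrow> norm (f i x) \<le> M i"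
  shows "((\<lambda>i. integral {a..b} (f i)) has_sum integral {a..b} (\<lambda>x. \<Sum>\<^sub>\<infinity>i\<in>I. f i x)) I"
proof -
  have u: "uniform_limit {a..b} (\<lambda>X w. \<Sum>i\<in>X. f i w) (\<lambda>w. \<Sum>\<^sub>\<infinity>i\<in>I. f i w) (finite_subsets_at_top I)"
    using assms by (intro Weierstrass_m_test_general) auto
  obtain J K where JK: "\<And>X. ((\<lambda>w. \<Sum>i\<in>X. f i w) has_integral J X) {a..b}"
      "((\<lambda>w. \<Sum>\<^sub>\<infinity>i\<in>I. f i w) has_integral K) {a..b}" "(J \<longlongrightarrow> K) (finite_subsets_at_top I)"
    by (rule uniform_limit_integral[OF u])
       (auto intro!: continuous_on_sum assms(1))
  have "\<forall>\<^sub>F X in finite_subsets_at_top I. J X = (\<Sum>i\<in>X. integral {a..b} (f i))"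
    unfolding eventually_finite_subsets_at_top
  proof (intro exI[of _ "{}"] conjI allI impI)
    fix X assume "finite X \<and> {} \<subseteq> X \<and> X \<subseteq> I"
    hence "((\<lambda>w. \<Sum>i\<in>X. f i w) has_integral (\<Sum>i\<in>X. integral {a..b} (f i))) {a..b}"
      using assms(1) by (intro has_integral_sum integrable_integral integrable_continuous_real) auto
    thus "J X = (\<Sum>i\<in>X. integral {a..b} (f i))" using JK(1) has_integral_unique by blast
  qed auto
  hence "((\<lambda>X. \<Sum>i\<in>X. integral {a..b} (f i)) \<longlongrightarrow> K) (finite_subsets_at_top I)"
    using JK(3) tendsto_cong by force
  thus ?thesis using JK(2) unfolding has_sum_def by (simp add: integral_unique)
qed

section \<open>Poisson summation\<close>

definition ee :: "complex \<Rightarrow> complex" where "ee z = exp (2 * of_real pi * \<i> * z)"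

lemma ee_add: "ee (a + b) = ee a * ee b"
  by (simp add: ee_def ring_distribs exp_add)

lemma ee_0 [simp]: "ee 0 = 1" by (simp add: ee_def)

lemma ee_neq_0 [simp]: "ee z \<noteq> 0" by (simp add: ee_def)

lemma ee_minus: "ee (- z) = inverse (ee z)"
  by (simp add: ee_def exp_minus)

lemma ee_of_int [simp]: "ee (of_int n) = 1"
proof -
  have "exp (2 * of_real pi * \<i> * of_int n) = exp (\<i> * (of_int (2 * n) * of_real pi))"
    by (simp add: mult_ac)
  thus ?thesis unfolding ee_def using exp_integer_2pi[of "of_int n"] by (simp add: mult_ac)
qed

lemma ee_half: "ee (1/2) = -1"
  by (simp add: ee_def)

lemma norm_ee: "norm (ee z) = exp (- 2 * pi * Im z)"
  by (simp add: ee_def norm_exp_eq_Re)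

lemma cnj_ee: "cnj (ee z) = ee (- cnj z)"
  by (simp add: ee_def exp_cnj)

lemma continuous_on_ee [continuous_intros]:
  "continuous_on S f \<Longrightarrow> continuous_on S (\<lambda>x. ee (f x))"
  unfolding ee_def by (intro continuous_intros)

lemma holomorphic_on_ee [holomorphic_intros]:
  "f holomorphic_on S \<Longrightarrow> (\<lambda>x. ee (f x)) holomorphic_on S"
  unfolding ee_def by (intro holomorphic_intros)

lemma ee_real: "ee (of_real x) = cis (2 * pi * x)"
  by (simp add: ee_def cis_conv_exp mult_ac)

section \<open>Uniqueness of Fourier coefficients on the unit interval\<close>

context
  fixes f :: "real \<Rightarrow> complex"
  assumes cont: "continuous_on {0..1} f"
    and zero: "\<And>k::int. integral {0..1} (\<lambda>x. f x * ee (of_int k * of_real x)) = 0"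
begin

text \<open>The functions orthogonal to \<open>f\<close> in this sense form a module over the trigonometric
  polynomials, so by Stone--Weierstrass they include uniform approximations of the conjugate of \<open>f\<close>.\<close>

definition orth :: "(real \<Rightarrow> complex) \<Rightarrow> bool" where
  "orth h \<longleftrightarrow> continuous_on {0..1} h \<and>
     (\<forall>k::int. integral {0..1} (\<lambda>x. f x * h x * ee (of_int k * of_real x)) = 0)"

lemma orth_one: "orth (\<lambda>x. 1)"
  using zero by (simp add: orth_def)

lemma orth_add: "orth g \<Longrightarrow> orth h \<Longrightarrow> orth (\<lambda>x. g x + h x)"
proof -
  assume gh: "orth g" "orth h"
  hence c: "continuous_on {0..1} g" "continuous_on {0..1} h" by (auto simp: orth_def)
  have "integral {0..1} (\<lambda>x. f x * (g x + h x) * ee (of_int k * of_real x)) = 0" for k :: int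
  proof -
    have "integral {0..1} (\<lambda>x. f x * g x * ee (of_int k * of_real x) + f x * h x * ee (of_int k * of_real x)) =
      integral {0..1} (\<lambda>x. f x * g x * ee (of_int k * of_real x)) +
      integral {0..1} (\<lambda>x. f x * h x * ee (of_int k * of_real x))"
      using cont c by (intro Henstock_Kurzweil_Integration.integral_add integrable_continuous_real continuous_intros)
    thus ?thesis using gh by (simp add: orth_def ring_distribs)
  qed
  thus ?thesis using c by (auto simp: orth_def intro!: continuous_intros)
qed

lemma orth_cmult: "orth g \<Longrightarrow> orth (\<lambda>x. c * g x)"
proof -
  assume g: "orth g"
  have "integral {0..1} (\<lambda>x. f x * (c * g x) * ee (of_int k * of_real x)) = 0" for k :: int
  proof -
    have "integral {0..1} (\<lambda>x. c * (f x * g x * ee (of_int k * of_real x))) = c * 0"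
      using g by (subst integral_mult_right) (auto simp: orth_def)
    thus ?thesis by (simp add: mult_ac)
  qed
  thus ?thesis using g by (auto simp: orth_def intro!: continuous_intros)
qed

lemma orth_ee: "orth g \<Longrightarrow> orth (\<lambda>x. ee (of_int m * of_real x) * g x)"
proof -
  assume g: "orth g"
  have "integral {0..1} (\<lambda>x. f x * (ee (of_int m * of_real x) * g x) * ee (of_int k * of_real x)) = 0" for k :: int
  proof -
    have "(\<lambda>x. f x * (ee (of_int m * of_real x) * g x) * ee (of_int k * of_real x)) =
          (\<lambda>x. f x * g x * ee (of_int (m + k) * of_real x))"
      by (simp add: ring_distribs ee_add mult_ac)
    thus ?thesis using g unfolding orth_def by metis
  qed
  thus ?thesis using g by (auto simp: orth_def intro!: continuous_intros)
qed

lemma orth_polynomial: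
  assumes "real_polynomial_function p"
  shows "orth g \<Longrightarrow> orth (\<lambda>x. of_real (p (ee (of_real x))) * g x)"
  using assms
proof (induction p arbitrary: g rule: real_polynomial_function.induct)
  case (linear p)
  \<comment> \<open>A real-linear \<open>p\<close> takes cos + i sin to cos * \<open>p 1\<close> +
    sin * \<open>p \<i>\<close>. Writing cos and sin by exponentials gives a combination of
    \<open>ee\<close> at x and at -x, and \<open>orth_ee\<close> applies to both.\<close>
  have e: "of_real (p (ee (of_real x))) * g x =
     ((of_real (p 1) - \<i> * of_real (p \<i>)) / 2) * (ee (of_int 1 * of_real x) * g x) +
     ((of_real (p 1) + \<i> * of_real (p \<i>)) / 2) * (ee (of_int (-1) * of_real x) * g x)" for x
  proof -
    have "ee (of_real x) = cos (2 * pi * x) *\<^sub>R 1 + sin (2 * pi * x) *\<^sub>R \<i>"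
      by (simp add: ee_real complex_eq_iff)
    hence "p (ee (of_real x)) = cos (2 * pi * x) * p 1 + sin (2 * pi * x) * p \<i>"
      using linear(1) by (simp add: linear_add linear_scale bounded_linear.linear)
    moreover have "ee (of_int 1 * of_real x) = of_real (cos (2 * pi * x)) + \<i> * of_real (sin (2 * pi * x))"
      by (simp add: ee_real complex_eq_iff)
    moreover have "ee (of_int (-1) * of_real x) = of_real (cos (2 * pi * x)) - \<i> * of_real (sin (2 * pi * x))"
      using ee_real[of "-x"] by (simp add: complex_eq_iff)
    moreover have "(C * P + S * Q) * G = (P - \<i> * Q) / 2 * ((C + \<i> * S) * G) +
        (P + \<i> * Q) / 2 * ((C - \<i> * S) * G)" for C P S Q G :: complex
      by (simp add: field_simps)
    ultimately show ?thesis by (simp only: of_real_add of_real_mult)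
  qed
  show ?case unfolding e by (intro orth_add orth_cmult orth_ee linear)
next
  case (const c)
  thus ?case by (rule orth_cmult)
next
  case (add p q)
  thus ?case using orth_add[OF add.IH(1)[OF add.prems] add.IH(2)[OF add.prems]]
    by (simp add: ring_distribs)
next
  case (mult p q)
  have "orth (\<lambda>x. of_real (p (ee (of_real x))) * (of_real (q (ee (of_real x))) * g x))"
    by (intro mult)
  thus ?case by (simp add: mult_ac)
qed

text \<open>The condition \<open>f 0 = f 1\<close> lets \<open>f\<close> descend to a continuous
  function on the unit circle, where polynomials in the coordinates approximate its conjugate. Each
  approximant is orthogonal to \<open>f\<close>, so the integral of |f|^2 lies below every positive
  bound.\<close>

lemma fourier_zero_imp_zero:
  assumes "f 0 = f 1" "x \<in> {0..1}"
  shows "f x = 0"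
proof -
  define p where "p = (\<lambda>x::real. ee (of_real x))"
  \<comment> \<open>Any preimage under \<open>p\<close> may be chosen: within [0,1] only 0 and 1
    share an image, and \<open>f\<close> agrees there.\<close>
  define F where "F = (\<lambda>w. f (SOME x. x \<in> {0..1} \<and> p x = w))"
  have F: "F (p x) = f x" if x: "x \<in> {0..1}" for x
  proof -
    define y where "y = (SOME y. y \<in> {0..1} \<and> p y = p x)"
    have "y \<in> {0..1} \<and> p y = p x" unfolding y_def by (rule someI[of _ x]) (use x in auto)
    hence y: "y \<in> {0..1}" "cis (2 * pi * y) = cis (2 * pi * x)" by (auto simp: p_def ee_real)
    hence "sin (2 * pi * y) = sin (2 * pi * x) \<and> cos (2 * pi * y) = cos (2 * pi * x)"
      by (simp add: complex_eq_iff)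
    then obtain n where "2 * pi * y = 2 * pi * x + 2 * pi * of_int n"
      using sin_cos_eq_iff[of "2*pi*y" "2*pi*x"] by auto
    hence "2 * pi * (y - (x + of_int n)) = 0" by (simp add: algebra_simps)
    hence n: "y = x + of_int n" by simp
    hence "n = -1 \<or> n = 0 \<or> n = 1" using x y(1) by auto
    hence "f y = f x"
    proof (elim disjE)
      assume "n = 1"
      hence "x = 0" "y = 1" using x y(1) n by auto
      thus ?thesis using assms(1) by simp
    next
      assume "n = -1"
      hence "x = 1" "y = 0" using x y(1) n by auto
      thus ?thesis using assms(1) by simp
    qed (use n in auto)
    thus ?thesis unfolding F_def y_def .
  qed
  have contp: "continuous_on {0..1} p" unfolding p_def by (intro continuous_intros)
  define S where "S = p ` {0..1}"
  have compS: "compact S" unfolding S_def by (rule compact_continuous_image[OF contp]) simp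
  have contF: "continuous_on S F"
  proof (subst continuous_on_closed_vimage)
    show "closed S" using compS by (rule compact_imp_closed)
    \<comment> \<open>\<open>p\<close> maps compact sets to compact sets, so \<open>F\<close>
      inherits continuity from \<open>f\<close>: a preimage under \<open>F\<close> is the
      \<open>p\<close>-image of the corresponding preimage under \<open>f\<close>.\<close>
    show "\<forall>B. closed B \<longrightarrow> closed (F -` B \<inter> S)"
    proof (intro allI impI)
      fix B :: "complex set" assume B: "closed B"
      have "F -` B \<inter> S = p ` (f -` B \<inter> {0..1})"
        unfolding S_def using F by force
      moreover have "closed (f -` B \<inter> {0..1})" using B cont continuous_on_closed_vimage[of "{0..1}" f] by simp
      hence "compact (f -` B \<inter> {0..1})"
        by (metis compact_Icc compact_Int_closed inf_commute inf.idem inf.left_commute inf_sup_aci(1))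
      hence "compact (p ` (f -` B \<inter> {0..1}))"
        by (intro compact_continuous_image continuous_on_subset[OF contp]) auto
      ultimately show "closed (F -` B \<inter> S)" by (simp add: compact_imp_closed)
    qed
  qed
  have bdd: "bounded (f ` {0..1})"
    by (intro compact_imp_bounded compact_continuous_image cont) simp
  then obtain B where B: "B > 0" "\<And>x. x \<in> {0..1} \<Longrightarrow> norm (f x) \<le> B"
    unfolding bounded_pos by auto
  have int_sq: "integral {0..1} (\<lambda>x. f x * cnj (f x)) = 0"
  proof -
    have "norm (integral {0..1} (\<lambda>x. f x * cnj (f x))) \<le> e" if e: "e > 0" for e
    proof -
      obtain g where g: "polynomial_function g" "\<And>w. w \<in> S \<Longrightarrow> norm (cnj (F w) - g w) < e / B"
        using Stone_Weierstrass_polynomial_function[of S "\<lambda>w. cnj (F w)" "e / B"] compS contF e B(1)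
        by (auto intro: continuous_intros)
      have gr: "real_polynomial_function (\<lambda>w. Re (g w))" "real_polynomial_function (\<lambda>w. Im (g w))"
        using g(1) bounded_linear_Re bounded_linear_Im unfolding polynomial_function_def o_def by blast+
      have "orth (\<lambda>x. of_real (Re (g (ee (of_real x)))) * 1 + \<i> * (of_real (Im (g (ee (of_real x)))) * 1))"
        by (intro orth_add orth_cmult orth_polynomial[OF gr(1)] orth_polynomial[OF gr(2)] orth_one)
      hence og: "orth (\<lambda>x. g (p x))" by (simp add: p_def flip: complex_eq)
      hence gz: "integral {0..1} (\<lambda>x. f x * g (p x)) = 0" and cg: "continuous_on {0..1} (\<lambda>x. g (p x))"
        unfolding orth_def by (auto dest: spec[of _ 0])
      have "integral {0..1} (\<lambda>x. f x * cnj (f x)) = integral {0..1} (\<lambda>x. f x * (cnj (f x) - g (p x)))"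
      proof -
        have "integral {0..1} (\<lambda>x. f x * cnj (f x) - f x * g (p x)) =
          integral {0..1} (\<lambda>x. f x * cnj (f x)) - integral {0..1} (\<lambda>x. f x * g (p x))"
          using cont cg by (intro Henstock_Kurzweil_Integration.integral_diff integrable_continuous_real continuous_intros)
        thus ?thesis using gz by (simp add: ring_distribs)
      qed
      also have "norm \<dots> \<le> B * (e / B) * (1 - 0)"
      proof (rule integral_bound)
        show "continuous_on {0..1} (\<lambda>x. f x * (cnj (f x) - g (p x)))"
          using cont cg by (intro continuous_intros)
        fix t :: real assume t: "t \<in> {0..1}"
        have "norm (cnj (F (p t)) - g (p t)) < e / B" using t by (intro g(2)) (auto simp: S_def)
        thus "norm (f t * (cnj (f t) - g (p t))) \<le> B * (e / B)"
          unfolding norm_mult using B(1) B(2)[OF t] F[OF t] by (intro mult_mono) auto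
      qed auto
      finally show ?thesis using B(1) by simp
    qed
    hence "norm (integral {0..1} (\<lambda>x. f x * cnj (f x))) \<le> 0" by (rule field_le_epsilon) simp
    thus ?thesis by simp
  qed
  have "((\<lambda>x. (norm (f x))\<^sup>2) has_integral 0) {0..1}"
  proof -
    have "((\<lambda>x. f x * cnj (f x)) has_integral 0) {0..1}"
      using cont by (subst int_sq[symmetric]) (intro integrable_integral integrable_continuous_real continuous_intros)
    hence "((\<lambda>x. Re (f x * cnj (f x))) has_integral Re 0) {0..1}"
      by (rule has_integral_Re)
    moreover have "Re (f x * cnj (f x)) = (norm (f x))\<^sup>2" for x
      unfolding complex_mult_cnj cmod_power2 by simp
    ultimately show ?thesis by simp
  qed
  hence "(norm (f x))\<^sup>2 = 0"
    using assms(2) cont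
    by (intro has_integral_0_cbox_imp_0[where a = 0 and b = 1 and f = "\<lambda>x. (norm (f x))\<^sup>2"]) (auto intro!: continuous_intros)
  thus ?thesis by simp
qed

end

lemma fourier_coeffs_determine:
  fixes f g :: "real \<Rightarrow> complex"
  assumes "continuous_on {0..1} f" "continuous_on {0..1} g" "f 0 = f 1" "g 0 = g 1"
    "\<And>k::int. integral {0..1} (\<lambda>x. f x * ee (of_int k * of_real x)) =
       integral {0..1} (\<lambda>x. g x * ee (of_int k * of_real x))"
    "x \<in> {0..1}"
  shows "f x = g x"
proof -
  have "integral {0..1} (\<lambda>x. (f x - g x) * ee (of_int k * of_real x)) = 0" for k :: int
  proof -
    have "integral {0..1} (\<lambda>x. f x * ee (of_int k * of_real x) - g x * ee (of_int k * of_real x)) =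
      integral {0..1} (\<lambda>x. f x * ee (of_int k * of_real x)) - integral {0..1} (\<lambda>x. g x * ee (of_int k * of_real x))"
      using assms by (intro Henstock_Kurzweil_Integration.integral_diff integrable_continuous_real continuous_intros)
    thus ?thesis using assms(5) by (simp add: ring_distribs)
  qed
  hence "f x - g x = 0"
    using assms by (intro fourier_zero_imp_zero[where f = "\<lambda>x. f x - g x"]) (auto intro!: continuous_intros)
  thus ?thesis by simp
qed

section \<open>Poisson summation for Gaussians with a complex shift\<close>

lemma gaussian_fourier:
  assumes a: "a > 0"
  shows "integrable lborel (\<lambda>x::real. of_real (exp (- pi * a * x\<^sup>2)) * ee (of_real (s * x)))"
    and "(LBINT x. of_real (exp (- pi * a * x\<^sup>2)) * ee (of_real (s * x))) =
           of_real (exp (- pi * s\<^sup>2 / a) / sqrt a)"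
proof -
  \<comment> \<open>\<open>c\<close> and \<open>t\<close> rescale the characteristic function of the
    standard normal law: (c x)^2 / 2 = pi a x^2 and t (c x) = 2 pi s x.\<close>
  define c where "c = sqrt (2 * pi * a)"
  have c: "c > 0" "c\<^sup>2 = 2 * pi * a" using a by (auto simp: c_def)
  define t where "t = 2 * pi * s / c"
  define h where "h = (\<lambda>x::real. std_normal_density x *\<^sub>R iexp (t * x))"
  have hc: "h (0 + c * x) = of_real (1 / sqrt (2 * pi)) * (of_real (exp (- pi * a * x\<^sup>2)) * ee (of_real (s * x)))" for x
  proof -
    have "(c * x)\<^sup>2 / 2 = pi * a * x\<^sup>2" using c(2) by (simp add: power_mult_distrib)
    moreover have "t * (c * x) = 2 * pi * (s * x)" using c(1) by (simp add: t_def)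
    moreover have "h (0 + c * x) = of_real (1 / sqrt (2 * pi) * exp (- ((c * x)\<^sup>2 / 2))) * iexp (t * (c * x))"
      by (simp add: h_def std_normal_density_def scaleR_conv_of_real)
    ultimately have "h (0 + c * x) = of_real (1 / sqrt (2 * pi) * exp (- (pi * a * x\<^sup>2))) * iexp (2 * pi * (s * x))"
      by (simp only:)
    thus ?thesis by (simp add: ee_def mult_ac)
  qed
  have meas: "h \<in> borel_measurable lborel" unfolding h_def by measurable
  have inth: "integrable lborel h"
  proof (rule Bochner_Integration.integrable_bound[of lborel std_normal_density])
    show "integrable lborel std_normal_density"
      using integrable_std_normal_moment[of 0] by simp
  qed (use meas in \<open>auto simp: h_def\<close>)
  have "integral\<^sup>L lborel h = char std_normal_distribution t"
    unfolding char_def h_def by (subst integral_density) auto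
  hence vh: "integral\<^sup>L lborel h = of_real (exp (- t\<^sup>2 / 2))"
    by (simp add: char_std_normal_distribution)
  have "integrable lborel (\<lambda>x. h (0 + c * x))"
    using inth c(1) by (intro lborel_integrable_real_affine) auto
  hence "integrable lborel (\<lambda>x. of_real (sqrt (2 * pi)) * h (0 + c * x))" by simp
  moreover have e: "of_real (sqrt (2 * pi)) * h (0 + c * x) =
       of_real (exp (- pi * a * x\<^sup>2)) * ee (of_real (s * x))" for x
    unfolding hc by simp
  ultimately show int: "integrable lborel (\<lambda>x::real. of_real (exp (- pi * a * x\<^sup>2)) * ee (of_real (s * x)))"
    by simp
  have "(LBINT x. of_real (exp (- pi * a * x\<^sup>2)) * ee (of_real (s * x))) =
      of_real (sqrt (2 * pi)) * (LBINT x. h (0 + c * x))"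
    unfolding e[symmetric] by simp
  also have "(LBINT x. h (0 + c * x)) = of_real (exp (- t\<^sup>2 / 2)) / of_real c"
    using lborel_integral_real_affine[of c h 0] c(1) vh by (simp add: scaleR_conv_of_real field_simps)
  also have "of_real (sqrt (2 * pi)) * (of_real (exp (- t\<^sup>2 / 2)) / of_real c) =
     (of_real (sqrt (2 * pi) * exp (- t\<^sup>2 / 2) / c) :: complex)" by simp
  also have "- t\<^sup>2 / 2 = - pi * s\<^sup>2 / a"
    using a c by (simp add: t_def power_divide power_mult_distrib power2_eq_square)
  also have "sqrt (2 * pi) * exp (- pi * s\<^sup>2 / a) / c = exp (- pi * s\<^sup>2 / a) / sqrt a"
    using a by (simp add: c_def real_sqrt_mult field_simps)
  finally show "(LBINT x. of_real (exp (- pi * a * x\<^sup>2)) * ee (of_real (s * x))) =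
           of_real (exp (- pi * s\<^sup>2 / a) / sqrt a)" .
qed


text \<open>The integer translates of [0,1] tile the line, so integrating the periodization over
  [0,1] integrates \<open>h\<close> over the line. With \<open>h\<close> a Gaussian times an
  exponential this computes a Fourier coefficient.\<close>

lemma gaussian_periodization_coeff:
  fixes h :: "real \<Rightarrow> complex"
  assumes int: "integrable lborel h" and cont: "continuous_on UNIV h"
    and M: "M summable_on UNIV" "\<And>(m::int) x. x \<in> {0..1} \<Longrightarrow> norm (h (x + of_int m)) \<le> M m"
  shows "integral {0..1} (\<lambda>x. \<Sum>\<^sub>\<infinity>m::int. h (x + of_int m)) = (LBINT x. h x)"
proof -
  define J where "J = integral {0..1} (\<lambda>x. \<Sum>\<^sub>\<infinity>m::int. h (x + of_int m))"
  have c': "continuous_on S h" for S using cont continuous_on_subset by blast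
  have hs: "((\<lambda>m::int. integral {0..1} (\<lambda>x. h (x + of_int m))) has_sum J) UNIV"
    unfolding J_def
    by (rule has_sum_integral[OF _ M(1) M(2)])
       (auto intro!: continuous_on_compose2[OF cont] continuous_intros)
  have sh: "integral {0..1} (\<lambda>x. h (x + of_int m)) = integral {of_int m..of_int m + 1} h" for m :: int
    using integral_shift[where a = 0 and b = 1 and c = "of_int m" and f = h] c' by (simp add: add.commute o_def)
  \<comment> \<open>An unordered sum is the limit along any cofinal chain of finite sets. Half-open
    blocks are taken because the unit intervals starting at -N, ..., N - 1 make up exactly
    [-N, N].\<close>
  have fl: "filterlim (\<lambda>N. {- int N..<int N}) (finite_subsets_at_top UNIV) sequentially"
  proof (rule filterlim_finite_subsets_at_top[THEN iffD2], intro allI impI)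
    fix X :: "int set" assume "finite X \<and> X \<subseteq> UNIV"
    hence "finite (abs ` X)" by simp
    then obtain K where K: "\<And>x. x \<in> X \<Longrightarrow> \<bar>x\<bar> \<le> K"
      by (metis bdd_above_finite bdd_above_def imageI)
    show "\<forall>\<^sub>F N in sequentially. finite {- int N..<int N} \<and> X \<subseteq> {- int N..<int N} \<and> {- int N..<int N} \<subseteq> UNIV"
      using eventually_ge_at_top[of "nat (K + 1)"]
    proof eventually_elim
      case (elim N)
      have "x \<in> {- int N..<int N}" if "x \<in> X" for x using K[OF that] elim by auto
      thus ?case by auto
    qed
  qed
  have part: "(\<Sum>m\<in>{- int N..<int N}. integral {of_int m..of_int m + 1} h) = integral {- real N..real N} h" for N
  proof (induction N)
    case (Suc N)
    have "{- int (Suc N)..<int (Suc N)} = insert (- int (Suc N)) (insert (int N) {- int N..<int N})"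
      by auto
    hence "(\<Sum>m\<in>{- int (Suc N)..<int (Suc N)}. integral {of_int m..of_int m + 1} h) =
      integral {- 1 - real N..- real N} h + (integral {- real N..real N} h + integral {real N..real N + 1} h)"
      using Suc by (simp add: add_ac)
    also have "integral {- real N..real N} h + integral {real N..real N + 1} h = integral {- real N..real N + 1} h"
      by (intro Henstock_Kurzweil_Integration.integral_combine integrable_continuous_real c') auto
    also have "integral {- 1 - real N..- real N} h + integral {- real N..real N + 1} h = integral {- 1 - real N..real N + 1} h"
      by (intro Henstock_Kurzweil_Integration.integral_combine integrable_continuous_real c') auto
    finally show ?case by (simp add: add_ac)
  qed simp
  have "(\<lambda>N. integral {- real N..real N} h) \<longlonglongrightarrow> J"
    using filterlim_compose[OF hs[unfolded has_sum_def] fl] by (simp add: sh part)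
  moreover have "(\<lambda>N. integral {- real N..real N} h) \<longlonglongrightarrow> (LBINT x. h x)"
  proof -
    have "(\<lambda>N. LBINT x. indicator {- real N..real N} x *\<^sub>R h x) \<longlonglongrightarrow> (LBINT x. h x)"
    proof (rule integral_dominated_convergence[where w = "\<lambda>x. norm (h x)"])
      show "integrable lborel (\<lambda>x. norm (h x))" using int by simp
      show "AE x in lborel. (\<lambda>N. indicator {- real N..real N} x *\<^sub>R h x) \<longlonglongrightarrow> h x"
      proof (intro AE_I2 tendsto_eventually)
        fix x :: real
        show "\<forall>\<^sub>F N in sequentially. indicator {- real N..real N} x *\<^sub>R h x = h x"
          using eventually_ge_at_top[of "nat \<lceil>\<bar>x\<bar>\<rceil>"]
          by eventually_elim (auto simp: indicator_def abs_le_iff ceiling_le_iff nat_le_iff)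
      qed
    qed (use int in \<open>auto simp: indicator_def\<close>)
    moreover have "(LBINT x. indicator {- real N..real N} x *\<^sub>R h x) = integral {- real N..real N} h" for N
      using set_borel_integral_eq_integral(2)[OF borel_integrable_atLeastAtMost'[OF c'], of "- real N" "real N"]
      by (simp add: set_lebesgue_integral_def)
    ultimately show ?thesis by simp
  qed
  ultimately show ?thesis unfolding J_def by (rule LIMSEQ_unique)
qed

lemma square_shift_lower: "(m + x)\<^sup>2 \<ge> m\<^sup>2 / 2 - (x::real)\<^sup>2"
proof -
  have "(m + 2 * x)\<^sup>2 \<ge> 0" by simp
  thus ?thesis by (simp add: power2_eq_square algebra_simps)
qed

lemma norm_gaussian_shift_le:
  fixes u :: complex
  assumes a: "a > 0" and R: "norm u \<le> R"
  shows "norm (exp (- of_real (pi * a) * (u + of_int m)\<^sup>2)) \<le>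
     exp (pi * a * (2 * R\<^sup>2)) * exp (- (pi * a / 2) * (of_int m)\<^sup>2)"
proof -
  have "(Re u)\<^sup>2 + (Im u)\<^sup>2 \<le> R\<^sup>2"
    using R by (simp add: cmod_power2[symmetric] power_mono)
  hence "(Re u)\<^sup>2 \<le> R\<^sup>2" "(Im u)\<^sup>2 \<le> R\<^sup>2" by (smt (verit) zero_le_power2)+
  hence "(of_int m + Re u)\<^sup>2 - (Im u)\<^sup>2 \<ge> (of_int m)\<^sup>2 / 2 - 2 * R\<^sup>2"
    using square_shift_lower[of "of_int m" "Re u"] by linarith
  moreover have "Re ((u + of_int m)\<^sup>2) = (of_int m + Re u)\<^sup>2 - (Im u)\<^sup>2"
    by (simp add: power2_eq_square algebra_simps)
  ultimately have "pi * a * Re ((u + of_int m)\<^sup>2) \<ge> pi * a * ((of_int m)\<^sup>2 / 2 - 2 * R\<^sup>2)"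
    using a by (intro mult_left_mono) auto
  hence "exp (- (pi * a * Re ((u + of_int m)\<^sup>2))) \<le> exp (pi * a * (2 * R\<^sup>2) + - (pi * a / 2) * (of_int m)\<^sup>2)"
    by (subst exp_le_cancel_iff) (simp add: algebra_simps)
  moreover have "norm (exp (- of_real (pi * a) * (u + of_int m)\<^sup>2)) = exp (- (pi * a * Re ((u + of_int m)\<^sup>2)))"
    by (subst norm_exp_eq_Re) (simp only: Re_complex_of_real flip: of_real_minus, simp)
  ultimately show ?thesis by (simp only: exp_add)
qed

text \<open>The imaginary part of \<open>u\<close> causes growth like exp(2 pi R |k|). The
  inequality 4 a R |k| \<le> k^2 + 4 a^2 R^2 trades this growth for half of the Gaussian
  exponent.\<close>

lemma norm_theta_term_le:
  assumes a: "a > 0" and R: "norm u \<le> R"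
  shows "norm (of_real (exp (- pi * (of_int k)\<^sup>2 / a)) * ee (of_int k * u)) \<le>
     exp (2 * pi * a * R\<^sup>2) * exp (- (pi / (2 * a)) * (of_int k)\<^sup>2)"
proof -
  have R0: "R \<ge> 0" using R norm_ge_zero order_trans by blast
  have "\<bar>Im u\<bar> \<le> R" using R abs_Im_le_cmod order_trans by blast
  hence "\<bar>of_int k * Im u\<bar> \<le> \<bar>of_int k\<bar> * R" by (simp add: abs_mult mult_left_mono)
  hence 1: "- (of_int k * Im u) \<le> \<bar>of_int k\<bar> * R" by linarith
  have "(\<bar>of_int k\<bar> - 2 * a * R)\<^sup>2 \<ge> 0" by simp
  hence "4 * a * (\<bar>of_int k\<bar> * R) \<le> (of_int k)\<^sup>2 + 4 * a\<^sup>2 * R\<^sup>2"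
    by (simp add: power2_eq_square algebra_simps)
  hence "2 * (\<bar>of_int k\<bar> * R) \<le> (of_int k)\<^sup>2 / (2 * a) + 2 * a * R\<^sup>2"
    using a by (simp add: field_simps power2_eq_square)
  hence "- 2 * (of_int k * Im u) \<le> (of_int k)\<^sup>2 / (2 * a) + 2 * a * R\<^sup>2" using 1 by linarith
  hence "pi * (- 2 * (of_int k * Im u)) \<le> pi * ((of_int k)\<^sup>2 / (2 * a) + 2 * a * R\<^sup>2)"
    by (intro mult_left_mono) auto
  moreover have "pi * (of_int k)\<^sup>2 / a = 2 * (pi * ((of_int k)\<^sup>2 / (2 * a)))" by simp
  ultimately have "- pi * (of_int k)\<^sup>2 / a + (- 2 * pi * (of_int k * Im u)) \<le>
     2 * pi * a * R\<^sup>2 + - (pi / (2 * a)) * (of_int k)\<^sup>2"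
    by (simp add: algebra_simps)
  thus ?thesis unfolding norm_mult norm_ee by (simp flip: exp_add)
qed

text \<open>Both sides are continuous with equal values at 0 and 1, so Fourier coefficients decide.
  On the left the sum unfolds to the Gaussian transform at \<open>l\<close>; on the right
  orthogonality leaves only the term \<open>k = -l\<close>.\<close>

lemma poisson_gaussian_real:
  assumes a: "a > 0" and x: "x \<in> {0..1}"
  shows "(\<Sum>\<^sub>\<infinity>m::int. exp (- of_real (pi * a) * (of_real x + of_int m)\<^sup>2)) =
    of_real (1 / sqrt a) * (\<Sum>\<^sub>\<infinity>k::int. of_real (exp (- pi * (of_int k)\<^sup>2 / a)) * ee (of_int k * of_real x))"
    (is "?G x = ?S x")
proof -
  define M1 where "M1 = (\<lambda>m::int. exp (pi * a * (2 * 1\<^sup>2)) * exp (- (pi * a / 2) * (of_int m)\<^sup>2))"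
  define M2 where "M2 = (\<lambda>m::int. exp (2 * pi * a * 1\<^sup>2) * exp (- (pi / (2 * a)) * (of_int m)\<^sup>2))"
  have M: "M1 summable_on UNIV" "M2 summable_on UNIV" unfolding M1_def M2_def
    using a by (intro summable_on_cmult_right summable_on_gaussian; simp)+
  have b1: "norm (exp (- of_real (pi * a) * (of_real x + of_int m)\<^sup>2) :: complex) \<le> M1 m" if "x \<in> {0..1}" for m x
    unfolding M1_def using that by (intro norm_gaussian_shift_le a) auto
  have b2: "norm (of_real (exp (- pi * (of_int k)\<^sup>2 / a)) * ee (of_int k * of_real x)) \<le> M2 k" if "x \<in> {0..1}" for k x
    unfolding M2_def using that by (intro norm_theta_term_le a) auto
  define h where "h = (\<lambda>(l::int) (x::real). of_real (exp (- pi * a * x\<^sup>2)) * ee (of_int l * of_real x))"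
  have hs: "h l (x + of_int m) = exp (- of_real (pi * a) * (of_real x + of_int m)\<^sup>2) * ee (of_int l * of_real x)" for l m x
  proof -
    have "ee (of_int l * of_real (x + of_int m)) = ee (of_int l * of_real x) * ee (of_int (l * m))"
      by (subst ee_add[symmetric]) (simp add: algebra_simps)
    moreover have "of_real (exp (- pi * a * (x + of_int m)\<^sup>2)) = exp (- of_real (pi * a) * (of_real x + of_int m)\<^sup>2 :: complex)"
      by (simp flip: exp_of_real)
    ultimately show ?thesis by (simp add: h_def del: of_int_mult)
  qed
  have n1: "norm (ee (of_int l * of_real x)) = 1" for l x by (simp add: norm_ee)
  show ?thesis
  proof (rule fourier_coeffs_determine[where f = ?G and g = ?S])
    show "continuous_on {0..1} ?G"
      by (rule continuous_on_infsum[OF _ M(1) b1]) (auto intro!: continuous_intros)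
    have cS: "continuous_on {0..1} (\<lambda>x. \<Sum>\<^sub>\<infinity>k::int. of_real (exp (- pi * (of_int k)\<^sup>2 / a)) * ee (of_int k * of_real x))"
      by (rule continuous_on_infsum[OF _ M(2) b2]) (auto intro!: continuous_intros)
    thus "continuous_on {0..1} ?S" by (intro continuous_intros)
    show "?G 0 = ?G 1"
    proof -
      have "bij_betw (\<lambda>m::int. m + 1) UNIV UNIV" by (rule bij_betw_byWitness[where f' = "\<lambda>m. m - 1"]) auto
      from infsum_reindex_bij_betw[OF this, of "\<lambda>m. exp (- of_real (pi * a) * (of_int m)\<^sup>2) :: complex"]
      show ?thesis by (simp add: add.commute)
    qed
    show "?S 0 = ?S 1" using ee_of_int by simp
    show "integral {0..1} (\<lambda>x. ?G x * ee (of_int l * of_real x)) =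
          integral {0..1} (\<lambda>x. ?S x * ee (of_int l * of_real x))" for l :: int
    proof -
      have "integral {0..1} (\<lambda>x. ?G x * ee (of_int l * of_real x)) =
         integral {0..1} (\<lambda>x. \<Sum>\<^sub>\<infinity>m::int. h l (x + of_int m))"
        by (simp only: hs infsum_cmult_left')
      also have "\<dots> = (LBINT x. h l x)"
      proof (rule gaussian_periodization_coeff[OF _ _ M(1)])
        show "integrable lborel (h l)"
          using gaussian_fourier(1)[OF a, of "of_int l"] by (simp add: h_def)
        show "continuous_on UNIV (h l)" unfolding h_def by (intro continuous_intros)
        show "norm (h l (x + of_int m)) \<le> M1 m" if "x \<in> {0..1}" for m x
          unfolding hs norm_mult n1 using b1[OF that] by simp
      qed
      also have "\<dots> = of_real (exp (- pi * (of_int l)\<^sup>2 / a) / sqrt a)"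
        using gaussian_fourier(2)[OF a, of "of_int l"] by (simp add: h_def)
      finally have L: "integral {0..1} (\<lambda>x. ?G x * ee (of_int l * of_real x)) = of_real (exp (- pi * (of_int l)\<^sup>2 / a) / sqrt a)" .
      define T where "T = (\<lambda>(k::int) (x::real). of_real (exp (- pi * (of_int k)\<^sup>2 / a)) * ee (of_int k * of_real x) * ee (of_int l * of_real x))"
      have Tk: "T k = (\<lambda>x. of_real (exp (- pi * (of_int k)\<^sup>2 / a)) * ee (of_int (k + l) * of_real x))" for k
        by (simp add: T_def fun_eq_iff ring_distribs ee_add mult_ac)
      have ik: "integral {0..1} (\<lambda>x. ee (of_int k * of_real x)) = (if k = 0 then 1 else 0)" for k :: int
      proof (cases "k = 0")
        case False
        have "((\<lambda>x. ee (of_int k * of_real x)) has_integral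
           ee (of_int k * of_real 1) / (2 * of_real pi * \<i> * of_int k) - ee (of_int k * of_real 0) / (2 * of_real pi * \<i> * of_int k)) {0..1}"
          using False
          by (intro fundamental_theorem_of_calculus)
             (auto simp: ee_def intro!: derivative_eq_intros has_vector_derivative_real_field)
        thus ?thesis using False by (simp add: integral_unique)
      qed simp
      have "((\<lambda>k. integral {0..1} (T k)) has_sum integral {0..1} (\<lambda>x. \<Sum>\<^sub>\<infinity>k. T k x)) UNIV"
      proof (rule has_sum_integral[OF _ M(2)])
        show "continuous_on {0..1} (T k)" for k unfolding T_def by (intro continuous_intros)
        show "norm (T k x) \<le> M2 k" if "x \<in> {0..1}" for k x
          unfolding T_def norm_mult[of _ "ee (of_int l * of_real x)"] n1 using b2[OF that] by simp
      qed
      moreover have "integral {0..1} (T k) = (if k = - l then of_real (exp (- pi * (of_int l)\<^sup>2 / a)) else 0)" for k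
        unfolding Tk by (subst integral_mult_right) (auto simp: ik simp del: of_int_add)
      ultimately have "((\<lambda>k. if k = - l then of_real (exp (- pi * (of_int l)\<^sup>2 / a)) else 0) has_sum integral {0..1} (\<lambda>x. \<Sum>\<^sub>\<infinity>k. T k x)) UNIV"
        by simp
      moreover have "((\<lambda>k. if k = - l then of_real (exp (- pi * (of_int l)\<^sup>2 / a)) else 0) has_sum (of_real (exp (- pi * (of_int l)\<^sup>2 / a)) :: complex)) UNIV"
      proof -
        have "((\<lambda>k. if k = - l then of_real (exp (- pi * (of_int l)\<^sup>2 / a)) else 0) has_sum (\<Sum>k\<in>{-l}. if k = - l then of_real (exp (- pi * (of_int l)\<^sup>2 / a)) else (0::complex))) {-l}"
          by (rule has_sum_finite) simp
        thus ?thesis by (subst has_sum_cong_neutral[where T = "{-l}" and g = "\<lambda>k. if k = - l then of_real (exp (- pi * (of_int l)\<^sup>2 / a)) else 0"]) auto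
      qed
      ultimately have iT: "integral {0..1} (\<lambda>x. \<Sum>\<^sub>\<infinity>k. T k x) = of_real (exp (- pi * (of_int l)\<^sup>2 / a))"
        by (rule has_sum_unique)
      have "integral {0..1} (\<lambda>x. ?S x * ee (of_int l * of_real x)) =
            integral {0..1} (\<lambda>x. of_real (1 / sqrt a) * (\<Sum>\<^sub>\<infinity>k. T k x))"
        unfolding T_def infsum_cmult_left' by (simp only: mult.assoc)
      also have "\<dots> = of_real (1 / sqrt a) * integral {0..1} (\<lambda>x. \<Sum>\<^sub>\<infinity>k. T k x)"
        by (rule integral_mult_right)
      finally have R: "integral {0..1} (\<lambda>x. ?S x * ee (of_int l * of_real x)) =
          of_real (1 / sqrt a) * integral {0..1} (\<lambda>x. \<Sum>\<^sub>\<infinity>k. T k x)" .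
      show ?thesis unfolding L R iT by simp
    qed
  qed (rule x)
qed

text \<open>Both sides are entire in \<open>u\<close> and agree on [0,1], which accumulates at 0.
  Complex shifts are required because row n of the lattice leads to the shift n z + 1/2.\<close>

theorem poisson_gaussian:
  assumes a: "a > 0"
  shows "(\<Sum>\<^sub>\<infinity>m::int. exp (- of_real (pi * a) * (u + of_int m)\<^sup>2)) =
    of_real (1 / sqrt a) * (\<Sum>\<^sub>\<infinity>k::int. of_real (exp (- pi * (of_int k)\<^sup>2 / a)) * ee (of_int k * u))"
    (is "?G u = ?S u")
proof -
  have hG: "?G holomorphic_on UNIV"
  proof (rule holomorphic_on_infsum)
    fix z :: complex
    have "norm w \<le> norm z + 1" if "w \<in> cball z 1" for w
      using that norm_triangle_sub[of w z] by (simp add: dist_norm norm_minus_commute)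
    thus "\<exists>r>0. \<exists>M. cball z r \<subseteq> UNIV \<and> M summable_on UNIV \<and>
      (\<forall>m\<in>UNIV. \<forall>w\<in>cball z r. norm (exp (- of_real (pi * a) * (w + of_int m)\<^sup>2)) \<le> M m)"
      using a by (intro exI[of _ 1] conjI exI[of _ "\<lambda>m. exp (pi * a * (2 * (norm z + 1)\<^sup>2)) * exp (- (pi * a / 2) * (of_int m)\<^sup>2)"]
        summable_on_cmult_right summable_on_gaussian ballI norm_gaussian_shift_le) auto
  qed (auto intro!: holomorphic_intros)
  have hS: "?S holomorphic_on UNIV"
  proof (intro holomorphic_intros holomorphic_on_infsum)
    fix z :: complex
    have "norm w \<le> norm z + 1" if "w \<in> cball z 1" for w
      using that norm_triangle_sub[of w z] by (simp add: dist_norm norm_minus_commute)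
    thus "\<exists>r>0. \<exists>M. cball z r \<subseteq> UNIV \<and> M summable_on UNIV \<and>
      (\<forall>k\<in>UNIV. \<forall>w\<in>cball z r. norm (of_real (exp (- pi * (of_int k)\<^sup>2 / a)) * ee (of_int k * w)) \<le> M k)"
      using a by (intro exI[of _ 1] conjI exI[of _ "\<lambda>k. exp (2 * pi * a * (norm z + 1)\<^sup>2) * exp (- (pi / (2 * a)) * (of_int k)\<^sup>2)"]
        summable_on_cmult_right summable_on_gaussian ballI norm_theta_term_le) auto
  qed auto
  have "?G u - ?S u = 0"
  proof (rule analytic_continuation[where f = "\<lambda>u. ?G u - ?S u" and S = UNIV and U = "of_real ` {0..1}" and \<xi> = 0])
    show "(\<lambda>u. ?G u - ?S u) holomorphic_on UNIV" by (intro holomorphic_intros hG hS)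
    have "(0::complex) islimpt of_real ` {0<..<1::real}"
    proof (rule islimpt_sequential[THEN iffD2], intro exI[of _ "\<lambda>n. of_real (1 / real (n + 2))"] conjI allI)
      show "(\<lambda>n. of_real (1 / real (n + 2)) :: complex) \<longlonglongrightarrow> 0"
      proof -
        have "(\<lambda>n. 1 / real (n + 2)) \<longlonglongrightarrow> 0" by real_asymp
        from tendsto_of_real[OF this, where 'a = complex] show ?thesis by simp
      qed
      show "of_real (1 / real (n + 2)) \<in> of_real ` {0<..<1::real} - {0}" for n
        by (intro DiffI imageI) auto
    qed
    thus "(0::complex) islimpt of_real ` {0..1}" by (rule islimpt_subset) auto
    show "?G z - ?S z = 0" if "z \<in> of_real ` {0..1}" for z
      using that poisson_gaussian_real[OF a] by auto
  qed auto
  thus ?thesis by simp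
qed

section \<open>Gauss's product for the theta series\<close>

lemma convergent_prod_qpoch:
  fixes a q :: complex
  assumes "norm q < 1" "\<And>t. a * q ^ t \<noteq> 1"
  shows "convergent_prod (\<lambda>t. 1 - a * q ^ t)"
proof -
  have "summable (\<lambda>t. norm a * norm q ^ t)" using assms by (intro summable_mult summable_geometric) auto
  hence "summable (\<lambda>t. norm (- (a * q ^ t)))" by (simp add: norm_mult norm_power)
  hence "convergent_prod (\<lambda>t. 1 + - (a * q ^ t))"
    using assms(2) by (intro summable_imp_convergent_prod_complex) auto
  thus ?thesis by simp
qed

lemma qpoch_inf_nonzero:
  assumes "norm q < 1" "\<And>t. a * q ^ t \<noteq> 1"
  shows "qpoch_inf a q \<noteq> 0"
  unfolding qpoch_inf_def using assms(2)
  by (intro prodinf_nonzero convergent_prod_qpoch assms) (metis eq_iff_diff_eq_0)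

lemma qpoch_inf_LIMSEQ:
  assumes "norm q < 1" "\<And>t. a * q ^ t \<noteq> 1"
  shows "(\<lambda>n. \<Prod>t<n. 1 - a * q ^ t) \<longlonglongrightarrow> qpoch_inf a q"
proof -
  have "(\<lambda>n. \<Prod>t\<le>n. 1 - a * q ^ t) \<longlonglongrightarrow> qpoch_inf a q"
    unfolding qpoch_inf_def by (rule convergent_prod_LIMSEQ[OF convergent_prod_qpoch[OF assms]])
  hence "(\<lambda>n. \<Prod>t<Suc n. 1 - a * q ^ t) \<longlonglongrightarrow> qpoch_inf a q" by (simp add: lessThan_Suc_atMost)
  thus ?thesis by (rule LIMSEQ_imp_Suc)
qed

lemma qpoch_inf_rec:
  assumes "norm q < 1" "\<And>t. a * q ^ t \<noteq> 1"
  shows "qpoch_inf a q = (1 - a) * qpoch_inf (a * q) q"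
proof -
  have "(\<lambda>n. \<Prod>t<Suc n. 1 - a * q ^ t) \<longlonglongrightarrow> qpoch_inf a q"
    using qpoch_inf_LIMSEQ[OF assms] by (rule LIMSEQ_Suc)
  moreover have "(\<Prod>t<Suc n. 1 - a * q ^ t) = (1 - a) * (\<Prod>t<n. 1 - a * q * q ^ t)" for n
    by (subst prod.lessThan_Suc_shift) (simp add: mult_ac)
  moreover have "(\<lambda>n. (1 - a) * (\<Prod>t<n. 1 - a * q * q ^ t)) \<longlonglongrightarrow> (1 - a) * qpoch_inf (a * q) q"
    using assms(2)[of "Suc _"] by (intro tendsto_mult tendsto_const qpoch_inf_LIMSEQ assms(1)) (simp add: mult_ac)
  ultimately show ?thesis using LIMSEQ_unique by simp
qed

context
  fixes q :: complex
  assumes q: "norm q < 1"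
begin

lemma power_neq_1: "q ^ Suc n \<noteq> 1"
proof
  assume "q ^ Suc n = 1"
  hence "norm q ^ Suc n = 1" by (metis norm_one norm_power)
  moreover have "norm q ^ Suc n < 1" using power_decreasing[of 1 "Suc n" "norm q"] q by simp
  ultimately show False by simp
qed

lemma power_neq_minus_1: "q ^ n \<noteq> -1"
proof
  assume *: "q ^ n = -1"
  hence "norm q ^ n = 1" by (metis norm_minus_cancel norm_one norm_power)
  hence "n = 0" using power_less_one_iff[of "norm q" n] q by fastforce
  thus False using * by simp
qed

lemma qpoch_q: "(\<lambda>n. \<Prod>t<n. 1 - q ^ Suc t) \<longlonglongrightarrow> qpoch_inf q q" "qpoch_inf q q \<noteq> 0"
  using qpoch_inf_LIMSEQ[OF q, of q] qpoch_inf_nonzero[OF q, of q] power_neq_1 by (simp_all add: mult_ac)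

lemma qpoch_mq: "(\<lambda>n. \<Prod>t<n. 1 + q ^ Suc t) \<longlonglongrightarrow> qpoch_inf (-q) q" "qpoch_inf (-q) q \<noteq> 0"
proof -
  have "- q * q ^ t \<noteq> 1" for t using power_neq_minus_1[of "Suc t"] by (metis minus_mult_left minus_minus power_Suc)
  thus "(\<lambda>n. \<Prod>t<n. 1 + q ^ Suc t) \<longlonglongrightarrow> qpoch_inf (-q) q" "qpoch_inf (-q) q \<noteq> 0"
    using qpoch_inf_LIMSEQ[OF q, of "-q"] qpoch_inf_nonzero[OF q, of "-q"] by simp_all
qed

lemma qpoch_m1: "(\<lambda>n. \<Prod>t<n. 1 + q ^ t) \<longlonglongrightarrow> qpoch_inf (-1) q" "qpoch_inf (-1) q = 2 * qpoch_inf (-q) q"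
proof -
  have *: "- 1 * q ^ t \<noteq> 1" for t using power_neq_minus_1[of t] by (metis minus_mult_left minus_minus mult_1)
  show "(\<lambda>n. \<Prod>t<n. 1 + q ^ t) \<longlonglongrightarrow> qpoch_inf (-1) q" "qpoch_inf (-1) q = 2 * qpoch_inf (-q) q"
    using qpoch_inf_LIMSEQ[OF q, of "-1"] qpoch_inf_rec[OF q, of "-1"] * by simp_all
qed

text \<open>A finite form of Gauss's identity in the manner of Shanks: the sums telescope in \<open>n\<close>, and
  all summands with \<open>s > 0\<close> vanish in the limit.\<close>

definition shanks_P :: "nat \<Rightarrow> complex" where
  "shanks_P n = (\<Prod>j<n. (1 - q ^ Suc j) / (1 + q ^ Suc j))"

definition shanks_a :: "nat \<Rightarrow> complex" where
  "shanks_a s = (\<Prod>j<s. (1 + q ^ j) / (1 - q ^ Suc j))"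

definition shanks_F :: "nat \<Rightarrow> complex" where
  "shanks_F n = shanks_P n * (\<Sum>s\<le>n. (-1) ^ s * q ^ (s * Suc n) * shanks_a s)"

text \<open>All factors cancel in pairs except 1 + q^0 = 2 at the start of \<open>shanks_a\<close>.
  This is the 2 in front of each term of the theta series.\<close>

lemma shanks_Pa: "shanks_P n * shanks_a n * (1 + q ^ n) = 2"
proof (induction n)
  case (Suc n)
  have nz: "1 - q ^ Suc n \<noteq> 0" "1 + q ^ Suc n \<noteq> 0"
    using power_neq_1[of n] power_neq_minus_1[of "Suc n"] by (simp_all add: add_eq_0_iff del: power_Suc)
  have "shanks_P (Suc n) * shanks_a (Suc n) * (1 + q ^ Suc n) =
     shanks_P n * shanks_a n * (1 + q ^ n) * (((1 - q ^ Suc n) / (1 - q ^ Suc n)) * ((1 + q ^ Suc n) / (1 + q ^ Suc n)))"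
    unfolding shanks_P_def shanks_a_def prod.lessThan_Suc by (simp add: mult_ac del: power_Suc)
  thus ?case using Suc nz by simp
qed (simp add: shanks_P_def shanks_a_def)

lemma shanks_step: "shanks_F (Suc n) - shanks_F n = 2 * (-1) ^ Suc n * q ^ (Suc n)\<^sup>2"
proof -
  define N where "N = Suc n"
  define a where "a = shanks_a"
  \<comment> \<open>\<open>- u\<close> is an antidifference in \<open>s\<close> of the summand in
    \<open>tele\<close>: the recurrence \<open>a_rec\<close> collapses the sum up to
    \<open>m\<close> to its boundary term.\<close>
  define u where "u s = (-1) ^ s * a s * (1 + q ^ s) * q ^ (Suc s * N)" for s
  have nz: "1 - q ^ Suc s \<noteq> 0" "1 + q ^ Suc s \<noteq> 0" for s
    using power_neq_1[of s] power_neq_minus_1[of "Suc s"] by (simp_all add: add_eq_0_iff del: power_Suc)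
  have nzN: "1 + q ^ N \<noteq> 0" unfolding N_def by (rule nz)
  have a_rec: "a (Suc s) * (1 - q ^ Suc s) = a s * (1 + q ^ s)" for s
    using nz(1)[of s] by (simp add: a_def shanks_a_def del: power_Suc)
  have P_rec: "shanks_P N * (1 + q ^ N) = shanks_P n * (1 - q ^ N)"
    using nzN by (simp add: N_def shanks_P_def del: power_Suc)
  have tele: "(\<Sum>s\<le>m. (-1) ^ s * a s * q ^ (s * N) * (- (1 - q ^ s) - q ^ N * (1 + q ^ s))) = - u m" for m
  proof (induction m)
    case 0
    show ?case by (simp add: u_def)
  next
    case (Suc m)
    have "(-1) ^ Suc m * a (Suc m) * q ^ (Suc m * N) * (- (1 - q ^ Suc m) - q ^ N * (1 + q ^ Suc m)) =
       (-1) ^ m * q ^ (Suc m * N) * (a (Suc m) * (1 - q ^ Suc m)) - u (Suc m)"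
      by (simp add: u_def algebra_simps power_add)
    also have "(-1) ^ m * q ^ (Suc m * N) * (a (Suc m) * (1 - q ^ Suc m)) = u m"
      unfolding a_rec by (simp add: u_def mult_ac)
    finally show ?case using Suc by simp
  qed
  have "(shanks_F N - shanks_F n) * (1 + q ^ N) =
     shanks_P n * (1 - q ^ N) * (\<Sum>s\<le>N. (-1) ^ s * q ^ (s * Suc N) * a s)
       - shanks_P n * (1 + q ^ N) * (\<Sum>s\<le>n. (-1) ^ s * q ^ (s * N) * a s)"
  proof -
    have "(x * S - y * T) * w = (x * w) * S - y * w * T" for x y w S T :: complex
      by (simp add: algebra_simps)
    from this[of "shanks_P N" _ "shanks_P n"] show ?thesis
      unfolding shanks_F_def a_def[symmetric] by (simp only: P_rec flip: N_def)
  qed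
  \<comment> \<open>The summand s = N is split off; for s \<le> n the two sums merge by (1 - q^N)
    q^s - (1 + q^N) = -(1 - q^s) - q^N (1 + q^s).\<close>
  also have "\<dots> = shanks_P n * (1 - q ^ N) * ((-1) ^ N * q ^ (N * Suc N) * a N) +
     shanks_P n * (\<Sum>s\<le>n. (-1) ^ s * a s * q ^ (s * N) * (- (1 - q ^ s) - q ^ N * (1 + q ^ s)))"
    unfolding N_def sum.atMost_Suc
    by (simp add: sum_distrib_left algebra_simps power_add sum.distrib sum_subtractf sum_negf)
  also have "\<dots> = shanks_P n * (1 - q ^ N) * ((-1) ^ N * q ^ (N * Suc N) * a N) - shanks_P n * u n"
    unfolding tele by simp
  also have "u n = - ((-1) ^ N * (a N * (1 - q ^ N)) * q ^ (N * N))"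
    using a_rec[of n] by (simp add: u_def N_def del: power_Suc) (simp add: mult_ac)
  also have "shanks_P n * (1 - q ^ N) * ((-1) ^ N * q ^ (N * Suc N) * a N)
      - shanks_P n * - ((-1) ^ N * (a N * (1 - q ^ N)) * q ^ (N * N)) =
      (shanks_P n * (1 - q ^ N)) * ((-1) ^ N * a N * q ^ (N * N)) * (1 + q ^ N)"
    by (simp add: algebra_simps power_add)
  also have "\<dots> = (shanks_P N * a N * (1 + q ^ N)) * ((-1) ^ N * q ^ (N * N)) * (1 + q ^ N)"
    unfolding P_rec[symmetric] by (simp add: mult_ac)
  also have "shanks_P N * a N * (1 + q ^ N) = 2" unfolding a_def by (rule shanks_Pa)
  finally show ?thesis using nzN by (simp add: N_def power2_eq_square del: power_Suc)
qed

lemma shanks_F_eq: "shanks_F n = 1 + (\<Sum>k<n. 2 * (-1) ^ Suc k * q ^ (Suc k)\<^sup>2)"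
proof (induction n)
  case (Suc n)
  thus ?case using shanks_step[of n] by (simp add: algebra_simps)
qed (simp add: shanks_F_def shanks_P_def shanks_a_def)

theorem gauss_theta_product:
  "(\<lambda>k. 2 * (-1) ^ Suc k * q ^ (Suc k)\<^sup>2) sums (qpoch_inf q q / qpoch_inf (-q) q - 1)"
proof -
  have P: "shanks_P \<longlonglongrightarrow> qpoch_inf q q / qpoch_inf (-q) q"
    unfolding shanks_P_def prod_dividef by (intro tendsto_divide qpoch_q qpoch_mq)
  have "shanks_a \<longlonglongrightarrow> qpoch_inf (-1) q / qpoch_inf q q"
    unfolding shanks_a_def prod_dividef by (intro tendsto_divide qpoch_q qpoch_m1)
  hence "Bseq shanks_a" by (intro convergent_imp_Bseq) (auto simp: convergent_def)
  then obtain B where B: "B > 0" "\<And>s. norm (shanks_a s) \<le> B" by (auto simp: Bseq_def)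
  \<comment> \<open>Each summand with s at least 1 carries q^(s(n+1)) and is at most B |q|^n, and
    there are n of them. Only s = 0, which contributes 1, survives in the limit.\<close>
  define R where "R n = (\<Sum>s\<in>{1..n}. (-1) ^ s * q ^ (s * Suc n) * shanks_a s)" for n
  have split: "(\<Sum>s\<le>n. (-1) ^ s * q ^ (s * Suc n) * shanks_a s) = 1 + R n" for n
    unfolding R_def atMost_atLeast0 by (subst sum.atLeast_Suc_atMost) (auto simp: shanks_a_def)
  have "R \<longlonglongrightarrow> 0"
  proof (rule Lim_null_comparison)
    show "\<forall>\<^sub>F n in sequentially. norm (R n) \<le> B * (real n * norm q ^ n)"
    proof (intro always_eventually allI)
      fix n
      have "norm (R n) \<le> (\<Sum>s\<in>{1..n}. norm q ^ n * B)"
        unfolding R_def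
      proof (intro sum_norm_le)
        fix s assume s: "s \<in> {1..n}"
        have "norm q ^ (s * Suc n) \<le> norm q ^ n"
          using s q by (intro power_decreasing) (auto intro: order_trans[OF _ mult_le_mono[of 1 s n "Suc n"]] simp del: mult_Suc_right)
        thus "norm ((-1) ^ s * q ^ (s * Suc n) * shanks_a s) \<le> norm q ^ n * B"
          unfolding norm_mult norm_power using B by (auto intro!: mult_mono)
      qed
      thus "norm (R n) \<le> B * (real n * norm q ^ n)" by (simp add: mult_ac)
    qed
    have "(\<lambda>n. real n * norm q ^ n) \<longlonglongrightarrow> 0" using q powser_times_n_limit_0[of "norm q"] by simp
    thus "(\<lambda>n. B * (real n * norm q ^ n)) \<longlonglongrightarrow> 0" by (rule tendsto_mult_right_zero)
  qed
  hence "(\<lambda>n. shanks_P n * (1 + R n)) \<longlonglongrightarrow> qpoch_inf q q / qpoch_inf (-q) q * (1 + 0)"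
    by (intro tendsto_mult tendsto_add P tendsto_const)
  moreover have "shanks_F = (\<lambda>n. shanks_P n * (1 + R n))"
    by (simp only: shanks_F_def[abs_def] split)
  ultimately have "shanks_F \<longlonglongrightarrow> qpoch_inf q q / qpoch_inf (-q) q"
    by simp
  hence "(\<lambda>n. shanks_F n - 1) \<longlonglongrightarrow> qpoch_inf q q / qpoch_inf (-q) q - 1"
    by (intro tendsto_diff tendsto_const)
  thus ?thesis by (simp add: sums_def shanks_F_eq)
qed

end

lemma infsum_int_split:
  fixes f :: "int \<Rightarrow> 'a :: banach"
  assumes "f summable_on UNIV"
  shows "infsum f UNIV = (\<Sum>\<^sub>\<infinity>n. f (int n)) + (\<Sum>\<^sub>\<infinity>n. f (- int (Suc n)))"
proof -
  have "infsum f UNIV = infsum f (range int) + infsum f (range (\<lambda>n. - int (Suc n)))"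
    by (subst int_UNIV_split, rule infsum_Un_disjoint) (auto intro: summable_on_subset_banach[OF assms])
  also have "infsum f (range int) = (\<Sum>\<^sub>\<infinity>n. f (int n))"
    by (subst infsum_reindex) (auto simp: inj_on_def o_def)
  also have "infsum f (range (\<lambda>n. - int (Suc n))) = (\<Sum>\<^sub>\<infinity>n. f (- int (Suc n)))"
    by (subst infsum_reindex) (auto simp: inj_on_def o_def)
  finally show ?thesis .
qed

lemma summable_on_int_nat:
  fixes f :: "int \<Rightarrow> 'a :: banach"
  assumes "f summable_on UNIV"
  shows "(\<lambda>n. f (int n)) summable_on UNIV" "(\<lambda>n. f (int (Suc n))) summable_on UNIV"
    "(\<lambda>n. f (- int (Suc n))) summable_on UNIV"
proof -
  have *: "(\<lambda>n::nat. f (g n)) summable_on UNIV" if "inj g" for g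
  proof -
    have "f summable_on range g" by (rule summable_on_subset_banach[OF assms]) simp
    thus ?thesis using that by (subst (asm) summable_on_reindex) (auto simp: o_def)
  qed
  show "(\<lambda>n. f (int n)) summable_on UNIV" "(\<lambda>n. f (int (Suc n))) summable_on UNIV"
    "(\<lambda>n. f (- int (Suc n))) summable_on UNIV"
    by (rule *; simp add: inj_def)+
qed

lemma infsum_nat_Suc:
  fixes f :: "nat \<Rightarrow> 'a :: banach"
  assumes "(\<lambda>n. f (Suc n)) summable_on UNIV"
  shows "(\<Sum>\<^sub>\<infinity>n. f n) = f 0 + (\<Sum>\<^sub>\<infinity>n. f (Suc n))"
proof -
  have U: "(UNIV :: nat set) = {0} \<union> range Suc" using not0_implies_Suc by auto
  have "f summable_on range Suc" using assms by (subst summable_on_reindex) (auto simp: o_def)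
  hence "infsum f UNIV = infsum f {0} + infsum f (range Suc)"
    by (subst U, intro infsum_Un_disjoint) auto
  also have "infsum f (range Suc) = (\<Sum>\<^sub>\<infinity>n. f (Suc n))" by (subst infsum_reindex) (auto simp: o_def)
  finally show ?thesis by simp
qed

lemma infsum_int_even:
  fixes f :: "int \<Rightarrow> complex"
  assumes "f summable_on UNIV" "\<And>n. f (- n) = f n"
  shows "infsum f UNIV = f 0 + 2 * (\<Sum>\<^sub>\<infinity>n. f (int (Suc n)))"
  using infsum_int_split[OF assms(1)] infsum_nat_Suc[OF summable_on_int_nat(2)[OF assms(1)]] assms(2)
  by (simp del: of_nat_Suc)

section \<open>The theta multiplier\<close>

definition theta :: "complex \<Rightarrow> complex" where
  "theta z = (\<Sum>\<^sub>\<infinity>n::int. ee (of_int (n\<^sup>2) * z))"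

text \<open>Since n^2 and n have the same parity, this is the alternating series, the function that
  the overview calls theta. Taking it as a translate reduces its transformation law to that of
  \<open>theta\<close>.\<close>

definition theta4 :: "complex \<Rightarrow> complex" where
  "theta4 z = theta (z + 1/2)"

lemma norm_ee_square: "norm (ee (of_int (n\<^sup>2) * z)) = exp (- (2 * pi * Im z) * (of_int n)\<^sup>2)"
  by (simp add: norm_ee algebra_simps flip: of_int_power)

lemma norm_ee_square_le:
  assumes "Im z \<ge> c" shows "norm (ee (of_int (n\<^sup>2) * z)) \<le> exp (- (2 * pi * c) * (of_int n)\<^sup>2)"
proof -
  have "2 * pi * c * (of_int n)\<^sup>2 \<le> 2 * pi * Im z * (of_int n)\<^sup>2"
    using assms by (intro mult_right_mono mult_left_mono) auto
  thus ?thesis unfolding norm_ee_square by simp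
qed

lemma open_upper_half: "open {z. Im z > 0}"
  by (simp add: open_Collect_less continuous_intros)

lemma cball_upper_half:
  assumes "w \<in> cball z (Im z / 2)" shows "Im w \<ge> Im z / 2"
proof -
  have "\<bar>Im (z - w)\<bar> \<le> Im z / 2" using assms abs_Im_le_cmod[of "z - w"] by (simp add: dist_norm)
  hence "Im z - Im w \<le> Im z / 2" using abs_ge_self[of "Im (z - w)"] by simp
  thus ?thesis by simp
qed

lemma holomorphic_theta: "theta holomorphic_on {z. Im z > 0}"
  unfolding theta_def
proof (rule holomorphic_on_infsum[OF open_upper_half])
  fix z :: complex assume z: "z \<in> {z. Im z > 0}"
  show "\<exists>r>0. \<exists>M. cball z r \<subseteq> {z. Im z > 0} \<and> M summable_on UNIV \<and>
      (\<forall>n\<in>UNIV. \<forall>w\<in>cball z r. norm (ee (of_int (n\<^sup>2) * w)) \<le> M n)"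
  proof (intro exI[of _ "Im z / 2"] conjI exI[of _ "\<lambda>n. exp (- (2 * pi * (Im z / 2)) * (of_int n)\<^sup>2)"] ballI subsetI)
    show "w \<in> {z. Im z > 0}" if "w \<in> cball z (Im z / 2)" for w
      using cball_upper_half[OF that] z by simp
    show "(\<lambda>n::int. exp (- (2 * pi * (Im z / 2)) * (of_int n)\<^sup>2)) summable_on UNIV"
      using z by (intro summable_on_gaussian) simp
    show "norm (ee (of_int (n\<^sup>2) * w)) \<le> exp (- (2 * pi * (Im z / 2)) * (of_int n)\<^sup>2)"
      if "w \<in> cball z (Im z / 2)" for n w by (rule norm_ee_square_le[OF cball_upper_half[OF that]])
  qed (use z in auto)
qed (auto intro!: holomorphic_intros)

lemma theta_plus_int: "theta (z + of_int k) = theta z"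
proof -
  have "ee (of_int (n\<^sup>2) * (z + of_int k)) = ee (of_int (n\<^sup>2) * z) * ee (of_int (n\<^sup>2 * k))" for n
    unfolding ee_add[symmetric] by (simp add: algebra_simps)
  thus ?thesis unfolding theta_def by (simp only: ee_of_int mult_1_right)
qed

lemma theta_inversion_imag:
  assumes y: "y > 0"
  shows "theta (- 1 / (4 * (\<i> * of_real y))) = csqrt (- 2 * \<i> * (\<i> * of_real y)) * theta (\<i> * of_real y)"
proof -
  have g: "ee (of_int (n\<^sup>2) * (\<i> * of_real t)) = of_real (exp (- pi * (of_int n)\<^sup>2 * (2 * t)))" for n t
    by (simp add: ee_def mult_ac flip: exp_of_real)
  have "- 1 / (4 * (\<i> * of_real y)) = \<i> * of_real (1 / (4 * y))"
    using y by (simp add: field_simps)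
  hence L: "theta (- 1 / (4 * (\<i> * of_real y))) = (\<Sum>\<^sub>\<infinity>k::int. of_real (exp (- pi * (of_int k)\<^sup>2 / (2 * y))))"
    unfolding theta_def by (simp only: g) simp
  have "theta (\<i> * of_real y) = (\<Sum>\<^sub>\<infinity>m::int. exp (- of_real (pi * (2 * y)) * (0 + of_int m)\<^sup>2))"
    unfolding theta_def g by (intro infsum_cong) (simp add: mult_ac flip: exp_of_real)
  also have "\<dots> = of_real (1 / sqrt (2 * y)) * (\<Sum>\<^sub>\<infinity>k::int. of_real (exp (- pi * (of_int k)\<^sup>2 / (2 * y))))"
    using poisson_gaussian[of "2 * y" 0] y by simp
  finally have "theta (\<i> * of_real y) = of_real (1 / sqrt (2 * y)) * theta (- 1 / (4 * (\<i> * of_real y)))"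
    unfolding L .
  moreover have "csqrt (- 2 * \<i> * (\<i> * of_real y)) = of_real (sqrt (2 * y))"
    using y csqrt_of_real_nonneg[of "of_real (2 * y)"] by (simp add: mult.assoc[symmetric] real_sqrt_mult)
  ultimately show ?thesis using y by (simp flip: of_real_mult)
qed

lemma Im_moebius:
  fixes a b c d :: real
  shows "Im ((of_real a * z + of_real b) / (of_real c * z + of_real d)) =
    (a * d - b * c) * Im z / (norm (of_real c * z + of_real d))\<^sup>2"
  unfolding cmod_power2 Im_divide by (simp add: power2_eq_square algebra_simps)

lemma Im_minus_inverse_pos: "Im z > 0 \<Longrightarrow> Im (- 1 / (4 * z)) > 0"
  using Im_moebius[of 0 z "-1" 4 0] by (auto intro!: divide_pos_pos)

text \<open>Poisson summation with shift 0 gives the formula on the imaginary axis. Both sides are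
  holomorphic on the half-plane, the root because \<open>- 2 * \<i> * z\<close> has positive real
  part there and so avoids the cut of \<open>csqrt\<close>.\<close>

lemma theta_inversion:
  assumes z: "Im z > 0"
  shows "theta (- 1 / (4 * z)) = csqrt (- 2 * \<i> * z) * theta z"
proof -
  let ?H = "{z. Im z > 0}"
  have "theta (- 1 / (4 * z)) - csqrt (- 2 * \<i> * z) * theta z = 0"
  proof (rule analytic_continuation[where f = "\<lambda>z. theta (- 1 / (4 * z)) - csqrt (- 2 * \<i> * z) * theta z"
        and S = ?H and U = "(\<lambda>y. \<i> * of_real y) ` {0<..}" and \<xi> = \<i>])
    show "(\<lambda>z. theta (- 1 / (4 * z)) - csqrt (- 2 * \<i> * z) * theta z) holomorphic_on ?H"
    proof (intro holomorphic_intros holomorphic_theta)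
      have "(theta \<circ> (\<lambda>z. - 1 / (4 * z))) holomorphic_on ?H"
        by (rule holomorphic_on_compose_gen[OF _ holomorphic_theta])
           (use Im_minus_inverse_pos in \<open>auto intro!: holomorphic_intros\<close>)
      thus "(\<lambda>z. theta (- 1 / (4 * z))) holomorphic_on ?H" by (simp add: o_def)
    next
      fix z :: complex assume "z \<in> ?H"
      hence "Re (- 2 * \<i> * z) > 0" by simp
      thus "- 2 * \<i> * z \<notin> \<real>\<^sub>\<le>\<^sub>0" by (auto simp: complex_nonpos_Reals_iff)
    qed
    show "connected ?H" by (intro convex_connected convex_halfspace_Im_gt)
    have "\<i> islimpt (\<lambda>y. \<i> * of_real y) ` {0<..}"
    proof (rule islimpt_sequential[THEN iffD2], intro exI[of _ "\<lambda>n. \<i> * of_real (1 + 1 / real (n + 1))"] conjI allI)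
      have "(\<lambda>n. 1 + 1 / real (n + 1)) \<longlonglongrightarrow> 1" by real_asymp
      from tendsto_mult[OF tendsto_const tendsto_of_real[OF this], of \<i>]
      show "(\<lambda>n. \<i> * of_real (1 + 1 / real (n + 1))) \<longlonglongrightarrow> \<i>" by simp
      show "\<i> * of_real (1 + 1 / real (n + 1)) \<in> (\<lambda>y. \<i> * of_real y) ` {0<..} - {\<i>}" for n
        by (intro DiffI imageI) (auto simp: complex_eq_iff add_pos_pos)
    qed
    thus "\<i> islimpt (\<lambda>y. \<i> * of_real y) ` {0<..}" .
    show "theta (- 1 / (4 * w)) - csqrt (- 2 * \<i> * w) * theta w = 0" if "w \<in> (\<lambda>y. \<i> * of_real y) ` {0<..}" for w
      using that theta_inversion_imag by auto
  qed (use z open_upper_half in auto)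
  thus ?thesis by simp
qed

lemma csqrt_upper: "Im z > 0 \<Longrightarrow> Re (csqrt z) > 0 \<and> Im (csqrt z) > 0"
  and csqrt_lower: "Im z < 0 \<Longrightarrow> Re (csqrt z) > 0 \<and> Im (csqrt z) < 0"
proof -
  have "\<bar>Re z\<bar> < cmod z" if "Im z \<noteq> 0"
    using that abs_Re_le_cmod[of z] cmod_power2[of z] by (smt (verit) power2_abs power2_eq_iff zero_eq_power2)
  thus "Im z > 0 \<Longrightarrow> Re (csqrt z) > 0 \<and> Im (csqrt z) > 0"
    "Im z < 0 \<Longrightarrow> Re (csqrt z) > 0 \<and> Im (csqrt z) < 0"
    by (auto simp: mult_less_0_iff)
qed

lemma csqrt_right: "Re z > 0 \<Longrightarrow> Re (csqrt z) > \<bar>Im (csqrt z)\<bar>"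
proof -
  assume z: "Re z > 0"
  have "Re ((csqrt z)\<^sup>2) = (Re (csqrt z))\<^sup>2 - (Im (csqrt z))\<^sup>2" by (simp add: power2_eq_square)
  hence "(Im (csqrt z))\<^sup>2 < (Re (csqrt z))\<^sup>2" using z by (simp only: power2_csqrt)
  thus ?thesis using Re_csqrt[of z] by (metis abs_le_square_iff abs_of_nonneg not_less)
qed

text \<open>Principal roots multiply only up to sign. The laws below come down to deciding this sign
  from the quadrants in which the roots lie.\<close>

lemma csqrt_mult_cases:
  "csqrt a * csqrt b = csqrt (a * b) \<or> csqrt a * csqrt b = - csqrt (a * b)"
proof -
  have "(csqrt a * csqrt b)\<^sup>2 = (csqrt (a * b))\<^sup>2" by (simp add: power_mult_distrib)
  thus ?thesis by (rule power2_eq_iff[THEN iffD1])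
qed

text \<open>With S the inversion sending z to -1/(4z), the map here is S, then translation by -1,
  then S. Two inversions and the periodicity of \<open>theta\<close> give the law up to the sign of
  a product of roots.\<close>

lemma theta_V:
  assumes z: "Im z > 0"
  shows "theta (z / (4 * z + 1)) = csqrt (4 * z + 1) * theta z"
proof -
  have z0: "z \<noteq> 0" "4 * z + 1 \<noteq> 0" using z by (auto simp: complex_eq_iff)
  define u where "u = - 1 / (4 * z)"
  have u: "Im u > 0" unfolding u_def by (rule Im_minus_inverse_pos[OF z])
  define z' where "z' = - 1 / (4 * (u - 1))"
  have z': "Im z' > 0" unfolding z'_def using u by (intro Im_minus_inverse_pos) simp
  have nz: "u - 1 \<noteq> 0" using u by auto
  have zz: "z' = z / (4 * z + 1)"
    using z0 nz unfolding z'_def u_def by (simp add: divide_simps) (simp add: algebra_simps)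
  have uz: "- 1 / (4 * z') = u - 1" unfolding z'_def using nz by (simp add: field_simps)
  have "csqrt (- 2 * \<i> * z') * theta z' = theta (u - 1)" using theta_inversion[OF z'] uz by simp
  also have "\<dots> = theta u" using theta_plus_int[of u "-1"] by simp
  also have "\<dots> = csqrt (- 2 * \<i> * z) * theta z" unfolding u_def by (rule theta_inversion[OF z])
  finally have e: "csqrt (- 2 * \<i> * z') * theta z' = csqrt (- 2 * \<i> * z) * theta z" .
  define A where "A = csqrt (4 * z + 1)"
  define B where "B = csqrt (- 2 * \<i> * z')"
  define s where "s = csqrt (- 2 * \<i> * z)"
  have A: "Re A > 0" "Im A > 0" using csqrt_upper[of "4 * z + 1"] z by (auto simp: A_def)
  have B: "Re B > \<bar>Im B\<bar>" using csqrt_right[of "- 2 * \<i> * z'"] z' by (auto simp: B_def)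
  have s: "Re s > \<bar>Im s\<bar>" using csqrt_right[of "- 2 * \<i> * z"] z by (auto simp: s_def)
  have prod: "(4 * z + 1) * (- 2 * \<i> * z') = - 2 * \<i> * z" using z0 by (simp add: zz)
  have "A * B = s \<or> A * B = - s"
    using csqrt_mult_cases[of "4 * z + 1" "- 2 * \<i> * z'"] unfolding prod A_def B_def s_def .
  \<comment> \<open>\<open>A\<close> lies in the open first quadrant, \<open>B\<close> and
    \<open>s\<close> within 45 degrees of the positive axis. Hence Re + Im is positive at
    \<open>A * B\<close> and negative at \<open>- s\<close>.\<close>
  moreover have "A * B \<noteq> - s"
  proof
    assume "A * B = - s"
    hence "Re (A * B) + Im (A * B) < 0" using s by auto
    moreover have "Re (A * B) + Im (A * B) = Re A * (Re B + Im B) + Im A * (Re B - Im B)"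
      by (simp add: algebra_simps)
    moreover have "Re A * (Re B + Im B) > 0" "Im A * (Re B - Im B) > 0" using A B by auto
    ultimately show False by linarith
  qed
  ultimately have "s = A * B" by simp
  hence "B * theta z' = B * (A * theta z)" using e by (simp add: A_def B_def s_def mult_ac)
  moreover have "B \<noteq> 0" using B by auto
  ultimately have "theta z' = A * theta z" by simp
  thus ?thesis by (simp add: zz A_def)
qed

text \<open>The inverse substitution, obtained by applying \<open>theta_V\<close> at the image point
  \<open>w\<close>. The two roots involved have product 1 rather than -1 because they lie in the
  first and the fourth quadrant.\<close>

lemma theta_V':
  assumes z: "Im z > 0"
  shows "theta (z / (1 - 4 * z)) = csqrt (1 - 4 * z) * theta z"
proof -
  define w where "w = z / (1 - 4 * z)"
  have nz: "1 - 4 * z \<noteq> 0" using z by (auto simp: complex_eq_iff)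
  have w: "Im w > 0"
    using Im_moebius[of 1 z 0 "-4" 1] z nz by (simp add: w_def)
  have w1: "4 * w + 1 = 1 / (1 - 4 * z)" using nz by (simp add: w_def field_simps)
  have "w / (4 * w + 1) = z" unfolding w1 using nz by (simp add: w_def)
  hence e: "theta z = csqrt (1 / (1 - 4 * z)) * theta w" using theta_V[OF w] w1 by simp
  have "Im (4 * w + 1) > 0" using w by simp
  hence i: "Im (1 / (1 - 4 * z)) > 0" by (simp only: w1)
  have A: "Re (csqrt (1 / (1 - 4 * z))) > 0" "Im (csqrt (1 / (1 - 4 * z))) > 0"
    using csqrt_upper[OF i] by auto
  have B: "Re (csqrt (1 - 4 * z)) > 0" "Im (csqrt (1 - 4 * z)) < 0"
    using csqrt_lower[of "1 - 4 * z"] z by auto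
  define p where "p = csqrt (1 - 4 * z) * csqrt (1 / (1 - 4 * z))"
  have "Re p > 0" unfolding p_def
    using mult_pos_pos[OF A(1) B(1)] mult_pos_neg[OF A(2) B(2)] by (simp add: algebra_simps del: csqrt.simps)
  moreover have "p = csqrt 1 \<or> p = - csqrt 1"
    using csqrt_mult_cases[of "1 - 4 * z" "1 / (1 - 4 * z)"] nz unfolding p_def by (simp del: csqrt.simps)
  ultimately have "p = 1" by auto
  hence "csqrt (1 - 4 * z) * csqrt (1 / (1 - 4 * z)) = 1" by (simp only: p_def)
  thus ?thesis using e by (simp add: w_def mult.assoc[symmetric] del: csqrt.simps)
qed

text \<open>The multiplier depends on the bottom row alone. Quantifying over all completing top rows
  and all \<open>z\<close> makes this a property of the pair \<open>(c, d)\<close> that can be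
  carried through the descent.\<close>

definition theta_multiplier :: "int \<Rightarrow> int \<Rightarrow> bool" where
  "theta_multiplier c d \<longleftrightarrow> (\<forall>a b z. a * d - b * c = 1 \<longrightarrow> Im z > 0 \<longrightarrow>
     theta ((of_int a * z + of_int b) / (of_int c * z + of_int d)) =
       of_int (shimura_symbol c d) * inverse (theta_eps d) * csqrt (of_int c * z + of_int d) * theta z)"

text \<open>A translation of \<open>z\<close> changes neither \<open>theta\<close> nor the
  automorphy factor, only the name of its constant term. So the multiplier has to be periodic in
  \<open>d\<close>, and this is where reciprocity enters.\<close>

lemma theta_multiplier_T:
  assumes P: "theta_multiplier c d" and S: "shimura_symbol c (d + k * c) = shimura_symbol c d"
    and E: "theta_eps (d + k * c) = theta_eps d"
  shows "theta_multiplier c (d + k * c)"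
  unfolding theta_multiplier_def
proof (intro allI impI)
  fix a b z assume ab: "a * (d + k * c) - b * c = 1" and z: "Im (z::complex) > 0"
  have 1: "a * d - (b - k * a) * c = 1" using ab by (simp add: algebra_simps)
  have 2: "Im (z + of_int k) > 0" using z by simp
  have "(of_int a * z + of_int b) / (of_int c * z + of_int (d + k * c)) =
    (of_int a * (z + of_int k) + of_int (b - k * a)) / (of_int c * (z + of_int k) + of_int d :: complex)"
    by (simp add: algebra_simps)
  moreover have "of_int c * (z + of_int k) + of_int d = of_int c * z + (of_int (d + k * c) :: complex)"
    by (simp add: algebra_simps)
  ultimately show "theta ((of_int a * z + of_int b) / (of_int c * z + of_int (d + k * c))) =
     of_int (shimura_symbol c (d + k * c)) * inverse (theta_eps (d + k * c)) *
     csqrt (of_int c * z + of_int (d + k * c)) * theta z"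
    using P[unfolded theta_multiplier_def, rule_format, OF 1 2] by (simp only: S E theta_plus_int)
qed

text \<open>Precomposition with z/(4kz + 1) splits the automorphy factor as \<gamma> = \<alpha>
  \<beta>. The Jacobi symbol modulo \<open>d\<close> stays the same, so the sign by which the roots
  fail to multiply must match the sign factor of \<open>shimura_symbol\<close>.\<close>

lemma theta_multiplier_V:
  assumes P: "theta_multiplier c d" and k: "k = 1 \<or> k = -1" and d: "d \<noteq> 0"
  shows "theta_multiplier (c + 4 * k * d) d"
  unfolding theta_multiplier_def
proof (intro allI impI)
  fix a b z assume ab: "a * d - b * (c + 4 * k * d) = 1" and z: "Im (z::complex) > 0"
  define c' where "c' = c + 4 * k * d"
  define \<alpha> where "\<alpha> = 4 * of_int k * z + 1"
  define w where "w = z / \<alpha>"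
  define \<beta> where "\<beta> = of_int c * w + of_int d"
  define \<gamma> where "\<gamma> = of_int c' * z + (of_int d :: complex)"
  have nz: "\<alpha> \<noteq> 0" using z k by (auto simp: \<alpha>_def complex_eq_iff)
  have w: "Im w > 0"
    using Im_moebius[of 1 z 0 "4 * of_int k" 1] z nz by (simp add: w_def \<alpha>_def)
  have 1: "(a - 4 * k * b) * d - b * c = 1" using ab by (simp add: algebra_simps)
  have ga: "\<gamma> = \<alpha> * \<beta>" using nz unfolding \<beta>_def \<gamma>_def w_def c'_def by (simp add: field_simps) (simp add: \<alpha>_def algebra_simps)
  have "of_int a * z + of_int b = \<alpha> * (of_int (a - 4 * k * b) * w + of_int b)"
    using nz unfolding w_def by (simp add: field_simps) (simp add: \<alpha>_def algebra_simps)
  hence "(of_int a * z + of_int b) / \<gamma> = (of_int (a - 4 * k * b) * w + of_int b) / \<beta>"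
    using nz by (simp add: ga)
  hence "theta ((of_int a * z + of_int b) / \<gamma>) =
     of_int (shimura_symbol c d) * inverse (theta_eps d) * csqrt \<beta> * theta w"
    using P[unfolded theta_multiplier_def, rule_format, OF 1 w] by (simp add: \<beta>_def del: csqrt.simps)
  also have "theta w = csqrt \<alpha> * theta z"
    using k theta_V[OF z] theta_V'[OF z] by (auto simp: w_def \<alpha>_def simp del: csqrt.simps)
  finally have th1: "theta ((of_int a * z + of_int b) / \<gamma>) =
     of_int (shimura_symbol c d) * inverse (theta_eps d) * (csqrt \<alpha> * csqrt \<beta>) * theta z" by (simp only: mult_ac)
  have jc: "jacobi c' d = jacobi c d" unfolding c'_def by (rule jacobi_cong) (simp add: cong_iff_dvd_diff)
  define p where "p = csqrt \<alpha> * csqrt \<beta>"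
  define s where "s = csqrt \<gamma>"
  have ps: "p = s \<or> p = - s" unfolding p_def s_def ga by (rule csqrt_mult_cases)
  have Rs: "Re s \<ge> 0" unfolding s_def by (rule Re_csqrt)
  have Re_pos: "p = s" if "Re p > 0" using ps Rs that by auto
  have Rep: "Re p = Re (csqrt \<alpha>) * Re (csqrt \<beta>) - Im (csqrt \<alpha>) * Im (csqrt \<beta>)"
    and Imp: "Im p = Re (csqrt \<alpha>) * Im (csqrt \<beta>) + Im (csqrt \<alpha>) * Re (csqrt \<beta>)"
    by (simp_all add: p_def del: csqrt.simps)
  have Imb: "Im \<beta> = of_int c * Im w" "Im \<gamma> = of_int c' * Im z" "Im \<alpha> = 4 * of_int k * Im z"
    by (simp_all add: \<beta>_def \<gamma>_def \<alpha>_def)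
  have bpos: "Re (csqrt \<beta>) > 0 \<and> Im (csqrt \<beta>) > 0" if "c > 0" using that w by (intro csqrt_upper) (simp add: Imb)
  have bneg: "Re (csqrt \<beta>) > 0 \<and> Im (csqrt \<beta>) < 0" if "c < 0" using that w by (intro csqrt_lower) (simp add: Imb mult_neg_pos)
  have spos: "Im s > 0" if "c' > 0" using that z csqrt_upper[of \<gamma>] by (simp add: Imb s_def del: csqrt.simps)
  have sneg: "Im s < 0" if "c' < 0" using that z csqrt_lower[of \<gamma>] by (simp add: Imb s_def mult_neg_pos del: csqrt.simps)
  have dneg: "Re (csqrt (of_int d)) = 0 \<and> Im (csqrt (of_int d)) > 0" if "d < 0" using that by simp
  have dpos: "Re (csqrt (of_int d)) > 0 \<and> Im (csqrt (of_int d)) = 0" if "d > 0" using that by simp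
  have b0: "\<beta> = of_int d" if "c = 0" using that by (simp add: \<beta>_def)
  have s0: "s = csqrt (of_int d)" if "c' = 0" using that by (simp add: s_def \<gamma>_def)
  \<comment> \<open>The imaginary part of the root of \<alpha> has the sign of \<open>k\<close>,
    that of \<beta> the sign of \<open>c\<close> (for \<open>c = 0\<close>, \<beta> is just
    \<open>d\<close>). This fixes the sign of the real or imaginary part of \<open>p\<close>, and
    comparison with \<open>s\<close> decides. The outcome \<open>p = - s\<close> occurs exactly when
    \<open>d < 0\<close> and just one of \<open>c\<close>, \<open>c'\<close> is negative.\<close>
  have key: "of_int (shimura_symbol c d) * p = of_int (shimura_symbol c' d) * s"
  proof (cases "k = 1")
    case True
    have al: "Re (csqrt \<alpha>) > 0" "Im (csqrt \<alpha>) > 0" using csqrt_upper[of \<alpha>] z True by (auto simp: Imb simp del: csqrt.simps)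
    have c'k: "c' = c + 4 * d" using True by (simp add: c'_def)
    consider (neg) "c < 0" | (pos) "c > 0" | (zpos) "c = 0" "d > 0" | (zneg) "c = 0" "d < 0" using d by linarith
    thus ?thesis
    proof cases
      case neg
      have "Re p > 0" unfolding Rep using al bneg[OF neg] mult_pos_pos[of "Re (csqrt \<alpha>)" "Re (csqrt \<beta>)"]
          mult_pos_neg[of "Im (csqrt \<alpha>)" "Im (csqrt \<beta>)"] by linarith
      hence "p = s" by (rule Re_pos)
      moreover have "d < 0 \<Longrightarrow> c' < 0" using neg c'k by simp
      ultimately show ?thesis using neg by (auto simp: shimura_symbol_jacobi jc)
    next
      case pos
      have "Im p > 0" unfolding Imp using al bpos[OF pos] by (intro add_pos_pos mult_pos_pos) auto
      moreover have "Im s > 0" if "c' \<ge> 0" using that spos s0 dneg pos c'k by (cases "c' = 0") (auto simp del: csqrt.simps)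
      moreover have "d < 0" if "c' < 0" using that pos c'k by linarith
      ultimately have "(c' \<ge> 0 \<and> p = s) \<or> (c' < 0 \<and> d < 0 \<and> p = - s)" using ps sneg by fastforce
      thus ?thesis using pos by (auto simp: shimura_symbol_jacobi jc)
    next
      case zpos
      have "Re p > 0" unfolding Rep b0[OF zpos(1)] using al dpos[OF zpos(2)] by (simp del: csqrt.simps)
      hence "p = s" by (rule Re_pos)
      thus ?thesis using zpos by (auto simp: shimura_symbol_jacobi jc)
    next
      case zneg
      have "Im p > 0" unfolding Imp b0[OF zneg(1)] using al dneg[OF zneg(2)] by (simp del: csqrt.simps)
      moreover have c': "c' < 0" using zneg c'k by simp
      ultimately have "p = - s" using ps sneg by fastforce
      thus ?thesis using zneg c' by (auto simp: shimura_symbol_jacobi jc)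
    qed
  next
    case False
    hence k1: "k = -1" using k by simp
    have al: "Re (csqrt \<alpha>) > 0" "Im (csqrt \<alpha>) < 0" using csqrt_lower[of \<alpha>] z k1 by (auto simp: Imb simp del: csqrt.simps)
    have c'k: "c' = c - 4 * d" using k1 by (simp add: c'_def)
    consider (pos) "c > 0" | (neg) "c < 0" | (zpos) "c = 0" "d > 0" | (zneg) "c = 0" "d < 0" using d by linarith
    thus ?thesis
    proof cases
      case pos
      have "Re p > 0" unfolding Rep using al bpos[OF pos] mult_pos_pos[of "Re (csqrt \<alpha>)" "Re (csqrt \<beta>)"]
          mult_neg_pos[of "Im (csqrt \<alpha>)" "Im (csqrt \<beta>)"] by linarith
      hence "p = s" by (rule Re_pos)
      moreover have "d < 0 \<Longrightarrow> \<not> c' < 0" using pos c'k by simp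
      ultimately show ?thesis using pos by (auto simp: shimura_symbol_jacobi jc)
    next
      case neg
      have "Im p < 0" unfolding Imp using al bneg[OF neg] by (intro add_neg_neg mult_pos_neg mult_neg_pos) auto
      moreover have "d < 0" if "c' \<ge> 0" using that neg c'k by linarith
      moreover have "Im s > 0" if "c' \<ge> 0" using that spos s0 dneg neg c'k by (cases "c' = 0") (auto simp del: csqrt.simps)
      ultimately have "(c' \<ge> 0 \<and> d < 0 \<and> p = - s) \<or> (c' < 0 \<and> p = s)" using ps sneg by fastforce
      thus ?thesis using neg by (auto simp: shimura_symbol_jacobi jc)
    next
      case zpos
      have "Re p > 0" unfolding Rep b0[OF zpos(1)] using al dpos[OF zpos(2)] by (simp del: csqrt.simps)
      hence "p = s" by (rule Re_pos)
      thus ?thesis using zpos by (auto simp: shimura_symbol_jacobi jc)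
    next
      case zneg
      have "Re p > 0" unfolding Rep b0[OF zneg(1)] using al dneg[OF zneg(2)] by (simp add: mult_neg_pos del: csqrt.simps)
      hence "p = s" by (rule Re_pos)
      moreover have "\<not> c' < 0" using zneg c'k by simp
      ultimately show ?thesis using zneg by (auto simp: shimura_symbol_jacobi jc)
    qed
  qed
  have "theta ((of_int a * z + of_int b) / \<gamma>) = (of_int (shimura_symbol c d) * p) * inverse (theta_eps d) * theta z"
    unfolding th1 p_def by (simp only: mult_ac)
  also have "\<dots> = of_int (shimura_symbol c' d) * inverse (theta_eps d) * s * theta z"
    unfolding key by (simp only: mult_ac)
  finally show "theta ((of_int a * z + of_int b) / (of_int (c + 4 * k * d) * z + of_int d)) =
     of_int (shimura_symbol (c + 4 * k * d) d) * inverse (theta_eps d) *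
     csqrt (of_int (c + 4 * k * d) * z + of_int d) * theta z"
    unfolding s_def \<gamma>_def c'_def .
qed

lemma theta_eps_cong: "[d = d'] (mod 4) \<Longrightarrow> theta_eps d = theta_eps d'"
  by (simp add: theta_eps_def cong_def)

lemma theta_multiplier_zero: "d = 1 \<or> d = -1 \<Longrightarrow> theta_multiplier 0 d"
  unfolding theta_multiplier_def
proof (elim disjE; intro allI impI)
  fix a b z assume "d = 1" "a * d - b * 0 = (1::int)"
  thus "theta ((of_int a * z + of_int b) / (of_int 0 * z + of_int d)) =
    of_int (shimura_symbol 0 d) * inverse (theta_eps d) * csqrt (of_int 0 * z + of_int d) * theta z"
    using theta_plus_int[of z b] by (simp add: shimura_symbol_def theta_eps_def)
next
  fix a b z assume d: "d = -1" "a * d - b * 0 = (1::int)"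
  have "shimura_symbol 0 (-1) = 1" using jacobi_uminus[of 0 1] by (simp add: shimura_symbol_jacobi)
  moreover have "theta_eps (-1) = \<i>" by (simp add: theta_eps_def cong_def)
  ultimately show "theta ((of_int a * z + of_int b) / (of_int 0 * z + of_int d)) =
    of_int (shimura_symbol 0 d) * inverse (theta_eps d) * csqrt (of_int 0 * z + of_int d) * theta z"
    using theta_plus_int[of z "-b"] d by (simp add: csqrt_minus)
qed

text \<open>Descent on \<open>\<bar>c\<bar> + \<bar>d\<bar>\<close>: the translation \<open>z \<mapsto> z \<plusminus> 1\<close> changes \<open>d\<close> by \<open>\<plusminus>c\<close> and
  \<open>z \<mapsto> z / (1 \<plusminus> 4z)\<close> changes \<open>c\<close> by \<open>\<plusminus>4d\<close>.\<close>

theorem theta_multiplier: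
  assumes "4 dvd c" "odd d" "coprime c d"
  shows "theta_multiplier c d"
  using assms
proof (induction "nat (\<bar>c\<bar> + \<bar>d\<bar>)" arbitrary: c d rule: less_induct)
  case less
  obtain m where m: "c = 4 * m" using less.prems(1) by auto
  \<comment> \<open>Neither move shortens a pair with |c| = 2|d|, but this is impossible when 4
    divides \<open>c\<close> and \<open>d\<close> is odd. If |c| is larger, passing to ||c| - 4|d||
    is a decrease; if smaller, passing from |d| to ||d| - |c|| is one.\<close>
  have ne: "\<bar>c\<bar> \<noteq> 2 * \<bar>d\<bar>" using m less.prems(2) by presburger
  have d0: "d \<noteq> 0" using less.prems(2) by auto
  consider "c = 0" | "c \<noteq> 0" "\<bar>c\<bar> > 2 * \<bar>d\<bar>" | "c \<noteq> 0" "\<bar>c\<bar> < 2 * \<bar>d\<bar>" using ne by linarith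
  thus ?case
  proof cases
    case 1
    hence "is_unit d" using less.prems(3) by simp
    hence "d = 1 \<or> d = -1" by (metis zdvd1_eq abs_if minus_equation_iff)
    thus ?thesis using theta_multiplier_zero 1 by simp
  next
    case 2
    define k where "k = sgn c * sgn d"
    have k: "k = 1 \<or> k = -1" using 2(1) d0 by (auto simp: k_def sgn_if)
    have lt: "\<bar>c - 4 * k * d\<bar> < \<bar>c\<bar>" using 2 d0 by (auto simp: k_def sgn_if abs_if split: if_splits)
    have "theta_multiplier (c - 4 * k * d) d"
    proof (rule less.hyps)
      show "nat (\<bar>c - 4 * k * d\<bar> + \<bar>d\<bar>) < nat (\<bar>c\<bar> + \<bar>d\<bar>)" using lt by simp
      show "4 dvd c - 4 * k * d" using m by simp
      have "gcd d (c - 4 * k * d) = gcd d c" using gcd_add_mult[of d "- 4 * k" c] by (simp add: algebra_simps)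
      thus "coprime (c - 4 * k * d) d" using less.prems(3) by (simp add: coprime_iff_gcd_eq_1 gcd.commute)
    qed (rule less.prems)
    from theta_multiplier_V[OF this k d0] show ?thesis by simp
  next
    case 3
    define k where "k = sgn c * sgn d"
    have lt: "\<bar>d - k * c\<bar> < \<bar>d\<bar>" using 3 d0 by (auto simp: k_def sgn_if abs_if split: if_splits)
    have od: "odd (d - k * c)" using less.prems(2) m by simp
    have "gcd c (d - k * c) = gcd c d" using gcd_add_mult[of c "- k" d] by (simp add: algebra_simps)
    hence cp: "coprime c (d - k * c)" using less.prems(3) by (simp add: coprime_iff_gcd_eq_1)
    have "theta_multiplier c (d - k * c)"
      using lt by (intro less.hyps less.prems od cp) simp
    hence "theta_multiplier c (d - k * c + k * c)"
    proof (rule theta_multiplier_T)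
      show "shimura_symbol c (d - k * c + k * c) = shimura_symbol c (d - k * c)"
        by (rule shimura_symbol_periodic) (use less.prems 3 od cp in auto)
      show "theta_eps (d - k * c + k * c) = theta_eps (d - k * c)"
        by (rule theta_eps_cong) (simp add: cong_iff_dvd_diff m)
    qed
    thus ?thesis by simp
  qed
qed

theorem theta4_multiplier:
  assumes "a * d - b * c = 1" "16 dvd c" "Im z > 0"
  shows "theta4 ((of_int a * z + of_int b) / (of_int c * z + of_int d)) =
    of_int (shimura_symbol c d) * inverse (theta_eps d) * csqrt (of_int c * z + of_int d) * theta4 z"
proof -
  obtain m where m: "c = 16 * m" using assms(2) by auto
  have "odd (a * d)" using assms(1) m by (metis dvd_diff dvd_mult even_numeral odd_one dvd_mult2 dvd_trans assms(2) even_mult_iff)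
  hence ad: "odd a" "odd d" by auto
  have "even (d - a)" using ad by simp
  then obtain h where h: "d - a = 2 * h" by (elim evenE)
  \<comment> \<open>Conjugation by the translation by 1/2 turns the entries into a + c/2, b + (d -
    a)/2 - c/4, c and d - c/2, all of them integers here.\<close>
  define a' b' d' where "a' = a + 8 * m" and "b' = b + h - 4 * m" and "d' = d - 8 * m"
  have d: "d = a + 2 * h" using h by simp
  have det: "a' * d' - b' * c = 1" using assms(1) unfolding a'_def b'_def d'_def m d by (simp add: algebra_simps)
  have od': "odd d'" using ad by (simp add: d'_def)
  have cop: "coprime c d"
  proof (rule coprimeI)
    fix e assume "e dvd c" "e dvd d"
    hence "e dvd a * d - b * c" by (intro dvd_diff dvd_mult) auto
    thus "is_unit e" using assms(1) by simp
  qed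
  have cop': "coprime c d'"
  proof (rule coprimeI)
    fix e assume "e dvd c" "e dvd d'"
    hence "e dvd a' * d' - b' * c" by (intro dvd_diff dvd_mult) auto
    thus "is_unit e" using det by simp
  qed
  have "theta_multiplier c d'" by (rule theta_multiplier) (use assms(2) od' cop' in \<open>auto intro: dvd_trans[of 4 16]\<close>)
  moreover have z': "Im (z + 1/2) > 0" using assms(3) by simp
  ultimately have *: "theta ((of_int a' * (z + 1/2) + of_int b') / (of_int c * (z + 1/2) + of_int d')) =
     of_int (shimura_symbol c d') * inverse (theta_eps d') * csqrt (of_int c * (z + 1/2) + of_int d') * theta (z + 1/2)"
    using det unfolding theta_multiplier_def by blast
  have den: "of_int c * (z + 1/2) + of_int d' = of_int c * z + (of_int d :: complex)"
    by (simp add: d'_def m algebra_simps)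
  have nz: "of_int c * z + (of_int d :: complex) \<noteq> 0"
  proof
    assume 0: "of_int c * z + (of_int d :: complex) = 0"
    hence "of_int c * Im z = 0" by (auto simp: complex_eq_iff)
    hence "c = 0" using assms(3) by simp
    thus False using 0 ad by simp
  qed
  have num: "of_int a' * (z + 1/2) + of_int b' =
      (of_int a * z + of_int b) + (of_int c * z + of_int d) * (1/2 :: complex)"
    by (simp add: a'_def b'_def m d algebra_simps)
  \<comment> \<open>\<open>d'\<close> differs from \<open>d\<close> by c/2, which need not be a
    multiple of \<open>c\<close>. Cancelling the square 4 leaves the top entry \<open>4 * m\<close>,
    which divides the difference and is still a multiple of 4. This is the use of 16 dividing
    \<open>c\<close>.\<close>
  have S: "shimura_symbol c d' = shimura_symbol c d"
  proof (cases "m = 0")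
    case False
    have "shimura_symbol (4 * (4 * m)) d' = shimura_symbol (4 * m) d'" by (rule shimura_symbol_four_mult[OF od'])
    also have "\<dots> = shimura_symbol (4 * m) d"
    proof (rule shimura_symbol_periodic)
      show "coprime (4 * m) d" "coprime (4 * m) d'"
        by (rule coprime_divisors[OF _ dvd_refl cop] coprime_divisors[OF _ dvd_refl cop']; simp add: m)+
    qed (use False ad od' in \<open>auto simp: d'_def\<close>)
    also have "\<dots> = shimura_symbol (4 * (4 * m)) d" by (rule shimura_symbol_four_mult[OF ad(2), symmetric])
    finally show ?thesis by (simp add: m)
  qed (simp add: d'_def)
  have E: "theta_eps d' = theta_eps d" by (rule theta_eps_cong) (simp add: d'_def cong_iff_dvd_diff)
  have shift: "(N + D * (1/2)) / D = N / D + 1/2" if "D \<noteq> 0" for N D :: complex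
    using that by (simp add: add_divide_distrib)
  show ?thesis using * unfolding den num S E theta4_def shift[OF nz] .
qed

section \<open>Partial fractions of 1/sin^2, and termwise integration\<close>

lemma Polygamma_1_reflection:
  fixes z :: complex
  assumes z: "z \<notin> \<int>"
  shows "Polygamma 1 z + Polygamma 1 (1 - z) = (of_real pi)\<^sup>2 / (sin (of_real pi * z))\<^sup>2"
proof -
  define S where "S = - (\<int> :: complex set)"
  have S: "open S" unfolding S_def by (intro open_Compl closed_Ints)
  have nI: "w \<notin> \<int>\<^sub>\<le>\<^sub>0" "1 - w \<notin> \<int>\<^sub>\<le>\<^sub>0" "sin (of_real pi * w) \<noteq> 0" if "w \<in> S" for w
  proof -
    show "w \<notin> \<int>\<^sub>\<le>\<^sub>0" using that nonpos_Ints_subset_Ints by (auto simp: S_def)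
    show "1 - w \<notin> \<int>\<^sub>\<le>\<^sub>0"
    proof
      assume "1 - w \<in> \<int>\<^sub>\<le>\<^sub>0"
      hence "1 - (1 - w) \<in> \<int>" using nonpos_Ints_subset_Ints by (intro Ints_diff) auto
      thus False using that by (simp add: S_def)
    qed
    show "sin (of_real pi * w) \<noteq> 0"
    proof
      assume "sin (of_real pi * w) = 0"
      then obtain n :: int where "of_real pi * w = of_int n * of_real pi"
        unfolding sin_eq_0 by (metis of_real_mult of_real_of_int_eq)
      hence "w = of_int n" by (simp add: mult.commute)
      thus False using that by (simp add: S_def)
    qed
  qed
  \<comment> \<open>Differentiating the reflection formula for \<open>rGamma\<close> gives this
    cotangent formula; differentiating once more gives the claim.\<close>
  have d1: "Digamma (1 - w) - Digamma w = of_real pi * cot (of_real pi * w)" if w: "w \<in> S" for w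
  proof -
    have "((\<lambda>w. rGamma w * rGamma (1 - w)) has_field_derivative
        (rGamma w * (rGamma (1 - w) * Digamma (1 - w)) - rGamma w * Digamma w * rGamma (1 - w))) (at w)"
      using nI(1,2)[OF w] by (auto intro!: derivative_eq_intros simp: algebra_simps)
    moreover have "((\<lambda>w. rGamma w * rGamma (1 - w)) has_field_derivative cos (of_real pi * w)) (at w)"
      unfolding rGamma_reflection_complex by (auto intro!: derivative_eq_intros)
    ultimately have "rGamma w * (rGamma (1 - w) * Digamma (1 - w)) - rGamma w * Digamma w * rGamma (1 - w) = cos (of_real pi * w)"
      by (rule DERIV_unique)
    hence "(rGamma w * rGamma (1 - w)) * (Digamma (1 - w) - Digamma w) = cos (of_real pi * w)"
      by (simp add: algebra_simps)
    thus ?thesis using nI(3)[OF w] unfolding rGamma_reflection_complex by (simp add: cot_def field_simps)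
  qed
  have zS: "z \<in> S" using z by (simp add: S_def)
  have "((\<lambda>w. Digamma (1 - w) - Digamma w) has_field_derivative (- Polygamma 1 (1 - z) - Polygamma 1 z)) (at z)"
    using nI(1,2)[OF zS] by (auto intro!: derivative_eq_intros)
  moreover have "((\<lambda>w. Digamma (1 - w) - Digamma w) has_field_derivative
      of_real pi * (of_real pi * (- inverse ((sin (of_real pi * z))\<^sup>2)))) (at z)"
  proof (rule DERIV_cong_ev[THEN iffD2, OF refl _ refl])
    show "\<forall>\<^sub>F w in nhds z. Digamma (1 - w) - Digamma w = of_real pi * cot (of_real pi * w)"
      using eventually_nhds_in_open[OF S zS] by eventually_elim (rule d1)
    show "((\<lambda>w. of_real pi * cot (of_real pi * w)) has_field_derivative
      of_real pi * (of_real pi * (- inverse ((sin (of_real pi * z))\<^sup>2)))) (at z)"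
      using nI(3)[OF zS] by (auto intro!: derivative_eq_intros DERIV_chain'[OF _ DERIV_cot])
  qed
  ultimately have "- Polygamma 1 (1 - z) - Polygamma 1 z = of_real pi * (of_real pi * (- inverse ((sin (of_real pi * z))\<^sup>2)))"
    by (rule DERIV_unique)
  hence "- (- Polygamma 1 (1 - z) - Polygamma 1 z) = (of_real pi)\<^sup>2 / (sin (of_real pi * z))\<^sup>2"
    by (simp add: power2_eq_square divide_inverse)
  thus ?thesis by simp
qed

lemma infsum_eq_suminf:
  fixes f :: "nat \<Rightarrow> 'a :: banach"
  assumes "f summable_on UNIV" shows "(\<Sum>\<^sub>\<infinity>n. f n) = (\<Sum>n. f n)"
  by (rule sums_unique[OF has_sum_imp_sums[OF has_sum_infsum[OF assms]]])

text \<open>An enumeration of \<open>I\<close> turns the unordered sums into series, for which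
  absolute convergence permits the exchange; it also makes the values independent of the
  enumeration.\<close>

lemma integral_infsum_swap:
  fixes f :: "'i \<Rightarrow> 'a \<Rightarrow> complex"
  assumes I: "countable I" "infinite I"
    and int: "\<And>p. integrable M (f p)"
    and s1: "(\<lambda>p. LINT t|M. norm (f p t)) summable_on I"
    and s2: "\<And>t. (\<lambda>p. norm (f p t)) summable_on I"
  shows "integral\<^sup>L M (\<lambda>t. \<Sum>\<^sub>\<infinity>p\<in>I. f p t) = (\<Sum>\<^sub>\<infinity>p\<in>I. integral\<^sup>L M (f p))"
proof -
  obtain e :: "nat \<Rightarrow> 'i" where e: "bij_betw e UNIV I" using bij_betw_from_nat_into[OF I] by blast
  have s1': "(\<lambda>p. norm (integral\<^sup>L M (f p))) summable_on I"
    by (rule summable_on_comparison_test[OF s1]) auto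
  have nat_sum: "(\<Sum>n. g (e n)) = (\<Sum>\<^sub>\<infinity>p\<in>I. g p)" if "(\<lambda>p. norm (g p)) summable_on I" for g :: "'i \<Rightarrow> complex"
  proof -
    have "g summable_on I" using that by (rule abs_summable_summable)
    hence "(\<lambda>n. g (e n)) summable_on UNIV" using summable_on_reindex_bij_betw[OF e, of g] by simp
    hence "(\<Sum>n. g (e n)) = (\<Sum>\<^sub>\<infinity>n. g (e n))" by (rule infsum_eq_suminf[symmetric])
    also have "\<dots> = (\<Sum>\<^sub>\<infinity>p\<in>I. g p)" by (rule infsum_reindex_bij_betw[OF e])
    finally show ?thesis .
  qed
  have "integral\<^sup>L M (\<lambda>t. \<Sum>n. f (e n) t) = (\<Sum>n. integral\<^sup>L M (f (e n)))"
  proof (rule integral_suminf)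
    show "AE t in M. summable (\<lambda>n. norm (f (e n) t))"
      using summable_on_reindex_bij_betw[OF e, of "\<lambda>p. norm (f p _)"] s2
      by (intro AE_I2 summable_on_imp_summable) simp
    show "summable (\<lambda>n. LINT t|M. norm (f (e n) t))"
      using summable_on_reindex_bij_betw[OF e, of "\<lambda>p. LINT t|M. norm (f p t)"] s1
      by (intro summable_on_imp_summable) simp
  qed (rule int)
  thus ?thesis using nat_sum[OF s2] nat_sum[OF s1'] by simp
qed

text \<open>The terms with nonnegative m form the trigamma series at \<open>z\<close>, those with
  negative m the one at \<open>1 - z\<close>.\<close>

lemma infsum_inverse_square_shift:
  fixes z :: complex
  assumes z: "z \<notin> \<int>" and s: "(\<lambda>m::int. 1 / (z + of_int m)\<^sup>2) summable_on UNIV"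
  shows "(\<Sum>\<^sub>\<infinity>m::int. 1 / (z + of_int m)\<^sup>2) = (of_real pi)\<^sup>2 / (sin (of_real pi * z))\<^sup>2"
proof -
  have P: "Polygamma 1 w = (\<Sum>k. 1 / (w + of_nat k)\<^sup>2)" for w :: complex
    by (simp add: Polygamma_def divide_inverse power2_eq_square)
  have "(\<Sum>\<^sub>\<infinity>m::int. 1 / (z + of_int m)\<^sup>2) =
      (\<Sum>\<^sub>\<infinity>n. 1 / (z + of_nat n)\<^sup>2) + (\<Sum>\<^sub>\<infinity>n. 1 / (z - of_nat (Suc n))\<^sup>2)"
    using infsum_int_split[OF s] by (simp del: of_nat_Suc add: of_int_minus)
  also have "(\<Sum>\<^sub>\<infinity>n. 1 / (z + of_nat n)\<^sup>2) = (\<Sum>n. 1 / (z + of_nat n)\<^sup>2)"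
    using summable_on_int_nat(1)[OF s] by (intro infsum_eq_suminf) simp
  also have "(\<Sum>\<^sub>\<infinity>n. 1 / (z - of_nat (Suc n))\<^sup>2) = (\<Sum>n. 1 / (z - of_nat (Suc n))\<^sup>2)"
    using summable_on_int_nat(3)[OF s] by (intro infsum_eq_suminf) (simp add: algebra_simps)
  also have "(\<lambda>n. 1 / (z - of_nat (Suc n))\<^sup>2) = (\<lambda>n. 1 / ((1 - z) + of_nat n)\<^sup>2)"
    by (simp add: fun_eq_iff power2_eq_square algebra_simps)
  finally show ?thesis using Polygamma_1_reflection[OF z] P by simp
qed

section \<open>The lattice sum\<close>

abbreviation Lattice :: "(int \<times> int) set" where "Lattice \<equiv> UNIV \<times> {m. odd m}"

definition lattice_pt :: "complex \<Rightarrow> int \<times> int \<Rightarrow> complex" where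
  "lattice_pt z p = 2 * of_int (fst p) * z + of_int (snd p)"

definition lattice_pt_re :: "complex \<Rightarrow> int \<times> int \<Rightarrow> real" where
  "lattice_pt_re z p = 2 * of_int (fst p) * Re z + of_int (snd p)"

text \<open>With \<lambda> the lattice point and n its first coordinate, this family joins exp(-pi
  |\<lambda>|^2 / (4 Im z)) at t = Im z to the limit exp(pi i n \<lambda>) as t grows. Its
  t-derivative carries a factor \<lambda>^2, which removes the denominator of the lattice
  sum.\<close>

definition gauss_term :: "complex \<Rightarrow> int \<times> int \<Rightarrow> real \<Rightarrow> complex" where
  "gauss_term z p t = exp (- of_real pi * (lattice_pt z p)\<^sup>2 / of_real (4 * t) + of_real pi * \<i> * of_int (fst p) * lattice_pt z p)"

definition lattice_sum :: "complex \<Rightarrow> complex" where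
  "lattice_sum z = (\<Sum>\<^sub>\<infinity>p\<in>Lattice. exp (- of_real (pi * (norm (lattice_pt z p))\<^sup>2 / (4 * Im z))) / (lattice_pt z p)\<^sup>2)"

lemma lattice_pt_Re [simp]: "Re (lattice_pt z p) = lattice_pt_re z p"
  and lattice_pt_Im [simp]: "Im (lattice_pt z p) = 2 * of_int (fst p) * Im z"
  by (simp_all add: lattice_pt_def lattice_pt_re_def)

lemma peetre: "1 + m\<^sup>2 \<le> 2 * (1 + u\<^sup>2) * (1 + (u + m :: real)\<^sup>2)"
proof -
  have "2 * (1 + u\<^sup>2) * (1 + (u + m)\<^sup>2) - (1 + m\<^sup>2) = (m + 2 * u)\<^sup>2 + 1 + 2 * (u * (u + m))\<^sup>2"
    by (simp add: power2_eq_square algebra_simps)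
  moreover have "(m + 2 * u)\<^sup>2 + 1 + 2 * (u * (u + m))\<^sup>2 \<ge> 0" by simp
  ultimately show ?thesis by linarith
qed

text \<open>Separates \<open>m\<close> from the shift \<open>u\<close>, which depends on the row, at
  the cost of a factor polynomial in \<open>u\<close> that the Gaussian decay over the rows can
  afford.\<close>

lemma peetre_inverse: "1 / (1 + (u + m)\<^sup>2) \<le> 2 * (1 + u\<^sup>2) * (1 / (1 + (m::real)\<^sup>2))"
  using peetre[of m u] by (simp add: field_simps add_pos_nonneg)

lemma theta4_series: "theta4 w = (\<Sum>\<^sub>\<infinity>n::int. ee (of_int n / 2) * ee (of_int (n\<^sup>2) * w))"
proof -
  have "ee (of_int (n\<^sup>2) * (w + 1/2)) = ee (of_int n / 2) * ee (of_int (n\<^sup>2) * w)" for n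
  proof -
    have "even (n\<^sup>2 - n)" by simp
    then obtain h where h: "n\<^sup>2 - n = 2 * h" by (elim evenE)
    hence n2: "n\<^sup>2 = n + 2 * h" by simp
    have "of_int (n\<^sup>2) * (w + 1/2) = of_int n / 2 + of_int (n\<^sup>2) * w + of_int h"
      unfolding n2 by (simp add: algebra_simps add_divide_distrib)
    thus ?thesis by (simp only: ee_add ee_of_int mult_1_right)
  qed
  thus ?thesis unfolding theta4_def theta_def by (simp only:)
qed

lemma ee_half_int: "ee (of_int n / 2) = (if even n then 1 else -1)"
proof (cases "even n")
  case True
  then obtain m where "n = 2 * m" by (elim evenE)
  thus ?thesis by simp
next
  case False
  then obtain m where m: "n = 2 * m + 1" by (elim oddE)
  have "ee (of_int n / 2) = ee (of_int m) * ee (1/2)"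
    unfolding ee_add[symmetric] by (simp add: m add_divide_distrib)
  thus ?thesis using False by (simp add: ee_half)
qed

lemma theta4_summable_norm: "Im w > 0 \<Longrightarrow> (\<lambda>n::int. norm (ee (of_int n / 2) * ee (of_int (n\<^sup>2) * w))) summable_on UNIV"
proof -
  assume w: "Im w > 0"
  have "norm (ee (of_int n / 2)) = 1" for n by (simp add: ee_half_int)
  thus ?thesis
    using summable_on_gaussian[of "2 * pi * Im w"] w by (simp only: norm_mult norm_ee_square) simp
qed

context
  fixes z :: complex and y :: real
  assumes y: "y = Im z" "y > 0"
begin

text \<open>A product of a function of the row and a function of the column, hence summable over the
  lattice. The estimates of lattice terms below pass through it.\<close>

definition gauss_majorant :: "int \<times> int \<Rightarrow> real" where
  "gauss_majorant p = exp (- (pi * y) * (of_int (fst p))\<^sup>2) * (1 + 4 * (Re z)\<^sup>2 * (of_int (fst p))\<^sup>2) * (1 / (1 + (of_int (snd p))\<^sup>2))"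

lemma gauss_majorant_summable: "gauss_majorant summable_on Lattice"
proof -
  have "(\<lambda>n::int. \<bar>of_int n\<bar> ^ 0 * exp (- (pi * y) * (of_int n)\<^sup>2) + 4 * (Re z)\<^sup>2 * (\<bar>of_int n\<bar> ^ 2 * exp (- (pi * y) * (of_int n)\<^sup>2))) summable_on UNIV"
    using y by (intro summable_on_add summable_on_cmult_right summable_on_gaussian_poly) auto
  hence "(\<lambda>n::int. exp (- (pi * y) * (of_int n)\<^sup>2) * (1 + 4 * (Re z)\<^sup>2 * (of_int n)\<^sup>2)) summable_on UNIV"
    by (simp add: algebra_simps)
  from summable_on_times_nonneg[OF this summable_on_int_inverse_square]
  have "(\<lambda>(n::int, m::int). exp (- (pi * y) * (of_int n)\<^sup>2) * (1 + 4 * (Re z)\<^sup>2 * (of_int n)\<^sup>2) * (1 / (1 + (of_int m)\<^sup>2))) summable_on UNIV \<times> UNIV"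
    by simp
  hence "gauss_majorant summable_on UNIV \<times> UNIV" by (simp add: gauss_majorant_def[abs_def] case_prod_unfold)
  thus ?thesis by (rule summable_on_subset_banach) auto
qed

lemma gauss_majorant_bound:
  "exp (- (pi * y) * (of_int (fst p))\<^sup>2) * (1 / (1 + (lattice_pt_re z p)\<^sup>2)) \<le> 2 * gauss_majorant p"
proof -
  have "1 / (1 + (lattice_pt_re z p)\<^sup>2) \<le> 2 * (1 + (2 * of_int (fst p) * Re z)\<^sup>2) * (1 / (1 + (of_int (snd p))\<^sup>2))"
    unfolding lattice_pt_re_def by (rule peetre_inverse)
  hence "exp (- (pi * y) * (of_int (fst p))\<^sup>2) * (1 / (1 + (lattice_pt_re z p)\<^sup>2)) \<le>
     exp (- (pi * y) * (of_int (fst p))\<^sup>2) * (2 * (1 + (2 * of_int (fst p) * Re z)\<^sup>2) * (1 / (1 + (of_int (snd p))\<^sup>2)))"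
    by (rule mult_left_mono) simp
  also have "\<dots> = 2 * gauss_majorant p" by (simp add: gauss_majorant_def power_mult_distrib algebra_simps)
  finally show ?thesis .
qed

lemma lattice_pt_nonzero: "p \<in> Lattice \<Longrightarrow> lattice_pt z p \<noteq> 0"
proof
  assume p: "p \<in> Lattice" and 0: "lattice_pt z p = 0"
  have "2 * of_int (fst p) * y = 0" using 0 lattice_pt_Im[of z p] y(1) by simp
  hence "fst p = 0" using y(2) by simp
  moreover have "lattice_pt_re z p = 0" using 0 lattice_pt_Re[of z p] by simp
  ultimately have "snd p = 0" by (simp add: lattice_pt_re_def)
  thus False using p by auto
qed

lemma norm_gauss_term_le:
  assumes t: "t \<ge> y"
  shows "norm (gauss_term z p t) \<le> exp (- (pi * y) * (of_int (fst p))\<^sup>2) * exp (- pi * (lattice_pt_re z p)\<^sup>2 / (4 * t))"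
proof -
  define n where "n = (of_int (fst p) :: real)"
  have t0: "t > 0" using t y(2) by simp
  have "Re (- of_real pi * (lattice_pt z p)\<^sup>2 / of_real (4 * t) + of_real pi * \<i> * of_int (fst p) * lattice_pt z p) =
     - pi * ((lattice_pt_re z p)\<^sup>2 - (2 * n * y)\<^sup>2) / (4 * t) - pi * n * (2 * n * y)"
    by (simp add: n_def y(1) power2_eq_square Re_divide_of_real del: of_real_mult)
  also have "\<dots> = - pi * (lattice_pt_re z p)\<^sup>2 / (4 * t) + (pi * n\<^sup>2 * y) * (y / t) - 2 * (pi * n\<^sup>2 * y)"
    using t0 by (simp add: field_simps power2_eq_square)
  \<comment> \<open>Here y/t \<le> 1. Of the decay 2 pi n^2 y, one half pays for the growth caused
    by the imaginary part of the lattice point; the other half remains for every t.\<close>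
  also have "\<dots> \<le> - pi * (lattice_pt_re z p)\<^sup>2 / (4 * t) + (pi * n\<^sup>2 * y) * 1 - 2 * (pi * n\<^sup>2 * y)"
    using t t0 y(2) by (intro add_mono diff_mono mult_left_mono order_refl) auto
  finally have "norm (gauss_term z p t) \<le> exp (- (pi * y) * n\<^sup>2 + - pi * (lattice_pt_re z p)\<^sup>2 / (4 * t))"
    unfolding gauss_term_def norm_exp_eq_Re by (simp add: mult_ac)
  thus ?thesis by (simp only: exp_add n_def)
qed

text \<open>exp(-x) \<le> 1/(1 + x) weakens the Gaussian decay to a quadratic one, which
  \<open>peetre_inverse\<close> can separate. The constant grows with \<open>t\<close>, which is
  harmless since the bound serves for sums at fixed \<open>t\<close>.\<close>

lemma norm_gauss_term_le_gauss_majorant: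
  assumes t: "t \<ge> y"
  shows "norm (gauss_term z p t) \<le> 2 * (1 + 4 * t / pi) * gauss_majorant p"
proof -
  have t0: "t > 0" using t y(2) by simp
  define X where "X = (lattice_pt_re z p)\<^sup>2"
  have X: "X \<ge> 0" by (simp add: X_def)
  have "exp (- pi * X / (4 * t)) = 1 / exp (pi * X / (4 * t))" using exp_minus[of "pi * X / (4 * t)"] by (simp add: inverse_eq_divide)
  also have "\<dots> \<le> 1 / (1 + pi * X / (4 * t))"
    using t0 X by (intro divide_left_mono exp_ge_add_one_self mult_pos_pos add_pos_nonneg) auto
  also have "\<dots> \<le> (1 + 4 * t / pi) * (1 / (1 + X))"
  proof -
    have "1 + X \<le> (1 + 4 * t / pi) * (1 + pi * X / (4 * t))"
      using t0 X by (simp add: field_simps)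
    thus ?thesis using t0 X by (simp add: divide_le_eq le_divide_eq add_pos_nonneg mult_ac)
  qed
  finally have "exp (- (pi * y) * (of_int (fst p))\<^sup>2) * exp (- pi * X / (4 * t)) \<le>
     exp (- (pi * y) * (of_int (fst p))\<^sup>2) * ((1 + 4 * t / pi) * (1 / (1 + X)))"
    by (rule mult_left_mono) simp
  also have "\<dots> = (1 + 4 * t / pi) * (exp (- (pi * y) * (of_int (fst p))\<^sup>2) * (1 / (1 + X)))" by simp
  also have "\<dots> \<le> (1 + 4 * t / pi) * (2 * gauss_majorant p)"
    unfolding X_def using t0 gauss_majorant_bound by (intro mult_left_mono) auto
  also have "\<dots> = 2 * (1 + 4 * t / pi) * gauss_majorant p" by (simp only: mult_ac)
  finally show ?thesis by (rule order_trans[OF norm_gauss_term_le[OF t, of p, folded X_def]])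
qed

text \<open>The integral is (1 - exp(-pi X^2 / (4y))) / X^2, which decays like 1/(1 + X^2): it is at
  most 1/X^2, and at most pi/(4y) by 1 - exp(-x) \<le> x. The antiderivative has X^2 in its
  denominator, so \<open>X = 0\<close> is treated apart.\<close>

lemma gaussian_reciprocal_integral:
  fixes X :: real
  shows "set_integrable lborel {y<..} (\<lambda>t. pi / (4 * t\<^sup>2) * exp (- pi * X\<^sup>2 / (4 * t)))"
    and "(LBINT t:{y<..}. pi / (4 * t\<^sup>2) * exp (- pi * X\<^sup>2 / (4 * t))) \<le> (2 + pi / (2 * y)) * (1 / (1 + X\<^sup>2))"
proof -
  let ?f = "\<lambda>t. pi / (4 * t\<^sup>2) * exp (- pi * X\<^sup>2 / (4 * t))"
  have e: "einterval (ereal y) \<infinity> = {y<..}" by (auto simp: einterval_def)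
  have c: "isCont ?f t" if "t > y" for t using that y(2) by (intro continuous_intros) auto
  have main: "set_integrable lborel {y<..} ?f \<and> (LBINT t:{y<..}. ?f t) = B - F y"
    if F: "\<And>t. t > 0 \<Longrightarrow> (F has_real_derivative ?f t) (at t)" and B: "(F \<longlongrightarrow> B) at_top" for F B
  proof -
    have Fy: "(F \<longlongrightarrow> F y) (at_right y)"
      using DERIV_isCont[OF F[OF y(2)]] unfolding isCont_def by (rule tendsto_within_subset) simp
    have "set_integrable lborel (einterval (ereal y) \<infinity>) ?f"
      by (rule interval_integral_FTC_nonneg(1)[where F = F and A = "F y" and B = B])
         (use F c Fy B y(2) in \<open>auto simp: ereal_tendsto_simps1\<close>)
    moreover have "(LBINT t=ereal y..\<infinity>. ?f t) = B - F y"
      by (rule interval_integral_FTC_nonneg(2)[where F = F and A = "F y" and B = B])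
         (use F c Fy B y(2) in \<open>auto simp: ereal_tendsto_simps1\<close>)
    ultimately show ?thesis by (simp add: e interval_lebesgue_integral_def)
  qed
  have "set_integrable lborel {y<..} ?f \<and> (LBINT t:{y<..}. ?f t) \<le> (2 + pi / (2 * y)) * (1 / (1 + X\<^sup>2))"
  proof (cases "X = 0")
    case True
    have F: "((\<lambda>t. - pi / (4 * t)) has_real_derivative ?f t) (at t)" if "t > 0" for t
      using that True by (auto intro!: derivative_eq_intros simp: power2_eq_square field_simps)
    have "((\<lambda>t. - pi / (4 * t)) \<longlongrightarrow> 0) at_top" by real_asymp
    from main[OF F this] have "set_integrable lborel {y<..} ?f" "(LBINT t:{y<..}. ?f t) = pi / (4 * y)" by auto
    moreover have "pi / (4 * y) \<le> 2 + pi / (2 * y)" using y(2) by (simp add: field_simps)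
    ultimately show ?thesis using True by simp
  next
    case False
    define F where "F = (\<lambda>t. exp (- pi * X\<^sup>2 / (4 * t)) / X\<^sup>2)"
    have F: "(F has_real_derivative ?f t) (at t)" if "t > 0" for t
      unfolding F_def using that False by (auto intro!: derivative_eq_intros simp: power2_eq_square field_simps)
    have "(F \<longlongrightarrow> exp 0 / X\<^sup>2) at_top" unfolding F_def
    proof (intro tendsto_divide tendsto_exp tendsto_const)
      show "((\<lambda>t. - pi * X\<^sup>2 / (4 * t)) \<longlongrightarrow> 0) at_top" by real_asymp
    qed (use False in auto)
    note m = main[OF F this]
    have "exp 0 / X\<^sup>2 - F y \<le> (2 + pi / (2 * y)) * (1 / (1 + X\<^sup>2))"
    proof (cases "X\<^sup>2 \<ge> 1")
      case True
      have "1 / Y \<le> 2 * (1 / (1 + Y))" if "Y \<ge> 1" for Y :: real using that by (simp add: field_simps)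
      from this[OF True] have le: "1 / X\<^sup>2 \<le> 2 * (1 / (1 + X\<^sup>2))" .
      have "exp 0 / X\<^sup>2 - F y \<le> 1 / X\<^sup>2" by (simp add: F_def)
      also have "\<dots> \<le> 2 * (1 / (1 + X\<^sup>2))" by (rule le)
      also have "\<dots> \<le> (2 + pi / (2 * y)) * (1 / (1 + X\<^sup>2))" using y(2) by (intro mult_right_mono) auto
      finally show ?thesis .
    next
      case False': False
      have "1 + (- pi * X\<^sup>2 / (4 * y)) \<le> exp (- pi * X\<^sup>2 / (4 * y))" by (rule exp_ge_add_one_self)
      hence "(1 - exp (- pi * X\<^sup>2 / (4 * y))) / X\<^sup>2 \<le> (pi * X\<^sup>2 / (4 * y)) / X\<^sup>2"
        by (intro divide_right_mono) auto
      hence "exp 0 / X\<^sup>2 - F y \<le> pi / (4 * y)" using False by (simp add: F_def diff_divide_distrib)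
      also have "\<dots> = (pi / (2 * y)) * (1 / 2)" by simp
      also have "\<dots> \<le> (2 + pi / (2 * y)) * (1 / (1 + X\<^sup>2))"
        using False' y(2) by (intro mult_mono divide_left_mono) (auto simp: add_pos_nonneg)
      finally show ?thesis .
    qed
    thus ?thesis using m by simp
  qed
  thus "set_integrable lborel {y<..} ?f" "(LBINT t:{y<..}. ?f t) \<le> (2 + pi / (2 * y)) * (1 / (1 + X\<^sup>2))" by auto
qed

lemma gauss_term_measurable: "set_borel_measurable lborel {y<..} (\<lambda>t. of_real (pi / (4 * t\<^sup>2)) * gauss_term z p t)"
proof -
  have "continuous_on {y<..} (\<lambda>t. of_real (pi / (4 * t\<^sup>2)) * gauss_term z p t)"
    unfolding gauss_term_def using y(2) by (intro continuous_intros) auto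
  from borel_measurable_continuous_on_indicator[OF _ this] show ?thesis
    by (simp add: set_borel_measurable_def)
qed

text \<open>The norm bound licenses the exchange of sum and integral; the value comes from the
  antiderivative \<open>gauss_term z p t / (lattice_pt z p)^2\<close>, where an odd second
  coordinate keeps the lattice point away from 0.\<close>

lemma gauss_term_integral:
  shows "set_integrable lborel {y<..} (\<lambda>t. of_real (pi / (4 * t\<^sup>2)) * gauss_term z p t)"
    and "(LBINT t:{y<..}. norm (of_real (pi / (4 * t\<^sup>2)) * gauss_term z p t)) \<le> 2 * (2 + pi / (2 * y)) * gauss_majorant p"
    and "p \<in> Lattice \<Longrightarrow> (LBINT t:{y<..}. of_real (pi / (4 * t\<^sup>2)) * gauss_term z p t) =
           (exp (of_real pi * \<i> * of_int (fst p) * lattice_pt z p) - gauss_term z p y) / (lattice_pt z p)\<^sup>2"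
proof -
  define K where "K = exp (- (pi * y) * (of_int (fst p))\<^sup>2)"
  define g where "g = (\<lambda>t. K * (pi / (4 * t\<^sup>2) * exp (- pi * (lattice_pt_re z p)\<^sup>2 / (4 * t))))"
  have K: "K \<ge> 0" by (simp add: K_def)
  have gi: "set_integrable lborel {y<..} g" unfolding g_def
    by (intro set_integrable_mult_right gaussian_reciprocal_integral)
  have le: "norm (of_real (pi / (4 * t\<^sup>2)) * gauss_term z p t) \<le> g t" if "t \<in> {y<..}" for t
  proof -
    have "norm (of_real (pi / (4 * t\<^sup>2)) * gauss_term z p t) = pi / (4 * t\<^sup>2) * norm (gauss_term z p t)"
      by (simp add: norm_mult norm_divide norm_power)
    also have "\<dots> \<le> pi / (4 * t\<^sup>2) * (K * exp (- pi * (lattice_pt_re z p)\<^sup>2 / (4 * t)))"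
      unfolding K_def using that by (intro mult_left_mono norm_gauss_term_le) auto
    finally show ?thesis by (simp add: g_def mult_ac)
  qed
  show int: "set_integrable lborel {y<..} (\<lambda>t. of_real (pi / (4 * t\<^sup>2)) * gauss_term z p t)"
    by (rule set_integrable_bound[OF gi gauss_term_measurable]) (use le K in \<open>auto intro!: AE_I2 order_trans[OF le] simp: g_def abs_mult\<close>)
  have "(LBINT t:{y<..}. norm (of_real (pi / (4 * t\<^sup>2)) * gauss_term z p t)) \<le> (LBINT t:{y<..}. g t)"
    by (rule set_integral_mono) (use int gi le in \<open>auto intro: set_integrable_norm\<close>)
  also have "\<dots> \<le> K * ((2 + pi / (2 * y)) * (1 / (1 + (lattice_pt_re z p)\<^sup>2)))"
    unfolding g_def using gaussian_reciprocal_integral(2)[of "lattice_pt_re z p"] K by (subst set_integral_mult_right) (rule mult_left_mono)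
  also have "\<dots> = (2 + pi / (2 * y)) * (K * (1 / (1 + (lattice_pt_re z p)\<^sup>2)))" by simp
  also have "\<dots> \<le> (2 + pi / (2 * y)) * (2 * gauss_majorant p)"
    unfolding K_def using y(2) by (intro mult_left_mono gauss_majorant_bound) auto
  also have "\<dots> = 2 * (2 + pi / (2 * y)) * gauss_majorant p" by (simp only: mult_ac)
  finally show "(LBINT t:{y<..}. norm (of_real (pi / (4 * t\<^sup>2)) * gauss_term z p t)) \<le> 2 * (2 + pi / (2 * y)) * gauss_majorant p" .
  show "(LBINT t:{y<..}. of_real (pi / (4 * t\<^sup>2)) * gauss_term z p t) =
           (exp (of_real pi * \<i> * of_int (fst p) * lattice_pt z p) - gauss_term z p y) / (lattice_pt z p)\<^sup>2" if p: "p \<in> Lattice"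
  proof -
    have nz: "lattice_pt z p \<noteq> 0" by (rule lattice_pt_nonzero[OF p])
    define F where "F = (\<lambda>t. gauss_term z p t / (lattice_pt z p)\<^sup>2)"
    have e: "einterval (ereal y) \<infinity> = {y<..}" by (auto simp: einterval_def)
    have F: "(F has_vector_derivative (of_real (pi / (4 * t\<^sup>2)) * gauss_term z p t)) (at t)" if "t > 0" for t
    proof -
      define f where "f = (\<lambda>s::complex. exp (- of_real pi * (lattice_pt z p)\<^sup>2 / (4 * s) + of_real pi * \<i> * of_int (fst p) * lattice_pt z p) / (lattice_pt z p)\<^sup>2)"
      have "(f has_field_derivative (of_real (pi / (4 * t\<^sup>2)) * gauss_term z p t)) (at (of_real t))"
        unfolding f_def gauss_term_def using that nz
        by (auto intro!: derivative_eq_intros simp: power2_eq_square field_simps)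
      hence "((\<lambda>x. f (of_real x)) has_vector_derivative (of_real (pi / (4 * t\<^sup>2)) * gauss_term z p t)) (at t)"
        by (rule has_vector_derivative_real_field)
      thus ?thesis by (simp add: F_def f_def gauss_term_def)
    qed
    have "(LBINT t=ereal y..\<infinity>. of_real (pi / (4 * t\<^sup>2)) * gauss_term z p t) =
       exp (of_real 0 + of_real pi * \<i> * of_int (fst p) * lattice_pt z p) / (lattice_pt z p)\<^sup>2 - F y"
    proof (rule interval_integral_FTC_integrable[where F = F])
      show "(F has_vector_derivative (of_real (pi / (4 * t\<^sup>2)) * gauss_term z p t)) (at t)" if "ereal y < ereal t" for t
        using that y(2) by (intro F) auto
      show "isCont (\<lambda>t. of_real (pi / (4 * t\<^sup>2)) * gauss_term z p t) t" if "ereal y < ereal t" for t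
        unfolding gauss_term_def using that y(2) by (intro continuous_intros) auto
      show "set_integrable lborel (einterval (ereal y) \<infinity>) (\<lambda>t. of_real (pi / (4 * t\<^sup>2)) * gauss_term z p t)"
        using int by (simp add: e)
      have "isCont F y" using F[OF y(2)] by (rule has_vector_derivative_continuous)
      hence "(F \<longlongrightarrow> F y) (at_right y)" unfolding isCont_def by (rule tendsto_within_subset) simp
      thus "((F \<circ> real_of_ereal) \<longlongrightarrow> F y) (at_right (ereal y))" by (simp add: ereal_tendsto_simps1)
      have l: "((\<lambda>t::real. 1 / (4 * t)) \<longlongrightarrow> 0) at_top" by real_asymp
      have "((\<lambda>t::real. - of_real pi * (lattice_pt z p)\<^sup>2 * of_real (1 / (4 * t))) \<longlongrightarrow> - of_real pi * (lattice_pt z p)\<^sup>2 * of_real 0) at_top"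
        by (intro tendsto_mult tendsto_const tendsto_of_real l)
      hence "((\<lambda>t::real. - of_real pi * (lattice_pt z p)\<^sup>2 / of_real (4 * t)) \<longlongrightarrow> of_real 0) at_top" by simp
      hence "(F \<longlongrightarrow> exp (of_real 0 + of_real pi * \<i> * of_int (fst p) * lattice_pt z p) / (lattice_pt z p)\<^sup>2) at_top"
        unfolding F_def gauss_term_def using nz by (intro tendsto_divide tendsto_exp tendsto_add tendsto_const) auto
      thus "((F \<circ> real_of_ereal) \<longlongrightarrow> exp (of_real 0 + of_real pi * \<i> * of_int (fst p) * lattice_pt z p) / (lattice_pt z p)\<^sup>2) (at_left \<infinity>)"
        by (simp add: ereal_tendsto_simps1)
    qed simp
    thus ?thesis by (simp add: e interval_lebesgue_integral_def F_def diff_divide_distrib)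
  qed
qed

text \<open>The exponent contains \<lambda> (\<lambda> - 4 i n y), and \<lambda> - 4 i n y is the
  conjugate of \<lambda> because Im \<lambda> = 2 n y.\<close>

lemma gauss_term_at_y: "gauss_term z p y = exp (- of_real (pi * (norm (lattice_pt z p))\<^sup>2 / (4 * Im z)))"
proof -
  have y0: "Im z \<noteq> 0" using y by simp
  have "- of_real pi * (lattice_pt z p)\<^sup>2 / of_real (4 * y) + of_real pi * \<i> * of_int (fst p) * lattice_pt z p
     = - of_real pi * (lattice_pt z p * (lattice_pt z p - \<i> * of_real (4 * of_int (fst p) * y))) / (of_real (4 * y) :: complex)"
    using y(2) by (simp add: field_simps power2_eq_square)
  also have "lattice_pt z p - \<i> * of_real (4 * of_int (fst p) * y) = cnj (lattice_pt z p)"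
    by (simp add: complex_eq_iff y(1))
  also have "lattice_pt z p * cnj (lattice_pt z p) = of_real ((norm (lattice_pt z p))\<^sup>2)" by (rule complex_norm_square[symmetric])
  finally show ?thesis unfolding gauss_term_def y(1) by simp
qed


lemma sum_gauss_term_summable:
  assumes t: "t \<ge> y"
  shows "(\<lambda>p. norm (gauss_term z p t)) summable_on Lattice"
  by (rule summable_on_norm_comparison(1)[OF summable_on_cmult_right[OF gauss_majorant_summable] norm_gauss_term_le_gauss_majorant[OF t]])

lemma infinite_Lattice: "infinite Lattice"
proof
  assume "finite Lattice"
  moreover have "(\<lambda>n::int. (n, 1::int)) ` UNIV \<subseteq> Lattice" by auto
  ultimately have "finite ((\<lambda>n::int. (n, 1::int)) ` UNIV)" using finite_subset by blast
  thus False by (subst (asm) finite_image_iff) (auto simp: inj_def)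
qed

lemma sum_integral_gauss_term:
  "(\<Sum>\<^sub>\<infinity>p\<in>Lattice. LBINT t:{y<..}. of_real (pi / (4 * t\<^sup>2)) * gauss_term z p t) =
   (LBINT t:{y<..}. of_real (pi / (4 * t\<^sup>2)) * (\<Sum>\<^sub>\<infinity>p\<in>Lattice. gauss_term z p t))"
proof -
  define f where "f = (\<lambda>p t. indicator {y<..} t *\<^sub>R (of_real (pi / (4 * t\<^sup>2)) * gauss_term z p t))"
  have int: "integrable lborel (f p)" for p
    using gauss_term_integral(1)[of p] by (simp add: f_def set_integrable_def)
  have nle: "(LBINT t. norm (f p t)) \<le> 2 * (2 + pi / (2 * y)) * gauss_majorant p" for p
    using gauss_term_integral(2)[of p] by (simp add: f_def set_lebesgue_integral_def indicator_def if_distrib cong: if_cong)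
  have s1: "(\<lambda>p. LBINT t. norm (f p t)) summable_on Lattice"
    by (rule summable_on_comparison_test[OF summable_on_cmult_right[OF gauss_majorant_summable] nle]) auto
  have s2: "(\<lambda>p. norm (f p t)) summable_on Lattice" for t
  proof (cases "t > y")
    case True
    have "(\<lambda>p. pi / (4 * t\<^sup>2) * norm (gauss_term z p t)) summable_on Lattice"
      using True by (intro summable_on_cmult_right sum_gauss_term_summable) auto
    thus ?thesis using True by (simp add: f_def norm_mult norm_divide norm_power)
  qed (simp add: f_def)
  have "(LBINT t. \<Sum>\<^sub>\<infinity>p\<in>Lattice. f p t) = (\<Sum>\<^sub>\<infinity>p\<in>Lattice. integral\<^sup>L lborel (f p))"
    by (rule integral_infsum_swap[OF countableI_type infinite_Lattice int s1 s2])
  moreover have "(\<Sum>\<^sub>\<infinity>p\<in>Lattice. f p t) = indicator {y<..} t *\<^sub>R (of_real (pi / (4 * t\<^sup>2)) * (\<Sum>\<^sub>\<infinity>p\<in>Lattice. gauss_term z p t))" for t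
    unfolding f_def scaleR_conv_of_real by (simp only: infsum_cmult_right')
  ultimately show ?thesis by (simp add: f_def set_lebesgue_integral_def)
qed

text \<open>The substitution \<open>l = n + k\<close> after Poisson summation over \<open>m\<close> makes the double series
  symmetric up to the sign \<open>(-1)\<^sup>l\<close>, so that the terms with \<open>l - n\<close> odd cancel.\<close>

definition row_term :: "real \<Rightarrow> int \<times> int \<Rightarrow> complex" where
  "row_term t p = ee (of_int (snd p) / 2) * ee (of_int (fst p * snd p) * z) * of_real (exp (- pi * (of_int (snd p - fst p))\<^sup>2 * t))"

lemma row_term_summable:
  assumes t: "t \<ge> y"
  shows "(\<lambda>p. norm (row_term t p)) summable_on UNIV"
proof -
  have "(\<lambda>(n::int, l::int). exp (- (pi * y) * (of_int n)\<^sup>2) * exp (- (pi * y) * (of_int l)\<^sup>2)) summable_on UNIV \<times> UNIV"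
    using y(2) by (intro summable_on_times_nonneg summable_on_gaussian) auto
  hence "(\<lambda>p::int \<times> int. exp (- (pi * y) * (of_int (fst p))\<^sup>2) * exp (- (pi * y) * (of_int (snd p))\<^sup>2)) summable_on UNIV"
    by (simp add: case_prod_unfold)
  thus ?thesis
  proof (rule summable_on_norm_comparison(1))
    fix p :: "int \<times> int"
    define n l where "n = (of_int (fst p) :: real)" and "l = (of_int (snd p) :: real)"
    have "norm (row_term t p) = exp (- 2 * pi * (n * l * y)) * exp (- pi * (l - n)\<^sup>2 * t)"
      by (simp add: row_term_def norm_mult norm_ee n_def l_def y(1))
    also have "\<dots> = exp (- 2 * pi * (n * l * y) + - pi * (l - n)\<^sup>2 * t)" by (rule exp_add[symmetric])
    also have "\<dots> \<le> exp (- 2 * pi * (n * l * y) + - pi * (l - n)\<^sup>2 * y)"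
      using t by (simp add: mult_left_mono)
    \<comment> \<open>With \<open>y\<close> in place of \<open>t\<close> the mixed terms cancel,
      leaving a product of two Gaussians.\<close>
    also have "- 2 * pi * (n * l * y) + - pi * (l - n)\<^sup>2 * y = - (pi * y) * n\<^sup>2 + - (pi * y) * l\<^sup>2"
      by (simp add: power2_eq_square algebra_simps)
    finally show "norm (row_term t p) \<le> exp (- (pi * y) * (of_int (fst p))\<^sup>2) * exp (- (pi * y) * (of_int (snd p))\<^sup>2)"
      by (simp only: exp_add n_def l_def)
  qed
qed

lemma row_poisson:
  assumes t: "t > 0"
  shows "(\<Sum>\<^sub>\<infinity>m\<in>{m. odd m}. gauss_term z (n, m) t) = of_real (sqrt t) * (\<Sum>\<^sub>\<infinity>l. row_term t (n, l))"
proof -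
  \<comment> \<open>For the odd number 2j + 1 the lattice point is 2 (v + j), so Poisson summation
    over j applies with parameter 1/t and shift \<open>v\<close>.\<close>
  define v where "v = of_int n * z + 1/2"
  have odd_bij: "bij_betw (\<lambda>j::int. 2 * j + 1) UNIV {m. odd m}"
    by (rule bij_betw_byWitness[where f' = "\<lambda>m. (m - 1) div 2"]) auto
  have E: "gauss_term z (n, 2 * j + 1) t = ee (of_int n * v) * exp (- of_real (pi * (1 / t)) * (v + of_int j)\<^sup>2)" for j
  proof -
    have l: "lattice_pt z (n, 2 * j + 1) = 2 * (v + of_int j)" by (simp add: lattice_pt_def v_def)
    have "gauss_term z (n, 2 * j + 1) t = exp (- of_real (pi * (1 / t)) * (v + of_int j)\<^sup>2) * exp (2 * of_real pi * \<i> * (of_int n * (v + of_int j)))"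
    proof -
      have "- of_real pi * (2 * x)\<^sup>2 / of_real (4 * t) + of_real pi * \<i> * of_int n * (2 * x) =
         - of_real (pi * (1 / t)) * x\<^sup>2 + 2 * of_real pi * \<i> * (of_int n * x)" for x :: complex
        using t by (simp add: power_mult_distrib)
      thus ?thesis unfolding gauss_term_def l by (simp only: fst_conv exp_add)
    qed
    also have "exp (2 * of_real pi * \<i> * (of_int n * (v + of_int j))) = ee (of_int n * v) * ee (of_int (n * j))"
      unfolding ee_add[symmetric] by (simp add: ee_def ring_distribs)
    finally show ?thesis by (simp del: of_int_mult)
  qed
  have "(\<Sum>\<^sub>\<infinity>m\<in>{m. odd m}. gauss_term z (n, m) t) = (\<Sum>\<^sub>\<infinity>j. gauss_term z (n, 2 * j + 1) t)"
    by (rule infsum_reindex_bij_betw[OF odd_bij, symmetric])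
  also have "\<dots> = ee (of_int n * v) * (\<Sum>\<^sub>\<infinity>j::int. exp (- of_real (pi * (1 / t)) * (v + of_int j)\<^sup>2))"
    unfolding E by (rule infsum_cmult_right')
  also have "(\<Sum>\<^sub>\<infinity>j::int. exp (- of_real (pi * (1 / t)) * (v + of_int j)\<^sup>2)) =
     of_real (sqrt t) * (\<Sum>\<^sub>\<infinity>k::int. of_real (exp (- pi * (of_int k)\<^sup>2 * t)) * ee (of_int k * v))"
    using poisson_gaussian[of "1 / t" v] t by (simp add: real_sqrt_divide)
  also have "ee (of_int n * v) * (of_real (sqrt t) * (\<Sum>\<^sub>\<infinity>k::int. of_real (exp (- pi * (of_int k)\<^sup>2 * t)) * ee (of_int k * v))) =
     of_real (sqrt t) * (\<Sum>\<^sub>\<infinity>k::int. ee (of_int n * v) * (of_real (exp (- pi * (of_int k)\<^sup>2 * t)) * ee (of_int k * v)))"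
    by (simp only: infsum_cmult_right' mult.left_commute)
  also have "(\<Sum>\<^sub>\<infinity>k::int. ee (of_int n * v) * (of_real (exp (- pi * (of_int k)\<^sup>2 * t)) * ee (of_int k * v))) =
     (\<Sum>\<^sub>\<infinity>k. row_term t (n, n + k))"
  proof (rule infsum_cong)
    fix k :: int
    have "ee (of_int n * v) * ee (of_int k * v) = ee (of_int (n + k) / 2) * ee (of_int (n * (n + k)) * z)"
      unfolding ee_add[symmetric] v_def by (simp add: algebra_simps add_divide_distrib)
    thus "ee (of_int n * v) * (of_real (exp (- pi * (of_int k)\<^sup>2 * t)) * ee (of_int k * v)) = row_term t (n, n + k)"
      by (simp add: row_term_def mult_ac)
  qed
  also have "(\<Sum>\<^sub>\<infinity>k. row_term t (n, n + k)) = (\<Sum>\<^sub>\<infinity>l. row_term t (n, l))"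
    by (rule infsum_reindex_bij_betw[where g = "\<lambda>k. n + k"], rule bij_betw_byWitness[where f' = "\<lambda>l. l - n"]) auto
  finally show ?thesis .
qed

lemma sum_gauss_term:
  assumes t: "t \<ge> y"
  shows "(\<Sum>\<^sub>\<infinity>p\<in>Lattice. gauss_term z p t) = of_real (sqrt t) * (theta4 z * theta4 (- z + 2 * \<i> * of_real t))"
proof -
  have t0: "t > 0" using t y(2) by simp
  have sE: "(\<lambda>p. gauss_term z p t) summable_on Lattice" using sum_gauss_term_summable[OF t] by (rule abs_summable_summable)
  have sF: "row_term t summable_on UNIV" using row_term_summable[OF t] by (rule abs_summable_summable)
  have "(\<Sum>\<^sub>\<infinity>p\<in>Lattice. gauss_term z p t) = (\<Sum>\<^sub>\<infinity>n. \<Sum>\<^sub>\<infinity>m\<in>{m. odd m}. gauss_term z (n, m) t)"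
    by (rule infsum_Sigma_banach[OF sE, symmetric])
  also have "\<dots> = of_real (sqrt t) * (\<Sum>\<^sub>\<infinity>n. \<Sum>\<^sub>\<infinity>l. row_term t (n, l))"
    unfolding row_poisson[OF t0] by (rule infsum_cmult_right')
  also have "(\<Sum>\<^sub>\<infinity>n. \<Sum>\<^sub>\<infinity>l. row_term t (n, l)) = infsum (row_term t) UNIV"
    using infsum_Sigma_banach[of "row_term t" UNIV "\<lambda>_. UNIV"] sF by simp
  also have "\<dots> = infsum (row_term t) {p. even (snd p - fst p)} + infsum (row_term t) {p. odd (snd p - fst p)}"
  proof -
    have "(UNIV :: (int \<times> int) set) = {p. even (snd p - fst p)} \<union> {p. odd (snd p - fst p)}" by auto
    thus ?thesis by (metis (no_types, lifting) infsum_Un_disjoint sF summable_on_subset_banach subset_UNIV disjoint_iff mem_Collect_eq)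
  qed
  also have "infsum (row_term t) {p. odd (snd p - fst p)} = 0"
  proof -
    have b: "bij_betw prod.swap {p :: int \<times> int. odd (snd p - fst p)} {p. odd (snd p - fst p)}"
      by (rule bij_betw_byWitness[where f' = prod.swap]) auto
    have "infsum (row_term t) {p. odd (snd p - fst p)} = infsum (\<lambda>p. row_term t (prod.swap p)) {p. odd (snd p - fst p)}"
      by (rule infsum_reindex_bij_betw[OF b, symmetric])
    also have "\<dots> = infsum (\<lambda>p. - row_term t p) {p. odd (snd p - fst p)}"
    proof (rule infsum_cong)
      fix p :: "int \<times> int" assume "p \<in> {p. odd (snd p - fst p)}"
      hence "ee (of_int (fst p) / 2) = - ee (of_int (snd p) / 2)" unfolding ee_half_int by auto
      moreover have "(real_of_int (fst p - snd p))\<^sup>2 = (real_of_int (snd p - fst p))\<^sup>2"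
        by (simp add: power2_commute)
      ultimately show "row_term t (prod.swap p) = - row_term t p" by (simp add: row_term_def mult_ac)
    qed
    also have "\<dots> = - infsum (row_term t) {p. odd (snd p - fst p)}" by (rule infsum_uminus)
    finally show ?thesis by simp
  qed
  also have "infsum (row_term t) {p. even (snd p - fst p)} = theta4 z * theta4 (- z + 2 * \<i> * of_real t)"
  proof -
    let ?w = "- z + 2 * \<i> * of_real t"
    have w: "Im ?w > 0" using t y by simp
    \<comment> \<open>Pairs of equal parity are n = a - j, l = a + j. Then n l = a^2 - j^2 and l - n
      = 2j, so the exponent separates: a^2 multiplies z, and j^2 multiplies -z + 2it.\<close>
    have b: "bij_betw (\<lambda>(a, j). (a - j, a + j)) (UNIV :: (int \<times> int) set) {p. even (snd p - fst p)}"
      by (rule bij_betw_byWitness[where f' = "\<lambda>(n, l). (n + (l - n) div 2, (l - n) div 2)"]) auto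
    have F: "row_term t (a - j, a + j) = (ee (of_int a / 2) * ee (of_int (a\<^sup>2) * z)) * (ee (of_int j / 2) * ee (of_int (j\<^sup>2) * ?w))" for a j
    proof -
      have "of_real (exp (- pi * (of_int ((a + j) - (a - j)))\<^sup>2 * t)) = ee (of_int (j\<^sup>2) * (2 * \<i> * of_real t))"
        by (simp add: ee_def exp_of_real[symmetric] power_mult_distrib mult_ac)
      hence "row_term t (a - j, a + j) = ee (of_int (a + j) / 2 + of_int ((a - j) * (a + j)) * z + of_int (j\<^sup>2) * (2 * \<i> * of_real t))"
        by (simp only: row_term_def ee_add fst_conv snd_conv)
      also have "of_int (a + j) / 2 + of_int ((a - j) * (a + j)) * z + of_int (j\<^sup>2) * (2 * \<i> * of_real t) =
         (of_int a / 2 + of_int (a\<^sup>2) * z) + (of_int j / 2 + of_int (j\<^sup>2) * ?w)"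
        by (simp add: algebra_simps add_divide_distrib power2_eq_square)
      finally show ?thesis by (simp only: ee_add)
    qed
    have "infsum (row_term t) {p. even (snd p - fst p)} = (\<Sum>\<^sub>\<infinity>p. row_term t (case p of (a, j) \<Rightarrow> (a - j, a + j)))"
      by (rule infsum_reindex_bij_betw[OF b, symmetric])
    also have "\<dots> = (\<Sum>\<^sub>\<infinity>(a, j)\<in>UNIV \<times> UNIV. (ee (of_int a / 2) * ee (of_int (a\<^sup>2) * z)) * (ee (of_int j / 2) * ee (of_int (j\<^sup>2) * ?w)))"
      unfolding UNIV_Times_UNIV by (rule infsum_cong) (auto simp only: F split: prod.splits)
    also have "\<dots> = (\<Sum>\<^sub>\<infinity>a. \<Sum>\<^sub>\<infinity>j. (ee (of_int a / 2) * ee (of_int (a\<^sup>2) * z)) * (ee (of_int j / 2) * ee (of_int (j\<^sup>2) * ?w)))"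
    proof (rule infsum_Sigma'_banach[symmetric])
      have "(\<lambda>(a, j). norm (ee (of_int a / 2) * ee (of_int (a\<^sup>2) * z)) * norm (ee (of_int j / 2) * ee (of_int (j\<^sup>2) * ?w))) summable_on UNIV \<times> UNIV"
        using y w by (intro summable_on_times_nonneg theta4_summable_norm) auto
      thus "(\<lambda>(a, j). (ee (of_int a / 2) * ee (of_int (a\<^sup>2) * z)) * (ee (of_int j / 2) * ee (of_int (j\<^sup>2) * ?w))) summable_on UNIV \<times> UNIV"
        by (rule summable_on_norm_comparison(2)) (auto simp: norm_mult)
    qed
    also have "\<dots> = theta4 z * theta4 ?w"
      unfolding theta4_series by (simp only: infsum_cmult_right' infsum_cmult_left')
    finally show ?thesis .
  qed
  finally show ?thesis by simp
qed

end

section \<open>The divisor-sum identity for the Eisenstein term\<close>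

context
  fixes q :: complex
  assumes q: "norm q < 1"
begin

text \<open>Comparison with a product of two one-variable series, by (a - 1) + (b - 1) \<le> a b and
  a + b \<le> 2 a b for positive a and b.\<close>

lemma summable_on_ab_power:
  fixes c :: "nat \<times> nat \<Rightarrow> complex"
  assumes "X \<subseteq> {1..} \<times> {1..}"
    "\<And>a b. (a, b) \<in> X \<Longrightarrow> norm (c (a, b)) \<le> K * real (a + b)"
    "\<And>a b. (a, b) \<in> X \<Longrightarrow> a * b \<le> e (a, b)" "K \<ge> 0"
  shows "(\<lambda>p. c p * q ^ e p) summable_on X"
proof -
  define g where "g n = real n * norm q ^ (n - 1)" for n
  have "summable (\<lambda>n. real (Suc n) * norm q ^ n)"
    using geometric_deriv_sums[of "norm q"] q by (auto simp: sums_iff)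
  hence "(\<lambda>n. g (Suc n)) summable_on UNIV" 
    by (intro summable_nonneg_imp_summable_on) (simp_all add: g_def)
  hence "g summable_on range Suc" by (subst summable_on_reindex) (auto simp: o_def)
  moreover have "range Suc = {1..}" using Suc_le_D by (force simp: image_iff)
  ultimately have g: "g summable_on {1..}" by simp
  have "(\<lambda>(a, b). g a * g b) summable_on {1..} \<times> {1..}"
    by (intro summable_on_times_nonneg g) (auto simp: g_def)
  hence "(\<lambda>p. 2 * K * (case p of (a, b) \<Rightarrow> g a * g b)) summable_on {1..} \<times> {1..}"
    by (intro summable_on_cmult_right)
  hence "(\<lambda>p. 2 * K * (case p of (a, b) \<Rightarrow> g a * g b)) summable_on X"
    using assms(1) by (rule summable_on_subset_banach)
  thus ?thesis
  proof (rule summable_on_norm_comparison(2))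
    fix p assume p: "p \<in> X"
    obtain a b where ab: "p = (a, b)" by (cases p)
    have a1: "a \<ge> 1" "b \<ge> 1" using p ab assms(1) by auto
    obtain i j where ij: "a = Suc i" "b = Suc j" using a1 by (metis One_nat_def Suc_le_D)
    have "(a - 1) + (b - 1) \<le> a * b" by (simp add: ij)
    also have "\<dots> \<le> e (a, b)" using assms(3) p ab by simp
    finally have "norm q ^ e (a, b) \<le> norm q ^ ((a - 1) + (b - 1))"
      using q by (intro power_decreasing) auto
    moreover have "real (a + b) \<le> 2 * (real a * real b)"
      by (simp add: ij algebra_simps)
    hence "K * real (a + b) \<le> K * (2 * (real a * real b))"
      using assms(4) by (rule mult_left_mono)
    hence "norm (c (a, b)) \<le> 2 * K * (real a * real b)" using assms(2)[of a b] p ab by simp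
    ultimately have "norm (c (a, b)) * norm q ^ e (a, b) \<le> 2 * K * (real a * real b) * norm q ^ ((a - 1) + (b - 1))"
      using assms(4) by (intro mult_mono) auto
    thus "norm (c p * q ^ e p) \<le> 2 * K * (case p of (a, b) \<Rightarrow> g a * g b)"
      by (simp add: ab norm_mult norm_power g_def power_add mult_ac)
  qed
qed

end

text \<open>Subtracting the series at -x from the series at x doubles the odd terms and removes the
  even ones, which turns the first formula into the second.\<close>

lemma has_sum_powser_odd:
  fixes x :: complex
  assumes "norm x < 1"
  shows "((\<lambda>j. of_nat j * x ^ j) has_sum (x / (1 - x)\<^sup>2)) {1..}"
    and "((\<lambda>j. of_nat (2 * j) * x ^ j) has_sum (x / (1 - x)\<^sup>2 + x / (1 + x)\<^sup>2)) {j. odd j}"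
proof -
  have main: "((\<lambda>j. of_nat j * y ^ j) has_sum (y / (1 - y)\<^sup>2)) UNIV" if y: "norm y < 1" for y :: complex
  proof -
    have "(\<lambda>n. y * (of_nat (Suc n) * y ^ n)) sums (y * (1 / (1 - y)\<^sup>2))"
      using geometric_deriv_sums[OF y] by (intro sums_mult)
    hence "(\<lambda>n. of_nat (Suc n) * y ^ Suc n) sums (y / (1 - y)\<^sup>2)" by (simp add: mult_ac)
    hence s: "(\<lambda>n. of_nat n * y ^ n) sums (y / (1 - y)\<^sup>2)" by (subst (asm) sums_Suc_iff) simp
    have "summable (\<lambda>n. real (Suc n) * norm y ^ n)"
      using geometric_deriv_sums[of "norm y"] y by (auto simp: sums_iff)
    hence "summable (\<lambda>n. norm y * (real (Suc n) * norm y ^ n))" by (rule summable_mult)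
    hence "summable (\<lambda>n. norm (of_nat (Suc n) * y ^ Suc n))"
      by (simp add: norm_mult norm_power mult_ac del: of_nat_Suc)
    hence "summable (\<lambda>n. norm (of_nat n * y ^ n))" by (subst (asm) summable_Suc_iff)
    thus ?thesis using s by (rule norm_summable_imp_has_sum)
  qed
  show "((\<lambda>j. of_nat j * x ^ j) has_sum (x / (1 - x)\<^sup>2)) {1..}"
    using main[OF assms] by (subst has_sum_cong_neutral[where T = UNIV and g = "\<lambda>j. of_nat j * x ^ j"]) (auto simp: not_le)
  have "((\<lambda>j. of_nat j * x ^ j - of_nat j * (- x) ^ j) has_sum (x / (1 - x)\<^sup>2 - (- x) / (1 - (- x))\<^sup>2)) UNIV"
    using has_sum_add[OF main[OF assms] has_sum_cmult_right[OF main[of "- x"], of "- 1"]] assms by simp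
  hence "((\<lambda>j. of_nat j * x ^ j - of_nat j * (- x) ^ j) has_sum (x / (1 - x)\<^sup>2 + x / (1 + x)\<^sup>2)) UNIV" by simp
  moreover have "((\<lambda>j. of_nat j * x ^ j - of_nat j * (- x) ^ j) has_sum v) UNIV \<longleftrightarrow>
     ((\<lambda>j. of_nat (2 * j) * x ^ j) has_sum v) {j. odd j}" for v
    by (rule has_sum_cong_neutral) (auto simp: power_minus_even power_minus_odd algebra_simps)
  ultimately show "((\<lambda>j. of_nat (2 * j) * x ^ j) has_sum (x / (1 - x)\<^sup>2 + x / (1 + x)\<^sup>2)) {j. odd j}" by simp
qed

text \<open>Over all positive a and b, symmetry of the exponent turns 2b - 4a into -2a. The terms
  with b = 2b' have the coefficient 4(b' - a), antisymmetric against the symmetric exponent 2ab',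
  and contribute nothing.\<close>

lemma infsum_double_divisor_odd:
  fixes Q :: complex
  assumes Q: "norm Q < 1"
  shows "(\<Sum>\<^sub>\<infinity>(a, b)\<in>{1..} \<times> {b. odd b}. (2 * of_nat b - 4 * of_nat a) * Q ^ (a * b)) =
         - 2 * (\<Sum>\<^sub>\<infinity>(a, b)\<in>{1..} \<times> {1..}. of_nat a * Q ^ (a * b))"
proof -
  let ?N = "{1..} :: nat set"
  have sub: "?N \<times> {b. odd b \<and> b \<ge> 1} \<subseteq> ?N \<times> ?N" "?N \<times> {b. even b \<and> b \<ge> 1} \<subseteq> ?N \<times> ?N" by auto
  define h where "h = (\<lambda>(a::nat, b::nat). (2 * of_nat b - 4 * of_nat a) * Q ^ (a * b))"
  define s where "s = (\<lambda>(a::nat, b::nat). of_nat a * Q ^ (a * b))"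
  define s' where "s' = (\<lambda>(a::nat, b::nat). of_nat b * Q ^ (a * b))"
  have bnd: "norm (2 * of_nat b - 4 * of_nat a :: complex) \<le> 4 * real (a + b)" for a b :: nat
    by (rule order_trans[OF norm_triangle_ineq4]) (simp add: norm_mult)
  have "(\<lambda>p. (case p of (a, b) \<Rightarrow> 2 * of_nat b - 4 * of_nat a) * Q ^ (case p of (a, b) \<Rightarrow> a * b)) summable_on ?N \<times> ?N"
    by (rule summable_on_ab_power[OF Q, where K = 4]) (use bnd in auto)
  hence sh: "h summable_on ?N \<times> ?N" by (simp add: h_def case_prod_unfold)
  have "(\<lambda>p. (case p of (a, b) \<Rightarrow> of_nat a) * Q ^ (case p of (a, b) \<Rightarrow> a * b)) summable_on ?N \<times> ?N"
    by (rule summable_on_ab_power[OF Q, where K = 1]) auto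
  hence ss: "s summable_on ?N \<times> ?N" by (simp add: s_def case_prod_unfold)
  have swap: "bij_betw prod.swap (?N \<times> ?N) (?N \<times> ?N)"
    by (rule bij_betw_byWitness[where f' = prod.swap]) auto
  have s's: "s' p = s (prod.swap p)" for p by (simp add: s_def s'_def case_prod_unfold mult_ac)
  have ss': "s' summable_on ?N \<times> ?N" "infsum s' (?N \<times> ?N) = infsum s (?N \<times> ?N)"
    unfolding s's using summable_on_reindex_bij_betw[OF swap, of s] ss infsum_reindex_bij_betw[OF swap, of s] by simp_all
  have "infsum h (?N \<times> ?N) = infsum (\<lambda>p. 2 * s' p + (- 4) * s p) (?N \<times> ?N)"
    by (rule infsum_cong) (simp add: h_def s_def s'_def case_prod_unfold algebra_simps)
  also have "\<dots> = infsum (\<lambda>p. 2 * s' p) (?N \<times> ?N) + infsum (\<lambda>p. (- 4) * s p) (?N \<times> ?N)"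
    by (intro infsum_add summable_on_cmult_right ss ss')
  also have "\<dots> = - 2 * infsum s (?N \<times> ?N)"
    unfolding infsum_cmult_right' ss'(2) by simp
  finally have all: "infsum h (?N \<times> ?N) = - 2 * infsum s (?N \<times> ?N)" .
  have even0: "infsum h (?N \<times> {b. even b \<and> b \<ge> 1}) = 0"
  proof -
    have "bij_betw (\<lambda>(a, b). (a, 2 * b)) (?N \<times> ?N) (?N \<times> {b. even b \<and> b \<ge> 1})"
      by (rule bij_betw_byWitness[where f' = "\<lambda>(a, b). (a, b div 2)"]) (auto elim!: evenE)
    from infsum_reindex_bij_betw[OF this, of h]
    have 1: "infsum h (?N \<times> {b. even b \<and> b \<ge> 1}) = infsum (\<lambda>(a, b). h (a, 2 * b)) (?N \<times> ?N)"
      by (simp add: case_prod_unfold)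
    have "infsum (\<lambda>(a, b). h (a, 2 * b)) (?N \<times> ?N) = infsum (\<lambda>p. (\<lambda>(a, b). h (a, 2 * b)) (prod.swap p)) (?N \<times> ?N)"
      by (rule infsum_reindex_bij_betw[OF swap, symmetric])
    also have "\<dots> = infsum (\<lambda>p. - (\<lambda>(a, b). h (a, 2 * b)) p) (?N \<times> ?N)"
      by (rule infsum_cong) (simp add: h_def case_prod_unfold algebra_simps)
    also have "\<dots> = - infsum (\<lambda>(a, b). h (a, 2 * b)) (?N \<times> ?N)"
      by (rule infsum_uminus)
    finally show ?thesis using 1 by simp
  qed
  have "?N \<times> ?N = ?N \<times> {b. odd b \<and> b \<ge> 1} \<union> ?N \<times> {b. even b \<and> b \<ge> 1}" by auto
  hence "infsum h (?N \<times> ?N) = infsum h (?N \<times> {b. odd b \<and> b \<ge> 1} \<union> ?N \<times> {b. even b \<and> b \<ge> 1})" by simp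
  also have "\<dots> = infsum h (?N \<times> {b. odd b \<and> b \<ge> 1}) + infsum h (?N \<times> {b. even b \<and> b \<ge> 1})"
    by (intro infsum_Un_disjoint summable_on_subset_banach[OF sh] sub) auto
  finally have "infsum h (?N \<times> {b. odd b \<and> b \<ge> 1}) = - 2 * infsum s (?N \<times> ?N)"
    using all even0 by simp
  moreover have "{b::nat. odd b \<and> b \<ge> 1} = {b. odd b}" using odd_pos by force
  ultimately show ?thesis by (simp add: h_def s_def)
qed

text \<open>Expand both fractions into \<open>\<Sum> 2j q\<^sup>n\<^sup>j\<close> over odd \<open>j\<close>. The exponent \<open>n(n + j)\<close> is then \<open>2ab\<close> with \<open>b\<close> odd,
  where \<open>{n, n + j} = {2a, b}\<close>, and \<open>(-1)\<^sup>n 2j = 2b - 4a\<close> for either order.\<close>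

theorem theta_divisor_identity:
  fixes q :: complex
  assumes q: "norm q < 1"
  shows "(\<Sum>\<^sub>\<infinity>n\<in>{1..}. (-1) ^ n * q ^ n\<^sup>2 * (q ^ n / (1 - q ^ n)\<^sup>2 + q ^ n / (1 + q ^ n)\<^sup>2)) =
         - 2 * (\<Sum>\<^sub>\<infinity>n\<in>{1..}. of_nat n * (q\<^sup>2) ^ n / (1 - (q\<^sup>2) ^ n))"
proof -
  let ?N = "{1..} :: nat set"
  let ?O = "{j::nat. odd j}"
  have nq: "norm (q ^ n) < 1" if "n \<ge> 1" for n
    using q that power_decreasing[of 1 n "norm q"] by (simp add: norm_power)
  have nq2: "norm (q\<^sup>2) < 1" using nq[of 2] by simp
  have Opos: "j \<ge> 1" if "odd j" for j :: nat using that odd_pos by force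
  have "(\<Sum>\<^sub>\<infinity>n\<in>?N. (-1) ^ n * q ^ n\<^sup>2 * (q ^ n / (1 - q ^ n)\<^sup>2 + q ^ n / (1 + q ^ n)\<^sup>2)) =
    (\<Sum>\<^sub>\<infinity>n\<in>?N. \<Sum>\<^sub>\<infinity>j\<in>?O. (-1) ^ n * q ^ n\<^sup>2 * (of_nat (2 * j) * (q ^ n) ^ j))"
    by (intro infsum_cong) (simp only: infsum_cmult_right' infsumI[OF has_sum_powser_odd(2)[OF nq]] atLeast_iff)
  also have "\<dots> = (\<Sum>\<^sub>\<infinity>(n, j)\<in>?N \<times> ?O. (-1) ^ n * q ^ n\<^sup>2 * (of_nat (2 * j) * (q ^ n) ^ j))"
  proof (rule infsum_Sigma'_banach)
    have "(\<lambda>p. (case p of (n, j) \<Rightarrow> (-1) ^ n * of_nat (2 * j)) * q ^ (case p of (n, j) \<Rightarrow> n\<^sup>2 + n * j)) summable_on ?N \<times> ?O"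
      by (rule summable_on_ab_power[OF q, where K = 2]) (auto simp: norm_mult norm_power Suc_le_eq odd_pos)
    thus "(\<lambda>(n, j). (-1) ^ n * q ^ n\<^sup>2 * (of_nat (2 * j) * (q ^ n) ^ j)) summable_on ?N \<times> ?O"
      by (simp add: case_prod_unfold power_add power_mult mult_ac)
  qed
  also have "\<dots> = (\<Sum>\<^sub>\<infinity>(a, b)\<in>?N \<times> ?O. (2 * of_nat b - 4 * of_nat a) * (q\<^sup>2) ^ (a * b))"
  proof -
    define \<phi> where "\<phi> = (\<lambda>(n::nat, j::nat). if even n then (n div 2, n + j) else ((n + j) div 2, n))"
    \<comment> \<open>For the inverse: 2a is even and b is odd, so they differ, the smaller one is n
      and the larger one n + j.\<close>
    have bij: "bij_betw \<phi> (?N \<times> ?O) (?N \<times> ?O)"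
    proof (rule bij_betw_byWitness[where f' = "\<lambda>(a, b). if 2 * a < b then (2 * a, b - 2 * a) else (b, 2 * a - b)"])
      show "\<forall>p\<in>?N \<times> ?O. (case \<phi> p of (a, b) \<Rightarrow> if 2 * a < b then (2 * a, b - 2 * a) else (b, 2 * a - b)) = p"
        by (auto simp: \<phi>_def dest: odd_pos)
      show "\<forall>p\<in>?N \<times> ?O. \<phi> (case p of (a, b) \<Rightarrow> if 2 * a < b then (2 * a, b - 2 * a) else (b, 2 * a - b)) = p"
        by (auto simp: \<phi>_def)
      show "\<phi> ` (?N \<times> ?O) \<subseteq> ?N \<times> ?O"
      proof
        fix p assume "p \<in> \<phi> ` (?N \<times> ?O)"
        then obtain n j where p: "p = \<phi> (n, j)" "n \<ge> 1" "odd j" by auto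
        show "p \<in> ?N \<times> ?O"
        proof (cases "even n")
          case True
          hence "n \<ge> 2" using p(2) by (cases "n = 1") auto
          thus ?thesis using p True by (simp add: \<phi>_def)
        next
          case False
          have "n + j \<ge> 2" using p Opos[of j] by simp
          thus ?thesis using p False by (simp add: \<phi>_def)
        qed
      qed
      show "(\<lambda>(a, b). if 2 * a < b then (2 * a, b - 2 * a) else (b, 2 * a - b)) ` (?N \<times> ?O) \<subseteq> ?N \<times> ?O"
        by (auto simp: Suc_le_eq odd_pos split: if_splits)
    qed
    have "(case \<phi> p of (a, b) \<Rightarrow> (2 * of_nat b - 4 * of_nat a) * (q\<^sup>2) ^ (a * b)) =
        (case p of (n, j) \<Rightarrow> (-1) ^ n * q ^ n\<^sup>2 * (of_nat (2 * j) * (q ^ n) ^ j))" if pin: "p \<in> ?N \<times> ?O" for p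
    proof -
      obtain n j where p: "p = (n, j)" "odd j" using pin by auto
      show ?thesis
      proof (cases "even n")
        case True
        then obtain m where m: "n = 2 * m" by (elim evenE)
        have "(q\<^sup>2) ^ (m * (2 * m + j)) = q ^ n\<^sup>2 * (q ^ n) ^ j"
        proof -
          have "2 * (m * (2 * m + j)) = n\<^sup>2 + n * j" by (simp add: m power2_eq_square algebra_simps)
          thus ?thesis by (simp flip: power_mult power_add)
        qed
        thus ?thesis by (simp add: p m \<phi>_def algebra_simps)
      next
        case False
        then obtain m where m: "n + j = 2 * m" using p(2) by (metis evenE odd_even_add)
        hence cj: "of_nat j = 2 * of_nat m - (of_nat n :: complex)"
          by (metis add_diff_cancel_left' of_nat_add of_nat_mult of_nat_numeral)
        have "n\<^sup>2 + n * j = n * (n + j)" by (simp add: power2_eq_square distrib_left)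
        hence "2 * (m * n) = n\<^sup>2 + n * j" using m by simp
        hence "(q\<^sup>2) ^ (m * n) = q ^ n\<^sup>2 * (q ^ n) ^ j"
          by (simp flip: power_mult power_add)
        moreover have "(n + j) div 2 = m" using m by simp
        ultimately show ?thesis using False by (simp add: p \<phi>_def cj algebra_simps)
      qed
    qed
    hence "(\<Sum>\<^sub>\<infinity>(n, j)\<in>?N \<times> ?O. (-1) ^ n * q ^ n\<^sup>2 * (of_nat (2 * j) * (q ^ n) ^ j)) =
      (\<Sum>\<^sub>\<infinity>p\<in>?N \<times> ?O. (case \<phi> p of (a, b) \<Rightarrow> (2 * of_nat b - 4 * of_nat a) * (q\<^sup>2) ^ (a * b)))"
      by (intro infsum_cong) simp
    also have "\<dots> = (\<Sum>\<^sub>\<infinity>(a, b)\<in>?N \<times> ?O. (2 * of_nat b - 4 * of_nat a) * (q\<^sup>2) ^ (a * b))"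
      by (rule infsum_reindex_bij_betw[OF bij])
    finally show ?thesis .
  qed
  also have "\<dots> = - 2 * (\<Sum>\<^sub>\<infinity>(a, b)\<in>?N \<times> ?N. of_nat a * (q\<^sup>2) ^ (a * b))"
    by (rule infsum_double_divisor_odd[OF nq2])
  also have "(\<Sum>\<^sub>\<infinity>(a, b)\<in>?N \<times> ?N. of_nat a * (q\<^sup>2) ^ (a * b)) =
      (\<Sum>\<^sub>\<infinity>a\<in>?N. \<Sum>\<^sub>\<infinity>b\<in>?N. of_nat a * (q\<^sup>2) ^ (a * b))"
  proof (rule infsum_Sigma'_banach[symmetric])
    have "(\<lambda>p. (case p of (a, b) \<Rightarrow> of_nat a) * (q\<^sup>2) ^ (case p of (a, b) \<Rightarrow> a * b)) summable_on ?N \<times> ?N"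
      by (rule summable_on_ab_power[OF nq2, where K = 1]) auto
    thus "(\<lambda>(a, b). of_nat a * (q\<^sup>2) ^ (a * b)) summable_on ?N \<times> ?N" by (simp add: case_prod_unfold)
  qed
  also have "\<dots> = (\<Sum>\<^sub>\<infinity>a\<in>?N. of_nat a * (q\<^sup>2) ^ a / (1 - (q\<^sup>2) ^ a))"
  proof (rule infsum_cong)
    fix a assume "a \<in> ?N"
    hence y: "norm ((q\<^sup>2) ^ a) < 1" using nq[of "2 * a"] by (simp add: power_mult)
    define y where "y = (q\<^sup>2) ^ a"
    have "summable (\<lambda>n. norm (y * y ^ n))" unfolding norm_mult norm_power
      using y by (intro summable_mult summable_geometric) (simp add: y_def)
    moreover have "(\<lambda>n. y * y ^ n) sums (y * (1 / (1 - y)))" using y by (intro sums_mult geometric_sums) (simp add: y_def)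
    ultimately have "((\<lambda>n. y * y ^ n) has_sum (y * (1 / (1 - y)))) UNIV" by (rule norm_summable_imp_has_sum)
    hence "((\<lambda>b. y ^ b) has_sum (y / (1 - y))) (range Suc)" by (subst has_sum_reindex) (auto simp: o_def)
    moreover have "range Suc = ?N" using Suc_le_D by (force simp: image_iff)
    ultimately have "(\<Sum>\<^sub>\<infinity>b\<in>?N. y ^ b) = y / (1 - y)" by (auto intro: infsumI)
    thus "(\<Sum>\<^sub>\<infinity>b\<in>?N. of_nat a * (q\<^sup>2) ^ (a * b)) = of_nat a * (q\<^sup>2) ^ a / (1 - (q\<^sup>2) ^ a)"
      by (simp add: y_def infsum_cmult_right' mult.assoc flip: power_mult)
  qed
  finally show ?thesis .
qed

section \<open>The lattice sum as a product with the theta series\<close>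

lemma nome_ee: "nome z = ee z" by (simp add: nome_def ee_def)

lemma norm_nome: "Im z > 0 \<Longrightarrow> norm (nome z) < 1" "nome z \<noteq> 0"
  by (simp_all add: nome_ee norm_ee)

lemma ee_of_nat_mult: "ee (of_nat n * z) = ee z ^ n"
  by (induction n) (simp_all add: ring_distribs ee_add)

lemma ee_powi: "ee z powi n = ee (of_int n * z)"
proof (cases "n \<ge> 0")
  case True
  then obtain k where "n = int k" by (elim nonneg_int_cases)
  thus ?thesis by (simp add: ee_of_nat_mult)
next
  case False
  then obtain k where "n = - int k" by (metis int_cases2 le_minus_iff neg_0_le_iff_le of_nat_0_le_iff)
  thus ?thesis using ee_minus[of "of_nat k * z"] by (simp add: ee_of_nat_mult power_int_minus)
qed

lemma infsum_atLeast_1: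
  fixes f :: "nat \<Rightarrow> 'a :: banach"
  shows "(\<Sum>\<^sub>\<infinity>n\<in>{1..}. f n) = (\<Sum>\<^sub>\<infinity>n. f (Suc n))" "f summable_on {1..} \<longleftrightarrow> (\<lambda>n. f (Suc n)) summable_on UNIV"
proof -
  have b: "bij_betw Suc UNIV {1..}" by (rule bij_betw_byWitness[where f' = "\<lambda>n. n - 1"]) auto
  show "(\<Sum>\<^sub>\<infinity>n\<in>{1..}. f n) = (\<Sum>\<^sub>\<infinity>n. f (Suc n))"
    by (rule infsum_reindex_bij_betw[OF b, symmetric])
  show "f summable_on {1..} \<longleftrightarrow> (\<lambda>n. f (Suc n)) summable_on UNIV"
    by (rule summable_on_reindex_bij_betw[OF b, symmetric])
qed

lemma theta4_product:
  assumes z: "Im z > 0"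
  shows "theta4 z = qpoch_inf (nome z) (nome z) / qpoch_inf (- nome z) (nome z)" "theta4 z \<noteq> 0"
proof -
  define q where "q = nome z"
  have q: "norm q < 1" using norm_nome z by (simp add: q_def)
  define f where "f = (\<lambda>n::int. ee (of_int n / 2) * ee (of_int (n\<^sup>2) * z))"
  have s: "f summable_on UNIV"
    unfolding f_def by (rule abs_summable_summable[OF theta4_summable_norm[OF z]])
  have fS: "f (int (Suc k)) = (-1) ^ Suc k * q ^ (Suc k)\<^sup>2" for k
  proof -
    have "ee (of_int ((int (Suc k))\<^sup>2) * z) = q ^ (Suc k)\<^sup>2"
      using ee_of_nat_mult[of "(Suc k)\<^sup>2" z] unfolding q_def nome_ee by (simp only: of_nat_power of_int_power of_int_of_nat_eq)
    moreover have "ee (of_int (int (Suc k)) / 2) = (-1) ^ Suc k"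
      unfolding ee_half_int by (simp add: minus_one_power_iff)
    ultimately show ?thesis by (simp only: f_def)
  qed
  have sS: "(\<lambda>k. f (int (Suc k))) summable_on UNIV" by (rule summable_on_int_nat(2)[OF s])
  have "theta4 z = infsum f UNIV" unfolding theta4_series f_def ..
  also have "\<dots> = f 0 + 2 * (\<Sum>\<^sub>\<infinity>n. f (int (Suc n)))"
  proof (rule infsum_int_even[OF s])
    show "f (- n) = f n" for n
      using ee_half_int[of n] ee_half_int[of "- n"] by (simp only: f_def even_minus power2_minus)
  qed
  also have "(\<Sum>\<^sub>\<infinity>n. f (int (Suc n))) = (\<Sum>n. f (int (Suc n)))" by (rule infsum_eq_suminf[OF sS])
  also have "2 * (\<Sum>n. f (int (Suc n))) = (\<Sum>n. 2 * f (int (Suc n)))"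
    using summable_on_imp_summable[OF sS] by (rule suminf_mult[symmetric])
  also have "\<dots> = (\<Sum>n. 2 * (-1) ^ Suc n * q ^ (Suc n)\<^sup>2)" unfolding fS by (simp only: mult.assoc)
  also have "\<dots> = qpoch_inf q q / qpoch_inf (-q) q - 1"
    using gauss_theta_product[OF q] by (simp only: sums_iff)
  finally show e: "theta4 z = qpoch_inf (nome z) (nome z) / qpoch_inf (- nome z) (nome z)"
    by (simp add: f_def q_def)
  show "theta4 z \<noteq> 0" unfolding e using qpoch_q(2)[OF q] qpoch_mq(2)[OF q] by (simp add: q_def)
qed

text \<open>The exponential prefactors cancel, and the product for q^2 is the product of those of 1
  - q^n and 1 + q^n; what remains is the quotient in \<open>theta4_product\<close>.\<close>

lemma eta_quotient:
  assumes z: "Im z > 0"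
  shows "(dedekind_eta z)\<^sup>2 / dedekind_eta (2 * z) = theta4 z"
proof -
  define q where "q = nome z"
  have q: "norm q < 1" using norm_nome z by (simp add: q_def)
  have pe: "(\<Prod>n. 1 - exp (2 * of_real pi * \<i> * of_nat (Suc n) * w)) = qpoch_inf (nome w) (nome w)" for w
  proof -
    have "exp (2 * of_real pi * \<i> * of_nat (Suc n) * w) = nome w * nome w ^ n" for n
      using ee_of_nat_mult[of "Suc n" w] by (simp add: nome_ee ee_def mult_ac del: of_nat_Suc)
    thus ?thesis by (simp add: qpoch_inf_def)
  qed
  have n2: "nome (2 * z) = q\<^sup>2"
    using ee_of_nat_mult[of 2 z] by (simp add: nome_ee q_def)
  have q2: "norm (q\<^sup>2) < 1" using q by (simp add: norm_power power_less_one_iff)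
  have "qpoch_inf (q\<^sup>2) (q\<^sup>2) = qpoch_inf q q * qpoch_inf (-q) q"
  proof (rule LIMSEQ_unique)
    show "(\<lambda>n. \<Prod>t<n. 1 - (q\<^sup>2) ^ Suc t) \<longlonglongrightarrow> qpoch_inf (q\<^sup>2) (q\<^sup>2)" by (rule qpoch_q(1)[OF q2])
    have "(\<lambda>n. (\<Prod>t<n. 1 - q ^ Suc t) * (\<Prod>t<n. 1 + q ^ Suc t)) \<longlonglongrightarrow> qpoch_inf q q * qpoch_inf (-q) q"
      by (intro tendsto_mult qpoch_q(1)[OF q] qpoch_mq(1)[OF q])
    moreover have "(1 - q ^ Suc t) * (1 + q ^ Suc t) = 1 - (q\<^sup>2) ^ Suc t" for t
    proof -
      have "(1 - X) * (1 + X) = 1 - X\<^sup>2" for X :: complex by (simp add: power2_eq_square algebra_simps)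
      moreover have "(q\<^sup>2) ^ Suc t = (q ^ Suc t)\<^sup>2"
        by (simp only: power_mult[symmetric] mult.commute[of 2 "Suc t"])
      ultimately show ?thesis by (simp only:)
    qed
    ultimately show "(\<lambda>n. \<Prod>t<n. 1 - (q\<^sup>2) ^ Suc t) \<longlonglongrightarrow> qpoch_inf q q * qpoch_inf (-q) q"
      by (simp only: prod.distrib[symmetric])
  qed
  hence "(dedekind_eta z)\<^sup>2 / dedekind_eta (2 * z) =
      (exp (of_real pi * \<i> * z / 12))\<^sup>2 / exp (of_real pi * \<i> * (2 * z) / 12) * ((qpoch_inf q q)\<^sup>2 / (qpoch_inf q q * qpoch_inf (-q) q))"
    unfolding dedekind_eta_def pe n2 q_def[symmetric] by (simp add: power_mult_distrib)
  also have "(exp (of_real pi * \<i> * z / 12))\<^sup>2 = exp (of_real pi * \<i> * (2 * z) / 12)"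
    by (simp add: power2_eq_square mult_exp_exp)
  finally show ?thesis using qpoch_q(2)[OF q] unfolding theta4_product(1)[OF z] q_def[symmetric]
    by (simp add: power2_eq_square)
qed

lemma NH_bar_eq:
  assumes z: "Im z > 0"
  shows "NH_bar z = of_real (1 / (4 * pi)) * (LBINT t:{Im z<..}. of_real (t powr (-3/2)) * theta4 (- z + 2 * \<i> * of_real t))"
proof -
  define y where "y = Im z"
  define f where "f = (\<lambda>t::real. indicator {0<..} t *\<^sub>R
        (let \<tau> = - cnj z + \<i> * of_real t
         in (dedekind_eta \<tau>)\<^sup>2 / (dedekind_eta (2 * \<tau>) * (- \<i> * (\<tau> + z)) powr (3/2)) * \<i>))"
  \<comment> \<open>The ray is reparametrized so that \<tau> = -z + 2it, the argument of the second
    theta factor in \<open>sum_gauss_term\<close>; then -i (\<tau> + z) = 2t, and the ray becomes t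
    > y.\<close>
  have f: "f (- 2 * y + 2 * t) = indicator {y<..} t *\<^sub>R (\<i> * of_real (1 / (2 * sqrt 2)) * (of_real (t powr (-3/2)) * theta4 (- z + 2 * \<i> * of_real t)))" for t
  proof (cases "t > y")
    case True
    hence t: "t > 0" using z by (simp add: y_def)
    define \<tau> where "\<tau> = - cnj z + \<i> * of_real (- 2 * y + 2 * t)"
    have \<tau>: "\<tau> = - z + 2 * \<i> * of_real t" by (simp add: \<tau>_def complex_eq_iff y_def)
    have "Im \<tau> > 0" using True z by (simp add: \<tau> y_def)
    hence e: "(dedekind_eta \<tau>)\<^sup>2 / dedekind_eta (2 * \<tau>) = theta4 \<tau>" by (rule eta_quotient)
    have "- \<i> * (\<tau> + z) = of_real (2 * t)" by (simp add: \<tau>)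
    hence "(- \<i> * (\<tau> + z)) powr (3/2) = of_real ((2 * t) powr (3/2))"
      using t powr_of_real[of "2 * t" "3/2"] by simp
    also have "(2 * t) powr (3/2) = 2 * sqrt 2 * t powr (3/2)"
    proof -
      have "(2::real) powr (3/2) = 2 powr (1 + 1/2)" by simp
      also have "\<dots> = 2 * sqrt 2" by (subst powr_add) (simp add: powr_half_sqrt)
      finally show ?thesis using t by (simp add: powr_mult)
    qed
    finally have p: "(- \<i> * (\<tau> + z)) powr (3/2) = of_real (2 * sqrt 2 * t powr (3/2))" .
    have "f (- 2 * y + 2 * t) = (dedekind_eta \<tau>)\<^sup>2 / (dedekind_eta (2 * \<tau>) * (- \<i> * (\<tau> + z)) powr (3/2)) * \<i>"
      using True by (simp add: f_def Let_def \<tau>_def)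
    also have "\<dots> = ((dedekind_eta \<tau>)\<^sup>2 / dedekind_eta (2 * \<tau>)) / (- \<i> * (\<tau> + z)) powr (3/2) * \<i>" by simp
    also have "\<dots> = \<i> * of_real (1 / (2 * sqrt 2)) * (of_real (t powr (-3/2)) * theta4 \<tau>)"
    proof -
      have inv: "t powr (-3/2) = 1 / t powr (3/2)" using powr_minus_divide[of t "3/2"] by simp
      show ?thesis unfolding e p inv of_real_divide of_real_mult of_real_1 by simp
    qed
    finally show ?thesis using True by (simp add: \<tau>)
  qed (simp add: f_def)
  have "(LINT t:{0<..}|lborel. (let \<tau> = - cnj z + \<i> * of_real t
         in (dedekind_eta \<tau>)\<^sup>2 / (dedekind_eta (2 * \<tau>) * (- \<i> * (\<tau> + z)) powr (3/2)) * \<i>)) = (LBINT t. f t)"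
    by (simp only: f_def set_lebesgue_integral_def)
  also have "\<dots> = 2 * (LBINT t. f (- 2 * y + 2 * t))"
    using lborel_integral_real_affine[of 2 f "- 2 * y"] by (simp add: scaleR_conv_of_real)
  also have "(LBINT t. f (- 2 * y + 2 * t)) = (LBINT t:{y<..}. \<i> * of_real (1 / (2 * sqrt 2)) * (of_real (t powr (-3/2)) * theta4 (- z + 2 * \<i> * of_real t)))"
    unfolding f set_lebesgue_integral_def ..
  also have "\<dots> = \<i> * of_real (1 / (2 * sqrt 2)) * (LBINT t:{y<..}. of_real (t powr (-3/2)) * theta4 (- z + 2 * \<i> * of_real t))"
    by (rule set_integral_mult_right)
  finally have I: "(LINT t:{0<..}|lborel. (let \<tau> = - cnj z + \<i> * of_real t
         in (dedekind_eta \<tau>)\<^sup>2 / (dedekind_eta (2 * \<tau>) * (- \<i> * (\<tau> + z)) powr (3/2)) * \<i>)) =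
     2 * (\<i> * of_real (1 / (2 * sqrt 2)) * (LBINT t:{y<..}. of_real (t powr (-3/2)) * theta4 (- z + 2 * \<i> * of_real t)))" .
  have c: "1 / (2 * of_real (sqrt 2) * of_real pi * \<i>) * (2 * (\<i> * of_real (1 / (2 * sqrt 2)))) = (of_real (1 / (4 * pi)) :: complex)"
  proof -
    have "of_real (sqrt 2) * of_real (sqrt 2) = (2 :: complex)" by (simp flip: of_real_mult)
    thus ?thesis by (simp add: field_simps)
  qed
  show ?thesis unfolding NH_bar_def I c[symmetric] y_def[symmetric] by (simp only: mult.assoc)
qed

section \<open>The holomorphic part: row sums of the lattice, N2 and E2\<close>

context
  fixes z :: complex and q :: complex
  assumes z: "Im z > 0" and q: "q = nome z"
begin

lemma qn: "norm q < 1" "q \<noteq> 0" using norm_nome z by (auto simp: q)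

lemma norm_power_int_eq_1: "norm (q powi k) = 1 \<Longrightarrow> k = 0"
proof -
  assume "norm (q powi k) = 1"
  hence "exp (- (2 * pi * (of_int k * Im z))) = 1" by (simp add: q nome_ee ee_powi norm_ee)
  thus ?thesis using z by simp
qed

text \<open>The infinite products cancel except for their initial factors: the pair at -1 and -q
  leaves 2, the pair at -q^n and -q^(n+1) leaves 1 + q^n. The latter is nonzero for negative n too,
  since |q^k| = 1 only for k = 0.\<close>

lemma qpoch_ratio: "qpoch (-1) q n / qpoch (-q) q n = 2 / (1 + q powi n)" "1 + q powi n \<noteq> 0"
proof -
  have ne: "- (q powi n) * q ^ t \<noteq> 1" for t
  proof
    assume a: "- (q powi n) * q ^ t = 1"
    have "q powi (n + int t) = q powi n * q ^ t" using qn(2) by (simp add: power_int_add)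
    hence *: "q powi (n + int t) = - 1" using a by (metis minus_mult_left minus_minus)
    hence "n + int t = 0" by (intro norm_power_int_eq_1) simp
    thus False using * by simp
  qed
  show "1 + q powi n \<noteq> 0" using ne[of 0] by (metis add.inverse_inverse add_eq_0_iff mult_1_right power_0)
  have "qpoch_inf (- (q powi n)) q = (1 - - (q powi n)) * qpoch_inf (- (q powi n) * q) q"
    by (rule qpoch_inf_rec[OF qn(1) ne])
  hence r: "qpoch_inf (-1 * q powi n) q = (1 + q powi n) * qpoch_inf (- q * q powi n) q"
    by (simp add: mult_ac)
  moreover have "qpoch_inf (- (q powi n)) q \<noteq> 0" by (rule qpoch_inf_nonzero[OF qn(1) ne])
  ultimately have "qpoch_inf (- q * q powi n) q \<noteq> 0" "1 + q powi n \<noteq> 0" by auto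
  moreover have "2 * W / ((1 + Q) * U) / (W / U) = 2 / (1 + Q)" if "W \<noteq> 0" "U \<noteq> 0" "1 + Q \<noteq> 0" for W Q U :: complex
    using that by simp
  ultimately show "qpoch (-1) q n / qpoch (-q) q n = 2 / (1 + q powi n)"
    unfolding qpoch_def r qpoch_m1(2)[OF qn(1)] using qpoch_mq(2)[OF qn(1)] by blast
qed

definition N2_term :: "int \<Rightarrow> complex" where
  "N2_term n = (-1) powi (n - 1) * q powi (n\<^sup>2 + n) * qpoch (-1) q n / ((1 - q powi n)\<^sup>2 * qpoch (-q) q n)"

lemma N2_term_eq: "N2_term n = 2 * (-1) powi (n - 1) * q powi (n\<^sup>2 + n) / ((1 - q powi n)\<^sup>2 * (1 + q powi n))"
proof -
  have "N2_term n = (-1) powi (n - 1) * q powi (n\<^sup>2 + n) / (1 - q powi n)\<^sup>2 * (qpoch (-1) q n / qpoch (-q) q n)"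
    by (simp add: N2_term_def)
  thus ?thesis unfolding qpoch_ratio by simp
qed

lemma norm_1_minus_power: "n \<ge> 1 \<Longrightarrow> norm (1 - q ^ n) \<ge> 1 - norm q" "n \<ge> 1 \<Longrightarrow> norm (1 + q ^ n) \<ge> 1 - norm q"
proof -
  assume "n \<ge> 1"
  hence "norm q ^ n \<le> norm q" using power_decreasing[of 1 n "norm q"] qn by simp
  thus "norm (1 - q ^ n) \<ge> 1 - norm q" "norm (1 + q ^ n) \<ge> 1 - norm q"
    using norm_triangle_ineq2[of 1 "q ^ n"] norm_diff_ineq[of 1 "q ^ n"] by (simp_all add: norm_power)
qed

lemma power_ne: "n \<ge> 1 \<Longrightarrow> 1 - q ^ n \<noteq> 0" "n \<ge> 1 \<Longrightarrow> 1 + q ^ n \<noteq> 0"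
  using norm_1_minus_power[of n] qn by auto

lemma N2_term_pos: "N2_term (int (Suc k)) = 2 * (-1) ^ k * q ^ ((Suc k)\<^sup>2 + Suc k) / ((1 - q ^ Suc k)\<^sup>2 * (1 + q ^ Suc k))"
proof -
  have "(int (Suc k))\<^sup>2 + int (Suc k) = int ((Suc k)\<^sup>2 + Suc k)" by (simp only: of_nat_power of_nat_add)
  moreover have "int (Suc k) - 1 = int k" by simp
  ultimately show ?thesis unfolding N2_term_eq by (simp only: power_int_of_nat)
qed

text \<open>Multiplying numerator and denominator by the cube of q^n clears the negative powers: the
  exponent n^2 - n becomes n^2 + 2n, and the denominator becomes that of the term at +n.\<close>

lemma N2_term_neg: "N2_term (- int (Suc k)) = 2 * (-1) ^ k * q ^ ((Suc k)\<^sup>2 + 2 * Suc k) / ((1 - q ^ Suc k)\<^sup>2 * (1 + q ^ Suc k))"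
proof -
  define n where "n = Suc k"
  define Q where "Q = q ^ n"
  have Q: "Q \<noteq> 0" "1 - Q \<noteq> 0" "1 + Q \<noteq> 0" using qn power_ne[of n] by (auto simp: Q_def n_def)
  have e: "(- int n)\<^sup>2 + (- int n) = int (n * n - n)" by (simp add: n_def power2_eq_square algebra_simps)
  have s: "- int n - 1 = - int (Suc n)" by simp
  have "(-1) powi (- int (Suc n)) = (-1 :: complex) ^ Suc n"
    by (simp only: power_int_minus power_int_of_nat) (simp add: power_inverse[symmetric] flip: power_inverse)
  hence sg: "(-1) powi (- int n - 1) = (-1 :: complex) ^ k" unfolding s by (simp add: n_def)
  have qn': "q powi (- int n) = 1 / Q" by (simp add: Q_def power_int_minus divide_inverse)
  have "N2_term (- int n) = 2 * (-1) ^ k * q ^ (n * n - n) / ((1 - 1 / Q)\<^sup>2 * (1 + 1 / Q))"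
    unfolding N2_term_eq e sg qn' by (simp only: power_int_of_nat)
  also have "(1 - 1 / Q)\<^sup>2 * (1 + 1 / Q) = ((1 - Q)\<^sup>2 * (1 + Q)) / Q ^ 3"
    using Q by (simp add: field_simps power2_eq_square power3_eq_cube)
  also have "2 * (-1) ^ k * q ^ (n * n - n) / (((1 - Q)\<^sup>2 * (1 + Q)) / Q ^ 3) =
      2 * (-1) ^ k * (q ^ (n * n - n) * Q ^ 3) / ((1 - Q)\<^sup>2 * (1 + Q))" using Q by simp
  also have "q ^ (n * n - n) * Q ^ 3 = q ^ (n\<^sup>2 + 2 * n)"
  proof -
    have "n * n - n + n * 3 = n\<^sup>2 + 2 * n" by (simp add: n_def power2_eq_square)
    thus ?thesis unfolding Q_def power_mult[symmetric] power_add[symmetric] by (simp only:)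
  qed
  finally show ?thesis by (simp only: n_def Q_def)
qed

lemma geometric_summable: "(\<lambda>k. c * norm q ^ k) summable_on UNIV"
  using qn by (intro summable_on_cmult_right summable_nonneg_imp_summable_on summable_geometric) auto

lemma summable_on_quotient:
  assumes "\<And>k. norm (u k) \<le> K * norm q ^ k" "\<And>k. norm (v k) \<ge> L" "L > 0"
  shows "(\<lambda>k. u k / v k :: complex) summable_on UNIV"
proof (rule summable_on_norm_comparison(2)[OF geometric_summable[of "K / L"]])
  fix k
  have "norm (u k / v k) \<le> (K * norm q ^ k) / L"
    unfolding norm_divide using assms(1)[of k] assms(2)[of k] assms(3) by (intro frac_le) (auto intro: order_trans[OF norm_ge_zero])
  thus "norm (u k / v k) \<le> K / L * norm q ^ k" by simp
qed

lemma norm_q_power_le: "k \<le> m \<Longrightarrow> norm (c * q ^ m) \<le> norm c * norm q ^ k"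
  unfolding norm_mult norm_power using qn power_decreasing[of k m "norm q"] by (intro mult_left_mono) auto

lemma N2_term_denominator: "norm ((1 - q ^ Suc k)\<^sup>2 * (1 + q ^ Suc k)) \<ge> (1 - norm q)\<^sup>2 * (1 - norm q)"
  unfolding norm_mult norm_power[of _ 2] using norm_1_minus_power[of "Suc k"] qn
  by (intro mult_mono power_mono) auto

text \<open>The terms at n and -n have the same denominator, and their numerators differ by a factor
  q^n. Their sum thus contains 1 + q^n, which cancels against the denominator.\<close>

lemma N2_term_sum:
  "(\<Sum>\<^sub>\<infinity>n\<in>{n::int. n \<noteq> 0}. N2_term n) = - 2 * (\<Sum>\<^sub>\<infinity>n\<in>{1..}. (-1) ^ n * q ^ n\<^sup>2 * (q ^ n / (1 - q ^ n)\<^sup>2))"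
proof -
  have L: "(1 - norm q)\<^sup>2 * (1 - norm q) > 0" using qn by simp
  have s1: "(\<lambda>k. N2_term (int (Suc k))) summable_on UNIV"
    unfolding N2_term_pos
    by (rule summable_on_quotient[OF order_trans[OF norm_q_power_le[of k m "2 * (-1) ^ k" for k m]] N2_term_denominator L, where K = 2])
       (auto simp: norm_mult norm_power)
  have s2: "(\<lambda>k. N2_term (- int (Suc k))) summable_on UNIV"
    unfolding N2_term_neg
    by (rule summable_on_quotient[OF order_trans[OF norm_q_power_le[of k m "2 * (-1) ^ k" for k m]] N2_term_denominator L, where K = 2])
       (auto simp: norm_mult norm_power)
  have b1: "bij_betw (\<lambda>k. int (Suc k)) UNIV {n. n > 0}"
    by (rule bij_betw_byWitness[where f' = "\<lambda>n. nat (n - 1)"]) auto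
  have b2: "bij_betw (\<lambda>k. - int (Suc k)) UNIV {n. n < 0}"
    by (rule bij_betw_byWitness[where f' = "\<lambda>n. nat (- n - 1)"]) auto
  have "{n::int. n \<noteq> 0} = {n. n > 0} \<union> {n. n < 0}" by auto
  hence "(\<Sum>\<^sub>\<infinity>n\<in>{n::int. n \<noteq> 0}. N2_term n) = (\<Sum>\<^sub>\<infinity>n\<in>{n. n > 0} \<union> {n. n < 0}. N2_term n)" by simp
  also have "\<dots> = (\<Sum>\<^sub>\<infinity>n\<in>{n. n > 0}. N2_term n) + (\<Sum>\<^sub>\<infinity>n\<in>{n. n < 0}. N2_term n)"
    using s1 s2 summable_on_reindex_bij_betw[OF b1, of N2_term] summable_on_reindex_bij_betw[OF b2, of N2_term]
    by (intro infsum_Un_disjoint) auto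
  also have "\<dots> = (\<Sum>\<^sub>\<infinity>k. N2_term (int (Suc k))) + (\<Sum>\<^sub>\<infinity>k. N2_term (- int (Suc k)))"
    using infsum_reindex_bij_betw[OF b1, of N2_term] infsum_reindex_bij_betw[OF b2, of N2_term] by simp
  also have "\<dots> = (\<Sum>\<^sub>\<infinity>k. N2_term (int (Suc k)) + N2_term (- int (Suc k)))" by (rule infsum_add[OF s1 s2, symmetric])
  also have "\<dots> = (\<Sum>\<^sub>\<infinity>k. - 2 * ((-1) ^ Suc k * q ^ (Suc k)\<^sup>2 * (q ^ Suc k / (1 - q ^ Suc k)\<^sup>2)))"
  proof (rule infsum_cong)
    fix k
    define n where "n = Suc k"
    define Q where "Q = q ^ n"
    have Q: "1 - Q \<noteq> 0" "1 + Q \<noteq> 0" using power_ne[of n] by (auto simp: Q_def n_def)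
    have "N2_term (int n) + N2_term (- int n) = 2 * (-1) ^ k * (q ^ n\<^sup>2 * Q) / ((1 - Q)\<^sup>2 * (1 + Q)) + 2 * (-1) ^ k * (q ^ n\<^sup>2 * Q * Q) / ((1 - Q)\<^sup>2 * (1 + Q))"
    proof -
      have "q ^ (n\<^sup>2 + n) = q ^ n\<^sup>2 * Q" "q ^ (n\<^sup>2 + 2 * n) = q ^ n\<^sup>2 * Q * Q"
        by (simp_all add: Q_def power_add mult_2)
      thus ?thesis using N2_term_pos[of k] N2_term_neg[of k] by (simp only: n_def[symmetric] Q_def[symmetric])
    qed
    also have "\<dots> = 2 * (-1) ^ k * (q ^ n\<^sup>2 * Q) * (1 + Q) / ((1 - Q)\<^sup>2 * (1 + Q))"
      by (simp add: add_divide_distrib[symmetric] algebra_simps)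
    also have "\<dots> = - 2 * ((-1) ^ n * q ^ n\<^sup>2 * (Q / (1 - Q)\<^sup>2))" using Q by (simp add: n_def)
    finally show "N2_term (int (Suc k)) + N2_term (- int (Suc k)) = - 2 * ((-1) ^ Suc k * q ^ (Suc k)\<^sup>2 * (q ^ Suc k / (1 - q ^ Suc k)\<^sup>2))"
      by (simp only: n_def Q_def)
  qed
  also have "\<dots> = - 2 * (\<Sum>\<^sub>\<infinity>n\<in>{1..}. (-1) ^ n * q ^ n\<^sup>2 * (q ^ n / (1 - q ^ n)\<^sup>2))"
    unfolding infsum_atLeast_1 by (rule infsum_cmult_right')
  finally show ?thesis .
qed

text \<open>Up to the factor pi^2 this is the sum over row \<open>n\<close> of exp(pi i n \<lambda>)
  / \<lambda>^2. At \<open>n = 0\<close> it is 1/4, the sum of 1/m^2 over odd m divided by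
  pi^2.\<close>

definition hol_term :: "int \<Rightarrow> complex" where
  "hol_term n = ee (of_int n / 2) * (ee (of_int (n\<^sup>2) * z) * ee (of_int n * z)) / (1 + ee (of_int n * z))\<^sup>2"

lemma hol_term_even: "hol_term (- n) = hol_term n"
proof -
  define E where "E = ee (of_int n * z)"
  have E: "E \<noteq> 0" by (simp add: E_def)
  have "ee (of_int (- n) * z) = inverse E" using ee_minus[of "of_int n * z"] by (simp add: E_def)
  moreover have "inverse E / (1 + inverse E)\<^sup>2 = E / (1 + E)\<^sup>2"
    using E by (simp add: divide_simps power2_eq_square) (simp add: algebra_simps)
  moreover have "ee (of_int (- n) / 2) = ee (of_int n / 2)"
    using ee_half_int[of n] ee_half_int[of "- n"] by (simp only: even_minus)
  ultimately show ?thesis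
    by (simp only: hol_term_def E_def[symmetric] power2_minus times_divide_eq_right[symmetric])
qed

lemma hol_term_Suc: "hol_term (int (Suc k)) = (-1) ^ Suc k * q ^ (Suc k)\<^sup>2 * (q ^ Suc k / (1 + q ^ Suc k)\<^sup>2)"
proof -
  have "ee (of_int ((int (Suc k))\<^sup>2) * z) = q ^ (Suc k)\<^sup>2"
    using ee_of_nat_mult[of "(Suc k)\<^sup>2" z] unfolding q nome_ee by (simp only: of_nat_power of_int_power of_int_of_nat_eq)
  moreover have "ee (of_int (int (Suc k)) * z) = q ^ Suc k"
    using ee_of_nat_mult[of "Suc k" z] unfolding q nome_ee by (simp only: of_int_of_nat_eq)
  moreover have "ee (of_int (int (Suc k)) / 2) = (-1) ^ Suc k" unfolding ee_half_int by (simp add: minus_one_power_iff)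
  ultimately show ?thesis by (simp only: hol_term_def times_divide_eq_right mult.assoc)
qed

lemma hol_term_summable: "hol_term summable_on UNIV"
proof -
  have "(\<lambda>k. ((-1) ^ Suc k * q ^ ((Suc k)\<^sup>2 + Suc k)) / (1 + q ^ Suc k)\<^sup>2) summable_on UNIV"
  proof (rule summable_on_quotient[where K = 1 and L = "(1 - norm q)\<^sup>2"])
    show "norm ((-1) ^ Suc k * q ^ ((Suc k)\<^sup>2 + Suc k)) \<le> 1 * norm q ^ k" for k
      by (rule order_trans[OF norm_q_power_le[of k]]) (auto simp: norm_power)
    show "(1 - norm q)\<^sup>2 \<le> norm ((1 + q ^ Suc k)\<^sup>2)" for k
      unfolding norm_power[of _ 2] using norm_1_minus_power[of "Suc k"] qn by (intro power_mono) auto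
  qed (use qn in auto)
  hence s: "(\<lambda>k. hol_term (int (Suc k))) summable_on UNIV" unfolding hol_term_Suc by (simp add: power_add mult_ac)
  have "(\<lambda>n. hol_term (int n)) summable_on {1..}" unfolding infsum_atLeast_1(2) by (rule s)
  moreover have "(UNIV :: nat set) = {0} \<union> {1..}" by auto
  ultimately have "(\<lambda>n. hol_term (int n)) summable_on UNIV"
    by (metis (no_types, lifting) finite.emptyI finite.insertI summable_on_Un_disjoint summable_on_finite disjoint_insert(2) inf_bot_left atLeast_iff not_one_le_zero Int_insert_left)
  thus ?thesis
  proof (rule summable_on_int)
    show "(\<lambda>n. hol_term (- int (Suc n))) summable_on UNIV" unfolding hol_term_even by (rule s)
  qed
qed

text \<open>The origin of the coefficients 1/12 and 1/6. Let A and D be the sums with (1 - q^n)^2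
  and (1 + q^n)^2 below, and S the divisor sum at q^2. \<open>N2_1_0\<close> contributes -2A, the
  bracket with \<open>Eisenstein_E2\<close> contributes 1/4 - 4S, and A + D = -2S makes the total
  1/4 + 2D.\<close>

lemma holomorphic_part_identity:
  "theta4 z * (N2_1_0 (nome z) + qpoch_inf (- nome z) (nome z) / qpoch_inf (nome z) (nome z)
             * (1/12 + 1/6 * Eisenstein_E2 (2 * z))) = infsum hol_term UNIV"
proof -
  let ?A = "\<Sum>\<^sub>\<infinity>n\<in>{1..}. (-1) ^ n * q ^ n\<^sup>2 * (q ^ n / (1 - q ^ n)\<^sup>2)"
  let ?D = "\<Sum>\<^sub>\<infinity>n\<in>{1..}. (-1) ^ n * q ^ n\<^sup>2 * (q ^ n / (1 + q ^ n)\<^sup>2)"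
  let ?S = "\<Sum>\<^sub>\<infinity>n\<in>{1..}. of_nat n * (q\<^sup>2) ^ n / (1 - (q\<^sup>2) ^ n)"
  have c: "theta4 z * (qpoch_inf (- q) q / qpoch_inf q q) = 1"
    using qpoch_q(2)[OF qn(1)] qpoch_mq(2)[OF qn(1)] unfolding theta4_product(1)[OF z] q[symmetric] by simp
  have N: "N2_1_0 q = qpoch_inf (- q) q / qpoch_inf q q * (- 2 * ?A)"
    unfolding N2_1_0_def N2_term_sum[symmetric] N2_term_def ..
  have R: "infsum hol_term UNIV = 1 / 4 + 2 * ?D"
    unfolding infsum_int_even[OF hol_term_summable hol_term_even] infsum_atLeast_1 hol_term_Suc
    by (simp add: hol_term_def power2_eq_square)
  have sA: "(\<lambda>n. (-1) ^ n * q ^ n\<^sup>2 * (q ^ n / (1 - q ^ n)\<^sup>2)) summable_on {1..}"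
  proof -
    have "(\<lambda>k. ((-1) ^ Suc k * q ^ ((Suc k)\<^sup>2 + Suc k)) / (1 - q ^ Suc k)\<^sup>2) summable_on UNIV"
    proof (rule summable_on_quotient[where K = 1 and L = "(1 - norm q)\<^sup>2"])
      show "norm ((-1) ^ Suc k * q ^ ((Suc k)\<^sup>2 + Suc k)) \<le> 1 * norm q ^ k" for k
        by (rule order_trans[OF norm_q_power_le[of k]]) (auto simp: norm_power)
      show "(1 - norm q)\<^sup>2 \<le> norm ((1 - q ^ Suc k)\<^sup>2)" for k
        unfolding norm_power[of _ 2] using norm_1_minus_power[of "Suc k"] qn by (intro power_mono) auto
    qed (use qn in auto)
    thus ?thesis unfolding infsum_atLeast_1(2) by (simp add: power_add mult_ac)
  qed
  have sD: "(\<lambda>n. (-1) ^ n * q ^ n\<^sup>2 * (q ^ n / (1 + q ^ n)\<^sup>2)) summable_on {1..}"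
    unfolding infsum_atLeast_1(2) hol_term_Suc[symmetric] by (rule summable_on_int_nat(2)[OF hol_term_summable])
  have AD: "?A + ?D = - 2 * ?S"
    unfolding theta_divisor_identity[OF qn(1), symmetric] infsum_add[OF sA sD, symmetric] by (simp only: distrib_left)
  have E: "Eisenstein_E2 (2 * z) = 1 - 24 * ?S"
  proof -
    have n2: "nome (2 * z) = q\<^sup>2" using ee_of_nat_mult[of 2 z] by (simp add: nome_ee q)
    have q2: "norm (q\<^sup>2) < 1" using qn by (simp add: norm_power power_less_one_iff)
    have "summable (\<lambda>n. 1 / (1 - norm q) * (norm q * (real (Suc n) * norm q ^ n)))"
      using geometric_deriv_sums[of "norm q"] qn by (intro summable_mult) (auto simp: sums_iff)
    hence "(\<lambda>n. 1 / (1 - norm q) * (norm q * (real (Suc n) * norm q ^ n))) summable_on UNIV"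
      using qn by (intro summable_nonneg_imp_summable_on) auto
    hence "(\<lambda>n. of_nat (Suc n) * (q\<^sup>2) ^ Suc n / (1 - (q\<^sup>2) ^ Suc n)) summable_on UNIV"
    proof (rule summable_on_norm_comparison(2))
      fix n
      have "norm (of_nat (Suc n) * (q\<^sup>2) ^ Suc n / (1 - (q\<^sup>2) ^ Suc n)) \<le> (real (Suc n) * norm q ^ Suc n) / (1 - norm q)"
        unfolding norm_divide
      proof (rule frac_le)
        show "norm (of_nat (Suc n) * (q\<^sup>2) ^ Suc n) \<le> real (Suc n) * norm q ^ Suc n"
          unfolding norm_mult norm_of_nat norm_power power_mult[symmetric] using qn
          by (intro mult_left_mono power_decreasing) auto
        show "1 - norm q \<le> norm (1 - (q\<^sup>2) ^ Suc n)"
          unfolding power_mult[symmetric] by (rule norm_1_minus_power(1)) simp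
      qed (use qn in auto)
      thus "norm (of_nat (Suc n) * (q\<^sup>2) ^ Suc n / (1 - (q\<^sup>2) ^ Suc n)) \<le> 1 / (1 - norm q) * (norm q * (real (Suc n) * norm q ^ n))"
        by (simp add: mult_ac)
    qed
    thus ?thesis unfolding Eisenstein_E2_def n2 infsum_atLeast_1 by (simp only: infsum_eq_suminf)
  qed
  have "theta4 z * (N2_1_0 q + qpoch_inf (- q) q / qpoch_inf q q * (1/12 + 1/6 * Eisenstein_E2 (2 * z))) =
     (theta4 z * (qpoch_inf (- q) q / qpoch_inf q q)) * (- 2 * ?A + (1/12 + 1/6 * Eisenstein_E2 (2 * z)))"
    unfolding N by (simp only: distrib_left mult.assoc)
  also have "\<dots> = - 2 * ?A + 1 / 4 - 4 * ?S" unfolding c E by (simp add: algebra_simps)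
  also have "\<dots> = - 2 * ?A + 1 / 4 + 2 * (?A + ?D)" unfolding AD by simp
  also have "\<dots> = infsum hol_term UNIV" unfolding R by (simp add: algebra_simps)
  finally show ?thesis unfolding q .
qed

text \<open>In row 0 the point is an odd integer, and half of its square is at least 1/2. In any
  other row the imaginary part alone contributes at least 4 (Im z)^2. The minimum serves both
  cases.\<close>

lemma norm_lattice_pt_lower:
  assumes p: "p \<in> Lattice"
  shows "(norm (lattice_pt z p))\<^sup>2 \<ge> min (1/2) (4 * (Im z)\<^sup>2) * (1 + (lattice_pt_re z p)\<^sup>2)"
proof -
  define c where "c = min (1/2) (4 * (Im z)\<^sup>2)"
  have c: "c \<le> 1/2" "c \<le> 4 * (Im z)\<^sup>2" "c \<ge> 0" by (auto simp: c_def)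
  have N: "(norm (lattice_pt z p))\<^sup>2 = (lattice_pt_re z p)\<^sup>2 + 4 * (Im z)\<^sup>2 * (of_int (fst p))\<^sup>2"
    unfolding cmod_power2 lattice_pt_Re lattice_pt_Im by (simp add: power_mult_distrib)
  have cl: "c * (lattice_pt_re z p)\<^sup>2 \<le> 1/2 * (lattice_pt_re z p)\<^sup>2" using c(1) by (rule mult_right_mono) simp
  show ?thesis
  proof (cases "fst p = 0")
    case True
    hence l: "lattice_pt_re z p = of_int (snd p)" by (simp add: lattice_pt_re_def)
    have "snd p \<noteq> 0" using p by auto
    hence "(snd p)\<^sup>2 \<ge> 1" by (metis abs_int_le_square abs_ge_zero int_one_le_iff_zero_less less_le_trans zero_less_abs_iff)
    hence "(lattice_pt_re z p)\<^sup>2 \<ge> 1" unfolding l by (metis of_int_1_le_iff of_int_power)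
    thus ?thesis unfolding N c_def[symmetric] using True cl c by (simp add: distrib_left)
  next
    case False
    hence "(fst p)\<^sup>2 \<ge> 1" by (metis abs_int_le_square abs_ge_zero int_one_le_iff_zero_less less_le_trans zero_less_abs_iff)
    hence "(of_int (fst p))\<^sup>2 \<ge> (1::real)" by (metis of_int_1_le_iff of_int_power)
    hence "4 * (Im z)\<^sup>2 * 1 \<le> 4 * (Im z)\<^sup>2 * (of_int (fst p))\<^sup>2" by (rule mult_left_mono) simp
    thus ?thesis unfolding N c_def[symmetric] distrib_left mult_1_right
      using cl c zero_le_power2[of "lattice_pt_re z p"] by linarith
  qed
qed

lemma summable_on_lattice_pt:
  assumes "\<And>p. p \<in> Lattice \<Longrightarrow> norm (g p) \<le> exp (- (pi * Im z) * (of_int (fst p))\<^sup>2)"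
  shows "(\<lambda>p. g p / (lattice_pt z p)\<^sup>2) summable_on Lattice"
proof (rule summable_on_norm_comparison(2)[OF summable_on_cmult_right[OF gauss_majorant_summable[OF refl z]]])
  fix p assume p: "p \<in> Lattice"
  define c where "c = min (1/2) (4 * (Im z)\<^sup>2)"
  have c: "c > 0" using z by (simp add: c_def)
  have "norm (g p / (lattice_pt z p)\<^sup>2) \<le> exp (- (pi * Im z) * (of_int (fst p))\<^sup>2) / (c * (1 + (lattice_pt_re z p)\<^sup>2))"
    unfolding norm_divide norm_power using assms[OF p] norm_lattice_pt_lower[OF p] c
    by (intro frac_le) (auto simp: c_def add_pos_nonneg)
  also have "\<dots> = 1 / c * (exp (- (pi * Im z) * (of_int (fst p))\<^sup>2) * (1 / (1 + (lattice_pt_re z p)\<^sup>2)))" by simp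
  also have "\<dots> \<le> 1 / c * (2 * gauss_majorant z (Im z) p)" using gauss_majorant_bound[OF refl z] c by (intro mult_left_mono) auto
  finally show "norm (g p / (lattice_pt z p)\<^sup>2) \<le> 2 / c * gauss_majorant z (Im z) p" by simp
qed

text \<open>With \<lambda> = 2 (v + j) and v = n z + 1/2, the exponential does not depend on j, and
  the partial fractions of 1/sin^2 apply. The shift by 1/2, that is the oddness of m, turns sin into
  cos and so produces 1 + q^n instead of 1 - q^n.\<close>

lemma sum_hol_term: "(\<Sum>\<^sub>\<infinity>p\<in>Lattice. exp (of_real pi * \<i> * of_int (fst p) * lattice_pt z p) / (lattice_pt z p)\<^sup>2) = (of_real pi)\<^sup>2 * infsum hol_term UNIV"
  and sum_hol_term_summable: "(\<lambda>p. exp (of_real pi * \<i> * of_int (fst p) * lattice_pt z p) / (lattice_pt z p)\<^sup>2) summable_on Lattice"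
proof -
  show s: "(\<lambda>p. exp (of_real pi * \<i> * of_int (fst p) * lattice_pt z p) / (lattice_pt z p)\<^sup>2) summable_on Lattice"
  proof (rule summable_on_lattice_pt)
    fix p :: "int \<times> int"
    have "Re (of_real pi * \<i> * of_int (fst p) * lattice_pt z p) = - (2 * pi * Im z * (of_int (fst p))\<^sup>2)"
      by (simp add: power2_eq_square)
    also have "\<dots> \<le> - (pi * Im z) * (of_int (fst p))\<^sup>2" using z by simp
    finally show "norm (exp (of_real pi * \<i> * of_int (fst p) * lattice_pt z p)) \<le> exp (- (pi * Im z) * (of_int (fst p))\<^sup>2)"
      by (simp only: norm_exp_eq_Re exp_le_cancel_iff)
  qed
  have row: "(\<Sum>\<^sub>\<infinity>m\<in>{m. odd m}. exp (of_real pi * \<i> * of_int n * lattice_pt z (n, m)) / (lattice_pt z (n, m))\<^sup>2) = (of_real pi)\<^sup>2 * hol_term n" for n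
  proof -
    define v where "v = of_int n * z + 1/2"
    have odd_bij: "bij_betw (\<lambda>j::int. 2 * j + 1) UNIV {m. odd m}"
      by (rule bij_betw_byWitness[where f' = "\<lambda>m. (m - 1) div 2"]) auto
    have E: "exp (of_real pi * \<i> * of_int n * lattice_pt z (n, 2 * j + 1)) / (lattice_pt z (n, 2 * j + 1))\<^sup>2 = (ee (of_int n * v) / 4) * (1 / (v + of_int j)\<^sup>2)" for j
    proof -
      have l: "lattice_pt z (n, 2 * j + 1) = 2 * (v + of_int j)" by (simp add: lattice_pt_def v_def)
      have "exp (of_real pi * \<i> * of_int n * lattice_pt z (n, 2 * j + 1)) = ee (of_int n * v + of_int (n * j))"
        unfolding l by (simp add: ee_def algebra_simps)
      also have "\<dots> = ee (of_int n * v)" by (simp only: ee_add ee_of_int mult_1_right)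
      finally have "exp (of_real pi * \<i> * of_int n * lattice_pt z (n, 2 * j + 1)) = ee (of_int n * v)" .
      moreover have "(lattice_pt z (n, 2 * j + 1))\<^sup>2 = 4 * (v + of_int j)\<^sup>2"
        unfolding l power_mult_distrib by simp
      ultimately show ?thesis by simp
    qed
    have "(\<lambda>m. exp (of_real pi * \<i> * of_int n * lattice_pt z (n, m)) / (lattice_pt z (n, m))\<^sup>2) summable_on {m. odd m}"
    proof -
      have "(\<lambda>p. exp (of_real pi * \<i> * of_int (fst p) * lattice_pt z p) / (lattice_pt z p)\<^sup>2) summable_on Pair n ` {m. odd m}"
        by (rule summable_on_subset_banach[OF s]) auto
      thus ?thesis by (subst (asm) summable_on_reindex) (auto simp: o_def inj_on_def)
    qed
    hence "(\<lambda>j. (ee (of_int n * v) / 4) * (1 / (v + of_int j)\<^sup>2)) summable_on UNIV"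
      unfolding E[symmetric] by (rule summable_on_reindex_bij_betw[OF odd_bij, THEN iffD2])
    hence sv: "(\<lambda>j. 1 / (v + of_int j)\<^sup>2) summable_on UNIV"
      by (drule_tac c = "4 / ee (of_int n * v)" in summable_on_cmult_right) simp
    have vI: "v \<notin> \<int>"
    proof
      assume "v \<in> \<int>"
      then obtain k where k: "v = of_int k" by (elim Ints_cases)
      hence "Im v = 0" by simp
      hence "n = 0" using z by (simp add: v_def)
      hence "of_int (2 * k) = (of_int 1 :: complex)" using k by (simp add: v_def mult.commute)
      hence "2 * k = 1" by (simp only: of_int_eq_iff)
      thus False by presburger
    qed
    have "(\<Sum>\<^sub>\<infinity>m\<in>{m. odd m}. exp (of_real pi * \<i> * of_int n * lattice_pt z (n, m)) / (lattice_pt z (n, m))\<^sup>2) =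
      (\<Sum>\<^sub>\<infinity>j. (ee (of_int n * v) / 4) * (1 / (v + of_int j)\<^sup>2))"
      unfolding E[symmetric] by (rule infsum_reindex_bij_betw[OF odd_bij, symmetric])
    also have "\<dots> = (ee (of_int n * v) / 4) * ((of_real pi)\<^sup>2 / (sin (of_real pi * v))\<^sup>2)"
      by (simp only: infsum_cmult_right' infsum_inverse_square_shift[OF vI sv])
    also have "sin (of_real pi * v) = cos (of_real pi * (of_int n * z))"
    proof -
      have "of_real pi / 2 - of_real pi * v = - (of_real pi * (of_int n * z))"
        by (simp add: v_def algebra_simps)
      thus ?thesis unfolding sin_cos_eq by (simp only: cos_minus)
    qed
    also have "(ee (of_int n * v) / 4) * ((of_real pi)\<^sup>2 / (cos (of_real pi * (of_int n * z)))\<^sup>2) = (of_real pi)\<^sup>2 * hol_term n"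
    proof -
      define E where "E = exp (\<i> * (of_real pi * (of_int n * z)))"
      have E0: "E \<noteq> 0" by (simp add: E_def)
      have "cos (of_real pi * (of_int n * z)) = (E + inverse E) / 2"
        unfolding E_def cos_exp_eq by (simp add: exp_minus)
      hence cosE: "cos (of_real pi * (of_int n * z)) = (1 + E * E) / (2 * E)"
        using E0 by (simp add: field_simps)
      have E2: "ee (of_int n * z) = E * E" unfolding E_def ee_def exp_add[symmetric] by (simp add: algebra_simps)
      have nz: "1 + E * E \<noteq> 0" using qpoch_ratio(2)[of n] by (simp add: q nome_ee ee_powi E2)
      have ev: "ee (of_int n * v) = ee (of_int n / 2) * ee (of_int (n\<^sup>2) * z)"
        unfolding ee_add[symmetric] v_def by (simp add: algebra_simps power2_eq_square)
      have "(A * B) / 4 * (P\<^sup>2 / ((1 + E * E) / (2 * E))\<^sup>2) = P\<^sup>2 * (A * (B * (E * E)) / (1 + E * E)\<^sup>2)" for A B P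
        using E0 nz by (simp add: power_divide power2_eq_square)
      thus ?thesis unfolding hol_term_def ev cosE E2 .
    qed
    finally show ?thesis .
  qed
  have "(\<Sum>\<^sub>\<infinity>p\<in>Lattice. exp (of_real pi * \<i> * of_int (fst p) * lattice_pt z p) / (lattice_pt z p)\<^sup>2) =
    (\<Sum>\<^sub>\<infinity>n. \<Sum>\<^sub>\<infinity>m\<in>{m. odd m}. exp (of_real pi * \<i> * of_int n * lattice_pt z (n, m)) / (lattice_pt z (n, m))\<^sup>2)"
    using infsum_Sigma_banach[OF s] by simp
  also have "\<dots> = (of_real pi)\<^sup>2 * infsum hol_term UNIV" unfolding row by (rule infsum_cmult_right')
  finally show "(\<Sum>\<^sub>\<infinity>p\<in>Lattice. exp (of_real pi * \<i> * of_int (fst p) * lattice_pt z p) / (lattice_pt z p)\<^sup>2) = (of_real pi)\<^sup>2 * infsum hol_term UNIV" .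
qed

theorem key_identity:
  "theta4 z * (N2_1_0 (nome z) + qpoch_inf (- nome z) (nome z) / qpoch_inf (nome z) (nome z)
             * (1/12 + 1/6 * Eisenstein_E2 (2 * z)) - NH_bar z) = lattice_sum z / (of_real pi)\<^sup>2"
proof -
  have HHs: "(\<lambda>p. gauss_term z p (Im z) / (lattice_pt z p)\<^sup>2) summable_on Lattice"
  proof (rule summable_on_lattice_pt)
    fix p :: "int \<times> int"
    have "norm (gauss_term z p (Im z)) \<le> exp (- (pi * Im z) * (of_int (fst p))\<^sup>2) * exp (- pi * (lattice_pt_re z p)\<^sup>2 / (4 * Im z))"
      by (rule norm_gauss_term_le[OF refl z]) simp
    also have "\<dots> \<le> exp (- (pi * Im z) * (of_int (fst p))\<^sup>2) * 1" using z by (intro mult_left_mono) auto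
    finally show "norm (gauss_term z p (Im z)) \<le> exp (- (pi * Im z) * (of_int (fst p))\<^sup>2)" by simp
  qed
  have HHe: "lattice_sum z = (\<Sum>\<^sub>\<infinity>p\<in>Lattice. gauss_term z p (Im z) / (lattice_pt z p)\<^sup>2)"
    unfolding lattice_sum_def gauss_term_at_y[OF refl z] ..
  have "(of_real pi)\<^sup>2 * infsum hol_term UNIV - lattice_sum z =
      (\<Sum>\<^sub>\<infinity>p\<in>Lattice. exp (of_real pi * \<i> * of_int (fst p) * lattice_pt z p) / (lattice_pt z p)\<^sup>2 + - (gauss_term z p (Im z) / (lattice_pt z p)\<^sup>2))"
    using infsum_add[OF sum_hol_term_summable summable_on_uminus[THEN iffD2, OF HHs]] unfolding sum_hol_term HHe infsum_uminus by simp
  also have "\<dots> = (\<Sum>\<^sub>\<infinity>p\<in>Lattice. LBINT t:{Im z<..}. of_real (pi / (4 * t\<^sup>2)) * gauss_term z p t)"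
    by (rule infsum_cong) (simp only: gauss_term_integral(3)[OF refl z] diff_divide_distrib, simp)
  also have "\<dots> = (LBINT t:{Im z<..}. of_real (pi / (4 * t\<^sup>2)) * (\<Sum>\<^sub>\<infinity>p\<in>Lattice. gauss_term z p t))"
    by (rule sum_integral_gauss_term[OF refl z])
  \<comment> \<open>The kernel pi/(4 t^2) times the square root from \<open>sum_gauss_term\<close>
    is (pi/4) t^(-3/2), the weight of the period integral in \<open>NH_bar_eq\<close>. The constants
    agree as pi/4 = pi^2 / (4 pi).\<close>
  also have "\<dots> = (LBINT t:{Im z<..}. (of_real (pi / 4) * theta4 z) * (of_real (t powr (-3/2)) * theta4 (- z + 2 * \<i> * of_real t)))"
  proof (rule set_lebesgue_integral_cong)
    show "\<forall>t. t \<in> {Im z<..} \<longrightarrow> of_real (pi / (4 * t\<^sup>2)) * (\<Sum>\<^sub>\<infinity>p\<in>Lattice. gauss_term z p t) =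
       (of_real (pi / 4) * theta4 z) * (of_real (t powr (-3/2)) * theta4 (- z + 2 * \<i> * of_real t))"
    proof (intro allI impI)
      fix t assume "t \<in> {Im z<..}"
      hence t: "t \<ge> Im z" "t > 0" using z by auto
      have "t powr (-3/2) = sqrt t / t\<^sup>2"
        using powr_diff[of t "1/2" 2] t by (simp add: powr_half_sqrt)
      hence "pi / (4 * t\<^sup>2) * sqrt t = pi / 4 * t powr (-3/2)" by simp
      hence "of_real (pi / (4 * t\<^sup>2)) * of_real (sqrt t) = (of_real (pi / 4) * of_real (t powr (-3/2)) :: complex)"
        by (simp only: of_real_mult[symmetric])
      thus "of_real (pi / (4 * t\<^sup>2)) * (\<Sum>\<^sub>\<infinity>p\<in>Lattice. gauss_term z p t) =
       (of_real (pi / 4) * theta4 z) * (of_real (t powr (-3/2)) * theta4 (- z + 2 * \<i> * of_real t))"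
        unfolding sum_gauss_term[OF refl z t(1)] by (simp only: mult.assoc[symmetric]) (simp only: mult_ac)
    qed
  qed simp
  also have "\<dots> = of_real (pi / 4) * theta4 z * (LBINT t:{Im z<..}. of_real (t powr (-3/2)) * theta4 (- z + 2 * \<i> * of_real t))"
    by (rule set_integral_mult_right)
  also have "\<dots> = (of_real pi)\<^sup>2 * (theta4 z * NH_bar z)"
    unfolding NH_bar_eq[OF z] by (simp add: power2_eq_square field_simps)
  finally have "(of_real pi)\<^sup>2 * (infsum hol_term UNIV - theta4 z * NH_bar z) = lattice_sum z"
    by (simp add: algebra_simps)
  hence "infsum hol_term UNIV - theta4 z * NH_bar z = lattice_sum z / (of_real pi)\<^sup>2" by (simp add: field_simps)
  thus ?thesis unfolding holomorphic_part_identity[symmetric] by (simp only: right_diff_distrib)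
qed

end

section \<open>Modularity\<close>

definition moeb :: "int \<Rightarrow> int \<Rightarrow> int \<Rightarrow> int \<Rightarrow> complex \<Rightarrow> complex" where
  "moeb a b c d z = (of_int a * z + of_int b) / (of_int c * z + of_int d)"

lemma moeb_denominator_nonzero:
  assumes "a * d - b * c = (1::int)" "Im z > 0"
  shows "of_int c * z + (of_int d :: complex) \<noteq> 0"
proof
  assume 0: "of_int c * z + (of_int d :: complex) = 0"
  hence "of_int c * Im z = 0" by (auto simp: complex_eq_iff)
  hence "c = 0" using assms(2) by simp
  moreover from this have "d = 0" using 0 by simp
  ultimately show False using assms(1) by simp
qed

lemma Im_moeb:
  assumes "a * d - b * c = 1"
  shows "Im (moeb a b c d z) = Im z / (norm (of_int c * z + of_int d :: complex))\<^sup>2"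
proof -
  have "of_int a * of_int d - of_int b * (of_int c :: real) = 1"
    using assms by (metis of_int_1 of_int_diff of_int_mult)
  thus ?thesis using Im_moebius[of "of_int a" z "of_int b" "of_int c" "of_int d"] by (simp add: moeb_def)
qed

lemma Im_moeb_pos:
  assumes "a * d - b * c = 1" "Im z > 0"
  shows "Im (moeb a b c d z) > 0"
  unfolding Im_moeb[OF assms(1)] using moeb_denominator_nonzero[OF assms] assms(2) by simp

text \<open>The row vector (2n, m) is multiplied by the matrix from the right, and the lattice point
  is divided by cz + d. An even \<open>c\<close> keeps the first entry even and the second one odd.
  The exponent is unchanged: the squared norm and Im z are divided by the same |cz + d|^2.\<close>

lemma lattice_sum_moeb:
  assumes det: "a * d - b * c = 1" and c: "even c" and z: "Im z > 0"
  shows "lattice_sum (moeb a b c d z) = (of_int c * z + of_int d)\<^sup>2 * lattice_sum z"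
proof -
  obtain h where h: "c = 2 * h" using c by (elim evenE)
  define D where "D = of_int c * z + (of_int d :: complex)"
  have D: "D \<noteq> 0" unfolding D_def by (rule moeb_denominator_nonzero[OF det z])
  define w where "w = moeb a b c d z"
  have det': "a * d - 2 * (b * h) = 1" using det by (simp add: h mult_ac)
  have "a * d = 2 * (b * h) + 1" using det' by simp
  hence "odd (a * d)" by simp
  hence od: "odd a" "odd d" by auto
  define \<phi> where "\<phi> = (\<lambda>(n, m). (n * a + m * h, 2 * n * b + m * d))"
  have e1: "d * (n * a + m * h) - h * (2 * n * b + m * d) = n" for n m
  proof -
    have "d * (n * a + m * h) - h * (2 * n * b + m * d) = n * (a * d - 2 * (b * h))" by (simp add: algebra_simps)
    thus ?thesis using det' by simp
  qed
  have e2: "a * (2 * n * b + m * d) - 2 * b * (n * a + m * h) = m" for n m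
  proof -
    have "a * (2 * n * b + m * d) - 2 * b * (n * a + m * h) = m * (a * d - 2 * (b * h))" by (simp add: algebra_simps)
    thus ?thesis using det' by simp
  qed
  have e3: "(d * n - h * m) * a + (a * m - 2 * b * n) * h = n" for n m
  proof -
    have "(d * n - h * m) * a + (a * m - 2 * b * n) * h = n * (a * d - 2 * (b * h))" by (simp add: algebra_simps)
    thus ?thesis using det' by simp
  qed
  have e4: "(2 * (d * n) - 2 * (h * m)) * b + (a * m - 2 * b * n) * d = m" for n m
  proof -
    have "(2 * (d * n) - 2 * (h * m)) * b + (a * m - 2 * b * n) * d = m * (a * d - 2 * (b * h))" by (simp add: algebra_simps)
    thus ?thesis using det' by simp
  qed
  have bij: "bij_betw \<phi> Lattice Lattice"
    by (rule bij_betw_byWitness[where f' = "\<lambda>(n, m). (d * n - h * m, a * m - 2 * b * n)"])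
       (auto simp: \<phi>_def e1 e2 e3 e4 od)
  have l: "lattice_pt w p = lattice_pt z (\<phi> p) / D" for p
  proof -
    have "lattice_pt w p * D = 2 * of_int (fst p) * (w * D) + of_int (snd p) * D" by (simp add: lattice_pt_def algebra_simps)
    also have "w * D = of_int a * z + of_int b" using D by (simp add: w_def moeb_def D_def)
    also have "2 * of_int (fst p) * (of_int a * z + of_int b) + of_int (snd p) * D = lattice_pt z (\<phi> p)"
      by (cases p) (simp add: lattice_pt_def \<phi>_def D_def h algebra_simps)
    finally show ?thesis using D by (simp add: field_simps)
  qed
  have Iw: "Im w = Im z / (norm D)\<^sup>2" unfolding w_def D_def by (rule Im_moeb[OF det])
  have "lattice_sum w = (\<Sum>\<^sub>\<infinity>p\<in>Lattice. D\<^sup>2 * (exp (- of_real (pi * (norm (lattice_pt z (\<phi> p)))\<^sup>2 / (4 * Im z))) / (lattice_pt z (\<phi> p))\<^sup>2))"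
    unfolding lattice_sum_def
  proof (rule infsum_cong)
    fix p
    have "pi * (norm (lattice_pt w p))\<^sup>2 / (4 * Im w) = pi * (norm (lattice_pt z (\<phi> p)))\<^sup>2 / (4 * Im z)"
      using D z by (simp add: l Iw norm_divide power_divide)
    thus "exp (- of_real (pi * (norm (lattice_pt w p))\<^sup>2 / (4 * Im w))) / (lattice_pt w p)\<^sup>2 =
       D\<^sup>2 * (exp (- of_real (pi * (norm (lattice_pt z (\<phi> p)))\<^sup>2 / (4 * Im z))) / (lattice_pt z (\<phi> p))\<^sup>2)"
      by (simp add: l power_divide)
  qed
  also have "\<dots> = D\<^sup>2 * lattice_sum z"
    unfolding infsum_cmult_right' lattice_sum_def
    by (subst infsum_reindex_bij_betw[OF bij, symmetric]) simp
  finally show ?thesis by (simp add: w_def D_def)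
qed

definition maass_fn :: "complex \<Rightarrow> complex" where
  "maass_fn z = N2_1_0 (nome z) + qpoch_inf (- nome z) (nome z) / qpoch_inf (nome z) (nome z)
             * (1/12 + 1/6 * Eisenstein_E2 (2 * z)) - NH_bar z"

lemma maass_fn_lattice_sum: "Im z > 0 \<Longrightarrow> maass_fn z = lattice_sum z / ((of_real pi)\<^sup>2 * theta4 z)"
  using key_identity[OF _ refl, of z] theta4_product(2)[of z] by (simp add: maass_fn_def field_simps)

lemma csqrt_cube: "w \<noteq> 0 \<Longrightarrow> csqrt w ^ 3 = w powr of_real (3/2)"
proof -
  assume w: "w \<noteq> 0"
  have "csqrt w ^ 3 = exp (Ln w / 2) ^ 3" by (simp only: csqrt_exp_Ln[OF w])
  also have "\<dots> = exp (3 * (Ln w / 2))" using exp_of_nat_mult[of 3 "Ln w / 2"] by simp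
  finally show ?thesis using w by (simp add: powr_def)
qed

text \<open>In weight k = 3/2 the exponent -2k is -3, and i^(-3) = i. The factor demanded of the
  form is thus the inverse of the one in the theta law.\<close>

lemma theta_eps_powr: "theta_eps d powr of_real (- 3) = theta_eps d"
proof -
  have "\<i> powr (- 3) = \<i>"
  proof -
    have "\<i> powr (- 3) = exp (- 3 * (\<i> * of_real (pi / 2)))" by (simp add: powr_def)
    also have "\<dots> = cis (- 3 * pi / 2)" by (simp add: cis_conv_exp mult_ac)
    also have "\<dots> = \<i>"
    proof -
      have "cis (- 3 * pi / 2) = cis (pi / 2 - 2 * pi)" by (rule arg_cong[of _ _ cis]) simp
      also have "\<dots> = cis (pi / 2) / cis (2 * pi)" by (rule cis_divide[symmetric])
      finally show ?thesis by simp
    qed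
    finally show ?thesis .
  qed
  thus ?thesis by (simp add: theta_eps_def)
qed

lemma shimura_symbol_unit:
  assumes "coprime c d" "d \<noteq> 0" shows "shimura_symbol c d = 1 \<or> shimura_symbol c d = -1"
  using jacobi_unit[OF assms] by (auto simp: shimura_symbol_jacobi)

text \<open>Weight 2 over weight 1/2: with s the principal root of D = cz + d, the quotient of s^4
  by s is s^3, the principal value of D^(3/2). The symbol is 1 or -1 and hence its own
  inverse.\<close>

lemma maass_fn_moeb:
  assumes det: "a * d - b * c = 1" and c: "16 dvd c" and z: "Im z > 0"
  shows "maass_fn (moeb a b c d z) = of_int (shimura_symbol c d) * theta_eps d powr of_real (- 3) *
     (of_int c * z + of_int d) powr of_real (3/2) * maass_fn z"
    and "odd d" "shimura_symbol c d = 1 \<or> shimura_symbol c d = -1"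
proof -
  have ec: "even c" using c by (rule dvd_trans[rotated]) simp
  have "a * d = b * c + 1" using det by simp
  hence "odd (a * d)" using ec by simp
  thus od: "odd d" by simp
  have cop: "coprime c d"
  proof (rule coprimeI)
    fix e assume "e dvd c" "e dvd d"
    hence "e dvd a * d - b * c" by (intro dvd_diff dvd_mult) auto
    thus "is_unit e" using det by simp
  qed
  show S: "shimura_symbol c d = 1 \<or> shimura_symbol c d = -1"
    using cop od by (intro shimura_symbol_unit) auto
  define D where "D = of_int c * z + (of_int d :: complex)"
  have D: "D \<noteq> 0" unfolding D_def by (rule moeb_denominator_nonzero[OF det z])
  define s where "s = csqrt D"
  have s: "s \<noteq> 0" "D = s\<^sup>2" using D by (simp_all add: s_def)
  define w where "w = moeb a b c d z"
  have w: "Im w > 0" unfolding w_def by (rule Im_moeb_pos[OF det z])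
  have t: "theta4 w = of_int (shimura_symbol c d) * inverse (theta_eps d) * s * theta4 z"
    using theta4_multiplier[OF det c z] by (simp only: w_def moeb_def s_def D_def)
  have H: "lattice_sum w = D\<^sup>2 * lattice_sum z" unfolding w_def D_def by (rule lattice_sum_moeb[OF det ec z])
  have e0: "theta_eps d \<noteq> 0" by (simp add: theta_eps_def)
  have t0: "theta4 z \<noteq> 0" by (rule theta4_product(2)[OF z])
  have S2: "1 / of_int (shimura_symbol c d) = (of_int (shimura_symbol c d) :: complex)" using S by auto
  have "maass_fn w = D\<^sup>2 * lattice_sum z / ((of_real pi)\<^sup>2 * theta4 w)" unfolding maass_fn_lattice_sum[OF w] H ..
  also have "\<dots> = 1 / of_int (shimura_symbol c d) * theta_eps d * s ^ 3 * (lattice_sum z / ((of_real pi)\<^sup>2 * theta4 z))"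
  proof -
    have "(s\<^sup>2)\<^sup>2 * X / (P * (S * inverse e * s * T)) = 1 / S * e * s ^ 3 * (X / (P * T))"
      if "e \<noteq> 0" for X P S e T :: complex
      using s(1) that by (simp add: divide_simps power2_eq_square power3_eq_cube)
    from this[OF e0] show ?thesis unfolding t s(2) .
  qed
  also have "\<dots> = of_int (shimura_symbol c d) * theta_eps d * D powr of_real (3/2) * maass_fn z"
    unfolding S2 maass_fn_lattice_sum[OF z] s_def csqrt_cube[OF D] ..
  finally show "maass_fn (moeb a b c d z) = of_int (shimura_symbol c d) * theta_eps d powr of_real (- 3) *
     (of_int c * z + of_int d) powr of_real (3/2) * maass_fn z"
    by (simp only: w_def D_def theta_eps_powr)
qed

lemma maass_fn_periodic: "Im z > 0 \<Longrightarrow> maass_fn (z + of_int k) = maass_fn z"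
proof -
  assume z: "Im z > 0"
  have "theta4 (z + of_int k) = theta4 z"
    using theta_plus_int[of "z + 1/2" k] by (simp add: theta4_def add_ac)
  moreover have "lattice_sum (z + of_int k) = lattice_sum z"
    using lattice_sum_moeb[of 1 1 k 0 z] z by (simp add: moeb_def)
  ultimately show ?thesis using z by (simp add: maass_fn_lattice_sum)
qed

section \<open>Growth at the cusps\<close>

lemma exp_minus_le: "(1 + t) * exp (- s * t) \<le> 1 + 1 / s" if "s > 0" "t \<ge> 0" for s t :: real
proof -
  have "(1 + t) * exp (- s * t) = (1 + t) / exp (s * t)" by (simp add: exp_minus divide_inverse)
  also have "\<dots> \<le> (1 + t) / (1 + s * t)"
    using that by (intro divide_left_mono exp_ge_add_one_self mult_pos_pos add_pos_nonneg) auto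
  also have "\<dots> \<le> 1 + 1 / s"
  proof -
    have "1 + t \<le> (1 + 1 / s) * (1 + s * t)" using that by (simp add: field_simps)
    thus ?thesis using that by (simp add: divide_le_eq add_pos_nonneg)
  qed
  finally show ?thesis .
qed

lemma norm_infsum_le_infsum:
  fixes f :: "'a \<Rightarrow> 'b :: banach" and g :: "'a \<Rightarrow> real"
  assumes g: "g summable_on B" and AB: "A \<subseteq> B"
    and le: "\<And>x. x \<in> A \<Longrightarrow> norm (f x) \<le> g x" and nn: "\<And>x. x \<in> B \<Longrightarrow> g x \<ge> 0"
  shows "norm (infsum f A) \<le> infsum g B"
proof -
  have gA: "g summable_on A" by (rule summable_on_subset_banach[OF g AB])
  have "f summable_on A" by (rule summable_on_norm_comparison[OF gA le])
  hence "norm (infsum f A) \<le> infsum g A"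
    by (rule norm_infsum_le[OF has_sum_infsum has_sum_infsum[OF gA] le])
  also have "\<dots> \<le> infsum g B"
    by (rule infsum_mono_neutral[OF gA g]) (use AB nn in auto)
  finally show ?thesis .
qed

definition int_square_const :: real where "int_square_const = (\<Sum>\<^sub>\<infinity>n::int. 1 / (1 + (of_int n)\<^sup>2))"

text \<open>For |Re w| \<le> 1 the polynomial factor of \<open>gauss_majorant\<close> is at most 4
  (1 + n^2). The Gaussian absorbs (1 + n^2)^2, leaving 1/(1 + n^2), at a cost of powers of 1 / Im w
  that the exponential covers.\<close>

lemma lattice_sum_bound:
  assumes w: "Im w > 0" "\<bar>Re w\<bar> \<le> 1"
  shows "norm (lattice_sum w) \<le> 16 * int_square_const\<^sup>2 * exp (3 / Im w)"
proof -
  define v where "v = Im w"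
  have v: "v > 0" using w by (simp add: v_def)
  define c where "c = min (1/2) (4 * v\<^sup>2)"
  have c: "c > 0" using v by (simp add: c_def)
  define L where "L = 2 / c * (4 * (1 + 2 / (pi * v))\<^sup>2)"
  define h where "h = (\<lambda>n::int. 1 / (1 + (of_int n)\<^sup>2) :: real)"
  have h0: "h n \<ge> 0" for n by (simp add: h_def)
  have hs: "(\<lambda>p. h (fst p) * h (snd p)) summable_on UNIV \<times> UNIV"
    using summable_on_times_nonneg[OF summable_on_int_inverse_square summable_on_int_inverse_square]
    by (simp add: h_def case_prod_unfold)
  have L0: "L \<ge> 0" using c by (simp add: L_def)
  have BBw: "gauss_majorant w v p \<le> 4 * (1 + 2 / (pi * v))\<^sup>2 * (h (fst p) * h (snd p))" for p
  proof -
    define t where "t = (of_int (fst p) :: real)\<^sup>2"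
    have t0: "t \<ge> 0" by (simp add: t_def)
    have "(Re w)\<^sup>2 \<le> 1" using w(2) by (simp add: abs_square_le_1)
    hence "4 * (Re w)\<^sup>2 * t \<le> 4 * t" using t0 by (simp add: mult_right_mono)
    hence "1 + 4 * (Re w)\<^sup>2 * t \<le> 4 * (1 + t)" by simp
    hence "exp (- (pi * v) * t) * (1 + 4 * (Re w)\<^sup>2 * t) \<le> exp (- (pi * v) * t) * (4 * (1 + t))"
      by (rule mult_left_mono) simp
    also have "\<dots> = 4 * ((1 + t) * exp (- (pi * v / 2) * t))\<^sup>2 * (1 / (1 + t))"
    proof -
      have "(exp (- (pi * v / 2) * t))\<^sup>2 = exp (- (pi * v) * t)"
        by (simp add: power2_eq_square flip: exp_add)
      hence sq: "((1 + t) * exp (- (pi * v / 2) * t))\<^sup>2 = (1 + t)\<^sup>2 * exp (- (pi * v) * t)"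
        by (simp only: power_mult_distrib)
      have alg: "X * (4 * s) = 4 * (s\<^sup>2 * X) * (1 / s)" if "s > 0" for X s :: real
        using that by (simp add: power2_eq_square)
      have "1 + t > 0" using t0 by simp
      thus ?thesis unfolding sq by (rule alg)
    qed
    also have "\<dots> \<le> 4 * (1 + 1 / (pi * v / 2))\<^sup>2 * (1 / (1 + t))"
      using exp_minus_le[of "pi * v / 2" t] v t0 by (intro mult_right_mono mult_left_mono power_mono) auto
    finally have "exp (- (pi * v) * t) * (1 + 4 * (Re w)\<^sup>2 * t) \<le> 4 * (1 + 2 / (pi * v))\<^sup>2 * (1 / (1 + t))" by simp
    hence "exp (- (pi * v) * t) * (1 + 4 * (Re w)\<^sup>2 * t) * h (snd p) \<le> 4 * (1 + 2 / (pi * v))\<^sup>2 * (1 / (1 + t)) * h (snd p)"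
      using h0 by (rule mult_right_mono)
    thus ?thesis using gauss_majorant_def[of v w, OF v_def v] by (simp add: h_def t_def mult_ac)
  qed
  have tb: "norm (exp (- of_real (pi * (norm (lattice_pt w p))\<^sup>2 / (4 * Im w))) / (lattice_pt w p)\<^sup>2) \<le> L * (h (fst p) * h (snd p))"
    if p: "p \<in> Lattice" for p
  proof -
    have "norm (gauss_term w p v) \<le> exp (- (pi * v) * (of_int (fst p))\<^sup>2) * exp (- pi * (lattice_pt_re w p)\<^sup>2 / (4 * v))"
      by (rule norm_gauss_term_le[OF v_def v]) simp
    also have "\<dots> \<le> exp (- (pi * v) * (of_int (fst p))\<^sup>2) * 1" using v by (intro mult_left_mono) auto
    finally have e: "norm (gauss_term w p v) \<le> exp (- (pi * v) * (of_int (fst p))\<^sup>2)" by simp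
    have "norm (gauss_term w p v / (lattice_pt w p)\<^sup>2) \<le> exp (- (pi * v) * (of_int (fst p))\<^sup>2) / (c * (1 + (lattice_pt_re w p)\<^sup>2))"
      unfolding norm_divide norm_power using e norm_lattice_pt_lower[OF w(1) refl p] c
      by (intro frac_le) (auto simp: c_def v_def add_pos_nonneg)
    also have "\<dots> = 1 / c * (exp (- (pi * v) * (of_int (fst p))\<^sup>2) * (1 / (1 + (lattice_pt_re w p)\<^sup>2)))" by simp
    also have "\<dots> \<le> 1 / c * (2 * gauss_majorant w v p)" using gauss_majorant_bound[OF v_def v] c by (intro mult_left_mono) auto
    also have "\<dots> \<le> 1 / c * (2 * (4 * (1 + 2 / (pi * v))\<^sup>2 * (h (fst p) * h (snd p))))"
      using BBw c by (intro mult_left_mono) auto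
    finally show ?thesis unfolding gauss_term_at_y[OF v_def v] by (simp add: L_def mult_ac)
  qed
  have Ls: "(\<lambda>p. L * (h (fst p) * h (snd p))) summable_on UNIV"
    using hs by (intro summable_on_cmult_right) simp
  have "norm (lattice_sum w) \<le> (\<Sum>\<^sub>\<infinity>p. L * (h (fst p) * h (snd p)))"
    unfolding lattice_sum_def by (rule norm_infsum_le_infsum[OF Ls _ tb]) (use L0 h0 in auto)
  also have "\<dots> = L * int_square_const\<^sup>2"
  proof -
    have "(\<Sum>\<^sub>\<infinity>p. h (fst p) * h (snd p)) = (\<Sum>\<^sub>\<infinity>n. \<Sum>\<^sub>\<infinity>m. h n * h m)"
      using infsum_Sigma_banach[of "\<lambda>p. h (fst p) * h (snd p)" UNIV "\<lambda>_. UNIV"] hs by simp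
    also have "\<dots> = int_square_const * int_square_const" unfolding int_square_const_def h_def by (simp only: infsum_cmult_right' infsum_cmult_left')
    finally show ?thesis by (simp add: infsum_cmult_right' power2_eq_square)
  qed
  \<comment> \<open>Of the exponent 3/v, the part 2/v bounds (1 + 2/(pi v))^2, and 1/v bounds 1/c,
    which is at most of order 1/v^2 for small \<open>v\<close>.\<close>
  also have "L \<le> 16 * exp (3 / v)"
  proof -
    have "1 + 2 / (pi * v) \<le> 1 + 1 / v" using pi_ge_two v by (simp add: field_simps)
    also have "\<dots> \<le> exp (1 / v)" by (rule exp_ge_add_one_self)
    finally have "(1 + 2 / (pi * v))\<^sup>2 \<le> (exp (1 / v))\<^sup>2" using v by (intro power_mono) auto
    hence 1: "(1 + 2 / (pi * v))\<^sup>2 \<le> exp (2 / v)" by (simp add: power2_eq_square flip: exp_add)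
    have "1 / c \<le> 2 * exp (1 / v)"
    proof (cases "1/2 \<le> 4 * v\<^sup>2")
      case True
      thus ?thesis using v by (simp add: c_def)
    next
      case False
      hence "1 / c = (1 / v)\<^sup>2 / 4" by (simp add: c_def power_divide)
      also have "\<dots> \<le> 2 * exp (1 / v)"
      proof -
        have "(1 / v)\<^sup>2 \<le> 2 * exp (1 / v)" using power_le_fact_exp[of "1 / v" 2] v by (simp add: fact_2)
        moreover have "exp (1 / v) > 0" by simp
        ultimately show ?thesis by linarith
      qed
      finally show ?thesis .
    qed
    hence 2: "2 / c \<le> 4 * exp (1 / v)" by linarith
    have "L \<le> 4 * exp (1 / v) * (4 * exp (2 / v))"
      unfolding L_def by (rule mult_mono[OF 2]) (use 1 in auto)
    also have "\<dots> = 16 * exp (1 / v + 2 / v)" unfolding exp_add by simp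
    also have "1 / v + 2 / v = 3 / v" by (simp flip: add_divide_distrib)
    finally show ?thesis .
  qed
  hence "L * int_square_const\<^sup>2 \<le> 16 * exp (3 / v) * int_square_const\<^sup>2" by (rule mult_right_mono) simp
  finally show ?thesis by (simp add: v_def mult_ac)
qed

definition zeta_two :: real where "zeta_two = (\<Sum>j. 1 / (real (Suc j))\<^sup>2)"

lemma zeta_two_summable: "summable (\<lambda>j. 1 / (real (Suc j))\<^sup>2)"
  using inverse_power_summable[of 2, where 'a = real] summable_Suc_iff[of "\<lambda>n. inverse (real n ^ 2)"]
  by (simp add: inverse_eq_divide)

text \<open>The logarithm is a double sum of r^(tj) / j. Summing over t first, with r^j / (1 - r^j)
  \<le> 1/(2 pi v j), leaves 1/(2 pi v) times the sum of 1/j^2.\<close>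

lemma prod_inverse_bound:
  assumes v: "v > 0"
  shows "(\<Prod>t<n. 1 / (1 - exp (- (2 * pi * v)) ^ Suc t)) \<le> exp (zeta_two / (2 * pi * v))"
proof -
  define r where "r = exp (- (2 * pi * v))"
  have r: "0 < r" "r < 1" using v by (auto simp: r_def)
  have rt: "0 < r ^ Suc t" "r ^ Suc t < 1" for t
    using r power_decreasing[of 1 "Suc t" r] by (auto simp del: power_Suc)
  have ser: "(\<lambda>j. x ^ Suc j / real (Suc j)) sums (- ln (1 - x))" if x: "0 < x" "x < 1" for x :: real
  proof -
    have "ln (1 - x) = (\<Sum>j. (- 1) ^ j * (1 / real (j + 1)) * ((1 - x) - 1) ^ Suc j)"
      using x by (intro ln_series) auto
    also have "(\<lambda>j. (- 1) ^ j * (1 / real (j + 1)) * ((1 - x) - 1) ^ Suc j) = (\<lambda>j. - (x ^ Suc j / real (Suc j)))"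
    proof
      fix j
      have "(- 1) ^ j * (- x) ^ Suc j = - (x ^ Suc j)"
        unfolding power_minus[of x] power_Suc by (simp flip: power_mult_distrib mult.assoc)
      thus "(- 1) ^ j * (1 / real (j + 1)) * ((1 - x) - 1) ^ Suc j = - (x ^ Suc j / real (Suc j))"
        by (simp add: field_simps del: power_Suc)
    qed
    finally have l: "ln (1 - x) = (\<Sum>j. - (x ^ Suc j / real (Suc j)))" .
    have s: "summable (\<lambda>j. x ^ Suc j / real (Suc j))"
    proof (rule summable_comparison_test)
      show "\<exists>N. \<forall>j\<ge>N. norm (x ^ Suc j / real (Suc j)) \<le> x ^ Suc j"
        using x by (intro exI[of _ 0] allI impI) (simp add: divide_le_eq mult_le_cancel_left1 del: power_Suc)
      show "summable (\<lambda>j. x ^ Suc j)" unfolding summable_Suc_iff using x by (intro summable_geometric) auto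
    qed
    have "- ln (1 - x) = (\<Sum>j. x ^ Suc j / real (Suc j))" unfolding l using s by (simp add: suminf_minus del: power_Suc)
    thus ?thesis using s by (simp add: sums_iff)
  qed
  have inner: "(\<Sum>t<n. (r ^ Suc t) ^ Suc j / real (Suc j)) \<le> 1 / (2 * pi * v) * (1 / (real (Suc j))\<^sup>2)" for j
  proof -
    define U where "U = 2 * pi * v * real (Suc j)"
    have U: "U > 0" using v by (simp add: U_def)
    define s where "s = exp (- U)"
    have s: "0 < s" "s < 1" using U by (auto simp: s_def)
    have rs: "r ^ Suc j = s" unfolding r_def s_def U_def exp_of_nat_mult[symmetric] by (simp only: mult_ac mult_minus_right)
    have "(\<Sum>t<n. (r ^ Suc t) ^ Suc j) = (\<Sum>t<n. s * s ^ t)"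
      by (intro sum.cong refl) (simp only: rs[symmetric] flip: power_mult power_Suc power_mult_distrib, simp add: power_add[symmetric] power_mult algebra_simps)
    also have "\<dots> \<le> (\<Sum>t. s * s ^ t)"
      using s by (intro sum_le_suminf summable_mult summable_geometric) auto
    also have "\<dots> = s / (1 - s)" using s by (simp add: suminf_mult suminf_geometric summable_geometric)
    also have "\<dots> = 1 / (exp U - 1)" using U by (simp add: s_def exp_minus field_simps)
    also have "\<dots> \<le> 1 / U"
    proof -
      have "U \<le> exp U - 1" using exp_ge_add_one_self[of U] by linarith
      thus ?thesis using U by (intro divide_left_mono mult_pos_pos) auto
    qed
    finally have "(\<Sum>t<n. (r ^ Suc t) ^ Suc j) / real (Suc j) \<le> 1 / U / real (Suc j)" by (rule divide_right_mono) simp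
    also have "1 / U / real (Suc j) = 1 / (2 * pi * v) * (1 / (real (Suc j))\<^sup>2)" by (simp add: U_def power2_eq_square)
    finally show ?thesis by (simp only: sum_divide_distrib)
  qed
  have s1: "summable (\<lambda>j. (r ^ Suc t) ^ Suc j / real (Suc j))" for t using ser[OF rt] by (rule sums_summable)
  have "(\<Sum>t<n. - ln (1 - r ^ Suc t)) = (\<Sum>t<n. \<Sum>j. (r ^ Suc t) ^ Suc j / real (Suc j))"
    by (intro sum.cong refl sums_unique ser rt)
  also have "\<dots> = (\<Sum>j. \<Sum>t<n. (r ^ Suc t) ^ Suc j / real (Suc j))" by (rule suminf_sum[OF s1, symmetric])
  also have "\<dots> \<le> (\<Sum>j. 1 / (2 * pi * v) * (1 / (real (Suc j))\<^sup>2))"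
    by (intro suminf_le inner summable_sum s1 summable_mult zeta_two_summable)
  also have "\<dots> = zeta_two / (2 * pi * v)" unfolding zeta_two_def by (subst suminf_mult[OF zeta_two_summable]) simp
  finally have le: "(\<Sum>t<n. - ln (1 - r ^ Suc t)) \<le> zeta_two / (2 * pi * v)" .
  have "(\<Prod>t<n. 1 / (1 - r ^ Suc t)) = exp (\<Sum>t<n. - ln (1 - r ^ Suc t))"
    unfolding exp_sum[OF finite_lessThan]
  proof (intro prod.cong refl)
    fix t
    have "1 - r ^ Suc t > 0" using rt[of t] by linarith
    thus "1 / (1 - r ^ Suc t) = exp (- ln (1 - r ^ Suc t))" by (simp only: exp_minus exp_ln inverse_eq_divide)
  qed
  also have "\<dots> \<le> exp (zeta_two / (2 * pi * v))" using le by (simp only: exp_le_cancel_iff)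
  finally show ?thesis unfolding r_def .
qed

text \<open>By Gauss's product, 1/\<open>theta4\<close> is the product of (1 + q^t) / (1 - q^t). As
  1 + x \<le> 1/(1 - x), it is bounded by the square of the product in
  \<open>prod_inverse_bound\<close>.\<close>

lemma theta4_inverse_bound:
  assumes w: "Im w > 0"
  shows "1 / norm (theta4 w) \<le> exp (zeta_two / (pi * Im w))"
proof -
  define q where "q = nome w"
  define r where "r = exp (- (2 * pi * Im w))"
  have nq: "norm q = r" by (simp add: q_def r_def nome_ee norm_ee)
  have q: "norm q < 1" using norm_nome w by (simp add: q_def)
  have r: "0 < r" "r < 1" using w by (auto simp: r_def)
  have lim: "(\<lambda>n. norm ((\<Prod>t<n. 1 + q ^ Suc t) / (\<Prod>t<n. 1 - q ^ Suc t))) \<longlonglongrightarrow> norm (qpoch_inf (-q) q / qpoch_inf q q)"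
    by (intro tendsto_norm tendsto_divide qpoch_q qpoch_mq q)
  have "norm (qpoch_inf (-q) q / qpoch_inf q q) \<le> exp (zeta_two / (pi * Im w))"
  proof (rule LIMSEQ_le_const2[OF lim], intro exI[of _ 0] allI impI)
    fix n
    have "norm ((\<Prod>t<n. 1 + q ^ Suc t) / (\<Prod>t<n. 1 - q ^ Suc t)) = (\<Prod>t<n. norm (1 + q ^ Suc t) / norm (1 - q ^ Suc t))"
      by (simp only: norm_divide prod_norm[symmetric] prod_dividef)
    also have "\<dots> \<le> (\<Prod>t<n. (1 / (1 - r ^ Suc t)) * (1 / (1 - r ^ Suc t)))"
    proof (rule prod_mono, intro conjI)
      fix t
      define x where "x = r ^ Suc t"
      have x: "0 < x" "x < 1" using r power_decreasing[of 1 "Suc t" r] by (auto simp: x_def simp del: power_Suc)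
      have nx: "norm (q ^ Suc t) = x" by (simp only: norm_power nq x_def)
      have "norm (1 + q ^ Suc t) \<le> 1 + x" using norm_triangle_ineq[of 1 "q ^ Suc t"] nx by simp
      also have "1 + x \<le> 1 / (1 - x)"
      proof -
        have "(1 + x) * (1 - x) \<le> 1" by (simp add: algebra_simps)
        thus ?thesis using x by (simp add: le_divide_eq)
      qed
      finally have n1: "norm (1 + q ^ Suc t) \<le> 1 / (1 - x)" .
      have n2: "norm (1 - q ^ Suc t) \<ge> 1 - x" using norm_triangle_ineq2[of 1 "q ^ Suc t"] nx by simp
      have "norm (1 + q ^ Suc t) / norm (1 - q ^ Suc t) \<le> (1 / (1 - x)) / (1 - x)"
        using n1 n2 x by (intro frac_le) auto
      thus "norm (1 + q ^ Suc t) / norm (1 - q ^ Suc t) \<le> (1 / (1 - r ^ Suc t)) * (1 / (1 - r ^ Suc t))"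
        by (simp add: x_def del: power_Suc)
    qed simp
    also have "\<dots> = (\<Prod>t<n. 1 / (1 - r ^ Suc t)) * (\<Prod>t<n. 1 / (1 - r ^ Suc t))" by (rule prod.distrib)
    also have "\<dots> \<le> exp (zeta_two / (2 * pi * Im w)) * exp (zeta_two / (2 * pi * Im w))"
    proof -
      have "1 - r ^ Suc t > 0" for t using r power_decreasing[of 1 "Suc t" r] by (simp del: power_Suc)
      hence "0 \<le> (\<Prod>t<n. 1 / (1 - r ^ Suc t))" by (intro prod_nonneg) (simp add: less_imp_le)
      thus ?thesis using prod_inverse_bound[OF w, of n, folded r_def] by (intro mult_mono) auto
    qed
    also have "\<dots> = exp (zeta_two / (pi * Im w))" by (simp flip: exp_add)
    finally show "norm ((\<Prod>t<n. 1 + q ^ Suc t) / (\<Prod>t<n. 1 - q ^ Suc t)) \<le> exp (zeta_two / (pi * Im w))" .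
  qed
  thus ?thesis unfolding theta4_product(1)[OF w] q_def by (simp add: norm_divide)
qed

text \<open>The bound for the lattice sum holds for |Re w| \<le> 1; integer periodicity carries it
  to the half-plane. A single constant serves as factor and in the exponent.\<close>

lemma maass_fn_bound:
  obtains K where "K > 0" "\<And>w. Im w > 0 \<Longrightarrow> norm (maass_fn w) \<le> K * exp (K / Im w)"
proof -
  define K0 where "K0 = 16 * int_square_const\<^sup>2"
  define K1 where "K1 = 3 + zeta_two / pi"
  define K where "K = 1 + K0 + \<bar>K1\<bar>"
  have K0: "K0 \<ge> 0" by (simp add: K0_def)
  have K: "K > 0" using K0 by (simp add: K_def)
  have b: "norm (maass_fn w) \<le> K * exp (K / Im w)" if w: "Im w > 0" "\<bar>Re w\<bar> \<le> 1" for w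
  proof -
    have p: "pi\<^sup>2 \<ge> 1" using pi_ge_two by (simp add: one_le_power)
    have "norm (maass_fn w) = norm (lattice_sum w) * (1 / norm (theta4 w)) / pi\<^sup>2"
      using w by (simp add: maass_fn_lattice_sum norm_divide norm_mult norm_power)
    also have "\<dots> \<le> norm (lattice_sum w) * (1 / norm (theta4 w)) / 1" using p by (intro divide_left_mono) auto
    also have "\<dots> \<le> (K0 * exp (3 / Im w)) * exp (zeta_two / (pi * Im w)) / 1"
      using lattice_sum_bound[OF w] theta4_inverse_bound[OF w(1)] K0 unfolding K0_def by (intro divide_right_mono mult_mono) auto
    also have "\<dots> = K0 * exp (K1 / Im w)" by (simp add: K1_def add_divide_distrib exp_add)
    also have "\<dots> \<le> K * exp (K / Im w)"
    proof (rule mult_mono)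
      have "K1 / Im w \<le> K / Im w" using w K0 by (intro divide_right_mono) (auto simp: K_def)
      thus "exp (K1 / Im w) \<le> exp (K / Im w)" by simp
    qed (use K0 K in \<open>auto simp: K_def\<close>)
    finally show ?thesis .
  qed
  have "norm (maass_fn w) \<le> K * exp (K / Im w)" if w: "Im w > 0" for w
  proof -
    define k where "k = - \<lfloor>Re w\<rfloor>"
    have "\<bar>Re (w + of_int k)\<bar> \<le> 1" unfolding k_def by (simp add: abs_le_iff) linarith
    hence "norm (maass_fn (w + of_int k)) \<le> K * exp (K / Im (w + of_int k))" using w by (intro b) auto
    thus ?thesis using maass_fn_periodic[OF w, of k] by simp
  qed
  thus ?thesis using K that by blast
qed

lemma norm_powr_of_real:
  fixes w :: complex
  shows "w \<noteq> 0 \<Longrightarrow> norm (w powr of_real s) = norm w powr s"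
  by (simp add: powr_def norm_exp_eq_Re)

lemma norm_maass_fn_moeb:
  assumes det: "a * d - b * c = 1" and c: "16 dvd c" and z: "Im z > 0"
  shows "norm (maass_fn (moeb a b c d z)) = norm (of_int c * z + of_int d :: complex) powr (3/2) * norm (maass_fn z)"
proof -
  have D: "of_int c * z + (of_int d :: complex) \<noteq> 0" by (rule moeb_denominator_nonzero[OF det z])
  have "norm (theta_eps d powr of_real (- 3)) = 1" unfolding theta_eps_powr by (simp add: theta_eps_def)
  moreover have "norm (of_int (shimura_symbol c d) :: complex) = 1" using maass_fn_moeb(3)[OF assms] by auto
  ultimately show ?thesis unfolding maass_fn_moeb(1)[OF assms] norm_mult norm_powr_of_real[OF D] by simp
qed

text \<open>With A the given matrix and T the unit translation, A T^(16k) A^(-1) has entries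
  \<open>a2\<close>, \<open>b2\<close>, \<open>c2\<close>, \<open>d2\<close>; its lower left entry
  is -16 k c^2, so it lies in \<open>Gamma0 16\<close>. The growth at the cusp therefore has period
  16 in Re z, and a bound uniform in Re z is needed on a strip only.\<close>

lemma maass_fn_growth_shift:
  fixes k :: int
  assumes det: "a * d - b * c = 1" and z: "Im z > 0"
  defines "z' \<equiv> z - of_int (16 * k)"
  shows "norm (of_int c * z + of_int d :: complex) powr (-3/2) * norm (maass_fn (moeb a b c d z)) =
     norm (of_int c * z' + of_int d :: complex) powr (-3/2) * norm (maass_fn (moeb a b c d z'))"
proof -
  have z': "Im z' > 0" using z by (simp add: z'_def)
  define D D' where "D = of_int c * z + (of_int d :: complex)" and "D' = of_int c * z' + (of_int d :: complex)"
  define N where "N = of_int a * z' + (of_int b :: complex)"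
  have D: "D \<noteq> 0" "D' \<noteq> 0" unfolding D_def D'_def by (rule moeb_denominator_nonzero[OF det z] moeb_denominator_nonzero[OF det z'])+
  define w where "w = moeb a b c d z'"
  have wN: "w = N / D'" by (simp add: w_def moeb_def N_def D'_def)
  have w: "Im w > 0" unfolding w_def by (rule Im_moeb_pos[OF det z'])
  define a2 b2 c2 d2 where "a2 = 1 - 16 * k * a * c" and "b2 = 16 * k * a * a" and "c2 = - 16 * k * c * c" and "d2 = 1 + 16 * k * a * c"
  have det2: "a2 * d2 - b2 * c2 = 1" by (simp add: a2_def b2_def c2_def d2_def algebra_simps)
  have ND: "of_int a * D' - of_int c * N = 1"
  proof -
    have "of_int a * D' - of_int c * N = of_int (a * d - b * c)" by (simp add: D'_def N_def algebra_simps)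
    thus ?thesis using det by simp
  qed
  have z_eq: "z = z' + 16 * of_int k" by (simp add: z'_def)
  have den: "of_int c2 * w + of_int d2 = D / D'"
  proof -
    have "(of_int c2 * w + of_int d2) * D' = D' + 16 * of_int k * of_int c * (of_int a * D' - of_int c * N)"
      using D by (simp add: wN c2_def d2_def algebra_simps)
    also have "\<dots> = D" unfolding ND by (simp add: D_def D'_def z_eq algebra_simps)
    finally show ?thesis using D by (simp add: field_simps)
  qed
  have num: "of_int a2 * w + of_int b2 = (of_int a * z + of_int b) / D'"
  proof -
    have "(of_int a2 * w + of_int b2) * D' = N + 16 * of_int k * of_int a * (of_int a * D' - of_int c * N)"
      using D by (simp add: wN a2_def b2_def algebra_simps)
    also have "\<dots> = of_int a * z + of_int b" unfolding ND by (simp add: N_def z_eq algebra_simps)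
    finally show ?thesis using D by (simp add: field_simps)
  qed
  have "moeb a2 b2 c2 d2 w = moeb a b c d z" unfolding moeb_def num den using D by (simp add: D_def)
  moreover have "norm (maass_fn (moeb a2 b2 c2 d2 w)) = norm (D / D') powr (3/2) * norm (maass_fn w)"
    using norm_maass_fn_moeb[OF det2 _ w] unfolding den by (simp add: c2_def)
  ultimately have e: "norm (maass_fn (moeb a b c d z)) = norm (D / D') powr (3/2) * norm (maass_fn w)" by simp
  have "norm D powr (-3/2) * norm (D / D') powr (3/2) = norm D' powr (-3/2)"
  proof -
    have "norm D powr (-3/2) * norm D powr (3/2) = 1" using D by (simp flip: powr_add)
    moreover have "norm D' powr (-3/2) = 1 / norm D' powr (3/2)" using powr_minus_divide[of "norm D'" "3/2"] by simp
    ultimately show ?thesis by (simp add: norm_divide powr_divide)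
  qed
  thus ?thesis unfolding e D_def[symmetric] D'_def[symmetric] w_def[symmetric] by (simp add: mult.assoc[symmetric])
qed

lemma maass_fn_growth:
  assumes det: "a * d - b * c = 1"
  shows "\<exists>C K. \<forall>z. Im z \<ge> 1 \<longrightarrow>
    norm ((of_int c * z + of_int d) powr of_real (-(3/2)) * maass_fn (moeb a b c d z)) \<le> K * exp (C * Im z)"
proof -
  obtain K where K: "K > 0" "\<And>w. Im w > 0 \<Longrightarrow> norm (maass_fn w) \<le> K * exp (K / Im w)" using maass_fn_bound by blast
  \<comment> \<open>After reduction |Re z'| \<le> 16, so |z'| \<le> 17 y for y at least 1, and |cz'
    + d| \<le> M y. As K / Im (Az') = K |cz' + d|^2 / y, the exponent is at most K M^2 y.\<close>
  define M where "M = (17 * \<bar>of_int c\<bar> + \<bar>of_int d\<bar> :: real)"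
  have "norm ((of_int c * z + of_int d) powr of_real (-(3/2)) * maass_fn (moeb a b c d z)) \<le> K * exp ((K * M\<^sup>2) * Im z)"
    if z1: "Im z \<ge> 1" for z
  proof -
    define y where "y = Im z"
    have z: "Im z > 0" "y \<ge> 1" using z1 by (auto simp: y_def)
    define k where "k = \<lfloor>Re z / 16\<rfloor>"
    define z' where "z' = z - of_int (16 * k)"
    have I: "Im z' = y" by (simp add: z'_def y_def)
    have "of_int k \<le> Re z / 16" "Re z / 16 < of_int k + 1" unfolding k_def by linarith+
    hence R: "\<bar>Re z'\<bar> \<le> 16" by (simp add: z'_def)
    define D' where "D' = of_int c * z' + (of_int d :: complex)"
    have D: "of_int c * z + (of_int d :: complex) \<noteq> 0" by (rule moeb_denominator_nonzero[OF det z(1)])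
    have "norm ((of_int c * z + of_int d) powr of_real (-(3/2)) * maass_fn (moeb a b c d z)) =
       norm (of_int c * z + of_int d :: complex) powr (-3/2) * norm (maass_fn (moeb a b c d z))"
      unfolding norm_mult norm_powr_of_real[OF D] by simp
    also have "\<dots> = norm D' powr (-3/2) * norm (maass_fn (moeb a b c d z'))"
      unfolding D'_def z'_def by (rule maass_fn_growth_shift[OF det z(1)])
    also have "\<dots> \<le> 1 * (K * exp ((K * M\<^sup>2) * y))"
    proof (rule mult_mono)
      have z': "Im z' > 0" using I z by simp
      \<comment> \<open>This disposes of the weight factor, whose exponent is negative.\<close>
      have "norm D' \<ge> 1"
      proof (cases "c = 0")
        case True
        hence "d = 1 \<or> d = -1" using det by (metis diff_zero mult_zero_right zmult_eq_1_iff)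
        thus ?thesis using True by (auto simp: D'_def)
      next
        case False
        have "1 * 1 \<le> \<bar>of_int c\<bar> * y" using False z by (intro mult_mono) auto
        also have "\<dots> = \<bar>Im D'\<bar>" using z by (simp add: D'_def I abs_mult)
        also have "\<dots> \<le> norm D'" by (rule abs_Im_le_cmod)
        finally show ?thesis by simp
      qed
      hence "norm D' powr (-3/2) \<le> 1 powr (-3/2)" by (intro powr_mono2') auto
      thus "norm D' powr (-3/2) \<le> 1" by simp
      have "norm z' \<le> 17 * y" using cmod_le[of z'] R I z by simp
      hence "\<bar>of_int c\<bar> * norm z' + \<bar>of_int d\<bar> * 1 \<le> \<bar>of_int c\<bar> * (17 * y) + \<bar>of_int d\<bar> * y"
        using z by (intro add_mono mult_left_mono) auto
      hence "norm D' \<le> M * y"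
        using norm_triangle_ineq[of "of_int c * z'" "of_int d"] by (simp add: D'_def M_def norm_mult algebra_simps)
      hence "(norm D')\<^sup>2 \<le> (M * y)\<^sup>2" by (intro power_mono) auto
      hence "(norm D')\<^sup>2 / y \<le> M\<^sup>2 * y" using z by (simp add: power2_eq_square field_simps)
      hence "K * ((norm D')\<^sup>2 / y) \<le> K * (M\<^sup>2 * y)" using K(1) by (intro mult_left_mono) auto
      moreover have "K / Im (moeb a b c d z') = K * ((norm D')\<^sup>2 / y)" unfolding Im_moeb[OF det] by (simp add: I D'_def)
      ultimately have "K / Im (moeb a b c d z') \<le> K * (M\<^sup>2 * y)" by (simp only:)
      hence "K * exp (K / Im (moeb a b c d z')) \<le> K * exp ((K * M\<^sup>2) * y)" using K(1) by (simp add: mult.assoc)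
      thus "norm (maass_fn (moeb a b c d z')) \<le> K * exp ((K * M\<^sup>2) * y)"
        using K(2)[OF Im_moeb_pos[OF det z']] by linarith
    qed (use K(1) in auto)
    finally show ?thesis by (simp add: y_def)
  qed
  thus ?thesis by blast
qed

section \<open>Smoothness and the Laplace equation\<close>

lemma Ck_on_cong:
  assumes "open S" "\<And>z. z \<in> S \<Longrightarrow> f z = g z" "Ck_on n f S"
  shows "Ck_on n g S"
  using assms(2,3)
proof (induction n arbitrary: f g)
  case 0
  thus ?case by (simp cong: continuous_on_cong)
next
  case (Suc n)
  have d: "(g has_derivative frechet_derivative f (at z)) (at z)" if "z \<in> S" for z
  proof (rule has_derivative_transform_within_open[OF _ assms(1) that])
    show "(f has_derivative frechet_derivative f (at z)) (at z)"
      using Suc.prems(2) that by (simp add: frechet_derivative_works)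
  qed (use Suc.prems in auto)
  hence fd: "frechet_derivative g (at z) = frechet_derivative f (at z)" if "z \<in> S" for z
    using that frechet_derivative_at by force
  have "Ck_on n (\<lambda>z. frechet_derivative g (at z) v) S" for v
    by (rule Suc.IH[of "\<lambda>z. frechet_derivative f (at z) v"]) (use fd Suc.prems in auto)
  thus ?case using d by (auto simp: differentiable_def)
qed

text \<open>\<open>Ck_on\<close> speaks of the derivative selected by
  \<open>frechet_derivative\<close>; on an open set this rule lets an explicit formula take its
  place.\<close>

lemma Ck_on_SucI:
  assumes "open S" "\<And>z. z \<in> S \<Longrightarrow> (f has_derivative f' z) (at z)" "\<And>v. Ck_on n (\<lambda>z. f' z v) S"
  shows "Ck_on (Suc n) f S"
proof -
  have "frechet_derivative f (at z) = f' z" if "z \<in> S" for z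
    using assms(2)[OF that] frechet_derivative_at by force
  hence "Ck_on n (\<lambda>z. frechet_derivative f (at z) v) S" for v
    by (intro Ck_on_cong[OF assms(1) _ assms(3)[of v]]) auto
  thus ?thesis using assms(2) by (auto simp: differentiable_def)
qed

lemma Ck_on_SucD:
  assumes "Ck_on (Suc n) f S" "z \<in> S"
  shows "(f has_derivative frechet_derivative f (at z)) (at z)"
  using assms by (simp add: frechet_derivative_works)

lemma Ck_on_Suc_imp: "Ck_on (Suc n) f S \<Longrightarrow> Ck_on n f S"
proof (induction n arbitrary: f)
  case 0
  thus ?case by (auto intro!: differentiable_imp_continuous_within continuous_at_imp_continuous_on)
qed auto

lemma Ck_on_add:
  assumes "open S" shows "Ck_on n f S \<Longrightarrow> Ck_on n g S \<Longrightarrow> Ck_on n (\<lambda>z. f z + g z) S"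
proof (induction n arbitrary: f g)
  case 0
  thus ?case by (auto intro: continuous_intros)
next
  case (Suc n)
  show ?case
  proof (rule Ck_on_SucI[OF assms])
    show "((\<lambda>z. f z + g z) has_derivative (\<lambda>v. frechet_derivative f (at z) v + frechet_derivative g (at z) v)) (at z)"
      if "z \<in> S" for z
      by (intro has_derivative_add Ck_on_SucD[OF Suc.prems(1) that] Ck_on_SucD[OF Suc.prems(2) that])
    show "Ck_on n (\<lambda>z. frechet_derivative f (at z) v + frechet_derivative g (at z) v) S" for v
      by (rule Suc.IH) (use Suc.prems in auto)
  qed
qed

lemma Ck_on_mult:
  assumes "open S" shows "Ck_on n f S \<Longrightarrow> Ck_on n g S \<Longrightarrow> Ck_on n (\<lambda>z. f z * g z) S"
proof (induction n arbitrary: f g)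
  case 0
  thus ?case by (auto intro: continuous_intros)
next
  case (Suc n)
  show ?case
  proof (rule Ck_on_SucI[OF assms])
    show "((\<lambda>z. f z * g z) has_derivative (\<lambda>v. f z * frechet_derivative g (at z) v + frechet_derivative f (at z) v * g z)) (at z)"
      if "z \<in> S" for z
      by (intro has_derivative_mult Ck_on_SucD[OF Suc.prems(1) that] Ck_on_SucD[OF Suc.prems(2) that])
    have "Ck_on n f S" "Ck_on n g S" using Ck_on_Suc_imp[OF Suc.prems(1)] Ck_on_Suc_imp[OF Suc.prems(2)] .
    thus "Ck_on n (\<lambda>z. f z * frechet_derivative g (at z) v + frechet_derivative f (at z) v * g z) S" for v
      by (intro Ck_on_add[OF assms] Suc.IH) (use Suc.prems in auto)
  qed
qed

lemma Ck_on_const: "open S \<Longrightarrow> Ck_on n (\<lambda>z. c) S"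
proof (induction n arbitrary: c)
  case (Suc n)
  show ?case
    by (rule Ck_on_SucI[OF Suc.prems has_derivative_const]) (rule Suc.IH[OF Suc.prems])
qed auto

lemma has_derivative_holomorphic:
  assumes "open S" "f holomorphic_on S" "z \<in> S"
  shows "(f has_derivative (\<lambda>v. deriv f z * v)) (at z)"
  using holomorphic_derivI[OF assms(2,1,3)] by (simp add: has_field_derivative_def)

lemma Ck_on_holomorphic:
  assumes "open S" shows "f holomorphic_on S \<Longrightarrow> Ck_on n f S"
proof (induction n arbitrary: f)
  case 0
  thus ?case by (auto intro: holomorphic_on_imp_continuous_on)
next
  case (Suc n)
  show ?case
  proof (rule Ck_on_SucI[OF assms])
    show "(f has_derivative (\<lambda>v. deriv f z * v)) (at z)" if "z \<in> S" for z
      by (rule has_derivative_holomorphic[OF assms Suc.prems that])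
    show "Ck_on n (\<lambda>z. deriv f z * v) S" for v
      by (intro Suc.IH holomorphic_on_mult holomorphic_on_const holomorphic_deriv assms Suc.prems)
  qed
qed

lemma Ck_on_cnj_holomorphic:
  assumes "open S" shows "f holomorphic_on S \<Longrightarrow> Ck_on n (\<lambda>z. cnj (f z)) S"
proof (induction n arbitrary: f)
  case 0
  thus ?case by (simp add: continuous_on_cnj holomorphic_on_imp_continuous_on)
next
  case (Suc n)
  show ?case
  proof (rule Ck_on_SucI[OF assms])
    show "((\<lambda>z. cnj (f z)) has_derivative (\<lambda>v. cnj (deriv f z * v))) (at z)" if "z \<in> S" for z
      by (intro has_derivative_cnj has_derivative_holomorphic[OF assms Suc.prems that])
    show "Ck_on n (\<lambda>z. cnj (deriv f z * v)) S" for v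
      by (intro Suc.IH holomorphic_on_mult holomorphic_on_const holomorphic_deriv assms Suc.prems)
  qed
qed

lemma has_derivative_Im_powr:
  assumes "Im z > 0"
  shows "((\<lambda>z. complex_of_real (Im z powr p)) has_derivative (\<lambda>v. of_real (p * Im v * Im z powr (p - 1)))) (at z)"
proof -
  have "((\<lambda>t. t powr p) has_derivative (*) (p * Im z powr (p - 1))) (at (Im z))"
    using has_real_derivative_powr[OF assms, of p] by (simp add: has_field_derivative_def)
  hence "((\<lambda>z. Im z powr p) has_derivative (\<lambda>v. p * Im z powr (p - 1) * Im v)) (at z)"
    by (rule has_derivative_compose[rotated]) (auto intro!: derivative_eq_intros)
  hence "((\<lambda>z. complex_of_real (Im z powr p)) has_derivative (\<lambda>v. of_real (p * Im z powr (p - 1) * Im v))) (at z)"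
    by (rule has_derivative_of_real)
  thus ?thesis by (simp add: mult_ac)
qed

lemma Ck_on_Im_powr: "Ck_on n (\<lambda>z. complex_of_real (Im z powr p)) upper_half_plane"
proof (induction n arbitrary: p)
  case 0
  show ?case by (auto intro!: continuous_intros)
next
  case (Suc n)
  show ?case
  proof (rule Ck_on_SucI[OF open_upper_half has_derivative_Im_powr])
    show "Ck_on n (\<lambda>z. complex_of_real (p * Im v * Im z powr (p - 1))) upper_half_plane" for v
      using Ck_on_mult[OF open_upper_half Ck_on_const[OF open_upper_half, of n "of_real (p * Im v)"] Suc.IH[of "p - 1"]] by simp
  qed simp
qed

text \<open>\<open>int_decode\<close> turns the sum into a series that can be differentiated term by
  term. The single majorant \<open>M\<close> controls the terms and the operator norms of their
  derivatives; its tails give the uniform convergence.\<close>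

lemma has_derivative_infsum_int:
  fixes f :: "int \<Rightarrow> complex \<Rightarrow> complex"
  assumes "open S" "convex S" "\<And>i x. x \<in> S \<Longrightarrow> (f i has_derivative f' i x) (at x)"
    "\<And>i x h. x \<in> S \<Longrightarrow> norm (f' i x h) \<le> M i * norm h"
    "\<And>i x. x \<in> S \<Longrightarrow> norm (f i x) \<le> M i" "M summable_on UNIV" "x \<in> S"
  shows "((\<lambda>x. \<Sum>\<^sub>\<infinity>i. f i x) has_derivative (\<lambda>h. \<Sum>\<^sub>\<infinity>i. f' i x h)) (at x)"
proof -
  define N where "N = (\<lambda>n. M (int_decode n))"
  have bij: "bij_betw int_decode UNIV UNIV" by (rule bij_int_decode)
  have M0: "M i \<ge> 0" for i using assms(5,7) norm_ge_zero order_trans by blast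
  have "N summable_on UNIV" unfolding N_def using summable_on_reindex_bij_betw[OF bij, of M] assms(6) by simp
  hence N: "summable N" by (rule summable_on_imp_summable)
  have N0: "N n \<ge> 0" for n by (simp add: N_def M0)
  have conv: "(\<Sum>\<^sub>\<infinity>i. u i) = (\<Sum>n. u (int_decode n))" "summable (\<lambda>n. u (int_decode n))"
    if "\<And>i. norm (u i) \<le> C * M i" for u :: "int \<Rightarrow> complex" and C
  proof -
    have "u summable_on UNIV"
      by (rule summable_on_norm_comparison(2)[OF summable_on_cmult_right[OF assms(6)] that])
    hence s: "(\<lambda>n. u (int_decode n)) summable_on UNIV" using summable_on_reindex_bij_betw[OF bij, of u] by simp
    thus "summable (\<lambda>n. u (int_decode n))" by (rule summable_on_imp_summable)
    show "(\<Sum>\<^sub>\<infinity>i. u i) = (\<Sum>n. u (int_decode n))"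
      using infsum_reindex_bij_betw[OF bij, of u] infsum_eq_suminf[OF s] by simp
  qed
  have cf: "(\<Sum>\<^sub>\<infinity>i. f i x) = (\<Sum>n. f (int_decode n) x)" "summable (\<lambda>n. f (int_decode n) x)" if "x \<in> S" for x
    using conv[of "\<lambda>i. f i x" 1] assms(5)[OF that] by auto
  have cf': "(\<Sum>\<^sub>\<infinity>i. f' i x h) = (\<Sum>n. f' (int_decode n) x h)" "summable (\<lambda>n. f' (int_decode n) x h)" if "x \<in> S" for x h
    using conv[of "\<lambda>i. f' i x h" "norm h"] assms(4)[OF that] by (auto simp: mult.commute)
  have "\<exists>g. \<forall>x\<in>S. (\<lambda>n. f (int_decode n) x) sums g x \<and> (g has_derivative (\<lambda>h. \<Sum>\<^sub>\<infinity>i. f' i x h)) (at x within S)"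
  proof (rule has_derivative_series[OF assms(2), where f' = "\<lambda>n. f' (int_decode n)"])
    show "(f (int_decode n) has_derivative f' (int_decode n) x) (at x within S)" if "x \<in> S" for n x
      by (rule has_derivative_at_withinI[OF assms(3)[OF that]])
    fix e :: real assume e: "e > 0"
    have "(\<lambda>n. \<Sum>i. N (i + n)) \<longlonglongrightarrow> 0" by (rule suminf_exist_split2[OF N])
    hence "\<forall>\<^sub>F n in sequentially. (\<Sum>i. N (i + n)) < e" using e by (rule order_tendstoD(2))
    thus "\<forall>\<^sub>F n in sequentially. \<forall>x\<in>S. \<forall>h. norm ((\<Sum>i<n. f' (int_decode i) x h) - (\<Sum>\<^sub>\<infinity>i. f' i x h)) \<le> e * norm h"
    proof eventually_elim
      case (elim n)
      show ?case
      proof (intro ballI allI)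
        fix x h assume x: "x \<in> S"
        have s: "summable (\<lambda>i. f' (int_decode i) x h)" by (rule cf'(2)[OF x])
        have "(\<Sum>i. f' (int_decode i) x h) = (\<Sum>i. f' (int_decode (i + n)) x h) + (\<Sum>i<n. f' (int_decode i) x h)"
          by (rule suminf_split_initial_segment[OF s])
        hence "norm ((\<Sum>i<n. f' (int_decode i) x h) - (\<Sum>\<^sub>\<infinity>i. f' i x h)) = norm (\<Sum>i. f' (int_decode (i + n)) x h)"
          unfolding cf'(1)[OF x] by (simp add: norm_minus_commute)
        also have "\<dots> \<le> (\<Sum>i. N (i + n) * norm h)"
        proof (rule norm_suminf_le)
          show "norm (f' (int_decode (i + n)) x h) \<le> N (i + n) * norm h" for i
            unfolding N_def by (rule assms(4)[OF x])
          show "summable (\<lambda>i. N (i + n) * norm h)"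
            using N by (intro summable_mult2) (simp add: summable_iff_shift)
        qed
        also have "\<dots> = (\<Sum>i. N (i + n)) * norm h"
          using N by (intro suminf_mult2[symmetric]) (simp add: summable_iff_shift)
        also have "\<dots> \<le> e * norm h" using elim by (intro mult_right_mono) auto
        finally show "norm ((\<Sum>i<n. f' (int_decode i) x h) - (\<Sum>\<^sub>\<infinity>i. f' i x h)) \<le> e * norm h" .
      qed
    qed
  next
    show "x \<in> S" by (rule assms(7))
    show "(\<lambda>n. f (int_decode n) x) sums (\<Sum>n. f (int_decode n) x)"
      using cf(2)[OF assms(7)] by (rule summable_sums)
  qed
  then obtain g where g: "\<And>x. x \<in> S \<Longrightarrow> (\<lambda>n. f (int_decode n) x) sums g x"
     "\<And>x. x \<in> S \<Longrightarrow> (g has_derivative (\<lambda>h. \<Sum>\<^sub>\<infinity>i. f' i x h)) (at x within S)" by blast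
  have eq: "g x = (\<Sum>\<^sub>\<infinity>i. f i x)" if "x \<in> S" for x
    using g(1)[OF that] cf(1)[OF that] by (simp add: sums_iff)
  have D: "(g has_derivative (\<lambda>h. \<Sum>\<^sub>\<infinity>i. f' i x h)) (at x)"
    using g(2)[OF assms(7)] unfolding at_within_open[OF assms(7,1)] .
  show ?thesis
    by (rule has_derivative_transform_within_open[OF D assms(1,7)]) (rule eq)
qed

text \<open>For nonzero \<open>n\<close> this is 2 sqrt(pi) |n| times the incomplete gamma function
  Gamma(-1/2, 4 pi n^2 y); for \<open>n = 0\<close> it is 2 y^(-1/2). The integral covers both cases
  at once.\<close>

definition gauss_tail :: "int \<Rightarrow> real \<Rightarrow> real" where
  "gauss_tail n y = (LBINT t:{y<..}. t powr (-3/2) * exp (- (4 * pi * t) * (of_int n)\<^sup>2))"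

lemma powr_tail:
  assumes y: "y > 0"
  shows "set_integrable lborel {y<..} (\<lambda>t::real. t powr (-3/2))"
    and "(LBINT t:{y<..}. t powr (-3/2)) = 2 * y powr (-1/2)"
proof -
  have e: "einterval (ereal y) \<infinity> = {y<..}" by (auto simp: einterval_def)
  define F where "F = (\<lambda>t::real. - 2 * t powr (-1/2))"
  have F: "(F has_real_derivative t powr (-3/2)) (at t)" if "t > 0" for t
    unfolding F_def using that by (auto intro!: derivative_eq_intros)
  have Fy: "(F \<longlongrightarrow> F y) (at_right y)"
    using DERIV_isCont[OF F[OF y]] unfolding isCont_def by (rule tendsto_within_subset) simp
  have Fi: "(F \<longlongrightarrow> 0) at_top" unfolding F_def by real_asymp
  have c: "isCont (\<lambda>t::real. t powr (-3/2)) t" if "t > y" for t using that y by (intro continuous_intros) auto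
  have 1: "set_integrable lborel (einterval (ereal y) \<infinity>) (\<lambda>t::real. t powr (-3/2))"
    by (rule interval_integral_FTC_nonneg(1)[where F = F and A = "F y" and B = 0])
       (use F c Fy Fi y in \<open>auto simp: ereal_tendsto_simps1\<close>)
  have 2: "(LBINT t=ereal y..\<infinity>. t powr (-3/2)) = 0 - F y"
    by (rule interval_integral_FTC_nonneg(2)[where F = F and A = "F y" and B = 0])
       (use F c Fy Fi y in \<open>auto simp: ereal_tendsto_simps1\<close>)
  show "set_integrable lborel {y<..} (\<lambda>t::real. t powr (-3/2))" using 1 by (simp add: e)
  show "(LBINT t:{y<..}. t powr (-3/2)) = 2 * y powr (-1/2)"
    using 2 by (simp add: e interval_lebesgue_integral_def F_def)
qed

lemma gauss_tail_integrable:
  assumes y: "y > 0"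
  shows "set_integrable lborel {y<..} (\<lambda>t. t powr (-3/2) * exp (- (4 * pi * t) * (of_int n)\<^sup>2))"
proof (rule set_integrable_bound[OF powr_tail(1)[OF y]])
  have "continuous_on {y<..} (\<lambda>t. t powr (-3/2) * exp (- (4 * pi * t) * (of_int n)\<^sup>2))"
    using y by (intro continuous_intros) auto
  from borel_measurable_continuous_on_indicator[OF _ this]
  show "set_borel_measurable lborel {y<..} (\<lambda>t. t powr (-3/2) * exp (- (4 * pi * t) * (of_int n)\<^sup>2))"
    by (simp add: set_borel_measurable_def)
qed (use y in \<open>auto intro!: AE_I2 mult_left_le\<close>)

lemma gauss_tail_bounds:
  assumes y: "y > 0"
  shows "0 \<le> gauss_tail n y" "gauss_tail n y \<le> exp (- (4 * pi * y) * (of_int n)\<^sup>2) * (2 * y powr (-1/2))"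
proof -
  show "0 \<le> gauss_tail n y" unfolding gauss_tail_def set_lebesgue_integral_def
    by (rule Bochner_Integration.integral_nonneg) (simp add: indicator_def)
  have "gauss_tail n y \<le> (LBINT t:{y<..}. exp (- (4 * pi * y) * (of_int n)\<^sup>2) * t powr (-3/2))"
    unfolding gauss_tail_def
  proof (rule set_integral_mono[OF gauss_tail_integrable[OF y]])
    show "set_integrable lborel {y<..} (\<lambda>t. exp (- (4 * pi * y) * (of_int n)\<^sup>2) * t powr (-3/2))"
      by (intro set_integrable_mult_right powr_tail(1)[OF y])
    fix t assume "t \<in> {y<..}"
    hence "exp (- (4 * pi * t) * (of_int n)\<^sup>2) \<le> exp (- (4 * pi * y) * (of_int n)\<^sup>2)"
      by (simp add: mult_right_mono)
    hence "exp (- (4 * pi * t) * (of_int n)\<^sup>2) * t powr (-3/2) \<le> exp (- (4 * pi * y) * (of_int n)\<^sup>2) * t powr (-3/2)"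
      by (rule mult_right_mono) simp
    thus "t powr (-3/2) * exp (- (4 * pi * t) * (of_int n)\<^sup>2) \<le> exp (- (4 * pi * y) * (of_int n)\<^sup>2) * t powr (-3/2)"
      by (simp only: mult.commute)
  qed
  also have "\<dots> = exp (- (4 * pi * y) * (of_int n)\<^sup>2) * (2 * y powr (-1/2))"
    by (simp only: set_integral_mult_right powr_tail(2)[OF y])
  finally show "gauss_tail n y \<le> exp (- (4 * pi * y) * (of_int n)\<^sup>2) * (2 * y powr (-1/2))" .
qed

text \<open>Near \<open>y\<close> the function is the tail from y/2, a constant, minus a proper
  integral starting at y/2, to which the fundamental theorem of calculus applies. The base point y/2
  stays clear of the singularity at 0.\<close>

lemma gauss_tail_derivative:
  assumes y: "y > 0"
  shows "(gauss_tail n has_real_derivative - (y powr (-3/2) * exp (- (4 * pi * y) * (of_int n)\<^sup>2))) (at y)"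
proof -
  define f where "f = (\<lambda>t. t powr (-3/2) * exp (- (4 * pi * t) * (of_int n)\<^sup>2))"
  define a b where "a = y / 2" and "b = 2 * y"
  have ab: "0 < a" "a < y" "y < b" using y by (auto simp: a_def b_def)
  have cf: "continuous_on {u..w} f" if "u > 0" for u w
    unfolding f_def using that by (intro continuous_intros) auto
  have gauss_tail_split: "gauss_tail n u = gauss_tail n a - integral {a..u} f" if "u \<ge> a" for u
  proof -
    have "set_integrable lborel {a<..} f" unfolding f_def by (rule gauss_tail_integrable[OF ab(1)])
    hence i: "set_integrable lborel {a<..u} f" "set_integrable lborel {u<..} f"
      using that by (auto intro: set_integrable_subset)
    have "{a<..} = {a<..u} \<union> {u<..}" using that by auto
    hence "gauss_tail n a = (LBINT t:{a<..u} \<union> {u<..}. f t)" by (simp add: gauss_tail_def f_def)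
    also have "\<dots> = (LBINT t:{a<..u}. f t) + (LBINT t:{u<..}. f t)"
      by (rule set_integral_Un[OF _ i]) auto
    also have "(LBINT t:{u<..}. f t) = gauss_tail n u" by (simp add: gauss_tail_def f_def)
    also have "(LBINT t:{a<..u}. f t) = (LBINT t:{a..u}. f t)"
      unfolding set_lebesgue_integral_def
    proof (rule integral_cong_AE)
      show "(\<lambda>t. indicator {a<..u} t *\<^sub>R f t) \<in> borel_measurable lborel"
        using i(1) unfolding set_integrable_def by (rule borel_measurable_integrable)
      show "(\<lambda>t. indicator {a..u} t *\<^sub>R f t) \<in> borel_measurable lborel"
        using borel_integrable_atLeastAtMost'[OF cf[OF ab(1)]] unfolding set_integrable_def
        by (rule borel_measurable_integrable)
      show "AE t in lborel. indicator {a<..u} t *\<^sub>R f t = indicator {a..u} t *\<^sub>R f t"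
        using AE_lborel_singleton[of a] by eventually_elim (auto simp: indicator_def)
    qed
    also have "\<dots> = integral {a..u} f"
      by (rule set_borel_integral_eq_integral(2)[OF borel_integrable_atLeastAtMost'[OF cf[OF ab(1)]]])
    finally show ?thesis by simp
  qed
  have "((\<lambda>u. integral {a..u} f) has_real_derivative f y) (at y within {a..b})"
    by (rule integral_has_real_derivative[OF cf[OF ab(1)]]) (use ab in auto)
  hence "((\<lambda>u. integral {a..u} f) has_real_derivative f y) (at y)"
    using ab by (simp add: at_within_Icc_at)
  hence "((\<lambda>u. gauss_tail n a - integral {a..u} f) has_real_derivative - f y) (at y)"
    by (auto intro!: derivative_eq_intros)
  moreover have "\<forall>\<^sub>F u in nhds y. gauss_tail n a - integral {a..u} f = gauss_tail n u"
  proof -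
    have "\<forall>\<^sub>F u in nhds y. u \<in> {a<..}" by (rule eventually_nhds_in_open) (use ab in auto)
    thus ?thesis by eventually_elim (rule gauss_tail_split[symmetric], simp)
  qed
  ultimately have "(gauss_tail n has_real_derivative - f y) (at y)"
    using DERIV_cong_ev[of y y "\<lambda>u. gauss_tail n a - integral {a..u} f" "gauss_tail n" "- f y" "- f y"] by simp
  thus ?thesis by (simp add: f_def)
qed


section \<open>The series of the nonholomorphic part and its derivatives\<close>

definition nonhol_sum :: "nat \<Rightarrow> complex \<Rightarrow> complex" where
  "nonhol_sum k z = (\<Sum>\<^sub>\<infinity>n::int. ee (of_int n / 2) * of_int n ^ (2 * k) * (ee (- (of_int (n\<^sup>2) * z)) * of_real (gauss_tail n (Im z))))"

text \<open>The k-th derivative of \<open>theta4\<close> divided by (2 pi i)^k. The weights n^(2k)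
  are carried along so that \<open>nonhol_sum\<close>, together with the conjugates of these moments
  and powers of Im z, is closed under differentiation.\<close>

definition theta4_moment :: "nat \<Rightarrow> complex \<Rightarrow> complex" where
  "theta4_moment k z = (\<Sum>\<^sub>\<infinity>n::int. ee (of_int n / 2) * of_int n ^ (2 * k) * ee (of_int (n\<^sup>2) * z))"

lemma theta4_moment_0: "theta4_moment 0 = theta4"
  by (simp add: fun_eq_iff theta4_moment_def theta4_series)

lemma norm_ee_half_int [simp]: "norm (ee (of_int n / 2)) = 1"
  unfolding ee_half_int by simp

lemma cnj_ee_half_int: "cnj (ee (of_int n / 2)) = ee (of_int n / 2)"
  unfolding ee_half_int by simp

lemma summable_on_theta_majorant:
  assumes "a > 0"
  shows "(\<lambda>n::int. C * (\<bar>of_int n\<bar> ^ m * exp (- (2 * pi * a) * (of_int n)\<^sup>2)) :: real) summable_on UNIV"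
  using assms by (intro summable_on_cmult_right summable_on_gaussian_poly) simp

lemma norm_coeff: "norm (ee (of_int n / 2) * of_int n ^ k) = \<bar>of_int n\<bar> ^ k"
  by (simp add: norm_mult norm_power)

lemma theta4_moment_deriv:
  assumes z: "Im z > 0"
  shows "(theta4_moment k has_field_derivative 2 * of_real pi * \<i> * theta4_moment (Suc k) z) (at z)"
proof -
  define a where "a = Im z / 2"
  define S where "S = {w. a < Im w}"
  define c where "c = (\<lambda>n::int. ee (of_int n / 2) * of_int n ^ (2 * k))"
  \<comment> \<open>The first part majorizes the derivative, whose weight has gained n^2, the second
    the term itself, both on the open and convex half-plane above Im z / 2.\<close>
  define M where "M = (\<lambda>n::int. 2 * pi * (\<bar>of_int n\<bar> ^ (2 * Suc k) * exp (- (2 * pi * a) * (of_int n)\<^sup>2)) + 1 * (\<bar>of_int n\<bar> ^ (2 * k) * exp (- (2 * pi * a) * (of_int n)\<^sup>2)) :: real)"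
  have a: "a > 0" using z by (simp add: a_def)
  have M: "M summable_on UNIV" unfolding M_def by (intro summable_on_add summable_on_theta_majorant a)
  have S: "open S" "convex S" unfolding S_def by (simp_all add: open_Collect_less continuous_intros convex_halfspace_Im_gt)
  have c2: "c n * of_int (n\<^sup>2) = ee (of_int n / 2) * of_int n ^ (2 * Suc k)" for n
    by (simp add: c_def power2_eq_square)
  have e: "norm (ee (of_int (n\<^sup>2) * w)) \<le> exp (- (2 * pi * a) * (of_int n)\<^sup>2)" if "w \<in> S" for n w
    using that by (intro norm_ee_square_le) (simp add: S_def)
  have D: "((\<lambda>w. \<Sum>\<^sub>\<infinity>n. c n * ee (of_int (n\<^sup>2) * w)) has_derivative (\<lambda>h. \<Sum>\<^sub>\<infinity>n. (2 * of_real pi * \<i> * h) * (ee (of_int n / 2) * of_int n ^ (2 * Suc k) * ee (of_int (n\<^sup>2) * z)))) (at z)"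
  proof (rule has_derivative_infsum_int[OF S, where M = M])
    fix n w assume w: "w \<in> S"
    have "((\<lambda>w. c n * ee (of_int (n\<^sup>2) * w)) has_field_derivative c n * (ee (of_int (n\<^sup>2) * w) * (2 * of_real pi * \<i> * of_int (n\<^sup>2)))) (at w)"
      unfolding ee_def by (auto intro!: derivative_eq_intros simp del: of_int_power)
    moreover have "(*) (c n * (ee (of_int (n\<^sup>2) * w) * (2 * of_real pi * \<i> * of_int (n\<^sup>2)))) =
       (\<lambda>h. (2 * of_real pi * \<i> * h) * (ee (of_int n / 2) * of_int n ^ (2 * Suc k) * ee (of_int (n\<^sup>2) * w)))"
      by (rule ext, unfold c2[symmetric]) (simp only: mult_ac)
    ultimately show "((\<lambda>w. c n * ee (of_int (n\<^sup>2) * w)) has_derivative (\<lambda>h. (2 * of_real pi * \<i> * h) * (ee (of_int n / 2) * of_int n ^ (2 * Suc k) * ee (of_int (n\<^sup>2) * w)))) (at w)"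
      by (simp only: has_field_derivative_def)
    fix h
    have "norm ((2 * of_real pi * \<i> * h) * (ee (of_int n / 2) * of_int n ^ (2 * Suc k) * ee (of_int (n\<^sup>2) * w))) \<le> 2 * pi * norm h * (\<bar>of_int n\<bar> ^ (2 * Suc k) * exp (- (2 * pi * a) * (of_int n)\<^sup>2))"
      unfolding norm_mult[of "2 * of_real pi * \<i> * h"] norm_mult[of "ee (of_int n / 2) * of_int n ^ (2 * Suc k)"] norm_coeff
      using e[OF w, of n] by (intro mult_mono) (auto simp: norm_mult)
    also have "\<dots> \<le> M n * norm h" unfolding M_def ring_distribs by (simp add: mult_ac)
    finally show "norm ((2 * of_real pi * \<i> * h) * (ee (of_int n / 2) * of_int n ^ (2 * Suc k) * ee (of_int (n\<^sup>2) * w))) \<le> M n * norm h" .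
    have "norm (c n * ee (of_int (n\<^sup>2) * w)) \<le> \<bar>of_int n\<bar> ^ (2 * k) * exp (- (2 * pi * a) * (of_int n)\<^sup>2)"
      unfolding norm_mult[of "c n"] unfolding c_def norm_coeff using e[OF w, of n] by (intro mult_mono) auto
    also have "\<dots> \<le> M n" unfolding M_def by simp
    finally show "norm (c n * ee (of_int (n\<^sup>2) * w)) \<le> M n" .
  qed (use M z in \<open>auto simp: S_def a_def\<close>)
  have "(\<Sum>\<^sub>\<infinity>n. (2 * of_real pi * \<i> * h) * (ee (of_int n / 2) * of_int n ^ (2 * Suc k) * ee (of_int (n\<^sup>2) * z))) = 2 * of_real pi * \<i> * theta4_moment (Suc k) z * h" for h
    unfolding theta4_moment_def infsum_cmult_right' by (simp only: mult_ac)
  moreover have "(\<lambda>w. \<Sum>\<^sub>\<infinity>n. c n * ee (of_int (n\<^sup>2) * w)) = theta4_moment k" by (simp only: theta4_moment_def[abs_def] c_def)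
  ultimately show ?thesis using D unfolding has_field_derivative_def by (simp only:)
qed

lemma theta4_moment_holomorphic: "theta4_moment k holomorphic_on upper_half_plane"
  unfolding holomorphic_on_def using theta4_moment_deriv field_differentiable_at_within field_differentiable_def by blast

text \<open>ee(-n^2 z) is holomorphic, and differentiating it leads to the next member of the
  family. The tail depends on Im z alone; its derivative turns ee(-n^2 z) into the conjugate of
  ee(n^2 z) and so yields the conjugate theta series with weight y^(-3/2).\<close>

lemma nonhol_sum_derivative:
  assumes z: "Im z > 0"
  shows "(nonhol_sum k has_derivative (\<lambda>h. - (2 * of_real pi * \<i> * h * nonhol_sum (Suc k) z) - of_real (Im h * Im z powr (-3/2)) * cnj (theta4_moment k z))) (at z)"
proof -
  define a where "a = Im z / 2"
  define S where "S = {w. a < Im w}"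
  define c where "c = (\<lambda>n::int. ee (of_int n / 2) * of_int n ^ (2 * k))"
  define G where "G = (\<lambda>n::int. exp (- (2 * pi * a) * (of_int n)\<^sup>2) :: real)"
  define M where "M = (\<lambda>n::int. (4 * pi * a powr (-1/2)) * (\<bar>of_int n\<bar> ^ (2 * Suc k) * G n) + (2 * a powr (-1/2) + a powr (-3/2)) * (\<bar>of_int n\<bar> ^ (2 * k) * G n) :: real)"
  have a: "a > 0" using z by (simp add: a_def)
  have M: "M summable_on UNIV" unfolding M_def G_def by (intro summable_on_add summable_on_theta_majorant a)
  have S: "open S" "convex S" unfolding S_def by (simp_all add: open_Collect_less continuous_intros convex_halfspace_Im_gt)
  have c2: "c n * of_int (n\<^sup>2) = ee (of_int n / 2) * of_int n ^ (2 * Suc k)" for n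
    by (simp add: c_def power2_eq_square)
  have cc: "cnj (c n) = c n" for n by (simp add: c_def cnj_ee_half_int)
  have ee_cnj: "ee (- (of_int (n\<^sup>2) * w)) * of_real (exp (- (4 * pi * Im w) * (of_int n)\<^sup>2)) = cnj (ee (of_int (n\<^sup>2) * w))" for n w
  proof -
    have "of_real (exp (- (4 * pi * Im w) * (of_int n)\<^sup>2)) = ee (of_int (n\<^sup>2) * (2 * \<i> * of_real (Im w)))"
      by (simp add: ee_def mult_ac flip: exp_of_real)
    moreover have "- cnj (of_int (n\<^sup>2) * w) = - (of_int (n\<^sup>2) * w) + of_int (n\<^sup>2) * (2 * \<i> * of_real (Im w))"
      by (simp add: complex_eq_iff del: of_int_power)
    ultimately show ?thesis unfolding cnj_ee by (simp only: ee_add)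
  qed
  have eb: "norm (ee (of_int (n\<^sup>2) * w)) \<le> G n" if "w \<in> S" for n w
    unfolding G_def using that by (intro norm_ee_square_le) (simp add: S_def)
  \<comment> \<open>By itself ee(-n^2 w) grows like exp(2 pi n^2 Im w); the exp(-4 pi n^2 Im w) in
    the bound for the tail overcomes this.\<close>
  have Pb: "norm (ee (- (of_int (n\<^sup>2) * w)) * of_real (gauss_tail n (Im w))) \<le> G n * (2 * a powr (-1/2))" if w: "w \<in> S" for n w
  proof -
    have y: "Im w > 0" "Im w \<ge> a" using w a by (auto simp: S_def)
    have "norm (ee (- (of_int (n\<^sup>2) * w)) * of_real (gauss_tail n (Im w))) \<le>
       norm (ee (- (of_int (n\<^sup>2) * w))) * (exp (- (4 * pi * Im w) * (of_int n)\<^sup>2) * (2 * Im w powr (-1/2)))"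
      unfolding norm_mult using gauss_tail_bounds[OF y(1), of n] by (intro mult_left_mono) auto
    also have "\<dots> = norm (ee (- (of_int (n\<^sup>2) * w)) * of_real (exp (- (4 * pi * Im w) * (of_int n)\<^sup>2))) * (2 * Im w powr (-1/2))"
      by (simp add: norm_mult)
    also have "\<dots> = norm (ee (of_int (n\<^sup>2) * w)) * (2 * Im w powr (-1/2))" unfolding ee_cnj by simp
    also have "\<dots> \<le> G n * (2 * a powr (-1/2))"
      using eb[OF w, of n] y a by (intro mult_mono powr_mono2') (auto simp: G_def)
    finally show ?thesis .
  qed
  define f' where "f' = (\<lambda>(n::int) w h. - (2 * of_real pi * \<i> * h) * (ee (of_int n / 2) * of_int n ^ (2 * Suc k) * (ee (- (of_int (n\<^sup>2) * w)) * of_real (gauss_tail n (Im w))))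
        - of_real (Im h * Im w powr (-3/2)) * (c n * cnj (ee (of_int (n\<^sup>2) * w))))"
  have bnd: "norm (f' n w h) \<le> M n * norm h" "norm (c n * (ee (- (of_int (n\<^sup>2) * w)) * of_real (gauss_tail n (Im w)))) \<le> M n"
    "norm (- (2 * of_real pi * \<i> * h) * (ee (of_int n / 2) * of_int n ^ (2 * Suc k) * (ee (- (of_int (n\<^sup>2) * w)) * of_real (gauss_tail n (Im w))))) \<le> M n * norm h"
    "norm (of_real (Im h * Im w powr (-3/2)) * (c n * cnj (ee (of_int (n\<^sup>2) * w)))) \<le> M n * norm h" if w: "w \<in> S" for n w h
  proof -
    have y: "Im w > 0" "Im w \<ge> a" using w a by (auto simp: S_def)
    have G0: "G n \<ge> 0" by (simp add: G_def)
    have 1: "norm (- (2 * of_real pi * \<i> * h) * (ee (of_int n / 2) * of_int n ^ (2 * Suc k) * (ee (- (of_int (n\<^sup>2) * w)) * of_real (gauss_tail n (Im w))))) \<le>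
        (2 * pi * norm h) * (\<bar>of_int n\<bar> ^ (2 * Suc k) * (G n * (2 * a powr (-1/2))))"
      unfolding norm_mult[of "- (2 * of_real pi * \<i> * h)"] norm_mult[of "ee (of_int n / 2) * of_int n ^ (2 * Suc k)"] norm_coeff
      using Pb[OF w, of n] G0 by (intro mult_mono) (auto simp: norm_mult)
    have 2: "norm (of_real (Im h * Im w powr (-3/2)) * (c n * cnj (ee (of_int (n\<^sup>2) * w)))) \<le> (norm h * a powr (-3/2)) * (\<bar>of_int n\<bar> ^ (2 * k) * G n)"
    proof -
      have "norm (of_real (Im h * Im w powr (-3/2)) :: complex) \<le> norm h * a powr (-3/2)"
      proof -
        have "norm (of_real (Im h * Im w powr (-3/2)) :: complex) = \<bar>Im h\<bar> * Im w powr (-3/2)"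
          by (simp only: norm_of_real abs_mult) simp
        also have "\<dots> \<le> norm h * a powr (-3/2)"
          using abs_Im_le_cmod[of h] y a by (intro mult_mono powr_mono2') auto
        finally show ?thesis .
      qed
      thus ?thesis unfolding norm_mult[of "of_real (Im h * Im w powr (-3/2))"] norm_mult[of "c n"]
        unfolding c_def norm_coeff complex_mod_cnj using eb[OF w, of n] by (intro mult_mono) auto
    qed
    have M1: "(2 * pi * norm h) * (\<bar>of_int n\<bar> ^ (2 * Suc k) * (G n * (2 * a powr (-1/2)))) + (norm h * a powr (-3/2)) * (\<bar>of_int n\<bar> ^ (2 * k) * G n) \<le> M n * norm h"
    proof -
      have "0 \<le> 2 * a powr (-1/2) * (\<bar>of_int n\<bar> ^ (2 * k) * G n) * norm h" using G0 by simp
      thus ?thesis unfolding M_def ring_distribs by (simp add: mult_ac)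
    qed
    have p: "0 \<le> (2 * pi * norm h) * (\<bar>of_int n\<bar> ^ (2 * Suc k) * (G n * (2 * a powr (-1/2))))" "0 \<le> (norm h * a powr (-3/2)) * (\<bar>of_int n\<bar> ^ (2 * k) * G n)"
      using G0 by auto
    show "norm (f' n w h) \<le> M n * norm h"
      unfolding f'_def by (rule order_trans[OF norm_triangle_ineq4]) (use 1 2 M1 in linarith)
    show "norm (- (2 * of_real pi * \<i> * h) * (ee (of_int n / 2) * of_int n ^ (2 * Suc k) * (ee (- (of_int (n\<^sup>2) * w)) * of_real (gauss_tail n (Im w))))) \<le> M n * norm h"
      using 1 M1 p by linarith
    show "norm (of_real (Im h * Im w powr (-3/2)) * (c n * cnj (ee (of_int (n\<^sup>2) * w)))) \<le> M n * norm h"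
      using 2 M1 p by linarith
    have "norm (c n * (ee (- (of_int (n\<^sup>2) * w)) * of_real (gauss_tail n (Im w)))) \<le> \<bar>of_int n\<bar> ^ (2 * k) * (G n * (2 * a powr (-1/2)))"
      unfolding norm_mult[of "c n"] unfolding c_def norm_coeff using Pb[OF w, of n] by (intro mult_mono) auto
    also have "\<dots> \<le> M n"
    proof -
      have "0 \<le> (4 * pi * a powr (-1/2)) * (\<bar>of_int n\<bar> ^ (2 * Suc k) * G n)" "0 \<le> a powr (-3/2) * (\<bar>of_int n\<bar> ^ (2 * k) * G n)" using G0 by auto
      thus ?thesis unfolding M_def ring_distribs by (simp add: mult_ac)
    qed
    finally show "norm (c n * (ee (- (of_int (n\<^sup>2) * w)) * of_real (gauss_tail n (Im w)))) \<le> M n" .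
  qed
  have zS: "z \<in> S" using z by (simp add: S_def a_def)
  have D: "((\<lambda>w. \<Sum>\<^sub>\<infinity>n. c n * (ee (- (of_int (n\<^sup>2) * w)) * of_real (gauss_tail n (Im w)))) has_derivative (\<lambda>h. \<Sum>\<^sub>\<infinity>n. f' n z h)) (at z)"
  proof (rule has_derivative_infsum_int[OF S _ bnd(1,2) M zS])
    fix n w assume w: "w \<in> S"
    hence y: "Im w > 0" using a by (auto simp: S_def)
    have "((\<lambda>w. ee (- (of_int (n\<^sup>2) * w))) has_field_derivative (ee (- (of_int (n\<^sup>2) * w)) * (- (2 * of_real pi * \<i> * of_int (n\<^sup>2))))) (at w)"
      unfolding ee_def by (auto intro!: derivative_eq_intros simp del: of_int_power)
    hence d1: "((\<lambda>w. ee (- (of_int (n\<^sup>2) * w))) has_derivative (\<lambda>h. (ee (- (of_int (n\<^sup>2) * w)) * (- (2 * of_real pi * \<i> * of_int (n\<^sup>2)))) * h)) (at w)"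
      by (simp only: has_field_derivative_def)
    have "(gauss_tail n has_derivative (*) (- (Im w powr (-3/2) * exp (- (4 * pi * Im w) * (of_int n)\<^sup>2)))) (at (Im w))"
      using gauss_tail_derivative[OF y, of n] by (simp only: has_field_derivative_def)
    hence "((\<lambda>w. gauss_tail n (Im w)) has_derivative (\<lambda>h. - (Im w powr (-3/2) * exp (- (4 * pi * Im w) * (of_int n)\<^sup>2)) * Im h)) (at w)"
      by (rule has_derivative_compose[rotated]) (auto intro!: derivative_eq_intros)
    hence d2: "((\<lambda>w. of_real (gauss_tail n (Im w)) :: complex) has_derivative (\<lambda>h. of_real (- (Im w powr (-3/2) * exp (- (4 * pi * Im w) * (of_int n)\<^sup>2)) * Im h))) (at w)"
      by (rule has_derivative_of_real)
    have "((\<lambda>w. c n * (ee (- (of_int (n\<^sup>2) * w)) * of_real (gauss_tail n (Im w)))) has_derivative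
       (\<lambda>h. c n * (ee (- (of_int (n\<^sup>2) * w)) * of_real (- (Im w powr (-3/2) * exp (- (4 * pi * Im w) * (of_int n)\<^sup>2)) * Im h) +
          (ee (- (of_int (n\<^sup>2) * w)) * (- (2 * of_real pi * \<i> * of_int (n\<^sup>2)))) * h * of_real (gauss_tail n (Im w))))) (at w)"
      by (intro has_derivative_mult_right has_derivative_mult d1 d2)
    moreover have "c n * (ee (- (of_int (n\<^sup>2) * w)) * of_real (- (Im w powr (-3/2) * exp (- (4 * pi * Im w) * (of_int n)\<^sup>2)) * Im h) +
          (ee (- (of_int (n\<^sup>2) * w)) * (- (2 * of_real pi * \<i> * of_int (n\<^sup>2)))) * h * of_real (gauss_tail n (Im w))) = f' n w h" for h
    proof -
      have "C * (E * of_real (- (Y * X) * I) + (E * (- (2 * of_real pi * \<i> * N))) * h * P) =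
         - (2 * of_real pi * \<i> * h) * ((C * N) * (E * P)) - of_real (I * Y) * (C * (E * of_real X))" for C E N P :: complex and X Y I
        by (simp add: algebra_simps)
      thus ?thesis unfolding f'_def c2[symmetric] ee_cnj[symmetric] .
    qed
    ultimately show "((\<lambda>w. c n * (ee (- (of_int (n\<^sup>2) * w)) * of_real (gauss_tail n (Im w)))) has_derivative f' n w) (at w)"
      by (simp only:)
  qed
  have "(\<Sum>\<^sub>\<infinity>n. f' n z h) = - (2 * of_real pi * \<i> * h * nonhol_sum (Suc k) z) - of_real (Im h * Im z powr (-3/2)) * cnj (theta4_moment k z)" for h
  proof -
    have s1: "(\<lambda>n. - (2 * of_real pi * \<i> * h) * (ee (of_int n / 2) * of_int n ^ (2 * Suc k) * (ee (- (of_int (n\<^sup>2) * z)) * of_real (gauss_tail n (Im z))))) summable_on UNIV"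
      by (rule summable_on_norm_comparison(2)[OF summable_on_cmult_left[OF M] bnd(3)[OF zS]])
    have s2: "(\<lambda>n. of_real (Im h * Im z powr (-3/2)) * (c n * cnj (ee (of_int (n\<^sup>2) * z)))) summable_on UNIV"
      by (rule summable_on_norm_comparison(2)[OF summable_on_cmult_left[OF M] bnd(4)[OF zS]])
    have cn: "(\<Sum>\<^sub>\<infinity>n. c n * cnj (ee (of_int (n\<^sup>2) * z))) = cnj (theta4_moment k z)"
      unfolding theta4_moment_def infsum_cnj[symmetric] complex_cnj_mult c_def[symmetric] cc
      unfolding c_def complex_cnj_mult complex_cnj_power complex_cnj_of_int cnj_ee_half_int ..
    have "(\<Sum>\<^sub>\<infinity>n. f' n z h) = (\<Sum>\<^sub>\<infinity>n. - (2 * of_real pi * \<i> * h) * (ee (of_int n / 2) * of_int n ^ (2 * Suc k) * (ee (- (of_int (n\<^sup>2) * z)) * of_real (gauss_tail n (Im z)))))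
       - (\<Sum>\<^sub>\<infinity>n. of_real (Im h * Im z powr (-3/2)) * (c n * cnj (ee (of_int (n\<^sup>2) * z))))"
      using infsum_add[OF s1 summable_on_uminus[THEN iffD2, OF s2]]
      unfolding f'_def infsum_uminus by (simp only: diff_conv_add_uminus)
    thus ?thesis unfolding infsum_cmult_right' cn nonhol_sum_def by (simp only: mult_minus_left)
  qed
  moreover have "(\<lambda>w. \<Sum>\<^sub>\<infinity>n. c n * (ee (- (of_int (n\<^sup>2) * w)) * of_real (gauss_tail n (Im w)))) = nonhol_sum k" by (simp only: nonhol_sum_def[abs_def] c_def)
  ultimately show ?thesis using D by (simp only:)
qed

text \<open>The induction treats all \<open>k\<close> at once because differentiation raises
  \<open>k\<close>. The rest of the derivative is a power of Im z times the conjugate of a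
  holomorphic function.\<close>

lemma Ck_on_nonhol_sum: "Ck_on m (nonhol_sum k) upper_half_plane"
proof (induction m arbitrary: k)
  case 0
  show ?case
    using nonhol_sum_derivative[THEN has_derivative_continuous] by (auto intro!: continuous_at_imp_continuous_on)
next
  case (Suc m)
  show ?case
  proof (rule Ck_on_SucI[OF open_upper_half nonhol_sum_derivative])
    fix v
    have "Ck_on m (\<lambda>z. (- (2 * of_real pi * \<i> * v)) * nonhol_sum (Suc k) z + (of_real (- Im v) * of_real (Im z powr (-3/2))) * cnj (theta4_moment k z)) upper_half_plane"
      by (intro Ck_on_add[OF open_upper_half] Ck_on_mult[OF open_upper_half] Ck_on_const[OF open_upper_half] Suc.IH Ck_on_Im_powr
          Ck_on_cnj_holomorphic[OF open_upper_half theta4_moment_holomorphic])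
    thus "Ck_on m (\<lambda>z. - (2 * of_real pi * \<i> * v * nonhol_sum (Suc k) z) - of_real (Im v * Im z powr (-3/2)) * cnj (theta4_moment k z)) upper_half_plane"
      by simp
  qed auto
qed

text \<open>Termwise integration of the theta series along the ray. The coefficient grows like exp(2
  pi y n^2), but for t \<ge> y the factor exp(-4 pi t n^2) outweighs it.\<close>

lemma NH_bar_nonhol_sum:
  assumes z: "Im z > 0"
  shows "NH_bar z = of_real (1 / (4 * pi)) * nonhol_sum 0 z"
proof -
  define y where "y = Im z"
  have y: "y > 0" using z by (simp add: y_def)
  define q where "q = (\<lambda>n::int. ee (of_int n / 2) * ee (- (of_int (n\<^sup>2) * z)))"
  define r where "r = (\<lambda>(n::int) t. t powr (-3/2) * exp (- (4 * pi * t) * (of_int n)\<^sup>2))"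
  define f where "f = (\<lambda>n t. indicator {y<..} t *\<^sub>R (q n * of_real (r n t)))"
  have nq: "norm (q n) * exp (- (4 * pi * t) * (of_int n)\<^sup>2) \<le> exp (- (2 * pi * y) * (of_int n)\<^sup>2)" if "t \<ge> y" for n t
  proof -
    have "norm (q n) = exp (2 * pi * y * (of_int n)\<^sup>2)"
      by (simp add: q_def norm_mult norm_ee y_def mult_ac flip: of_int_power)
    hence "norm (q n) * exp (- (4 * pi * t) * (of_int n)\<^sup>2) = exp (2 * pi * y * (of_int n)\<^sup>2 + - (4 * pi * t) * (of_int n)\<^sup>2)"
      by (simp only: exp_add)
    also have "\<dots> \<le> exp (- (2 * pi * y) * (of_int n)\<^sup>2)"
    proof -
      have "4 * pi * y * (of_int n)\<^sup>2 \<le> 4 * pi * t * (of_int n)\<^sup>2" using that by (intro mult_right_mono mult_left_mono) auto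
      thus ?thesis by simp
    qed
    finally show ?thesis .
  qed
  have gs: "(\<lambda>n::int. C * exp (- (2 * pi * y) * (of_int n)\<^sup>2)) summable_on UNIV" for C :: real
    using y by (intro summable_on_cmult_right summable_on_gaussian) simp
  have ir: "set_integrable lborel {y<..} (r n)" for n unfolding r_def by (rule gauss_tail_integrable[OF y])
  have int: "integrable lborel (f n)" for n
  proof -
    have "set_integrable lborel {y<..} (\<lambda>t. complex_of_real (r n t))" 
      using integrable_of_real[OF ir[of n, unfolded set_integrable_def], where 'a = complex]
      by (simp add: set_integrable_def scaleR_conv_of_real)
    hence "set_integrable lborel {y<..} (\<lambda>t. q n * complex_of_real (r n t))" by (rule set_integrable_mult_right)
    thus ?thesis by (simp add: f_def set_integrable_def)
  qed
  have nf: "norm (f n t) = indicator {y<..} t *\<^sub>R (norm (q n) * r n t)" for n t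
    by (simp add: f_def norm_mult r_def indicator_def)
  have "(LBINT t. norm (f n t)) = norm (q n) * gauss_tail n y" for n
    unfolding nf gauss_tail_def r_def set_lebesgue_integral_def[symmetric] by (rule set_integral_mult_right)
  moreover have "norm (q n) * gauss_tail n y \<le> (2 * y powr (-1/2)) * exp (- (2 * pi * y) * (of_int n)\<^sup>2)" for n
  proof -
    have "norm (q n) * gauss_tail n y \<le> norm (q n) * (exp (- (4 * pi * y) * (of_int n)\<^sup>2) * (2 * y powr (-1/2)))"
      by (intro mult_left_mono gauss_tail_bounds y) auto
    also have "\<dots> = (2 * y powr (-1/2)) * (norm (q n) * exp (- (4 * pi * y) * (of_int n)\<^sup>2))" by simp
    also have "\<dots> \<le> (2 * y powr (-1/2)) * exp (- (2 * pi * y) * (of_int n)\<^sup>2)" by (intro mult_left_mono nq) auto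
    finally show ?thesis .
  qed
  ultimately have s1: "(\<lambda>n. LBINT t. norm (f n t)) summable_on UNIV"
    using gauss_tail_bounds(1)[OF y] by (intro summable_on_comparison_test[OF gs[of "2 * y powr (-1/2)"]]) auto
  have s2: "(\<lambda>n. norm (f n t)) summable_on UNIV" for t
  proof (cases "t > y")
    case True
    have "norm (f n t) \<le> t powr (-3/2) * exp (- (2 * pi * y) * (of_int n)\<^sup>2)" for n
    proof -
      have "norm (f n t) = t powr (-3/2) * (norm (q n) * exp (- (4 * pi * t) * (of_int n)\<^sup>2))"
        using True by (simp add: nf r_def)
      also have "\<dots> \<le> t powr (-3/2) * exp (- (2 * pi * y) * (of_int n)\<^sup>2)" using True by (intro mult_left_mono nq) auto
      finally show ?thesis .
    qed
    thus ?thesis by (intro summable_on_comparison_test[OF gs[of "t powr (-3/2)"]]) auto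
  qed (simp add: f_def)
  have "(LBINT t. \<Sum>\<^sub>\<infinity>n. f n t) = (\<Sum>\<^sub>\<infinity>n. integral\<^sup>L lborel (f n))"
    by (rule integral_infsum_swap[OF countableI_type infinite_UNIV_int int s1 s2])
  moreover have "integral\<^sup>L lborel (f n) = q n * of_real (gauss_tail n y)" for n
  proof -
    have "integral\<^sup>L lborel (f n) = (LBINT t:{y<..}. q n * of_real (r n t))" by (simp only: f_def set_lebesgue_integral_def)
    also have "\<dots> = q n * (LBINT t:{y<..}. of_real (r n t))" by (rule set_integral_mult_right)
    also have "(LBINT t:{y<..}. complex_of_real (r n t)) = of_real (LBINT t:{y<..}. r n t)" by (rule set_integral_complex_of_real)
    finally show ?thesis by (simp add: gauss_tail_def r_def)
  qed
  moreover have "(\<Sum>\<^sub>\<infinity>n. f n t) = indicator {y<..} t *\<^sub>R (of_real (t powr (-3/2)) * theta4 (- z + 2 * \<i> * of_real t))" for t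
  proof -
    have "q n * of_real (r n t) = of_real (t powr (-3/2)) * (ee (of_int n / 2) * ee (of_int (n\<^sup>2) * (- z + 2 * \<i> * of_real t)))" for n
    proof -
      have "of_real (exp (- (4 * pi * t) * (of_int n)\<^sup>2)) = ee (of_int (n\<^sup>2) * (2 * \<i> * of_real t))"
        by (simp add: ee_def mult_ac flip: exp_of_real)
      moreover have "of_int (n\<^sup>2) * (- z + 2 * \<i> * of_real t) = - (of_int (n\<^sup>2) * z) + of_int (n\<^sup>2) * (2 * \<i> * of_real t)"
        by (simp add: algebra_simps)
      ultimately show ?thesis by (simp only: q_def r_def of_real_mult ee_add mult_ac)
    qed
    thus ?thesis unfolding f_def scaleR_conv_of_real theta4_series by (simp only: infsum_cmult_right')
  qed
  ultimately have "(LBINT t:{y<..}. of_real (t powr (-3/2)) * theta4 (- z + 2 * \<i> * of_real t)) = (\<Sum>\<^sub>\<infinity>n. q n * of_real (gauss_tail n y))"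
    by (simp add: set_lebesgue_integral_def)
  also have "\<dots> = nonhol_sum 0 z" unfolding nonhol_sum_def q_def y_def by (simp only: mult_0_right power_0 mult_1_right mult.assoc)
  finally show ?thesis unfolding NH_bar_eq[OF z] y_def by simp
qed

no_notation fps_nth (infixl \<open>$\<close> 75)

section \<open>The holomorphic quotient, smoothness and the Laplace equation\<close>

definition hol_part :: "complex \<Rightarrow> complex" where
  "hol_part z = infsum (hol_term z) UNIV / theta4 z"

lemma maass_fn_split: "Im z > 0 \<Longrightarrow> maass_fn z = hol_part z - of_real (1 / (4 * pi)) * nonhol_sum 0 z"
  using holomorphic_part_identity[OF _ refl, of z] theta4_product(2)[of z]
  by (simp add: maass_fn_def hol_part_def NH_bar_nonhol_sum eq_divide_eq mult.commute)

text \<open>As \<open>hol_term\<close> is even, nonnegative \<open>n\<close> suffice. There 1 + ee(n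
  w) is 2 for n = 0 and otherwise at least 1 - exp(-2 pi a) in norm, uniformly for Im w \<ge>
  a.\<close>

lemma norm_hol_term_le:
  assumes w: "Im w \<ge> a" and a: "a > 0"
  shows "norm (hol_term w n) \<le> (1 / (1 - exp (- (2 * pi * a)))\<^sup>2) * exp (- (2 * pi * a) * (of_int n)\<^sup>2)"
proof -
  have w0: "Im w > 0" using w a by simp
  define \<delta> where "\<delta> = 1 - exp (- (2 * pi * a))"
  have d: "0 < \<delta>" "\<delta> \<le> 1" using a by (auto simp: \<delta>_def)
  have main: "norm (hol_term w n) \<le> (1 / \<delta>\<^sup>2) * exp (- (2 * pi * a) * (of_int n)\<^sup>2)" if n: "n \<ge> 0" for n
  proof -
    define E where "E = ee (of_int n * w)"
    have nE: "norm E = exp (- 2 * pi * (of_int n * Im w))" by (simp add: E_def norm_ee)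
    have E1: "norm E \<le> 1" using n w0 by (simp add: nE)
    have dE: "norm (1 + E) \<ge> \<delta>"
    proof (cases "n = 0")
      case True
      thus ?thesis using d by (simp add: E_def)
    next
      case False
      hence "1 * a \<le> of_int n * Im w" using n w a by (intro mult_mono) auto
      hence "norm E \<le> exp (- (2 * pi * a))" by (simp add: nE)
      thus ?thesis using norm_diff_ineq[of 1 E] by (simp add: \<delta>_def)
    qed
    have "norm (hol_term w n) = (norm (ee (of_int (n\<^sup>2) * w)) * norm E) / (norm (1 + E))\<^sup>2"
      unfolding hol_term_def[OF w0 refl] E_def norm_mult norm_divide norm_power by (simp add: norm_ee)
    also have "\<dots> \<le> (exp (- (2 * pi * a) * (of_int n)\<^sup>2) * 1) / \<delta>\<^sup>2"
      using d E1 dE norm_ee_square_le[OF w, of n] by (intro frac_le mult_mono power_mono) auto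
    finally show ?thesis by simp
  qed
  show ?thesis
  proof (cases "n \<ge> 0")
    case True
    thus ?thesis using main by (simp add: \<delta>_def)
  next
    case False
    thus ?thesis using main[of "- n"] hol_term_even[OF w0 refl, of n] by (simp add: \<delta>_def)
  qed
qed

lemma hol_part_holomorphic: "hol_part holomorphic_on upper_half_plane"
proof -
  have "(\<lambda>z. \<Sum>\<^sub>\<infinity>n. hol_term z n) holomorphic_on upper_half_plane"
  proof (rule holomorphic_on_infsum[OF open_upper_half])
    fix n :: int
    have nz: "1 + ee (of_int n * z) \<noteq> 0" if "z \<in> upper_half_plane" for z
      using qpoch_ratio(2)[of z "nome z" n] that by (simp add: nome_ee ee_powi)
    have "(\<lambda>z. ee (of_int n / 2) * (ee (of_int (n\<^sup>2) * z) * ee (of_int n * z)) / (1 + ee (of_int n * z))\<^sup>2)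
        holomorphic_on upper_half_plane"
      unfolding ee_def by (intro holomorphic_intros) (use nz in \<open>auto simp: ee_def\<close>)
    thus "(\<lambda>z. hol_term z n) holomorphic_on upper_half_plane"
      by (rule holomorphic_transform) (simp add: hol_term_def[OF _ refl])
  next
    fix z assume z: "z \<in> upper_half_plane"
    define a where "a = Im z / 2"
    have a: "a > 0" using z by (simp add: a_def)
    have I: "Im w \<ge> a" if "w \<in> cball z a" for w using cball_upper_half[of w z] that by (simp add: a_def)
    show "\<exists>r>0. \<exists>M. cball z r \<subseteq> upper_half_plane \<and> M summable_on UNIV \<and> (\<forall>n\<in>UNIV. \<forall>w\<in>cball z r. norm (hol_term w n) \<le> M n)"
    proof (intro exI[of _ a] conjI exI[of _ "\<lambda>n. (1 / (1 - exp (- (2 * pi * a)))\<^sup>2) * exp (- (2 * pi * a) * (of_int n)\<^sup>2)"] ballI a subsetI)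
      show "w \<in> upper_half_plane" if "w \<in> cball z a" for w using I[OF that] a by simp
      show "(\<lambda>n::int. (1 / (1 - exp (- (2 * pi * a)))\<^sup>2) * exp (- (2 * pi * a) * (of_int n)\<^sup>2)) summable_on UNIV"
        using a by (intro summable_on_cmult_right summable_on_gaussian) simp
      show "norm (hol_term w n) \<le> (1 / (1 - exp (- (2 * pi * a)))\<^sup>2) * exp (- (2 * pi * a) * (of_int n)\<^sup>2)" if "w \<in> cball z a" for n w
        by (rule norm_hol_term_le[OF I[OF that] a])
    qed
  qed
  moreover have "theta4 holomorphic_on upper_half_plane" using theta4_moment_holomorphic[of 0] by (simp add: theta4_moment_0)
  moreover have "theta4 z \<noteq> 0" if "z \<in> upper_half_plane" for z using theta4_product(2)[of z] that by simp
  ultimately show ?thesis unfolding hol_part_def[abs_def] by (intro holomorphic_intros) auto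
qed

lemma maass_fn_smooth: "smooth_on maass_fn upper_half_plane"
  unfolding smooth_on_def
proof
  fix n
  have "Ck_on n (\<lambda>z. hol_part z + of_real (- 1 / (4 * pi)) * nonhol_sum 0 z) upper_half_plane"
    by (intro Ck_on_add[OF open_upper_half] Ck_on_mult[OF open_upper_half] Ck_on_const[OF open_upper_half] Ck_on_nonhol_sum
        Ck_on_holomorphic[OF open_upper_half hol_part_holomorphic])
  thus "Ck_on n maass_fn upper_half_plane"
    by (rule Ck_on_cong[OF open_upper_half, rotated]) (simp add: maass_fn_split)
qed

lemma frechet_derivative_eqI:
  assumes "open S" "z \<in> S" "\<And>w. w \<in> S \<Longrightarrow> f w = g w" "(g has_derivative g') (at z)"
  shows "frechet_derivative f (at z) v = g' v"
proof -
  have "(f has_derivative g') (at z)"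
    by (rule has_derivative_transform_within_open[OF assms(4,1,2)]) (simp add: assms(3))
  thus ?thesis using frechet_derivative_at by force
qed

text \<open>The operator dx + i dy kills the holomorphic part and leaves i c y^(-3/2) times the
  conjugate of \<open>theta4\<close>. That conjugate is antiholomorphic, so the second-order part
  only differentiates the power of y, and the two multiples of y^(-1/2) cancel precisely in weight
  3/2.\<close>

lemma maass_fn_laplacian:
  assumes z: "Im z > 0"
  shows "hyp_laplacian (3/2) maass_fn z = 0"
proof -
  let ?H = "upper_half_plane"
  define F1 where "F1 = deriv hol_part"
  have F1: "F1 holomorphic_on ?H" unfolding F1_def by (intro holomorphic_deriv hol_part_holomorphic open_upper_half)
  have dF: "(hol_part has_derivative (\<lambda>v. F1 w * v)) (at w)" "(F1 has_derivative (\<lambda>v. deriv F1 w * v)) (at w)" if "w \<in> ?H" for w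
    unfolding F1_def using has_derivative_holomorphic[OF open_upper_half hol_part_holomorphic that]
      has_derivative_holomorphic[OF open_upper_half F1 that] by (simp_all add: F1_def)
  define c :: complex where "c = of_real (1 / (4 * pi))"
  have cpi: "c * of_real pi = 1 / 4" by (simp add: c_def)
  have dgg: "((\<lambda>w. hol_part w - c * nonhol_sum 0 w) has_derivative (\<lambda>v. F1 w * v - c * (- (2 * of_real pi * \<i> * v * nonhol_sum 1 w) - of_real (Im v * Im w powr (-3/2)) * cnj (theta4_moment 0 w)))) (at w)"
    if "w \<in> ?H" for w
    using nonhol_sum_derivative[of w 0] that by (intro has_derivative_diff dF has_derivative_mult_right) auto
  have gs: "maass_fn w = hol_part w - c * nonhol_sum 0 w" if "w \<in> ?H" for w using maass_fn_split[of w] that by (simp add: c_def)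
  have Dg: "frechet_derivative maass_fn (at w) v = F1 w * v - c * (- (2 * of_real pi * \<i> * v * nonhol_sum 1 w) - of_real (Im v * Im w powr (-3/2)) * cnj (theta4_moment 0 w))"
    if "w \<in> ?H" for w v
    by (rule frechet_derivative_eqI[OF open_upper_half that gs dgg[OF that]])
  \<comment> \<open>\<open>P\<close> and \<open>Q\<close> are closed forms of the first partial
    derivatives on the whole half-plane, so that the second ones arise by differentiating formulas;
    \<open>cpi\<close> reduces the coefficient 2 pi c to 1/2.\<close>
  define P where "P = (\<lambda>w. F1 w + \<i> / 2 * nonhol_sum 1 w)"
  define Q where "Q = (\<lambda>w. \<i> * F1 w - 1 / 2 * nonhol_sum 1 w + c * (of_real (Im w powr (-3/2)) * cnj (theta4_moment 0 w)))"
  have px: "partial_x maass_fn w = P w" if "w \<in> ?H" for w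
  proof -
    have "partial_x maass_fn w = F1 w + 2 * (c * of_real pi) * (\<i> * nonhol_sum 1 w)"
      unfolding partial_x_def Dg[OF that] by (simp add: algebra_simps)
    thus ?thesis unfolding cpi P_def by simp
  qed
  have py: "partial_y maass_fn w = Q w" if "w \<in> ?H" for w
  proof -
    have "partial_y maass_fn w = \<i> * F1 w + 2 * (c * of_real pi) * (\<i> * \<i> * nonhol_sum 1 w) + c * (of_real (Im w powr (-3/2)) * cnj (theta4_moment 0 w))"
      unfolding partial_y_def Dg[OF that] by (simp add: algebra_simps)
    thus ?thesis unfolding cpi Q_def by simp
  qed
  have zH: "z \<in> ?H" using z by simp
  define T0 T1 N2 where "T0 = cnj (theta4_moment 0 z)" and "T1 = cnj (theta4_moment 1 z)" and "N2 = nonhol_sum 2 z"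
  have dN1: "(nonhol_sum 1 has_derivative (\<lambda>h. - (2 * of_real pi * \<i> * h * N2) - of_real (Im h * Im z powr (-3/2)) * T1)) (at z)"
    using nonhol_sum_derivative[OF z, of 1] by (simp add: N2_def T1_def numeral_2_eq_2)
  have dP: "(P has_derivative (\<lambda>v. deriv F1 z * v + \<i> / 2 * (- (2 * of_real pi * \<i> * v * N2) - of_real (Im v * Im z powr (-3/2)) * T1))) (at z)"
    unfolding P_def by (intro has_derivative_add dF zH has_derivative_mult_right dN1)
  have dT: "((\<lambda>w. cnj (theta4_moment 0 w)) has_derivative (\<lambda>v. cnj (2 * of_real pi * \<i> * theta4_moment 1 z * v))) (at z)"
    using theta4_moment_deriv[OF z, of 0] by (intro has_derivative_cnj) (simp add: has_field_derivative_def)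
  have dQ: "(Q has_derivative (\<lambda>v. \<i> * (deriv F1 z * v) - 1 / 2 * (- (2 * of_real pi * \<i> * v * N2) - of_real (Im v * Im z powr (-3/2)) * T1)
       + c * (of_real (Im z powr (-3/2)) * cnj (2 * of_real pi * \<i> * theta4_moment 1 z * v) + of_real ((-3/2) * Im v * Im z powr (-3/2 - 1)) * cnj (theta4_moment 0 z)))) (at z)"
    unfolding Q_def
    by (intro has_derivative_add has_derivative_diff has_derivative_mult_right has_derivative_mult dF zH dN1 dT has_derivative_Im_powr z)
  have pxx: "partial_x (partial_x maass_fn) z = deriv F1 z + of_real pi * N2"
  proof -
    have "partial_x (partial_x maass_fn) z = deriv F1 z * 1 + \<i> / 2 * (- (2 * of_real pi * \<i> * 1 * N2) - of_real (Im 1 * Im z powr (-3/2)) * T1)"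
      unfolding partial_x_def[of "partial_x maass_fn"] by (rule frechet_derivative_eqI[OF open_upper_half zH px dP])
    thus ?thesis by (simp add: algebra_simps)
  qed
  \<comment> \<open>The terms in \<open>T1\<close> cancel: the coefficient 1/2 comes from the
    derivative of \<open>nonhol_sum 1\<close>, and 2 pi c = 1/2 from that of the conjugate theta
    function.\<close>
  have pyy: "partial_y (partial_y maass_fn) z = - deriv F1 z - of_real pi * N2 - c * (3/2) * of_real (Im z powr (-5/2)) * T0"
  proof -
    have "partial_y (partial_y maass_fn) z = \<i> * (deriv F1 z * \<i>) - 1 / 2 * (- (2 * of_real pi * \<i> * \<i> * N2) - of_real (Im \<i> * Im z powr (-3/2)) * T1)
       + c * (of_real (Im z powr (-3/2)) * cnj (2 * of_real pi * \<i> * theta4_moment 1 z * \<i>) + of_real ((-3/2) * Im \<i> * Im z powr (-3/2 - 1)) * cnj (theta4_moment 0 z))"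
      unfolding partial_y_def[of "partial_y maass_fn"] by (rule frechet_derivative_eqI[OF open_upper_half zH py dQ])
    also have "cnj (2 * of_real pi * \<i> * theta4_moment 1 z * \<i>) = - (2 * of_real pi * T1)"
      by (simp add: T1_def complex_eq_iff)
    also have "\<i> * (deriv F1 z * \<i>) - 1 / 2 * (- (2 * of_real pi * \<i> * \<i> * N2) - of_real (Im \<i> * Im z powr (-3/2)) * T1)
       + c * (of_real (Im z powr (-3/2)) * - (2 * of_real pi * T1) + of_real ((-3/2) * Im \<i> * Im z powr (-3/2 - 1)) * cnj (theta4_moment 0 z)) =
       - deriv F1 z - of_real pi * N2 + 1 / 2 * of_real (Im z powr (-3/2)) * T1 - 2 * (c * of_real pi) * (of_real (Im z powr (-3/2)) * T1)
       - c * (3/2) * of_real (Im z powr (-5/2)) * T0"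
      by (simp add: T0_def algebra_simps)
    finally show ?thesis unfolding cpi by simp
  qed
  have pp: "partial_x maass_fn z + \<i> * partial_y maass_fn z = \<i> * (c * (of_real (Im z powr (-3/2)) * T0))"
    unfolding px[OF zH] py[OF zH] P_def Q_def T0_def by (simp add: algebra_simps)
  have y1: "(Im z)\<^sup>2 * Im z powr (-5/2) = Im z powr (-1/2)"
    using z powr_add[of "Im z" 2 "-5/2"] by simp
  have y2: "Im z * Im z powr (-3/2) = Im z powr (-1/2)"
    using z powr_add[of "Im z" 1 "-3/2"] by simp
  have "hyp_laplacian (3/2) maass_fn z = c * (3/2) * of_real ((Im z)\<^sup>2 * Im z powr (-5/2)) * T0 - c * (3/2) * of_real (Im z * Im z powr (-3/2)) * T0"
    unfolding hyp_laplacian_def pxx pyy pp by (simp add: algebra_simps)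
  thus ?thesis unfolding y1 y2 by simp
qed

theorem theorem4p1:
  shows "\<exists>\<psi>. dirichlet_char 16 \<psi> \<and>
    weak_maass_form (3/2) (Gamma0 16) \<psi>
      (\<lambda>z. N2_1_0 (nome z)
           + qpoch_inf (- nome z) (nome z) / qpoch_inf (nome z) (nome z)
             * (1/12 + 1/6 * Eisenstein_E2 (2 * z))
           - NH_bar z)"
proof -
  define \<psi> where "\<psi> = (\<lambda>d::int. if coprime d 16 then 1 else 0 :: complex)"
  have det: "A $ 1 $ 1 * A $ 2 $ 2 - A $ 1 $ 2 * A $ 2 $ 1 = 1" if "A \<in> SL2Z" for A
    using that by (simp add: SL2Z_def det_2)
  have act: "moebius_act A z = moeb (A $ 1 $ 1) (A $ 1 $ 2) (A $ 2 $ 1) (A $ 2 $ 2) z" for A z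
    by (simp add: moebius_act_def moeb_def aut_factor_def)
  have "dirichlet_char 16 \<psi>"
  proof -
    have "coprime (m + 16) 16 \<longleftrightarrow> coprime m 16" for m :: int
      by (simp add: coprime_iff_gcd_eq_1 gcd_add1)
    thus ?thesis unfolding dirichlet_char_def \<psi>_def by simp
  qed
  moreover have "weak_maass_form (3/2) (Gamma0 16) \<psi> maass_fn"
    unfolding weak_maass_form_def
  proof (intro conjI ballI)
    show "2 * (3 / 2) \<in> (\<int> :: real set)" by simp
    show "(3 / 2 :: real) \<notin> \<int>"
    proof
      assume "(3 / 2 :: real) \<in> \<int>"
      then obtain n :: int where "3 / 2 = real_of_int n" by (elim Ints_cases)
      hence "real_of_int (2 * n) = real_of_int 3" by simp
      hence "2 * n = 3" by (simp only: of_int_eq_iff)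
      thus False by presburger
    qed
    show "Gamma0 16 \<subseteq> Gamma0 4" by (auto simp: Gamma0_def intro: dvd_trans[of 4 16])
    show "smooth_on maass_fn upper_half_plane" by (rule maass_fn_smooth)
    show "hyp_laplacian (3 / 2) maass_fn z = 0" if "z \<in> upper_half_plane" for z using that by (simp add: maass_fn_laplacian)
    show "linear_exp_growth_at_cusps (3 / 2) maass_fn"
      unfolding linear_exp_growth_at_cusps_def
    proof
      fix A assume A: "A \<in> SL2Z"
      obtain C K where CK: "\<And>z. Im z \<ge> 1 \<Longrightarrow>
          norm ((of_int (A $ 2 $ 1) * z + of_int (A $ 2 $ 2)) powr of_real (-(3/2)) *
            maass_fn (moeb (A $ 1 $ 1) (A $ 1 $ 2) (A $ 2 $ 1) (A $ 2 $ 2) z)) \<le> K * exp (C * Im z)"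
        using maass_fn_growth[OF det[OF A]] by blast
      show "\<exists>C K Y. Y > 0 \<and> (\<forall>z. Im z \<ge> Y \<longrightarrow>
        norm (aut_factor A z powr of_real (- (3 / 2)) * maass_fn (moebius_act A z)) \<le> K * exp (C * Im z))"
        unfolding act aut_factor_def using CK by (intro exI[of _ C] exI[of _ K] exI[of _ 1]) auto
    qed
    fix A z assume A: "A \<in> Gamma0 16" and z: "z \<in> upper_half_plane"
    have A': "A \<in> SL2Z" "16 dvd A $ 2 $ 1" using A by (auto simp: Gamma0_def)
    have z': "Im z > 0" using z by simp
    have "odd (A $ 2 $ 2)" using maass_fn_moeb(2)[OF det[OF A'(1)] A'(2) z'] .
    hence "coprime (A $ 2 $ 2) 2" by simp
    hence "coprime (A $ 2 $ 2) (2 ^ 4)" by (simp only: coprime_power_right_iff simp_thms)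
    hence "\<psi> (A $ 2 $ 2) = 1" by (simp add: \<psi>_def)
    moreover have "- 2 * (3 / 2 :: real) = - 3" by simp
    ultimately show "maass_fn (moebius_act A z) =
          of_int (shimura_symbol (A $ 2 $ 1) (A $ 2 $ 2)) *
          theta_eps (A $ 2 $ 2) powr of_real (- 2 * (3 / 2)) *
          \<psi> (A $ 2 $ 2) * aut_factor A z powr of_real (3 / 2) * maass_fn z"
      unfolding act aut_factor_def using maass_fn_moeb(1)[OF det[OF A'(1)] A'(2) z'] by (simp only: mult_1_right)
  qed
  ultimately show ?thesis unfolding maass_fn_def[abs_def] by blast
qed

end
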